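(* Let $\Omega$ be a bounded domain, $\alpha\in(0,1)$, $\rho\in\mathbb{C}$, $T>0$, let $U$ be bounded in $\bar\Omega$, and let $G_0\in L^2(\Omega)$. Let $G(x_0,\rho,t)$ be the solution of $$ {}^C_0D^{\alpha,x_0}_t G=\Delta G\ \text{ in }\Omega\times(0,T],\qquad G(x_0,\rho,0)=G_0(x_0)\ \text{ in }\Omega,\qquad G=0\ \text{ on }\partial\Omega\times(0,T].$$ Let $\tau=T/N$, $N\in\mathbb{N}$, $t_n=n\tau$, and let $G^n$ be the solution of the backward Euler scheme: $G^0=G_0$, $G^n=0$ on $\partial\Omega$, and $$\sum_{i=0}^{n-1}d^{\alpha,1}_i e^{-t_i\rho U(x_0)}G^{n-i}+AG^n=e^{-t_n\rho U(x_0)}\sum_{i=0}^{n-1}d_i^{\alpha,1}G^0\quad\text{in }\Omega,\quad n=1,\dots,N,$$ where the coefficients are defined by $\left(\frac{1-\zeta}{\tau}\right)^{\alpha}=\sum_{i=0}^\infty d_i^{\alpha,1}\zeta^i$. Then there is a constant $C>0$, independent of $\tau$, $n$ and $G_0$, such that for $n=1,\dots,N$ $$\|G(\cdot,\rho,t_n)-G^n\|_{L^2(\Omega)}\le C\,t_n^{-1}\,\tau\,\|G_0\|_{L^2(\Omega)}.$$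
   Context: All functions are complex valued. $A=-\Delta$ with zero Dirichlet boundary condition on $\Omega$. ${}^C_0D^{\alpha,x_0}_t$ is the Caputo fractional substantial derivative: ${}^C_0D^{\alpha,x_0}_tG(x_0,\rho,t)=e^{-t\rho U(x_0)}\;{}^C_0D^{\alpha}_t\big(e^{t\rho U(x_0)}G(x_0,\rho,t)\big)$, where ${}^C_0D^\alpha_t g(t)=\frac{1}{\Gamma(1-\alpha)}\int_0^t(t-\xi)^{-\alpha}g'(\xi)\,d\xi$. Meaning of the solution: put $\beta(z)=\beta(z,x_0)=z+\rho U(x_0)$; $\beta(z)$ and its (principal) powers act as multiplication operators in $x_0$. The Laplace transform in time of the solution is $\tilde G(z)=((\beta(z))^{\alpha}+A)^{-1}(\beta(z))^{\alpha-1}G_0$, i.e. $$G(t)=\frac{1}{2\pi\mathbf i}\int_{\Gamma_{\theta,\kappa}}e^{zt}((\beta(z))^{\alpha}+A)^{-1}(\beta(z))^{\alpha-1}G_0\,dz,$$ where $\Gamma_{\theta,\kappa}=\{|z|=\kappa,|\arg z|\le\theta\}\cup\{z=re^{\pm\mathbf i\theta}:r\ge\kappa\}$, oriented with increasing imaginary part, with $\theta\in(\pi/2,\pi)$ sufficiently close to $\pi/2$ and $\kappa>0$ sufficiently large (depending on $|\rho|\,\|U\|_{L^\infty(\bar\Omega)}$). *)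

theory Defs
  imports "HOL-Complex_Analysis.Complex_Analysis"
begin

section \<open>The space L2\<close>

text \<open>Elements of the Lebesgue space are represented by functions on the whole space; only their
  values almost everywhere on the domain matter.\<close>

definition L2 :: "'a::euclidean_space set \<Rightarrow> ('a \<Rightarrow> complex) set" where
  "L2 \<Omega> = {u \<in> borel_measurable (lebesgue_on \<Omega>). integrable (lebesgue_on \<Omega>) (\<lambda>x. (norm (u x))\<^sup>2)}"

definition L2_norm :: "'a::euclidean_space set \<Rightarrow> ('a \<Rightarrow> complex) \<Rightarrow> real" where
  "L2_norm \<Omega> u = sqrt (LINT x|lebesgue_on \<Omega>. (norm (u x))\<^sup>2)"

definition L2_inner :: "'a::euclidean_space set \<Rightarrow> ('a \<Rightarrow> complex) \<Rightarrow> ('a \<Rightarrow> complex) \<Rightarrow> complex" where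
  "L2_inner \<Omega> u v = (LINT x|lebesgue_on \<Omega>. u x * cnj (v x))"


section \<open>Test functions, Sobolev spaces and the Dirichlet Laplacian\<close>

definition partial_deriv :: "'a::euclidean_space \<Rightarrow> ('a \<Rightarrow> complex) \<Rightarrow> 'a \<Rightarrow> complex" where
  "partial_deriv i f x = frechet_derivative f (at x) i"

text \<open>Differentiability of all iterated partial derivatives makes them all continuous, so this
  is the class of infinitely often continuously differentiable functions.\<close>

definition smooth :: "('a::euclidean_space \<Rightarrow> complex) \<Rightarrow> bool" where
  "smooth f \<longleftrightarrow> (\<forall>is. set is \<subseteq> Basis \<longrightarrow> (\<forall>x. foldr partial_deriv is f differentiable (at x)))"

definition test_functions :: "'a::euclidean_space set \<Rightarrow> ('a \<Rightarrow> complex) set" where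
  "test_functions \<Omega> =
     {\<phi>. smooth \<phi> \<and> compact (closure {x. \<phi> x \<noteq> 0}) \<and> closure {x. \<phi> x \<noteq> 0} \<subseteq> \<Omega>}"

text \<open>\<open>has_weak_gradient \<Omega> u g\<close>: \<open>u\<close> lies in \<open>H\<^sup>1(\<Omega>)\<close> and its weak partial derivative in the
  coordinate direction \<open>i\<close> is \<open>g i\<close>.\<close>

definition has_weak_gradient ::
  "'a::euclidean_space set \<Rightarrow> ('a \<Rightarrow> complex) \<Rightarrow> ('a \<Rightarrow> 'a \<Rightarrow> complex) \<Rightarrow> bool" where
  "has_weak_gradient \<Omega> u g \<longleftrightarrow> u \<in> L2 \<Omega> \<and>
     (\<forall>i\<in>Basis. g i \<in> L2 \<Omega> \<and>
        (\<forall>\<phi>\<in>test_functions \<Omega>.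
           (LINT x|lebesgue_on \<Omega>. u x * partial_deriv i \<phi> x)
             = - (LINT x|lebesgue_on \<Omega>. g i x * \<phi> x)))"

text \<open>\<open>H10_gradient \<Omega> u g\<close>: \<open>u\<close> lies in \<open>H\<^sub>0\<^sup>1(\<Omega>)\<close>, the closure of the test functions in
  \<open>H\<^sup>1(\<Omega>)\<close>, and has weak gradient \<open>g\<close>.  For an arbitrary bounded domain this is the meaning of
  \<open>u = 0\<close> on the boundary.\<close>

definition H10_gradient ::
  "'a::euclidean_space set \<Rightarrow> ('a \<Rightarrow> complex) \<Rightarrow> ('a \<Rightarrow> 'a \<Rightarrow> complex) \<Rightarrow> bool" where
  "H10_gradient \<Omega> u g \<longleftrightarrow> has_weak_gradient \<Omega> u g \<and>
     (\<exists>\<phi>::nat \<Rightarrow> 'a \<Rightarrow> complex. (\<forall>k. \<phi> k \<in> test_functions \<Omega>) \<and>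
        (\<lambda>k. L2_norm \<Omega> (\<lambda>x. \<phi> k x - u x)) \<longlonglongrightarrow> 0 \<and>
        (\<forall>i\<in>Basis. (\<lambda>k. L2_norm \<Omega> (\<lambda>x. partial_deriv i (\<phi> k) x - g i x)) \<longlonglongrightarrow> 0))"

text \<open>The graph of \<open>A = -\<Delta>\<close> with zero Dirichlet condition: \<open>neg_dirichlet_laplacian \<Omega> u f\<close> means
  that \<open>u\<close> is in the domain of \<open>A\<close> and \<open>A u = f\<close>.  No regularity of the boundary is available, so
  the domain is that of the form realisation, \<open>{u \<in> H\<^sub>0\<^sup>1(\<Omega>). \<Delta>u \<in> L\<^sup>2(\<Omega>)}\<close>.\<close>

definition neg_dirichlet_laplacian ::
  "'a::euclidean_space set \<Rightarrow> ('a \<Rightarrow> complex) \<Rightarrow> ('a \<Rightarrow> complex) \<Rightarrow> bool" where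
  "neg_dirichlet_laplacian \<Omega> u f \<longleftrightarrow> f \<in> L2 \<Omega> \<and>
     (\<exists>g. H10_gradient \<Omega> u g \<and>
        (\<forall>\<phi>\<in>test_functions \<Omega>.
           (\<Sum>i\<in>Basis. L2_inner \<Omega> (g i) (partial_deriv i \<phi>)) = L2_inner \<Omega> f \<phi>))"

text \<open>\<open>w = (m + A)\<^sup>-\<^sup>1 h\<close>, where the function \<open>m\<close> acts by multiplication.\<close>

definition is_resolvent ::
  "'a::euclidean_space set \<Rightarrow> ('a \<Rightarrow> complex) \<Rightarrow> ('a \<Rightarrow> complex) \<Rightarrow> ('a \<Rightarrow> complex) \<Rightarrow> bool" where
  "is_resolvent \<Omega> m h w \<longleftrightarrow> neg_dirichlet_laplacian \<Omega> w (\<lambda>x. h x - m x * w x)"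


section \<open>The contour and the solution of the continuous problem\<close>

definition contour :: "real \<Rightarrow> real \<Rightarrow> complex set" where
  "contour \<theta> \<kappa> = {z. norm z = \<kappa> \<and> \<bar>Arg z\<bar> \<le> \<theta>}
     \<union> {rcis r \<theta> | r. \<kappa> \<le> r} \<union> {rcis r (-\<theta>) | r. \<kappa> \<le> r}"

text \<open>The integral along \<open>contour \<theta> \<kappa>\<close>, oriented with increasing imaginary part: in along the
  lower ray, counterclockwise along the arc, out along the upper ray.\<close>

definition has_integral_along_contour ::
  "(complex \<Rightarrow> complex) \<Rightarrow> real \<Rightarrow> real \<Rightarrow> complex \<Rightarrow> bool" where
  "has_integral_along_contour f \<theta> \<kappa> I \<longleftrightarrow> (\<exists>I_lower I_arc I_upper.
     ((\<lambda>r. f (rcis r (-\<theta>)) * cis (-\<theta>)) has_integral I_lower) {\<kappa>..} \<and>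
     (f has_contour_integral I_arc) (part_circlepath 0 \<kappa> (-\<theta>) \<theta>) \<and>
     ((\<lambda>r. f (rcis r \<theta>) * cis \<theta>) has_integral I_upper) {\<kappa>..} \<and>
     I = - I_lower + I_arc + I_upper)"

text \<open>The integral of an \<open>L\<^sup>2(\<Omega>)\<close>-valued function \<open>F\<close> is the element \<open>J\<close> of \<open>L\<^sup>2(\<Omega>)\<close> on which every
  continuous linear functional, i.e. every \<open>L2_inner \<Omega> _ v\<close>, takes the value of the scalar integral
  of the functional applied to \<open>F\<close>.\<close>

definition has_L2_integral_along_contour ::
  "'a::euclidean_space set \<Rightarrow> (complex \<Rightarrow> 'a \<Rightarrow> complex) \<Rightarrow> real \<Rightarrow> real \<Rightarrow> ('a \<Rightarrow> complex) \<Rightarrow> bool" where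
  "has_L2_integral_along_contour \<Omega> F \<theta> \<kappa> J \<longleftrightarrow> J \<in> L2 \<Omega> \<and>
     (\<forall>v\<in>L2 \<Omega>. has_integral_along_contour (\<lambda>z. L2_inner \<Omega> (F z) v) \<theta> \<kappa> (L2_inner \<Omega> J v))"

definition beta :: "complex \<Rightarrow> ('a \<Rightarrow> complex) \<Rightarrow> complex \<Rightarrow> 'a \<Rightarrow> complex" where
  "beta \<rho> U z x = z + \<rho> * U x"

text \<open>The solution on \<open>[0, T]\<close> is given by its initial value and, for positive times, by the inverse
  Laplace transform of \<open>w z = (\<beta>(z)\<^sup>\<alpha> + A)\<^sup>-\<^sup>1 \<beta>(z)\<^sup>\<alpha>\<^sup>-\<^sup>1 G0\<close>.  The nested filters
  say that \<open>\<theta> > \<pi>/2\<close> is sufficiently close to \<open>\<pi>/2\<close> and \<open>\<kappa>\<close> is sufficiently large (depending on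
  \<open>\<theta>\<close>); the integral does not depend on the choice of such \<open>\<theta>\<close>, \<open>\<kappa>\<close>.\<close>

definition is_solution ::
  "'a::euclidean_space set \<Rightarrow> real \<Rightarrow> complex \<Rightarrow> real \<Rightarrow> ('a \<Rightarrow> complex) \<Rightarrow> ('a \<Rightarrow> complex)
     \<Rightarrow> (real \<Rightarrow> 'a \<Rightarrow> complex) \<Rightarrow> bool" where
  "is_solution \<Omega> \<alpha> \<rho> T U G0 G \<longleftrightarrow>
     (AE x in lebesgue_on \<Omega>. G 0 x = G0 x) \<and>
     (\<forall>\<^sub>F \<theta> in at_right (pi / 2). \<forall>\<^sub>F \<kappa> in at_top. \<exists>w.
        (\<forall>z\<in>contour \<theta> \<kappa>. is_resolvent \<Omega> (\<lambda>x. beta \<rho> U z x powr of_real \<alpha>)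
            (\<lambda>x. beta \<rho> U z x powr of_real (\<alpha> - 1) * G0 x) (w z)) \<and>
        (\<forall>t\<in>{0<..T}. has_L2_integral_along_contour \<Omega>
            (\<lambda>z x. 1 / (2 * of_real pi * \<i>) * exp (z * of_real t) * w z x) \<theta> \<kappa> (G t)))"


section \<open>The backward Euler scheme\<close>

text \<open>\<open>((1 - \<zeta>) / \<tau>)\<^sup>\<alpha> = \<Sum>i. d i * \<zeta>\<^sup>i\<close> near 0, with the principal power.\<close>

definition BE_coeffs :: "real \<Rightarrow> real \<Rightarrow> (nat \<Rightarrow> real) \<Rightarrow> bool" where
  "BE_coeffs \<alpha> \<tau> d \<longleftrightarrow> (\<forall>\<zeta>::complex. norm \<zeta> < 1 \<longrightarrow>
     (\<lambda>i. of_real (d i) * \<zeta> ^ i) sums (((1 - \<zeta>) / of_real \<tau>) powr of_real \<alpha>))"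

text \<open>The boundary condition \<open>G\<^sup>n = 0\<close> is part of the domain of \<open>A\<close>; \<open>v\<close> is \<open>A G\<^sup>n\<close>.\<close>

definition is_BE_solution ::
  "'a::euclidean_space set \<Rightarrow> complex \<Rightarrow> ('a \<Rightarrow> complex) \<Rightarrow> ('a \<Rightarrow> complex) \<Rightarrow> real \<Rightarrow> nat
     \<Rightarrow> (nat \<Rightarrow> real) \<Rightarrow> (nat \<Rightarrow> 'a \<Rightarrow> complex) \<Rightarrow> bool" where
  "is_BE_solution \<Omega> \<rho> U G0 \<tau> N d Gd \<longleftrightarrow>
     (AE x in lebesgue_on \<Omega>. Gd 0 x = G0 x) \<and>
     (\<forall>n\<in>{1..N}. \<exists>v. neg_dirichlet_laplacian \<Omega> (Gd n) v \<and>
        (AE x in lebesgue_on \<Omega>.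
           (\<Sum>i<n. of_real (d i) * exp (- of_real (real i * \<tau>) * \<rho> * U x) * Gd (n - i) x) + v x
             = exp (- of_real (real n * \<tau>) * \<rho> * U x) * (\<Sum>i<n. of_real (d i)) * Gd 0 x))"

end

(* Since \<alpha> < 1, the power b^\<alpha> maps the right half plane, and even a slightly larger sector, into
   {Re w \<ge> c |w|}. Hence multiplication by \<beta>(z)^\<alpha> is coercive with constant of order |z|^\<alpha>, and A only has
   to be accretive for (\<beta>(z)^\<alpha> + A)^-1 and its z-derivatives to satisfy the expected bounds; no
   spectral theory is needed. The same holds for the symbol ((1 - exp(-\<tau> b)) / \<tau>)^\<alpha> of the
   scheme on a strip |Im z| \<le> \<pi> / \<tau>.

   Let S(z), S_\<tau>(z) be the two Laplace transforms. On the line Re z = 2K + 1 + 1/t, with K bounding |\<rho> U|,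
   two integrations by parts give 2 \<pi> i t^2 G(t) as the integral of exp(z t) S''(z), and the same for G^n
   with S_\<tau> and |Im z| \<le> \<pi> / \<tau>, where the boundary terms cancel because everything has period 2 \<pi> i / \<tau>.
   The two integrands differ by O(\<tau> |z|^-2) there, and S''(z) = O(|z|^-3) controls the remaining tails, so
   t^2 |G - G^n| = O(\<tau> t). *)
theory Submission
  imports Defs
begin

section \<open>Square integrable functions\<close>

text \<open>Two integrations by parts are the fewest that give the sharp rate: the differences of S,
  S' and S'' are of size \<tau>, \<tau>/|z| and \<tau>/|z|^2, and their integrals up to |Im z| =
  \<pi>/\<tau> are of order one, \<tau> log(1/\<tau>) and \<tau> t. On the chosen line the part 1/t
  keeps exp(z t) bounded for t \<le> T, and the part 2K keeps |z + \<rho> U| between |z|/2 and 2|z|.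
  No vector-valued integral is formed. The inner product with a fixed f is holomorphic in z, path
  integrals become differences of a primitive of exp(z t) <S''(z), f>, and in the end f is the error
  itself, so that <f, f> is its squared norm. The scheme supplies only G^1, ..., G^N, so its
  generating function is a polynomial, which solves the resolvent equation only up to a residual of
  order exp(-(N+1) \<tau> Re z). Comparing increments over one period and letting Re z tend to
  infinity removes this residual.\<close>

lemma L2_D: "u \<in> L2 \<Omega> \<Longrightarrow> u \<in> borel_measurable (lebesgue_on \<Omega>)"
    "u \<in> L2 \<Omega> \<Longrightarrow> integrable (lebesgue_on \<Omega>) (\<lambda>x. (norm (u x))\<^sup>2)"
  by (auto simp: L2_def)

lemma L2_dominated:
  assumes "u \<in> L2 \<Omega>" "f \<in> borel_measurable (lebesgue_on \<Omega>)"
    and le: "\<And>x. x \<in> \<Omega> \<Longrightarrow> norm (f x) \<le> B * norm (u x)" and "\<Omega> \<in> sets lebesgue"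
  shows "f \<in> L2 \<Omega>"
proof -
  have "integrable (lebesgue_on \<Omega>) (\<lambda>x. (norm (f x))\<^sup>2)"
  proof (rule Bochner_Integration.integrable_bound)
    show "integrable (lebesgue_on \<Omega>) (\<lambda>x. B\<^sup>2 * (norm (u x))\<^sup>2)"
      using L2_D[OF assms(1)] by simp
    show "(\<lambda>x. (norm (f x))\<^sup>2) \<in> borel_measurable (lebesgue_on \<Omega>)" using assms(2) by measurable
    show "AE x in lebesgue_on \<Omega>. norm ((norm (f x))\<^sup>2) \<le> norm (B\<^sup>2 * (norm (u x))\<^sup>2)"
      by (rule AE_I2) (use le in \<open>auto simp: power_mult_distrib[symmetric] intro!: power_mono\<close>)
  qed
  then show ?thesis using assms by (simp add: L2_def)
qed

lemma L2_norm_nonneg [simp]: "0 \<le> L2_norm \<Omega> u"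
  by (simp add: L2_norm_def)

lemma L2_norm_power2: "(L2_norm \<Omega> u)\<^sup>2 = (LINT x|lebesgue_on \<Omega>. (norm (u x))\<^sup>2)"
  by (simp add: L2_norm_def)

lemma L2_norm_minus [simp]: "L2_norm \<Omega> (\<lambda>x. - u x) = L2_norm \<Omega> u"
  by (simp add: L2_norm_def)

lemma L2_norm_diff_commute: "L2_norm \<Omega> (\<lambda>x. u x - v x) = L2_norm \<Omega> (\<lambda>x. v x - u x)"
  by (simp add: L2_norm_def norm_minus_commute)

lemma L2_norm_cmult [simp]: "L2_norm \<Omega> (\<lambda>x. c * u x) = norm c * L2_norm \<Omega> u"
  by (simp add: L2_norm_def norm_mult power_mult_distrib real_sqrt_mult)

lemma L2_norm_zero [simp]: "L2_norm \<Omega> (\<lambda>x. 0) = 0"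
  by (simp add: L2_norm_def)

locale bounded_domain =
  fixes \<Omega> :: "'a::euclidean_space set"
  assumes open_dom: "open \<Omega>" and bounded_dom: "bounded \<Omega>"
begin

abbreviation "\<mu> \<equiv> lebesgue_on \<Omega>"

lemma lmeas_dom: "\<Omega> \<in> lmeasurable"
  using open_dom bounded_dom lmeasurable_open by blast

lemma dom_sets [simp, intro]: "\<Omega> \<in> sets lebesgue"
  using lmeas_dom by (rule fmeasurableD)

lemma finite_measure_dom: "finite_measure \<mu>"
  using lmeas_dom by (rule finite_measure_lebesgue_on)

lemma L2_zero [simp, intro]: "(\<lambda>x. 0) \<in> L2 \<Omega>"
  by (simp add: L2_def)

lemma L2_cmult [simp, intro]: "u \<in> L2 \<Omega> \<Longrightarrow> (\<lambda>x. c * u x) \<in> L2 \<Omega>"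
  by (auto simp: L2_def norm_mult power_mult_distrib)

lemma L2_uminus [simp, intro]: "u \<in> L2 \<Omega> \<Longrightarrow> (\<lambda>x. - u x) \<in> L2 \<Omega>"
  by (auto simp: L2_def)

lemma L2_add [simp, intro]:
  assumes "u \<in> L2 \<Omega>" "v \<in> L2 \<Omega>"
  shows "(\<lambda>x. u x + v x) \<in> L2 \<Omega>"
proof -
  have "integrable \<mu> (\<lambda>x. (norm (u x + v x))\<^sup>2)"
  proof (rule Bochner_Integration.integrable_bound)
    show "integrable \<mu> (\<lambda>x. 2 * (norm (u x))\<^sup>2 + 2 * (norm (v x))\<^sup>2)"
      using L2_D[OF assms(1)] L2_D[OF assms(2)] by simp
    show "(\<lambda>x. (norm (u x + v x))\<^sup>2) \<in> borel_measurable \<mu>"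
      using L2_D[OF assms(1)] L2_D[OF assms(2)] by measurable
    have "(norm (a + b))\<^sup>2 \<le> 2 * (norm a)\<^sup>2 + 2 * (norm b)\<^sup>2" for a b :: complex
    proof -
      have "(norm (a + b))\<^sup>2 \<le> (norm a + norm b)\<^sup>2" by (simp add: norm_triangle_ineq power_mono)
      also have "\<dots> \<le> 2 * (norm a)\<^sup>2 + 2 * (norm b)\<^sup>2"
        using sum_squares_bound[of "norm a" "norm b"] by (simp add: power2_sum)
      finally show ?thesis .
    qed
    then show "AE x in \<mu>. norm ((norm (u x + v x))\<^sup>2) \<le> norm (2 * (norm (u x))\<^sup>2 + 2 * (norm (v x))\<^sup>2)"
      by (intro AE_I2) simp
  qed
  then show ?thesis using L2_D[OF assms(1)] L2_D[OF assms(2)] by (simp add: L2_def)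
qed

lemma L2_diff [simp, intro]: "u \<in> L2 \<Omega> \<Longrightarrow> v \<in> L2 \<Omega> \<Longrightarrow> (\<lambda>x. u x - v x) \<in> L2 \<Omega>"
  using L2_add[OF _ L2_uminus, of u v] by simp

lemma L2_sum [intro]: "(\<And>i. i \<in> I \<Longrightarrow> u i \<in> L2 \<Omega>) \<Longrightarrow> (\<lambda>x. \<Sum>i\<in>I. u i x) \<in> L2 \<Omega>"
  by (induction I rule: infinite_finite_induct) auto

lemma L2_mult:
  assumes "u \<in> L2 \<Omega>" "m \<in> borel_measurable \<mu>" "\<And>x. x \<in> \<Omega> \<Longrightarrow> norm (m x) \<le> B"
  shows "(\<lambda>x. m x * u x) \<in> L2 \<Omega>"
proof (rule L2_dominated[OF assms(1)])
  show "(\<lambda>x. m x * u x) \<in> borel_measurable \<mu>" using assms(2) L2_D(1)[OF assms(1)] by measurable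
  show "norm (m x * u x) \<le> B * norm (u x)" if "x \<in> \<Omega>" for x
    using assms(3)[OF that] by (simp add: norm_mult mult_right_mono)
qed auto

lemma L2_bounded:
  assumes "m \<in> borel_measurable \<mu>" "\<And>x. x \<in> \<Omega> \<Longrightarrow> norm (m x) \<le> B"
  shows "m \<in> L2 \<Omega>"
proof -
  have "(\<lambda>x. 1) \<in> L2 \<Omega>"
    using finite_measure.integrable_const[OF finite_measure_dom, of "1::real"] by (simp add: L2_def)
  from L2_mult[OF this assms] show ?thesis by simp
qed

lemma L2_norm_mult_le:
  assumes "u \<in> L2 \<Omega>" "m \<in> borel_measurable \<mu>" "\<And>x. x \<in> \<Omega> \<Longrightarrow> norm (m x) \<le> B" "0 \<le> B"
  shows "L2_norm \<Omega> (\<lambda>x. m x * u x) \<le> B * L2_norm \<Omega> u"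
proof -
  have "(LINT x|\<mu>. (norm (m x * u x))\<^sup>2) \<le> (LINT x|\<mu>. B\<^sup>2 * (norm (u x))\<^sup>2)"
  proof (rule integral_mono)
    show "integrable \<mu> (\<lambda>x. (norm (m x * u x))\<^sup>2)" using L2_D(2)[OF L2_mult[OF assms(1-3)]] .
    show "integrable \<mu> (\<lambda>x. B\<^sup>2 * (norm (u x))\<^sup>2)" using L2_D[OF assms(1)] by simp
    fix x assume "x \<in> space \<mu>"
    then have "norm (m x) \<le> B" using assms(3) by simp
    then have "(norm (m x * u x))\<^sup>2 \<le> (B * norm (u x))\<^sup>2"
      by (intro power_mono) (auto simp: norm_mult mult_right_mono)
    then show "(norm (m x * u x))\<^sup>2 \<le> B\<^sup>2 * (norm (u x))\<^sup>2" by (simp add: power_mult_distrib)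
  qed
  then have "(L2_norm \<Omega> (\<lambda>x. m x * u x))\<^sup>2 \<le> (B * L2_norm \<Omega> u)\<^sup>2"
    by (simp add: power_mult_distrib L2_norm_power2)
  then show ?thesis using assms(4) by (simp add: power2_le_iff_abs_le)
qed

lemma integrable_mult_L2:
  assumes "u \<in> L2 \<Omega>" "v \<in> L2 \<Omega>"
  shows "integrable \<mu> (\<lambda>x. u x * v x)"
proof (rule Bochner_Integration.integrable_bound)
  show "integrable \<mu> (\<lambda>x. (norm (u x))\<^sup>2 + (norm (v x))\<^sup>2)"
    using L2_D[OF assms(1)] L2_D[OF assms(2)] by simp
  show "(\<lambda>x. u x * v x) \<in> borel_measurable \<mu>"
    using L2_D[OF assms(1)] L2_D[OF assms(2)] by measurable
  have "a * b \<le> a\<^sup>2 + b\<^sup>2" if "0 \<le> a" "0 \<le> b" for a b :: real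
    using sum_squares_bound[of a b] mult_nonneg_nonneg[OF that] by linarith
  then show "AE x in \<mu>. norm (u x * v x) \<le> norm ((norm (u x))\<^sup>2 + (norm (v x))\<^sup>2)"
    by (intro AE_I2) (auto simp: norm_mult)
qed

lemma cnj_L2:
  assumes "v \<in> L2 \<Omega>"
  shows "(\<lambda>x. cnj (v x)) \<in> L2 \<Omega>"
proof -
  have "(\<lambda>x. cnj (v x)) \<in> borel_measurable \<mu>"
    by (rule measurable_compose[OF L2_D(1)[OF assms]], rule borel_measurable_continuous_onI)
       (intro continuous_intros)
  then show ?thesis using assms by (auto simp: L2_def)
qed

lemma integrable_inner: "u \<in> L2 \<Omega> \<Longrightarrow> v \<in> L2 \<Omega> \<Longrightarrow> integrable \<mu> (\<lambda>x. u x * cnj (v x))"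
  using integrable_mult_L2 cnj_L2 by blast

lemma inner_add_left:
  "u \<in> L2 \<Omega> \<Longrightarrow> v \<in> L2 \<Omega> \<Longrightarrow> w \<in> L2 \<Omega> \<Longrightarrow>
    L2_inner \<Omega> (\<lambda>x. u x + v x) w = L2_inner \<Omega> u w + L2_inner \<Omega> v w"
  unfolding L2_inner_def using integrable_inner
  by (simp add: distrib_right Bochner_Integration.integral_add)

lemma inner_diff_left:
  "u \<in> L2 \<Omega> \<Longrightarrow> v \<in> L2 \<Omega> \<Longrightarrow> w \<in> L2 \<Omega> \<Longrightarrow>
    L2_inner \<Omega> (\<lambda>x. u x - v x) w = L2_inner \<Omega> u w - L2_inner \<Omega> v w"
  unfolding L2_inner_def using integrable_inner
  by (simp add: left_diff_distrib Bochner_Integration.integral_diff)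

lemma inner_cmult_left: "L2_inner \<Omega> (\<lambda>x. c * u x) w = c * L2_inner \<Omega> u w"
  unfolding L2_inner_def by (simp add: mult.assoc)

lemma inner_cnj: "L2_inner \<Omega> u w = cnj (L2_inner \<Omega> w u)"
  unfolding L2_inner_def by (subst Bochner_Integration.integral_cnj[symmetric]) (simp add: mult.commute)

lemma inner_add_right:
  "u \<in> L2 \<Omega> \<Longrightarrow> v \<in> L2 \<Omega> \<Longrightarrow> w \<in> L2 \<Omega> \<Longrightarrow>
    L2_inner \<Omega> w (\<lambda>x. u x + v x) = L2_inner \<Omega> w u + L2_inner \<Omega> w v"
  by (simp add: inner_cnj[of w] inner_add_left)

lemma inner_cmult_right: "L2_inner \<Omega> w (\<lambda>x. c * u x) = cnj c * L2_inner \<Omega> w u"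
  by (simp add: inner_cnj[of w] inner_cmult_left)

lemma inner_self: "L2_inner \<Omega> u u = of_real ((L2_norm \<Omega> u)\<^sup>2)"
  unfolding L2_inner_def L2_norm_power2 by (simp add: complex_norm_square[symmetric] del: of_real_power)

lemma inner_zero_left [simp]: "L2_inner \<Omega> (\<lambda>x. 0) v = 0"
  by (simp add: L2_inner_def)

lemma Cauchy_Schwarz_L2:
  assumes "u \<in> L2 \<Omega>" "v \<in> L2 \<Omega>"
  shows "norm (L2_inner \<Omega> u v) \<le> L2_norm \<Omega> u * L2_norm \<Omega> v"
proof -
  let ?f = "\<lambda>x. norm (u x)" and ?g = "\<lambda>x. norm (v x)"
  have [measurable]: "u \<in> borel_measurable \<mu>" "v \<in> borel_measurable \<mu>" using assms L2_D by blast+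
  have int: "integrable \<mu> (\<lambda>x. ?f x * ?g x)"
    using integrable_norm[OF integrable_mult_L2[OF assms]] by (simp add: norm_mult)
  have "(\<integral>\<^sup>+x. ennreal (?f x) * ennreal (?g x) \<partial>\<mu>)\<^sup>2
      \<le> (\<integral>\<^sup>+x. (ennreal (?f x))\<^sup>2 \<partial>\<mu>) * (\<integral>\<^sup>+x. (ennreal (?g x))\<^sup>2 \<partial>\<mu>)"
    by (rule Cauchy_Schwarz_nn_integral) measurable
  also have "(\<integral>\<^sup>+x. (ennreal (?f x))\<^sup>2 \<partial>\<mu>) = ennreal ((L2_norm \<Omega> u)\<^sup>2)"
    using nn_integral_eq_integral[OF L2_D(2)[OF assms(1)]] by (simp add: ennreal_power L2_norm_power2)
  also have "(\<integral>\<^sup>+x. (ennreal (?g x))\<^sup>2 \<partial>\<mu>) = ennreal ((L2_norm \<Omega> v)\<^sup>2)"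
    using nn_integral_eq_integral[OF L2_D(2)[OF assms(2)]] by (simp add: ennreal_power L2_norm_power2)
  also have "(\<integral>\<^sup>+x. ennreal (?f x) * ennreal (?g x) \<partial>\<mu>) = ennreal (LINT x|\<mu>. ?f x * ?g x)"
    using nn_integral_eq_integral[OF int] by (simp add: ennreal_mult)
  finally have "(LINT x|\<mu>. ?f x * ?g x)\<^sup>2 \<le> (L2_norm \<Omega> u * L2_norm \<Omega> v)\<^sup>2"
    by (simp add: ennreal_power ennreal_mult[symmetric] power_mult_distrib integral_nonneg_AE)
  then have "(LINT x|\<mu>. ?f x * ?g x) \<le> L2_norm \<Omega> u * L2_norm \<Omega> v"
    by (rule power2_le_imp_le) simp
  moreover have "norm (L2_inner \<Omega> u v) \<le> (LINT x|\<mu>. norm (u x * cnj (v x)))"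
    unfolding L2_inner_def by (rule integral_norm_bound)
  ultimately show ?thesis by (simp add: norm_mult)
qed

lemma L2_norm_add_power2:
  assumes "u \<in> L2 \<Omega>" "v \<in> L2 \<Omega>"
  shows "(L2_norm \<Omega> (\<lambda>x. u x + v x))\<^sup>2 = (L2_norm \<Omega> u)\<^sup>2 + (L2_norm \<Omega> v)\<^sup>2 + 2 * Re (L2_inner \<Omega> u v)"
proof -
  have "complex_of_real ((L2_norm \<Omega> (\<lambda>x. u x + v x))\<^sup>2) = L2_inner \<Omega> (\<lambda>x. u x + v x) (\<lambda>x. u x + v x)"
    by (simp only: inner_self)
  also have "\<dots> = L2_inner \<Omega> u u + L2_inner \<Omega> u v + (cnj (L2_inner \<Omega> u v) + L2_inner \<Omega> v v)"
    using assms by (simp add: inner_add_left inner_add_right inner_cnj[of v u])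
  finally have "Re (complex_of_real ((L2_norm \<Omega> (\<lambda>x. u x + v x))\<^sup>2)) = Re (L2_inner \<Omega> u u + L2_inner \<Omega> u v + (cnj (L2_inner \<Omega> u v) + L2_inner \<Omega> v v))"
    by simp
  then show ?thesis unfolding inner_self by simp
qed

lemma L2_norm_triangle:
  assumes "u \<in> L2 \<Omega>" "v \<in> L2 \<Omega>"
  shows "L2_norm \<Omega> (\<lambda>x. u x + v x) \<le> L2_norm \<Omega> u + L2_norm \<Omega> v"
proof (rule power2_le_imp_le)
  have "Re (L2_inner \<Omega> u v) \<le> L2_norm \<Omega> u * L2_norm \<Omega> v"
    using Cauchy_Schwarz_L2[OF assms] complex_Re_le_cmod order_trans by blast
  then show "(L2_norm \<Omega> (\<lambda>x. u x + v x))\<^sup>2 \<le> (L2_norm \<Omega> u + L2_norm \<Omega> v)\<^sup>2"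
    by (simp add: L2_norm_add_power2 assms power2_sum)
qed simp

lemma L2_norm_triangle_diff:
  assumes "u \<in> L2 \<Omega>" "v \<in> L2 \<Omega>"
  shows "L2_norm \<Omega> (\<lambda>x. u x - v x) \<le> L2_norm \<Omega> u + L2_norm \<Omega> v"
  using L2_norm_triangle[OF assms(1) L2_uminus[OF assms(2)]] by simp

lemma L2_norm_triangle_via:
  assumes "u \<in> L2 \<Omega>" "v \<in> L2 \<Omega>" "w \<in> L2 \<Omega>"
  shows "L2_norm \<Omega> (\<lambda>x. u x - w x) \<le> L2_norm \<Omega> (\<lambda>x. u x - v x) + L2_norm \<Omega> (\<lambda>x. v x - w x)"
  using L2_norm_triangle[of "\<lambda>x. u x - v x" "\<lambda>x. v x - w x"] assms by simp

lemma L2_norm_eq_0D: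
  assumes "u \<in> L2 \<Omega>" "L2_norm \<Omega> u = 0"
  shows "AE x in \<mu>. u x = 0"
proof -
  have "(LINT x|\<mu>. (norm (u x))\<^sup>2) = 0" using assms(2) L2_norm_power2[of \<Omega> u] by simp
  then have "AE x in \<mu>. (norm (u x))\<^sup>2 = 0"
    using integral_nonneg_eq_0_iff_AE[OF L2_D(2)[OF assms(1)]] by simp
  then show ?thesis by simp
qed

lemma inner_cong_AE:
  assumes "u \<in> L2 \<Omega>" "u' \<in> L2 \<Omega>" "v \<in> L2 \<Omega>" "AE x in \<mu>. u x = u' x"
  shows "L2_inner \<Omega> u v = L2_inner \<Omega> u' v"
  unfolding L2_inner_def
proof (rule integral_cong_AE)
  have [measurable]: "u \<in> borel_measurable \<mu>" "u' \<in> borel_measurable \<mu>" "v \<in> borel_measurable \<mu>"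
    using assms L2_D by blast+
  have [measurable]: "(\<lambda>x. cnj (v x)) \<in> borel_measurable \<mu>" using L2_D(1)[OF cnj_L2[OF assms(3)]] .
  show "(\<lambda>x. u x * cnj (v x)) \<in> borel_measurable \<mu>" "(\<lambda>x. u' x * cnj (v x)) \<in> borel_measurable \<mu>"
    by measurable
  show "AE x in \<mu>. u x * cnj (v x) = u' x * cnj (v x)" using assms(4) by auto
qed

text \<open>Continuity of the pairing under strong convergence; weak identities for test functions
  are passed to limits through it.\<close>

lemma inner_tendsto:
  assumes "\<And>k. u k \<in> L2 \<Omega>" "u' \<in> L2 \<Omega>" "v \<in> L2 \<Omega>"
    and "(\<lambda>k. L2_norm \<Omega> (\<lambda>x. u k x - u' x)) \<longlonglongrightarrow> 0"
  shows "(\<lambda>k. L2_inner \<Omega> (u k) v) \<longlonglongrightarrow> L2_inner \<Omega> u' v"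
proof -
  have "(\<lambda>k. L2_inner \<Omega> (u k) v - L2_inner \<Omega> u' v) \<longlonglongrightarrow> 0"
  proof (rule Lim_null_comparison)
    show "\<forall>\<^sub>F k in sequentially. norm (L2_inner \<Omega> (u k) v - L2_inner \<Omega> u' v)
        \<le> L2_norm \<Omega> (\<lambda>x. u k x - u' x) * L2_norm \<Omega> v"
      using Cauchy_Schwarz_L2[of "\<lambda>x. u k x - u' x" v for k] assms
      by (intro always_eventually) (simp add: inner_diff_left)
    show "(\<lambda>k. L2_norm \<Omega> (\<lambda>x. u k x - u' x) * L2_norm \<Omega> v) \<longlonglongrightarrow> 0"
      using tendsto_mult_right[OF assms(4), of "L2_norm \<Omega> v"] by simp
  qed
  then show ?thesis by (simp add: LIM_zero_iff)
qed

text \<open>Cauchy-Schwarz against the constant 1, which is square integrable on a bounded domain.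
  It turns an L2 Cauchy sequence into an L1 Cauchy sequence.\<close>

lemma integral_norm_le_L2:
  assumes "u \<in> L2 \<Omega>"
  shows "(LINT x|\<mu>. norm (u x)) \<le> L2_norm \<Omega> (\<lambda>x. 1) * L2_norm \<Omega> u" "integrable \<mu> (\<lambda>x. norm (u x))"
proof -
  have one: "(\<lambda>x. 1) \<in> L2 \<Omega>" using L2_bounded[of "\<lambda>x. 1" 1] by simp
  have nu: "(\<lambda>x. complex_of_real (norm (u x))) \<in> L2 \<Omega>" using assms by (auto simp: L2_def)
  show int: "integrable \<mu> (\<lambda>x. norm (u x))"
    using integrable_norm[OF integrable_mult_L2[OF assms one]] by simp
  have "norm (L2_inner \<Omega> (\<lambda>x. complex_of_real (norm (u x))) (\<lambda>x. 1))
      \<le> L2_norm \<Omega> (\<lambda>x. complex_of_real (norm (u x))) * L2_norm \<Omega> (\<lambda>x. 1)"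
    by (rule Cauchy_Schwarz_L2[OF nu one])
  moreover have "L2_inner \<Omega> (\<lambda>x. complex_of_real (norm (u x))) (\<lambda>x. 1) = of_real (LINT x|\<mu>. norm (u x))"
    by (simp add: L2_inner_def)
  moreover have "L2_norm \<Omega> (\<lambda>x. complex_of_real (norm (u x))) = L2_norm \<Omega> u" by (simp add: L2_norm_def)
  ultimately show "(LINT x|\<mu>. norm (u x)) \<le> L2_norm \<Omega> (\<lambda>x. 1) * L2_norm \<Omega> u"
    by (simp add: mult.commute)
qed

text \<open>Fatou's lemma for the squared moduli.\<close>

lemma L2_norm_le_if_AE_lim:
  assumes u: "\<And>k. u k \<in> L2 \<Omega>" and v: "v \<in> borel_measurable \<mu>"
    and lim: "AE x in \<mu>. (\<lambda>k. u k x) \<longlonglongrightarrow> v x"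
    and le: "\<forall>\<^sub>F k in sequentially. L2_norm \<Omega> (u k) \<le> e" and "0 \<le> e"
  shows "v \<in> L2 \<Omega>" "L2_norm \<Omega> v \<le> e"
proof -
  have [measurable]: "u k \<in> borel_measurable \<mu>" "v \<in> borel_measurable \<mu>" for k using u v L2_D by blast+
  have "(\<integral>\<^sup>+x. ennreal ((norm (v x))\<^sup>2) \<partial>\<mu>) = (\<integral>\<^sup>+x. liminf (\<lambda>k. ennreal ((norm (u k x))\<^sup>2)) \<partial>\<mu>)"
  proof (rule nn_integral_cong_AE)
    show "AE x in \<mu>. ennreal ((norm (v x))\<^sup>2) = liminf (\<lambda>k. ennreal ((norm (u k x))\<^sup>2))"
      using lim
    proof eventually_elim
      case (elim x)
      then have "(\<lambda>k. ennreal ((norm (u k x))\<^sup>2)) \<longlonglongrightarrow> ennreal ((norm (v x))\<^sup>2)"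
        by (intro tendsto_ennrealI tendsto_intros)
      then show ?case using lim_imp_Liminf[OF sequentially_bot] by metis
    qed
  qed
  also have "\<dots> \<le> liminf (\<lambda>k. \<integral>\<^sup>+x. ennreal ((norm (u k x))\<^sup>2) \<partial>\<mu>)"
    by (rule nn_integral_liminf) measurable
  also have "\<dots> \<le> ennreal (e\<^sup>2)"
  proof (rule Liminf_le[OF sequentially_bot])
    show "\<forall>\<^sub>F k in sequentially. (\<integral>\<^sup>+x. ennreal ((norm (u k x))\<^sup>2) \<partial>\<mu>) \<le> ennreal (e\<^sup>2)"
      using le
    proof eventually_elim
      case (elim k)
      have "(\<integral>\<^sup>+x. ennreal ((norm (u k x))\<^sup>2) \<partial>\<mu>) = ennreal ((L2_norm \<Omega> (u k))\<^sup>2)"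
        using nn_integral_eq_integral[OF L2_D(2)[OF u]] by (simp add: L2_norm_power2)
      then show ?case using elim by (simp add: ennreal_leI power_mono)
    qed
  qed
  finally have le2: "(\<integral>\<^sup>+x. ennreal ((norm (v x))\<^sup>2) \<partial>\<mu>) \<le> ennreal (e\<^sup>2)" .
  have int: "integrable \<mu> (\<lambda>x. (norm (v x))\<^sup>2)"
    by (rule integrableI_bounded) (use le2 in \<open>auto simp: le_less_trans\<close>)
  then show "v \<in> L2 \<Omega>" by (simp add: L2_def)
  have "ennreal ((L2_norm \<Omega> v)\<^sup>2) \<le> ennreal (e\<^sup>2)"
    using le2 nn_integral_eq_integral[OF int] by (simp add: L2_norm_power2)
  then have "(L2_norm \<Omega> v)\<^sup>2 \<le> e\<^sup>2" by simp
  then show "L2_norm \<Omega> v \<le> e" using \<open>0 \<le> e\<close> by (rule power2_le_imp_le)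
qed

text \<open>Riesz-Fischer. The sequence is also Cauchy in L1, so a subsequence converges almost
  everywhere; the Cauchy bound then passes to this limit by Fatou's lemma.\<close>

lemma L2_complete:
  assumes u: "\<And>k. u k \<in> L2 \<Omega>"
    and Cau: "\<And>e. 0 < e \<Longrightarrow> \<exists>M. \<forall>j\<ge>M. \<forall>k\<ge>M. L2_norm \<Omega> (\<lambda>x. u j x - u k x) < e"
  obtains v where "v \<in> L2 \<Omega>" "(\<lambda>k. L2_norm \<Omega> (\<lambda>x. u k x - v x)) \<longlonglongrightarrow> 0"
proof -
  have [measurable]: "u k \<in> borel_measurable \<mu>" for k using u L2_D by blast+
  let ?c = "L2_norm \<Omega> (\<lambda>x. 1)"
  have "integrable \<mu> (u k)" for k
    using integrable_mult_L2[OF u[of k], of "\<lambda>x. 1"] L2_bounded[of "\<lambda>x. 1" 1] by simp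
  moreover have "\<exists>M. \<forall>i\<ge>M. \<forall>j\<ge>M. (LINT x|\<mu>. norm (u i x - u j x)) < e" if "0 < e" for e
  proof -
    \<comment> \<open>Dividing by \<open>?c + 1\<close> also covers a null domain, where
      \<open>?c\<close> vanishes.\<close>
    have "0 < e / (?c + 1)" using that L2_norm_nonneg[of \<Omega> "\<lambda>x. 1"] by (simp add: add_nonneg_pos)
    then obtain M where M: "\<forall>j\<ge>M. \<forall>k\<ge>M. L2_norm \<Omega> (\<lambda>x. u j x - u k x) < e / (?c + 1)" using Cau by blast
    have "(LINT x|\<mu>. norm (u i x - u j x)) < e" if "i \<ge> M" "j \<ge> M" for i j
    proof -
      have "(LINT x|\<mu>. norm (u i x - u j x)) \<le> ?c * L2_norm \<Omega> (\<lambda>x. u i x - u j x)"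
        by (rule integral_norm_le_L2) (use u in auto)
      also have "\<dots> \<le> ?c * (e / (?c + 1))"
        using M that by (intro mult_left_mono) (auto intro: less_imp_le)
      also have "\<dots> < e" using \<open>0 < e\<close> L2_norm_nonneg[of \<Omega> "\<lambda>x. 1"]
        by (simp add: pos_divide_less_eq add_nonneg_pos distrib_left mult.commute)
      finally show ?thesis .
    qed
    then show ?thesis by blast
  qed
  ultimately obtain r where r: "strict_mono r" "AE x in \<mu>. Cauchy (\<lambda>i. u (r i) x)"
    using cauchy_L1_AE_cauchy_subseq[of \<mu> u] by blast
  define v where "v x = lim (\<lambda>i. u (r i) x)" for x
  have vm [measurable]: "v \<in> borel_measurable \<mu>" unfolding v_def[abs_def] by measurable
  have lim: "AE x in \<mu>. (\<lambda>i. u (r i) x) \<longlonglongrightarrow> v x"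
    using r(2) by eventually_elim (simp add: v_def Cauchy_convergent convergent_LIMSEQ_iff[symmetric])
  \<comment> \<open>With \<open>j\<close> fixed, Fatou along the subsequence bounds
    \<open>v - u j\<close>; this also yields that \<open>v\<close> itself is square
    integrable.\<close>
  have close: "\<exists>M. \<forall>j\<ge>M. (\<lambda>x. v x - u j x) \<in> L2 \<Omega> \<and> L2_norm \<Omega> (\<lambda>x. v x - u j x) \<le> e" if e: "0 < e" for e
  proof -
    obtain M where M: "\<forall>j\<ge>M. \<forall>k\<ge>M. L2_norm \<Omega> (\<lambda>x. u j x - u k x) < e" using Cau[OF e] by blast
    have "(\<lambda>x. v x - u j x) \<in> L2 \<Omega> \<and> L2_norm \<Omega> (\<lambda>x. v x - u j x) \<le> e" if j: "j \<ge> M" for j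
    proof -
      have "AE x in \<mu>. (\<lambda>i. u (r i) x - u j x) \<longlonglongrightarrow> v x - u j x"
        using lim by eventually_elim (intro tendsto_intros)
      moreover have "\<forall>\<^sub>F i in sequentially. L2_norm \<Omega> (\<lambda>x. u (r i) x - u j x) \<le> e"
        using eventually_ge_at_top[of M]
      proof eventually_elim
        case (elim i)
        then have "r i \<ge> M" using seq_suble[OF r(1), of i] by simp
        then show ?case using M j by (auto intro: less_imp_le)
      qed
      moreover have "(\<lambda>x. v x - u j x) \<in> borel_measurable \<mu>" by measurable
      ultimately show ?thesis
        using L2_norm_le_if_AE_lim[of "\<lambda>i x. u (r i) x - u j x" "\<lambda>x. v x - u j x" e] u e by auto
    qed
    then show ?thesis by blast
  qed
  have "v \<in> L2 \<Omega>"
  proof -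
    obtain M where "(\<lambda>x. v x - u M x) \<in> L2 \<Omega>" using close[of 1] by auto
    from L2_add[OF this u[of M]] show ?thesis by simp
  qed
  moreover have "(\<lambda>k. L2_norm \<Omega> (\<lambda>x. u k x - v x)) \<longlonglongrightarrow> 0"
  proof (rule LIMSEQ_I)
    fix e :: real assume "0 < e"
    then obtain M where "\<forall>j\<ge>M. L2_norm \<Omega> (\<lambda>x. v x - u j x) \<le> e / 2" using close[of "e/2"] by auto
    then show "\<exists>no. \<forall>n\<ge>no. norm (L2_norm \<Omega> (\<lambda>x. u n x - v x) - 0) < e"
      using \<open>0 < e\<close> by (intro exI[of _ M]) (fastforce simp: L2_norm_diff_commute[of \<Omega> _ v])
  qed
  ultimately show ?thesis using that by blast
qed

end

section \<open>Test functions and integration by parts\<close>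

lemma partial_deriv_works:
  assumes "f differentiable (at x)"
  shows "(f has_derivative frechet_derivative f (at x)) (at x)"
  using assms frechet_derivative_works by blast

lemma partial_deriv_eq: "(f has_derivative f') (at x) \<Longrightarrow> partial_deriv i f x = f' i"
  unfolding partial_deriv_def by (simp add: frechet_derivative_at[symmetric])

lemma partial_deriv_add:
  "f differentiable (at x) \<Longrightarrow> g differentiable (at x) \<Longrightarrow>
    partial_deriv i (\<lambda>y. f y + g y) x = partial_deriv i f x + partial_deriv i g x"
  by (rule partial_deriv_eq[THEN trans, OF has_derivative_add[OF partial_deriv_works partial_deriv_works]])
     (auto simp: partial_deriv_def)

lemma partial_deriv_cmult:
  "f differentiable (at x) \<Longrightarrow> partial_deriv i (\<lambda>y. c * f y) x = c * partial_deriv i f x"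
  by (rule partial_deriv_eq[THEN trans, OF has_derivative_mult_right[OF partial_deriv_works]])
     (auto simp: partial_deriv_def)

lemma partial_deriv_mult:
  "f differentiable (at x) \<Longrightarrow> g differentiable (at x) \<Longrightarrow>
    partial_deriv i (\<lambda>y. f y * g y) x = f x * partial_deriv i g x + partial_deriv i f x * g x"
  by (rule partial_deriv_eq[THEN trans, OF has_derivative_mult[OF partial_deriv_works partial_deriv_works]])
     (auto simp: partial_deriv_def)

lemma smooth_differentiable: "smooth f \<Longrightarrow> f differentiable (at x)"
  unfolding smooth_def by (drule spec[of _ "[]"]) simp

lemma smooth_partial_deriv:
  assumes "smooth f" "i \<in> Basis"
  shows "smooth (partial_deriv i f)"
  unfolding smooth_def
proof (intro allI impI)
  fix "is" :: "'a list" and x assume "set is \<subseteq> Basis"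
  then show "foldr partial_deriv is (partial_deriv i f) differentiable (at x)"
    \<comment> \<open>\<open>foldr\<close> applies the last list entry first, so the inner
      derivative is appended at the end.\<close>
    using assms unfolding smooth_def by (elim allE[of _ "is @ [i]"]) auto
qed

lemma smooth_continuous: "smooth f \<Longrightarrow> continuous_on A f"
  by (intro continuous_at_imp_continuous_on ballI differentiable_imp_continuous_within smooth_differentiable)

lemma smooth_add:
  assumes "smooth f" "smooth g" shows "smooth (\<lambda>y. f y + g y)"
proof -
  have "foldr partial_deriv is (\<lambda>y. f y + g y) = (\<lambda>y. foldr partial_deriv is f y + foldr partial_deriv is g y)"
    if "set is \<subseteq> Basis" for "is"
    using that
  proof (induction "is")
    case (Cons i "is")
    then have "foldr partial_deriv is f differentiable (at x)" "foldr partial_deriv is g differentiable (at x)" for x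
      using assms unfolding smooth_def by auto
    then show ?case using Cons by (intro ext) (simp add: partial_deriv_add)
  qed simp
  then show ?thesis using assms unfolding smooth_def by (auto intro!: differentiable_add)
qed

lemma smooth_cmult:
  assumes "smooth f" shows "smooth (\<lambda>y. c * f y)"
proof -
  have "foldr partial_deriv is (\<lambda>y. c * f y) = (\<lambda>y. c * foldr partial_deriv is f y)"
    if "set is \<subseteq> Basis" for "is"
    using that
  proof (induction "is")
    case (Cons i "is")
    then have "foldr partial_deriv is f differentiable (at x)" for x
      using assms unfolding smooth_def by auto
    then show ?case using Cons by (intro ext) (simp add: partial_deriv_cmult)
  qed simp
  then show ?thesis using assms unfolding smooth_def by (auto intro!: differentiable_mult)
qed

lemma test_add:
  assumes "\<phi> \<in> test_functions \<Omega>" "\<psi> \<in> test_functions \<Omega>"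
  shows "(\<lambda>y. \<phi> y + \<psi> y) \<in> test_functions \<Omega>"
proof -
  have sub: "closure {x. \<phi> x + \<psi> x \<noteq> 0} \<subseteq> closure {x. \<phi> x \<noteq> 0} \<union> closure {x. \<psi> x \<noteq> 0}"
    unfolding closure_Un[symmetric] by (rule closure_mono) auto
  have "compact (closure {x. \<phi> x + \<psi> x \<noteq> 0})"
    using compact_Int_closed[OF compact_Un closed_closure, of "closure {x. \<phi> x \<noteq> 0}" "closure {x. \<psi> x \<noteq> 0}"
        "{x. \<phi> x + \<psi> x \<noteq> 0}"] sub assms
    by (simp add: test_functions_def Int_absorb1)
  then show ?thesis using assms sub by (auto simp: test_functions_def smooth_add)
qed

lemma test_cmult:
  assumes "\<phi> \<in> test_functions \<Omega>"
  shows "(\<lambda>y. c * \<phi> y) \<in> test_functions \<Omega>"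
proof -
  have sub: "closure {x. c * \<phi> x \<noteq> 0} \<subseteq> closure {x. \<phi> x \<noteq> 0}"
    by (rule closure_mono) auto
  have "compact (closure {x. c * \<phi> x \<noteq> 0})"
    using compact_Int_closed[of "closure {x. \<phi> x \<noteq> 0}" "closure {x. c * \<phi> x \<noteq> 0}"] sub assms
    by (auto simp: test_functions_def Int_absorb1)
  then show ?thesis using assms sub by (auto simp: test_functions_def smooth_cmult)
qed

lemma test_diff:
  assumes "\<phi> \<in> test_functions \<Omega>" "\<psi> \<in> test_functions \<Omega>"
  shows "(\<lambda>y. \<phi> y - \<psi> y) \<in> test_functions \<Omega>"
  using test_add[OF assms(1) test_cmult[OF assms(2), of "-1"]] by simp

lemma test_zero: "(\<lambda>y. 0) \<in> test_functions \<Omega>"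
proof -
  have "foldr partial_deriv is (\<lambda>y. 0) = (\<lambda>y. 0)" for "is" :: "'a list"
    by (induction "is") (auto simp: partial_deriv_def intro!: ext)
  then show ?thesis by (auto simp: test_functions_def smooth_def)
qed

lemma partial_deriv_zero_outside:
  assumes "x \<notin> closure {x. f x \<noteq> 0}"
  shows "partial_deriv i f x = 0"
proof -
  have "(f has_derivative (\<lambda>h. 0)) (at x)"
    by (rule has_derivative_transform_within_open[OF has_derivative_const[of 0], of "- closure {x. f x \<noteq> 0}"])
       (use assms closure_subset[of "{x. f x \<noteq> 0}"] in auto)
  then show ?thesis by (simp add: partial_deriv_eq)
qed

section \<open>Integration by parts for compactly supported functions\<close>

lemma continuous_compact_support_bounded:
  fixes f :: "'a::euclidean_space \<Rightarrow> complex"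
  assumes "continuous_on UNIV f" "compact K" "\<And>x. x \<notin> K \<Longrightarrow> f x = 0"
  obtains B where "0 \<le> B" "\<And>x. norm (f x) \<le> B"
proof -
  have "bounded (f ` K)"
    by (intro compact_imp_bounded compact_continuous_image continuous_on_subset[OF assms(1)] assms(2)) simp
  then obtain B where B: "0 < B" "\<And>x. x \<in> K \<Longrightarrow> norm (f x) \<le> B" by (auto simp: bounded_pos)
  show ?thesis
  proof (rule that[of B])
    show "norm (f x) \<le> B" for x using B assms(3)[of x] by (cases "x \<in> K") auto
  qed (use B in auto)
qed

text \<open>The derivative is the limit of difference quotients, each of which has integral zero
  because Lebesgue measure is translation invariant. Dominated convergence applies: the quotients
  are bounded by the bound \<open>B\<close> of the derivative and vanish outside one fixed
  ball.\<close>

lemma integral_partial_deriv_eq_0: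
  fixes F :: "'a::euclidean_space \<Rightarrow> complex"
  assumes dif: "\<And>x. F differentiable (at x)" and cont: "continuous_on UNIV (partial_deriv i F)"
    and K: "compact K" and zero: "\<And>x. x \<notin> K \<Longrightarrow> F x = 0" "\<And>x. x \<notin> K \<Longrightarrow> partial_deriv i F x = 0"
    and i: "i \<in> Basis"
  shows "(LINT x|lborel. partial_deriv i F x) = 0"
proof -
  let ?D = "partial_deriv i F"
  obtain B where B: "0 \<le> B" "\<And>x. norm (?D x) \<le> B"
    using continuous_compact_support_bounded[OF cont K zero(2)] by blast
  obtain R where R: "\<And>x. x \<in> K \<Longrightarrow> norm x \<le> R"
    using compact_imp_bounded[OF K] by (auto simp: bounded_iff)
  have Fcont: "continuous_on UNIV F"
    by (intro continuous_at_imp_continuous_on ballI differentiable_imp_continuous_within dif)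
  have [measurable]: "F \<in> borel_measurable borel" "?D \<in> borel_measurable borel"
    using Fcont cont by (auto intro: borel_measurable_continuous_onI)
  \<comment> \<open>Steps of length at most one, so that the shifted supports all stay in the ball
    of radius \<open>R + 1\<close>.\<close>
  define h where "h k = 1 / real (Suc k)" for k
  have h: "0 < h k" "h k \<le> 1" "h \<longlonglongrightarrow> 0" for k
    using lim_inverse_n' LIMSEQ_Suc[OF lim_inverse_n'] by (auto simp: h_def[abs_def] field_simps)
  define s where "s k x = (F (x + h k *\<^sub>R i) - F x) /\<^sub>R h k" for k x
  have deriv: "((\<lambda>t. F (x + t *\<^sub>R i)) has_derivative (\<lambda>r. r *\<^sub>R ?D (x + t *\<^sub>R i))) (at t within A)" for x t A
  proof -
    have "((\<lambda>t. F (x + t *\<^sub>R i)) has_derivative (\<lambda>r. frechet_derivative F (at (x + t *\<^sub>R i)) (r *\<^sub>R i))) (at t within A)"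
      by (rule has_derivative_compose[where g=F, OF _ partial_deriv_works[OF dif]])
         (auto intro!: derivative_eq_intros)
    moreover have "frechet_derivative F (at (x + t *\<^sub>R i)) (r *\<^sub>R i) = r *\<^sub>R ?D (x + t *\<^sub>R i)" for r
      using linear_frechet_derivative[OF dif] by (simp add: partial_deriv_def linear_cmul)
    ultimately show ?thesis by simp
  qed
  have mvt: "norm (F (x + t *\<^sub>R i) - F x) \<le> B * \<bar>t\<bar>" for x t
  proof -
    have "onorm (\<lambda>r::real. r *\<^sub>R ?D y) \<le> B" for y
      by (rule onorm_le) (use mult_right_mono[OF B(2) abs_ge_zero] in \<open>simp add: mult.commute\<close>)
    then show ?thesis
      using differentiable_bound[where f="\<lambda>t. F (x + t *\<^sub>R i)" and S=UNIV and B=B and x=t and y=0, OF _ deriv]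
      by simp
  qed
  have int: "integrable lborel F"
  proof -
    have "(\<lambda>x. indicator K x *\<^sub>R F x) = F" using zero(1) by (auto simp: indicator_def)
    then show ?thesis using borel_integrable_compact[OF K continuous_on_subset[OF Fcont]] by simp
  qed
  have int': "integrable lborel (\<lambda>x. F (x + c))" "(LINT x|lborel. F (x + c)) = (LINT x|lborel. F x)" for c
  proof -
    have "integrable (distr lborel borel ((+) c)) F" using int by (simp add: lborel_distr_plus)
    then show "integrable lborel (\<lambda>x. F (x + c))"
      by (subst (asm) integrable_distr_eq) (auto simp: add.commute)
    have "(LINT x|lborel. F x) = (LINT x|distr lborel borel ((+) c). F x)" by (simp add: lborel_distr_plus)
    also have "\<dots> = (LINT x|lborel. F (x + c))" by (subst integral_distr) (auto simp: add.commute)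
    finally show "(LINT x|lborel. F (x + c)) = (LINT x|lborel. F x)" by simp
  qed
  have "(\<lambda>k. LINT x|lborel. s k x) \<longlonglongrightarrow> (LINT x|lborel. ?D x)"
  proof (rule integral_dominated_convergence[where w="\<lambda>x. B * indicator (cball 0 (R + 1)) x"])
    show "?D \<in> borel_measurable lborel" by measurable
    show "s k \<in> borel_measurable lborel" for k unfolding s_def[abs_def] by measurable
    show "integrable lborel (\<lambda>x::'a. B * indicator (cball 0 (R + 1)) x :: real)"
      by (intro integrable_mult_right integrable_real_indicator) (use emeasure_lborel_cball_finite[of "0::'a" "R + 1"] in auto)
    show "AE x in lborel. (\<lambda>k. s k x) \<longlonglongrightarrow> ?D x"
    proof (rule AE_I2)
      fix x
      have "((\<lambda>t. F (x + t *\<^sub>R i)) has_vector_derivative ?D x) (at 0)"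
        using deriv[of x 0 UNIV] by (simp add: has_vector_derivative_def)
      then have "((\<lambda>t. (F (x + t *\<^sub>R i) - F x - t *\<^sub>R ?D x) /\<^sub>R \<bar>t\<bar>) \<longlongrightarrow> 0) (at 0)"
        by (intro tendsto_norm_zero_cancel[where f="\<lambda>t. _ t /\<^sub>R \<bar>t\<bar>"])
           (simp add: has_vector_derivative_def has_derivative_at divide_inverse mult.commute)
      moreover have "filterlim h (at 0) sequentially"
        using h(3) less_imp_neq[OF h(1)] by (auto simp: filterlim_at intro!: always_eventually)
      ultimately have "(\<lambda>k. (F (x + h k *\<^sub>R i) - F x - h k *\<^sub>R ?D x) /\<^sub>R \<bar>h k\<bar>) \<longlonglongrightarrow> 0"
        by (rule filterlim_compose)
      then have "(\<lambda>k. s k x - ?D x) \<longlonglongrightarrow> 0"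
        by (rule Lim_transform_eventually)
           (use h in \<open>auto simp: s_def scaleR_diff_right abs_of_pos less_imp_neq[symmetric] intro!: always_eventually\<close>)
      then show "(\<lambda>k. s k x) \<longlonglongrightarrow> ?D x" by (simp add: LIM_zero_iff)
    qed
    show "AE x in lborel. norm (s k x) \<le> B * indicator (cball 0 (R + 1)) x" for k
    proof (rule AE_I2)
      fix x
      show "norm (s k x) \<le> B * indicator (cball 0 (R + 1)) x"
      proof (cases "x \<in> cball 0 (R + 1)")
        case True
        have "norm (s k x) = norm (F (x + h k *\<^sub>R i) - F x) / h k"
          using h(1)[of k] by (simp add: s_def divide_inverse mult.commute)
        also have "\<dots> \<le> B" using mvt[of x "h k"] h(1)[of k] by (simp add: pos_divide_le_eq)
        finally show ?thesis using True by simp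
      next
        case False
        then have n: "norm x > R + 1" by simp
        then have "x \<notin> K" using R by force
        moreover have "x + h k *\<^sub>R i \<notin> K"
        proof
          assume "x + h k *\<^sub>R i \<in> K"
          then have "norm (x + h k *\<^sub>R i) \<le> R" by (rule R)
          moreover have "norm x \<le> norm (x + h k *\<^sub>R i) + norm (h k *\<^sub>R i)"
            using norm_triangle_ineq4[of "x + h k *\<^sub>R i" "h k *\<^sub>R i"] by simp
          ultimately show False using n h(1)[of k] h(2)[of k] i by simp
        qed
        ultimately show ?thesis using False by (simp add: s_def zero)
      qed
    qed
  qed
  moreover have "(LINT x|lborel. s k x) = 0" for k
    using int int' by (simp add: s_def)
  ultimately show ?thesis by (simp add: LIMSEQ_const_iff)
qed

lemma test_D:
  assumes "\<phi> \<in> test_functions \<Omega>"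
  shows "smooth \<phi>" "compact (closure {x. \<phi> x \<noteq> 0})" "closure {x. \<phi> x \<noteq> 0} \<subseteq> \<Omega>"
    "x \<notin> closure {x. \<phi> x \<noteq> 0} \<Longrightarrow> \<phi> x = 0"
  using assms closure_subset[of "{x. \<phi> x \<noteq> 0}"] by (auto simp: test_functions_def)

context bounded_domain begin

lemma continuous_measurable: "continuous_on UNIV f \<Longrightarrow> f \<in> borel_measurable \<mu>"
  by (intro continuous_imp_measurable_on_sets_lebesgue) (auto intro: continuous_on_subset)

lemma test_L2: assumes "\<phi> \<in> test_functions \<Omega>" shows "\<phi> \<in> L2 \<Omega>"
proof -
  have c: "continuous_on UNIV \<phi>" by (rule smooth_continuous[OF test_D(1)[OF assms]])
  obtain B where "\<And>x. norm (\<phi> x) \<le> B"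
    using continuous_compact_support_bounded[OF c test_D(2)[OF assms] test_D(4)[OF assms]] by blast
  then show ?thesis using L2_bounded[OF continuous_measurable[OF c]] by blast
qed

lemma test_partial_L2: assumes "\<phi> \<in> test_functions \<Omega>" "i \<in> Basis" shows "partial_deriv i \<phi> \<in> L2 \<Omega>"
proof -
  have c: "continuous_on UNIV (partial_deriv i \<phi>)"
    by (rule smooth_continuous[OF smooth_partial_deriv[OF test_D(1)[OF assms(1)] assms(2)]])
  obtain B where "\<And>x. norm (partial_deriv i \<phi> x) \<le> B"
    using continuous_compact_support_bounded[OF c test_D(2)[OF assms(1)] partial_deriv_zero_outside] by blast
  then show ?thesis using L2_bounded[OF continuous_measurable[OF c]] by blast
qed

text \<open>The product has compact support in the domain, so its derivative has integral zero over
  the whole space. Restricting to the domain loses nothing, since the derivative vanishes off the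
  support of \<open>\<phi>\<close>.\<close>

lemma test_integration_by_parts:
  assumes \<phi>: "\<phi> \<in> test_functions \<Omega>" and \<psi>: "\<psi> \<in> test_functions \<Omega>" and i: "i \<in> Basis"
  shows "(LINT x|\<mu>. \<phi> x * partial_deriv i \<psi> x) = - (LINT x|\<mu>. partial_deriv i \<phi> x * \<psi> x)"
proof -
  let ?F = "\<lambda>x. \<phi> x * \<psi> x" and ?K = "closure {x. \<phi> x \<noteq> 0}"
  note d = smooth_differentiable[OF test_D(1)[OF \<phi>]] smooth_differentiable[OF test_D(1)[OF \<psi>]]
  have D: "partial_deriv i ?F = (\<lambda>x. \<phi> x * partial_deriv i \<psi> x + partial_deriv i \<phi> x * \<psi> x)"
    by (rule ext) (rule partial_deriv_mult[OF d])
  have cont: "continuous_on UNIV (partial_deriv i ?F)" unfolding D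
    by (intro continuous_intros smooth_continuous smooth_partial_deriv test_D(1)[OF \<phi>] test_D(1)[OF \<psi>] i)
  have zero: "partial_deriv i ?F x = 0" if "x \<notin> ?K" for x
    using that test_D(4)[OF \<phi> that] partial_deriv_zero_outside[OF that] by (simp add: D)
  have "0 = (LINT x|lborel. partial_deriv i ?F x)"
  proof (rule integral_partial_deriv_eq_0[symmetric, where K="?K" and F="?F"])
    show "?F differentiable (at x)" for x by (rule differentiable_mult[OF d])
    show "?F x = 0" if "x \<notin> ?K" for x using test_D(4)[OF \<phi> that] by simp
  qed (use cont test_D(2)[OF \<phi>] zero i in auto)
  also have "\<dots> = (LINT x|lebesgue. partial_deriv i ?F x)"
    by (rule integral_completion[symmetric]) (use cont in \<open>auto intro: borel_measurable_continuous_onI\<close>)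
  also have "\<dots> = (LINT x|lebesgue. indicator \<Omega> x *\<^sub>R partial_deriv i ?F x)"
    by (rule Bochner_Integration.integral_cong) (use zero test_D(3)[OF \<phi>] in \<open>auto simp: indicator_def\<close>)
  also have "\<dots> = (LINT x|\<mu>. partial_deriv i ?F x)"
    by (rule integral_restrict_space[symmetric]) simp
  also have "\<dots> = (LINT x|\<mu>. \<phi> x * partial_deriv i \<psi> x) + (LINT x|\<mu>. partial_deriv i \<phi> x * \<psi> x)"
    unfolding D by (intro Bochner_Integration.integral_add integrable_mult_L2 test_L2 test_partial_L2 \<phi> \<psi> i)
  finally show ?thesis by (simp add: eq_neg_iff_add_eq_0)
qed

text \<open>For test functions the weak gradient is the classical one, and the defining identity
  survives L2 limits. Membership in the closure therefore only requires the convergence of functions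
  and gradients.\<close>

lemma H10_limit:
  assumes \<phi>: "\<And>k::nat. \<phi> k \<in> test_functions \<Omega>" and u: "u \<in> L2 \<Omega>" and g: "\<And>i. i \<in> Basis \<Longrightarrow> g i \<in> L2 \<Omega>"
    and lim: "(\<lambda>k. L2_norm \<Omega> (\<lambda>x. \<phi> k x - u x)) \<longlonglongrightarrow> 0"
      "\<And>i. i \<in> Basis \<Longrightarrow> (\<lambda>k. L2_norm \<Omega> (\<lambda>x. partial_deriv i (\<phi> k) x - g i x)) \<longlonglongrightarrow> 0"
  shows "H10_gradient \<Omega> u g"
proof -
  have "(LINT x|\<mu>. u x * partial_deriv i \<psi> x) = - (LINT x|\<mu>. g i x * \<psi> x)"
    if i: "i \<in> Basis" and \<psi>: "\<psi> \<in> test_functions \<Omega>" for i \<psi>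
  proof -
    \<comment> \<open>\<open>L2_inner\<close> conjugates its second argument, whereas the weak
      gradient is defined without conjugation; testing with conjugated functions reconciles the
      two.\<close>
    let ?p = "\<lambda>x. cnj (partial_deriv i \<psi> x)" and ?q = "\<lambda>x. cnj (\<psi> x)"
    have 1: "(\<lambda>k. L2_inner \<Omega> (\<phi> k) ?p) \<longlonglongrightarrow> L2_inner \<Omega> u ?p"
      by (intro inner_tendsto test_L2 \<phi> u lim cnj_L2 test_partial_L2 \<psi> i)
    have 2: "(\<lambda>k. L2_inner \<Omega> (partial_deriv i (\<phi> k)) ?q) \<longlonglongrightarrow> L2_inner \<Omega> (g i) ?q"
      by (intro inner_tendsto test_L2 \<phi> g lim cnj_L2 test_partial_L2 \<psi> i)
    have 3: "L2_inner \<Omega> (\<phi> k) ?p = - L2_inner \<Omega> (partial_deriv i (\<phi> k)) ?q" for k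
      using test_integration_by_parts[OF \<phi> \<psi> i] by (simp add: L2_inner_def)
    have "L2_inner \<Omega> u ?p = - L2_inner \<Omega> (g i) ?q"
      by (rule LIMSEQ_unique[OF 1]) (simp only: 3 tendsto_minus[OF 2])
    then show ?thesis by (simp add: L2_inner_def)
  qed
  then show ?thesis using assms unfolding H10_gradient_def has_weak_gradient_def by blast
qed

lemma H10_D:
  assumes "H10_gradient \<Omega> u g"
  shows "u \<in> L2 \<Omega>" "i \<in> Basis \<Longrightarrow> g i \<in> L2 \<Omega>"
  using assms by (auto simp: H10_gradient_def has_weak_gradient_def)

lemma L2_norm_tendsto_add:
  assumes "\<And>k. a k \<in> L2 \<Omega>" "\<And>k. b k \<in> L2 \<Omega>" "a' \<in> L2 \<Omega>" "b' \<in> L2 \<Omega>"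
    "(\<lambda>k. L2_norm \<Omega> (\<lambda>x. a k x - a' x)) \<longlonglongrightarrow> 0" "(\<lambda>k. L2_norm \<Omega> (\<lambda>x. b k x - b' x)) \<longlonglongrightarrow> 0"
  shows "(\<lambda>k. L2_norm \<Omega> (\<lambda>x. a k x + b k x - (a' x + b' x))) \<longlonglongrightarrow> 0"
proof (rule Lim_null_comparison)
  show "(\<lambda>k. L2_norm \<Omega> (\<lambda>x. a k x - a' x) + L2_norm \<Omega> (\<lambda>x. b k x - b' x)) \<longlonglongrightarrow> 0"
    using tendsto_add[OF assms(5,6)] by simp
  show "\<forall>\<^sub>F k in sequentially. norm (L2_norm \<Omega> (\<lambda>x. a k x + b k x - (a' x + b' x)))
      \<le> L2_norm \<Omega> (\<lambda>x. a k x - a' x) + L2_norm \<Omega> (\<lambda>x. b k x - b' x)"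
    using L2_norm_triangle[OF L2_diff[OF assms(1,3)] L2_diff[OF assms(2,4)]]
    by (intro always_eventually) (simp add: algebra_simps)
qed

lemma H10_add:
  assumes "H10_gradient \<Omega> u g" "H10_gradient \<Omega> u' g'"
  shows "H10_gradient \<Omega> (\<lambda>x. u x + u' x) (\<lambda>i x. g i x + g' i x)"
proof -
  obtain \<phi> where \<phi>: "\<And>k. \<phi> k \<in> test_functions \<Omega>" "(\<lambda>k. L2_norm \<Omega> (\<lambda>x. \<phi> k x - u x)) \<longlonglongrightarrow> 0"
      "\<And>i. i \<in> Basis \<Longrightarrow> (\<lambda>k. L2_norm \<Omega> (\<lambda>x. partial_deriv i (\<phi> k) x - g i x)) \<longlonglongrightarrow> 0"
    using assms(1) unfolding H10_gradient_def by blast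
  obtain \<psi> where \<psi>: "\<And>k. \<psi> k \<in> test_functions \<Omega>" "(\<lambda>k. L2_norm \<Omega> (\<lambda>x. \<psi> k x - u' x)) \<longlonglongrightarrow> 0"
      "\<And>i. i \<in> Basis \<Longrightarrow> (\<lambda>k. L2_norm \<Omega> (\<lambda>x. partial_deriv i (\<psi> k) x - g' i x)) \<longlonglongrightarrow> 0"
    using assms(2) unfolding H10_gradient_def by blast
  show ?thesis
  proof (rule H10_limit[of "\<lambda>k x. \<phi> k x + \<psi> k x"])
    show "(\<lambda>x. \<phi> k x + \<psi> k x) \<in> test_functions \<Omega>" for k by (intro test_add \<phi> \<psi>)
    show "(\<lambda>x. u x + u' x) \<in> L2 \<Omega>" using assms H10_D by blast
    show "(\<lambda>x. g i x + g' i x) \<in> L2 \<Omega>" if "i \<in> Basis" for i using assms H10_D that by blast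
    show "(\<lambda>k. L2_norm \<Omega> (\<lambda>x. \<phi> k x + \<psi> k x - (u x + u' x))) \<longlonglongrightarrow> 0"
      by (intro L2_norm_tendsto_add test_L2 \<phi> \<psi> H10_D(1)[OF assms(1)] H10_D(1)[OF assms(2)])
    fix i :: 'a assume i: "i \<in> Basis"
    have "partial_deriv i (\<lambda>x. \<phi> k x + \<psi> k x) x = partial_deriv i (\<phi> k) x + partial_deriv i (\<psi> k) x" for k x
      by (intro partial_deriv_add smooth_differentiable test_D(1)[OF \<phi>(1)] test_D(1)[OF \<psi>(1)])
    then show "(\<lambda>k. L2_norm \<Omega> (\<lambda>x. partial_deriv i (\<lambda>x. \<phi> k x + \<psi> k x) x - (g i x + g' i x))) \<longlonglongrightarrow> 0"
      using L2_norm_tendsto_add[OF test_partial_L2[OF \<phi>(1) i] test_partial_L2[OF \<psi>(1) i]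
        H10_D(2)[OF assms(1) i] H10_D(2)[OF assms(2) i] \<phi>(3)[OF i] \<psi>(3)[OF i]] by simp
  qed
qed

lemma H10_cmult:
  assumes "H10_gradient \<Omega> u g"
  shows "H10_gradient \<Omega> (\<lambda>x. c * u x) (\<lambda>i x. c * g i x)"
proof -
  obtain \<phi> where \<phi>: "\<And>k. \<phi> k \<in> test_functions \<Omega>" "(\<lambda>k. L2_norm \<Omega> (\<lambda>x. \<phi> k x - u x)) \<longlonglongrightarrow> 0"
      "\<And>i. i \<in> Basis \<Longrightarrow> (\<lambda>k. L2_norm \<Omega> (\<lambda>x. partial_deriv i (\<phi> k) x - g i x)) \<longlonglongrightarrow> 0"
    using assms(1) unfolding H10_gradient_def by blast
  show ?thesis
  proof (rule H10_limit[of "\<lambda>k x. c * \<phi> k x"])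
    show "(\<lambda>x. c * \<phi> k x) \<in> test_functions \<Omega>" for k by (intro test_cmult \<phi>)
    show "(\<lambda>x. c * u x) \<in> L2 \<Omega>" using assms H10_D by blast
    show "(\<lambda>x. c * g i x) \<in> L2 \<Omega>" if "i \<in> Basis" for i using assms H10_D that by blast
    show "(\<lambda>k. L2_norm \<Omega> (\<lambda>x. c * \<phi> k x - c * u x)) \<longlonglongrightarrow> 0"
      using tendsto_mult_left[OF \<phi>(2), of "norm c"] by (simp add: right_diff_distrib[symmetric])
    fix i :: 'a assume i: "i \<in> Basis"
    have "partial_deriv i (\<lambda>x. c * \<phi> k x) x = c * partial_deriv i (\<phi> k) x" for k x
      by (intro partial_deriv_cmult smooth_differentiable test_D(1)[OF \<phi>(1)])
    then show "(\<lambda>k. L2_norm \<Omega> (\<lambda>x. partial_deriv i (\<lambda>x. c * \<phi> k x) x - c * g i x)) \<longlonglongrightarrow> 0"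
      using tendsto_mult_left[OF \<phi>(3)[OF i], of "norm c"] by (simp add: right_diff_distrib[symmetric])
  qed
qed

abbreviation "lap \<equiv> neg_dirichlet_laplacian \<Omega>"

section \<open>The Dirichlet Laplacian\<close>

lemma lapD:
  assumes "lap u f"
  obtains g where "H10_gradient \<Omega> u g" "f \<in> L2 \<Omega>"
    "\<And>\<phi>. \<phi> \<in> test_functions \<Omega> \<Longrightarrow>
      (\<Sum>i\<in>Basis. L2_inner \<Omega> (g i) (partial_deriv i \<phi>)) = L2_inner \<Omega> f \<phi>"
  using assms unfolding neg_dirichlet_laplacian_def by blast

lemma lap_L2:
  assumes "lap u f" shows "u \<in> L2 \<Omega>" "f \<in> L2 \<Omega>"
  using lapD[OF assms] H10_D(1) by metis+

lemma lap_add: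
  assumes "lap u f" "lap v h"
  shows "lap (\<lambda>x. u x + v x) (\<lambda>x. f x + h x)"
proof -
  obtain g where g: "H10_gradient \<Omega> u g" "f \<in> L2 \<Omega>"
    "\<And>\<phi>. \<phi> \<in> test_functions \<Omega> \<Longrightarrow> (\<Sum>i\<in>Basis. L2_inner \<Omega> (g i) (partial_deriv i \<phi>)) = L2_inner \<Omega> f \<phi>"
    using lapD[OF assms(1)] by metis
  obtain g' where g': "H10_gradient \<Omega> v g'" "h \<in> L2 \<Omega>"
    "\<And>\<phi>. \<phi> \<in> test_functions \<Omega> \<Longrightarrow> (\<Sum>i\<in>Basis. L2_inner \<Omega> (g' i) (partial_deriv i \<phi>)) = L2_inner \<Omega> h \<phi>"
    using lapD[OF assms(2)] by metis
  have "(\<Sum>i\<in>Basis. L2_inner \<Omega> (\<lambda>x. g i x + g' i x) (partial_deriv i \<phi>)) = L2_inner \<Omega> (\<lambda>x. f x + h x) \<phi>"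
    if "\<phi> \<in> test_functions \<Omega>" for \<phi>
  proof -
    have "(\<Sum>i\<in>Basis. L2_inner \<Omega> (\<lambda>x. g i x + g' i x) (partial_deriv i \<phi>))
        = (\<Sum>i\<in>Basis. L2_inner \<Omega> (g i) (partial_deriv i \<phi>) + L2_inner \<Omega> (g' i) (partial_deriv i \<phi>))"
      by (intro sum.cong refl inner_add_left H10_D(2)[OF g(1)] H10_D(2)[OF g'(1)] test_partial_L2 that)
    then show ?thesis
      using g(3)[OF that] g'(3)[OF that] g(2) g'(2) test_L2[OF that] by (simp add: sum.distrib inner_add_left)
  qed
  then show ?thesis
    unfolding neg_dirichlet_laplacian_def using H10_add[OF g(1) g'(1)] L2_add[OF g(2) g'(2)] by blast
qed

lemma lap_cmult:
  assumes "lap u f"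
  shows "lap (\<lambda>x. c * u x) (\<lambda>x. c * f x)"
proof -
  obtain g where g: "H10_gradient \<Omega> u g" "f \<in> L2 \<Omega>"
    "\<And>\<phi>. \<phi> \<in> test_functions \<Omega> \<Longrightarrow> (\<Sum>i\<in>Basis. L2_inner \<Omega> (g i) (partial_deriv i \<phi>)) = L2_inner \<Omega> f \<phi>"
    using lapD[OF assms(1)] by metis
  have "(\<Sum>i\<in>Basis. L2_inner \<Omega> (\<lambda>x. c * g i x) (partial_deriv i \<phi>)) = L2_inner \<Omega> (\<lambda>x. c * f x) \<phi>"
    if "\<phi> \<in> test_functions \<Omega>" for \<phi>
    using g(3)[OF that] by (simp add: inner_cmult_left sum_distrib_left[symmetric])
  then show ?thesis
    unfolding neg_dirichlet_laplacian_def using H10_cmult[OF g(1)] L2_cmult[OF g(2)] by blast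
qed

lemma lap_diff:
  assumes "lap u f" "lap v h"
  shows "lap (\<lambda>x. u x - v x) (\<lambda>x. f x - h x)"
  using lap_add[OF assms(1) lap_cmult[OF assms(2), of "-1"]] by simp

lemma lap_zero: "lap (\<lambda>x. 0) (\<lambda>x. 0)"
proof -
  have "H10_gradient \<Omega> (\<lambda>x. 0) (\<lambda>i x. 0)"
    by (rule H10_limit[of "\<lambda>k x. 0"]) (auto simp: test_zero partial_deriv_def)
  then show ?thesis by (auto simp: neg_dirichlet_laplacian_def)
qed

lemma lap_sum:
  assumes "\<And>i. i \<in> I \<Longrightarrow> lap (u i) (f i)"
  shows "lap (\<lambda>x. \<Sum>i\<in>I. u i x) (\<lambda>x. \<Sum>i\<in>I. f i x)"
  using assms by (induction I rule: infinite_finite_induct) (auto intro: lap_zero lap_add)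

text \<open>Functions are not identified almost everywhere, so null-set changes of the right-hand
  side need this step. The function \<open>u\<close> stays untouched.\<close>

lemma lap_cong_AE:
  assumes "lap u f" "f' \<in> L2 \<Omega>" "AE x in \<mu>. f x = f' x"
  shows "lap u f'"
proof -
  obtain g where g: "H10_gradient \<Omega> u g" "f \<in> L2 \<Omega>"
    "\<And>\<phi>. \<phi> \<in> test_functions \<Omega> \<Longrightarrow> (\<Sum>i\<in>Basis. L2_inner \<Omega> (g i) (partial_deriv i \<phi>)) = L2_inner \<Omega> f \<phi>"
    using lapD[OF assms(1)] by metis
  have "L2_inner \<Omega> f \<phi> = L2_inner \<Omega> f' \<phi>" if "\<phi> \<in> test_functions \<Omega>" for \<phi>
    by (rule inner_cong_AE[OF g(2) assms(2) test_L2[OF that] assms(3)])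
  then show ?thesis unfolding neg_dirichlet_laplacian_def using g assms(2) by auto
qed

lemma inner_tendsto_right:
  assumes "\<And>k. u k \<in> L2 \<Omega>" "u' \<in> L2 \<Omega>" "v \<in> L2 \<Omega>"
    and "(\<lambda>k. L2_norm \<Omega> (\<lambda>x. u k x - u' x)) \<longlonglongrightarrow> 0"
  shows "(\<lambda>k. L2_inner \<Omega> v (u k)) \<longlonglongrightarrow> L2_inner \<Omega> v u'"
  unfolding inner_cnj[of v] by (intro tendsto_cnj inner_tendsto assms)

text \<open>Formally this is <A u, u> = |grad u|^2. The weak equation admits only test functions, so
  it is applied to the approximants of \<open>u\<close> and passed to the limit on both
  sides.\<close>

lemma lap_accretive:
  assumes "lap u f"
  shows "0 \<le> Re (L2_inner \<Omega> f u)"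
proof -
  obtain g where g: "H10_gradient \<Omega> u g" "f \<in> L2 \<Omega>"
    "\<And>\<phi>. \<phi> \<in> test_functions \<Omega> \<Longrightarrow> (\<Sum>i\<in>Basis. L2_inner \<Omega> (g i) (partial_deriv i \<phi>)) = L2_inner \<Omega> f \<phi>"
    using lapD[OF assms(1)] by metis
  obtain \<phi> where \<phi>: "\<And>k. \<phi> k \<in> test_functions \<Omega>" "(\<lambda>k. L2_norm \<Omega> (\<lambda>x. \<phi> k x - u x)) \<longlonglongrightarrow> 0"
      "\<And>i. i \<in> Basis \<Longrightarrow> (\<lambda>k. L2_norm \<Omega> (\<lambda>x. partial_deriv i (\<phi> k) x - g i x)) \<longlonglongrightarrow> 0"
    using g(1) unfolding H10_gradient_def by blast
  have 1: "(\<lambda>k. L2_inner \<Omega> f (\<phi> k)) \<longlonglongrightarrow> L2_inner \<Omega> f u"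
    by (intro inner_tendsto_right test_L2 \<phi> g H10_D(1)[OF g(1)])
  have 2: "(\<lambda>k. L2_inner \<Omega> f (\<phi> k)) \<longlonglongrightarrow> (\<Sum>i\<in>Basis. L2_inner \<Omega> (g i) (g i))"
    unfolding g(3)[OF \<phi>(1), symmetric]
    by (intro tendsto_sum inner_tendsto_right test_partial_L2 \<phi> H10_D(2)[OF g(1)])
  have "L2_inner \<Omega> f u = (\<Sum>i\<in>Basis. of_real ((L2_norm \<Omega> (g i))\<^sup>2))"
    using LIMSEQ_unique[OF 1 2] by (simp only: inner_self)
  then show ?thesis by (simp add: sum_nonneg)
qed

section \<open>Dirichlet's principle for positive shifts of the Laplacian\<close>

definition energy :: "real \<Rightarrow> ('a \<Rightarrow> complex) \<Rightarrow> real" where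
  "energy l \<phi> = (\<Sum>i\<in>Basis. (L2_norm \<Omega> (partial_deriv i \<phi>))\<^sup>2) + l * (L2_norm \<Omega> \<phi>)\<^sup>2"

definition functional :: "real \<Rightarrow> ('a \<Rightarrow> complex) \<Rightarrow> ('a \<Rightarrow> complex) \<Rightarrow> real" where
  "functional l h \<phi> = energy l \<phi> - 2 * Re (L2_inner \<Omega> h \<phi>)"

lemma L2_norm_add_cmult_power2:
  assumes "u \<in> L2 \<Omega>" "v \<in> L2 \<Omega>"
  shows "(L2_norm \<Omega> (\<lambda>x. u x + c * v x))\<^sup>2 =
    (L2_norm \<Omega> u)\<^sup>2 + (norm c)\<^sup>2 * (L2_norm \<Omega> v)\<^sup>2 + 2 * Re (cnj c * L2_inner \<Omega> u v)"
  using L2_norm_add_power2[OF assms(1) L2_cmult[OF assms(2), of c]]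
  by (simp add: inner_cmult_right power_mult_distrib)

text \<open>The factor of \<open>cnj c\<close> is the first variation at \<open>\<phi>\<close> in
  direction \<open>\<psi>\<close>. The values 1 and 1/2 of \<open>c\<close> give the parallelogram
  identity, general complex \<open>c\<close> the Euler-Lagrange equation.\<close>

lemma functional_expand:
  assumes \<phi>: "\<phi> \<in> test_functions \<Omega>" and \<psi>: "\<psi> \<in> test_functions \<Omega>" and h: "h \<in> L2 \<Omega>"
  shows "functional l h (\<lambda>x. \<phi> x + c * \<psi> x) = functional l h \<phi> + (norm c)\<^sup>2 * energy l \<psi>
    + 2 * Re (cnj c * ((\<Sum>i\<in>Basis. L2_inner \<Omega> (partial_deriv i \<phi>) (partial_deriv i \<psi>))
        + of_real l * L2_inner \<Omega> \<phi> \<psi> - L2_inner \<Omega> h \<psi>))"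
proof -
  have pd: "partial_deriv i (\<lambda>x. \<phi> x + c * \<psi> x) = (\<lambda>x. partial_deriv i \<phi> x + c * partial_deriv i \<psi> x)" for i
    by (rule ext) (simp add: partial_deriv_add partial_deriv_cmult smooth_differentiable
      differentiable_mult test_D(1)[OF \<phi>] test_D(1)[OF \<psi>])
  have "(L2_norm \<Omega> (\<lambda>x. partial_deriv i \<phi> x + c * partial_deriv i \<psi> x))\<^sup>2 =
     (L2_norm \<Omega> (partial_deriv i \<phi>))\<^sup>2 + (norm c)\<^sup>2 * (L2_norm \<Omega> (partial_deriv i \<psi>))\<^sup>2
      + 2 * Re (cnj c * L2_inner \<Omega> (partial_deriv i \<phi>) (partial_deriv i \<psi>))" if "i \<in> Basis" for i
    by (intro L2_norm_add_cmult_power2 test_partial_L2 that \<phi> \<psi>)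
  then have "(\<Sum>i\<in>Basis. (L2_norm \<Omega> (partial_deriv i (\<lambda>x. \<phi> x + c * \<psi> x)))\<^sup>2)
      = (\<Sum>i\<in>Basis. (L2_norm \<Omega> (partial_deriv i \<phi>))\<^sup>2) + (norm c)\<^sup>2 * (\<Sum>i\<in>Basis. (L2_norm \<Omega> (partial_deriv i \<psi>))\<^sup>2)
       + 2 * Re (cnj c * (\<Sum>i\<in>Basis. L2_inner \<Omega> (partial_deriv i \<phi>) (partial_deriv i \<psi>)))"
    unfolding pd by (simp add: sum.distrib sum_distrib_left)
  then show ?thesis
    unfolding functional_def energy_def
    using L2_norm_add_cmult_power2[OF test_L2[OF \<phi>] test_L2[OF \<psi>], of c]
    by (simp add: inner_add_right inner_cmult_right h test_L2 \<phi> \<psi> algebra_simps)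
qed

lemma energy_ge:
  assumes "0 \<le> l"
  shows "l * (L2_norm \<Omega> \<phi>)\<^sup>2 \<le> energy l \<phi>"
    "i \<in> Basis \<Longrightarrow> (L2_norm \<Omega> (partial_deriv i \<phi>))\<^sup>2 \<le> energy l \<phi>"
proof -
  show "l * (L2_norm \<Omega> \<phi>)\<^sup>2 \<le> energy l \<phi>" unfolding energy_def by (simp add: sum_nonneg)
  assume "i \<in> Basis"
  then have "(L2_norm \<Omega> (partial_deriv i \<phi>))\<^sup>2 \<le> (\<Sum>i\<in>Basis. (L2_norm \<Omega> (partial_deriv i \<phi>))\<^sup>2)"
    by (intro member_le_sum) auto
  then show "(L2_norm \<Omega> (partial_deriv i \<phi>))\<^sup>2 \<le> energy l \<phi>"
    using assms by (simp add: energy_def add_increasing2)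
qed

text \<open>Dirichlet's principle: the solution minimises \<^term>\<open>functional l h\<close> over the completion of
  the test functions, and the parallelogram identity makes minimising sequences Cauchy.\<close>

lemma real_resolvent_exists:
  assumes l: "0 < l" and h: "h \<in> L2 \<Omega>"
  shows "\<exists>u. lap u (\<lambda>x. h x - of_real l * u x)"
proof -
  let ?J = "functional l h"
  define d where "d = Inf (?J ` test_functions \<Omega>)"
  have lower: "- (L2_norm \<Omega> h)\<^sup>2 / l \<le> ?J \<phi>" if "\<phi> \<in> test_functions \<Omega>" for \<phi>
  proof -
    have "Re (L2_inner \<Omega> h \<phi>) \<le> L2_norm \<Omega> h * L2_norm \<Omega> \<phi>"
      using Cauchy_Schwarz_L2[OF h test_L2[OF that]] complex_Re_le_cmod order_trans by blast
    moreover have "l * (L2_norm \<Omega> \<phi>)\<^sup>2 \<le> energy l \<phi>" using energy_ge l by simp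
    \<comment> \<open>Completing the square bounds the functional from below.\<close>
    moreover have "0 \<le> (l * L2_norm \<Omega> \<phi> - L2_norm \<Omega> h)\<^sup>2 / l" using l by simp
    moreover have "(l * L2_norm \<Omega> \<phi> - L2_norm \<Omega> h)\<^sup>2 / l =
        l * (L2_norm \<Omega> \<phi>)\<^sup>2 - 2 * (L2_norm \<Omega> h * L2_norm \<Omega> \<phi>) + (L2_norm \<Omega> h)\<^sup>2 / l"
      using l by (simp add: power2_eq_square field_simps)
    ultimately show ?thesis unfolding functional_def by simp
  qed
  have bdd: "bdd_below (?J ` test_functions \<Omega>)" using lower by (intro bdd_belowI2)
  have d_le: "d \<le> ?J \<phi>" if "\<phi> \<in> test_functions \<Omega>" for \<phi>
    unfolding d_def using bdd that by (intro cInf_lower) auto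
  have "\<exists>\<phi>\<in>test_functions \<Omega>. ?J \<phi> < d + 1 / real (Suc k)" for k
  proof -
    have "?J ` test_functions \<Omega> \<noteq> {}" using test_zero by auto
    then show ?thesis
      using cInf_lessD[of "?J ` test_functions \<Omega>" "d + 1 / real (Suc k)"] by (auto simp: d_def)
  qed
  then obtain \<phi> where \<phi>: "\<phi> k \<in> test_functions \<Omega>" "?J (\<phi> k) < d + 1 / real (Suc k)" for k by metis
  have par: "energy l (\<lambda>x. \<phi> j x - \<phi> k x) \<le> 2 / real (Suc j) + 2 / real (Suc k)" for j k
  proof -
    define \<omega> where "\<omega> = (\<lambda>x. \<phi> j x - \<phi> k x)"
    have \<omega>: "\<omega> \<in> test_functions \<Omega>" unfolding \<omega>_def by (intro test_diff \<phi>)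
    \<comment> \<open>The first variation cancels between the two expansions below, which leaves:
      energy of the difference = 2 J(\<open>\<phi> j\<close>) + 2 J(\<open>\<phi> k\<close>) - 4
      J(midpoint).\<close>
    define B where "B = (\<Sum>i\<in>Basis. L2_inner \<Omega> (partial_deriv i (\<phi> k)) (partial_deriv i \<omega>))
        + of_real l * L2_inner \<Omega> (\<phi> k) \<omega> - L2_inner \<Omega> h \<omega>"
    have "(\<lambda>x. \<phi> k x + 1 * \<omega> x) = \<phi> j" by (simp add: \<omega>_def)
    then have "?J (\<phi> j) = ?J (\<phi> k) + energy l \<omega> + 2 * Re B"
      using functional_expand[OF \<phi>(1) \<omega> h, of l k 1] by (simp add: B_def)
    moreover have "?J (\<lambda>x. \<phi> k x + (1/2) * \<omega> x) = ?J (\<phi> k) + energy l \<omega> / 4 + Re B"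
      using functional_expand[OF \<phi>(1) \<omega> h, of l k "1/2"] by (simp add: B_def power2_eq_square)
    moreover have "d \<le> ?J (\<lambda>x. \<phi> k x + (1/2) * \<omega> x)"
      by (intro d_le test_add test_cmult \<phi> \<omega>)
    ultimately have "energy l \<omega> \<le> 2 * ?J (\<phi> j) + 2 * ?J (\<phi> k) - 4 * d" by simp
    also have "\<dots> \<le> 2 / real (Suc j) + 2 / real (Suc k)"
    proof -
      have "2 / real (Suc n) = 2 * (1 / real (Suc n))" for n by simp
      then show ?thesis using \<phi>(2)[of j] \<phi>(2)[of k] by simp
    qed
    finally show ?thesis by (simp add: \<omega>_def)
  qed
  have small: "\<exists>M. \<forall>j\<ge>M. \<forall>k\<ge>M. energy l (\<lambda>x. \<phi> j x - \<phi> k x) < e" if "0 < e" for e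
  proof -
    have "0 < e / 4" using that by simp
    from reals_Archimedean[OF this] obtain M where M: "1 / real (Suc M) < e / 4"
      unfolding inverse_eq_divide by blast
    have "energy l (\<lambda>x. \<phi> j x - \<phi> k x) < e" if "j \<ge> M" "k \<ge> M" for j k
    proof -
      have "1 / real (Suc j) \<le> 1 / real (Suc M)" "1 / real (Suc k) \<le> 1 / real (Suc M)"
        using that by (auto intro!: divide_left_mono)
      moreover have "2 / real (Suc n) = 2 * (1 / real (Suc n))" for n by simp
      ultimately show ?thesis using par[of j k] M by linarith
    qed
    then show ?thesis by blast
  qed
  obtain u where u: "u \<in> L2 \<Omega>" "(\<lambda>k. L2_norm \<Omega> (\<lambda>x. \<phi> k x - u x)) \<longlonglongrightarrow> 0"
  proof (rule L2_complete[of \<phi>])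
    show "\<phi> k \<in> L2 \<Omega>" for k by (intro test_L2 \<phi>)
    fix e :: real assume e: "0 < e"
    then obtain M where M: "\<forall>j\<ge>M. \<forall>k\<ge>M. energy l (\<lambda>x. \<phi> j x - \<phi> k x) < l * e\<^sup>2"
      using small[of "l * e\<^sup>2"] l by auto
    have "L2_norm \<Omega> (\<lambda>x. \<phi> j x - \<phi> k x) < e" if "j \<ge> M" "k \<ge> M" for j k
    proof -
      have "l * (L2_norm \<Omega> (\<lambda>x. \<phi> j x - \<phi> k x))\<^sup>2 < l * e\<^sup>2"
        by (rule le_less_trans[OF energy_ge(1)[OF less_imp_le[OF l]]]) (use M that in blast)
      then have "(L2_norm \<Omega> (\<lambda>x. \<phi> j x - \<phi> k x))\<^sup>2 < e\<^sup>2" using l by simp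
      then show ?thesis by (rule power2_less_imp_less) (use e in simp)
    qed
    then show "\<exists>M. \<forall>j\<ge>M. \<forall>k\<ge>M. L2_norm \<Omega> (\<lambda>x. \<phi> j x - \<phi> k x) < e" by blast
  qed
  have "\<exists>g. g \<in> L2 \<Omega> \<and> (\<lambda>k. L2_norm \<Omega> (\<lambda>x. partial_deriv i (\<phi> k) x - g x)) \<longlonglongrightarrow> 0"
    if i: "i \<in> Basis" for i
  proof (rule L2_complete[of "\<lambda>k. partial_deriv i (\<phi> k)"])
    show "partial_deriv i (\<phi> k) \<in> L2 \<Omega>" for k by (intro test_partial_L2 \<phi> i)
    fix e :: real assume e: "0 < e"
    then obtain M where M: "\<forall>j\<ge>M. \<forall>k\<ge>M. energy l (\<lambda>x. \<phi> j x - \<phi> k x) < e\<^sup>2"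
      using small[of "e\<^sup>2"] by auto
    have "L2_norm \<Omega> (\<lambda>x. partial_deriv i (\<phi> j) x - partial_deriv i (\<phi> k) x) < e" if "j \<ge> M" "k \<ge> M" for j k
    proof -
      have "partial_deriv i (\<lambda>x. \<phi> j x + (-1) * \<phi> k x) = (\<lambda>x. partial_deriv i (\<phi> j) x + (-1) * partial_deriv i (\<phi> k) x)"
        by (rule ext) (simp only: partial_deriv_add partial_deriv_cmult smooth_differentiable[OF test_D(1)[OF \<phi>(1)]]
          differentiable_mult differentiable_const)
      then have "(L2_norm \<Omega> (\<lambda>x. partial_deriv i (\<phi> j) x - partial_deriv i (\<phi> k) x))\<^sup>2 \<le> energy l (\<lambda>x. \<phi> j x - \<phi> k x)"
        using energy_ge(2)[of l i "\<lambda>x. \<phi> j x - \<phi> k x"] l i by simp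
      also have "\<dots> < e\<^sup>2" using M that by blast
      finally show ?thesis by (rule power2_less_imp_less) (use e in simp)
    qed
    then show "\<exists>M. \<forall>j\<ge>M. \<forall>k\<ge>M. L2_norm \<Omega> (\<lambda>x. partial_deriv i (\<phi> j) x - partial_deriv i (\<phi> k) x) < e" by blast
  qed auto
  then obtain g where g: "\<And>i. i \<in> Basis \<Longrightarrow> g i \<in> L2 \<Omega>"
    "\<And>i. i \<in> Basis \<Longrightarrow> (\<lambda>k. L2_norm \<Omega> (\<lambda>x. partial_deriv i (\<phi> k) x - g i x)) \<longlonglongrightarrow> 0" by metis
  have H: "H10_gradient \<Omega> u g" by (rule H10_limit[of \<phi>]) (use \<phi> u g in auto)
  have "(\<Sum>i\<in>Basis. L2_inner \<Omega> (g i) (partial_deriv i \<psi>)) = L2_inner \<Omega> (\<lambda>x. h x - of_real l * u x) \<psi>"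
    if \<psi>: "\<psi> \<in> test_functions \<Omega>" for \<psi>
  proof -
    \<comment> \<open>\<open>b k\<close> is the first variation along the minimising sequence and
      \<open>B\<close> its limit; the weak equation says that \<open>B\<close> vanishes.\<close>
    define b where "b k = (\<Sum>i\<in>Basis. L2_inner \<Omega> (partial_deriv i (\<phi> k)) (partial_deriv i \<psi>))
        + of_real l * L2_inner \<Omega> (\<phi> k) \<psi> - L2_inner \<Omega> h \<psi>" for k
    define B where "B = (\<Sum>i\<in>Basis. L2_inner \<Omega> (g i) (partial_deriv i \<psi>))
        + of_real l * L2_inner \<Omega> u \<psi> - L2_inner \<Omega> h \<psi>"
    have bB: "b \<longlonglongrightarrow> B"
      unfolding b_def[abs_def] B_def
      by (intro tendsto_intros inner_tendsto test_L2 test_partial_L2 \<phi> \<psi> u g)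
    \<comment> \<open>The sequence minimises up to \<open>1 / Suc k\<close>, so the quadratic
      polynomial in \<open>c\<close> becomes nonnegative in the limit.\<close>
    have var: "0 \<le> (norm c)\<^sup>2 * energy l \<psi> + 2 * Re (cnj c * B)" for c
    proof (rule LIMSEQ_le_const)
      have "(\<lambda>k. 1 / real (Suc k) + ((norm c)\<^sup>2 * energy l \<psi> + 2 * Re (cnj c * b k)))
          \<longlonglongrightarrow> 0 + ((norm c)\<^sup>2 * energy l \<psi> + 2 * Re (cnj c * B))"
        by (intro tendsto_add tendsto_const tendsto_mult tendsto_Re bB LIMSEQ_Suc[OF lim_1_over_n])
      then show "(\<lambda>k. 1 / real (Suc k) + ((norm c)\<^sup>2 * energy l \<psi> + 2 * Re (cnj c * b k)))
          \<longlonglongrightarrow> (norm c)\<^sup>2 * energy l \<psi> + 2 * Re (cnj c * B)" by simp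
      have "0 \<le> 1 / real (Suc k) + ((norm c)\<^sup>2 * energy l \<psi> + 2 * Re (cnj c * b k))" for k
      proof -
        have "d \<le> ?J (\<lambda>x. \<phi> k x + c * \<psi> x)" by (intro d_le test_add test_cmult \<phi> \<psi>)
        then show ?thesis using functional_expand[OF \<phi>(1) \<psi> h, of l k c] \<phi>(2)[of k] by (simp add: b_def)
      qed
      then show "\<exists>N. \<forall>k\<ge>N. 0 \<le> 1 / real (Suc k) + ((norm c)\<^sup>2 * energy l \<psi> + 2 * Re (cnj c * b k))" by blast
    qed
    have E0: "0 \<le> energy l \<psi>" using l by (auto simp: energy_def intro!: add_nonneg_nonneg sum_nonneg)
    \<comment> \<open>With \<open>c = - t B\<close> and \<open>t\<close> times the energy below one,
      the linear term dominates the quadratic one, which forces \<open>B = 0\<close>. Adding one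
      keeps the denominator positive.\<close>
    define t where "t = 1 / (energy l \<psi> + 1)"
    have t: "0 < t" "t * energy l \<psi> < 1" using E0 by (auto simp: t_def)
    have "Re (cnj (- of_real t * B) * B) = - t * (norm B)\<^sup>2"
      unfolding cmod_power2 by (simp add: power2_eq_square algebra_simps)
    then have "0 \<le> t\<^sup>2 * (norm B)\<^sup>2 * energy l \<psi> - 2 * t * (norm B)\<^sup>2"
      using var[of "- of_real t * B"] t by (simp add: norm_mult power_mult_distrib)
    also have "\<dots> = t * (norm B)\<^sup>2 * (t * energy l \<psi> - 2)" by (simp add: power2_eq_square algebra_simps)
    finally have *: "0 \<le> t * (norm B)\<^sup>2 * (t * energy l \<psi> - 2)" .
    have "B = 0"
    proof (rule ccontr)
      assume "B \<noteq> 0"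
      then have "t * (norm B)\<^sup>2 * (t * energy l \<psi> - 2) < 0" using t by (intro mult_pos_neg) auto
      with * show False by simp
    qed
    then show ?thesis
      unfolding B_def by (simp add: inner_diff_left inner_cmult_left h u \<psi> test_L2 eq_diff_eq)
  qed
  then show ?thesis
    unfolding neg_dirichlet_laplacian_def using H L2_diff[OF h L2_cmult[OF u(1)]]
    by (intro exI[of _ u] conjI exI[of _ g] ballI)
qed

section \<open>Coercive perturbations of the Laplacian\<close>

lemma L2_norm_triangle3:
  assumes "u \<in> L2 \<Omega>" "v \<in> L2 \<Omega>" "w \<in> L2 \<Omega>"
  shows "L2_norm \<Omega> (\<lambda>x. u x + v x + w x) \<le> L2_norm \<Omega> u + L2_norm \<Omega> v + L2_norm \<Omega> w"
  using L2_norm_triangle[OF L2_add[OF assms(1,2)] assms(3)] L2_norm_triangle[OF assms(1,2)] by linarith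

text \<open>Pairing the equation with \<open>w\<close> gives c |w|^2 \<le> Re <m w, w> \<le> Re <h,
  w>, where the second inequality is accretivity of A; Cauchy-Schwarz then allows a division by
  |w|.\<close>

lemma resolvent_bound:
  assumes w: "is_resolvent \<Omega> m h w" and h: "h \<in> L2 \<Omega>"
    and c: "0 < c" "\<And>x. x \<in> \<Omega> \<Longrightarrow> c \<le> Re (m x)"
  shows "L2_norm \<Omega> w \<le> L2_norm \<Omega> h / c"
proof -
  have lw: "lap w (\<lambda>x. h x - m x * w x)" using w by (simp add: is_resolvent_def)
  note wL2 = lap_L2(1)[OF lw]
  have mw: "(\<lambda>x. m x * w x) \<in> L2 \<Omega>" using L2_diff[OF h lap_L2(2)[OF lw]] by simp
  have "c * (L2_norm \<Omega> w)\<^sup>2 = (LINT x|\<mu>. c * (norm (w x))\<^sup>2)" by (simp add: L2_norm_power2)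
  also have "\<dots> \<le> (LINT x|\<mu>. Re (m x * w x * cnj (w x)))"
  proof (rule integral_mono)
    show "integrable \<mu> (\<lambda>x. c * (norm (w x))\<^sup>2)" using L2_D(2)[OF wL2] by simp
    show "integrable \<mu> (\<lambda>x. Re (m x * w x * cnj (w x)))"
      by (rule integrable_Re[OF integrable_inner[OF mw wL2]])
    fix x assume "x \<in> space \<mu>"
    then have "c \<le> Re (m x)" using c(2) by simp
    then have "c * (norm (w x))\<^sup>2 \<le> Re (m x) * (norm (w x))\<^sup>2" by (intro mult_right_mono) auto
    also have "\<dots> = Re (m x * of_real ((norm (w x))\<^sup>2))" by simp
    also have "m x * of_real ((norm (w x))\<^sup>2) = m x * w x * cnj (w x)"
      by (simp only: complex_norm_square mult.assoc)
    finally show "c * (norm (w x))\<^sup>2 \<le> Re (m x * w x * cnj (w x))" .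
  qed
  also have "\<dots> = Re (L2_inner \<Omega> (\<lambda>x. m x * w x) w)"
    unfolding L2_inner_def by (rule integral_Re[OF integrable_inner[OF mw wL2]])
  also have "\<dots> \<le> Re (L2_inner \<Omega> h w)"
    using lap_accretive[OF lw] by (simp add: inner_diff_left h mw wL2)
  also have "\<dots> \<le> L2_norm \<Omega> h * L2_norm \<Omega> w"
    using Cauchy_Schwarz_L2[OF h wL2] complex_Re_le_cmod[of "L2_inner \<Omega> h w"] by linarith
  finally have *: "c * L2_norm \<Omega> w * L2_norm \<Omega> w \<le> L2_norm \<Omega> h * L2_norm \<Omega> w"
    by (simp add: power2_eq_square mult.assoc)
  show ?thesis
  proof (cases "L2_norm \<Omega> w = 0")
    case False
    then have "c * L2_norm \<Omega> w \<le> L2_norm \<Omega> h"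
      using * L2_norm_nonneg[of \<Omega> w] by (simp add: less_le)
    then show ?thesis using c(1) by (simp add: pos_le_divide_eq mult.commute)
  qed (use c in simp)
qed

lemma is_resolvent_diff:
  assumes "is_resolvent \<Omega> m h w" "is_resolvent \<Omega> m h' w'"
  shows "is_resolvent \<Omega> m (\<lambda>x. h x - h' x) (\<lambda>x. w x - w' x)"
  using lap_diff[OF assms[unfolded is_resolvent_def]]
  unfolding is_resolvent_def by (simp add: algebra_simps)

lemma resolvent_unique:
  assumes "is_resolvent \<Omega> m h w" "is_resolvent \<Omega> m h w'"
    and "0 < c" "\<And>x. x \<in> \<Omega> \<Longrightarrow> c \<le> Re (m x)"
  shows "AE x in \<mu>. w x = w' x"
proof -
  have r: "is_resolvent \<Omega> m (\<lambda>x. 0) (\<lambda>x. w x - w' x)"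
    using is_resolvent_diff[OF assms(1,2)] by simp
  have "L2_norm \<Omega> (\<lambda>x. w x - w' x) \<le> 0"
    using resolvent_bound[OF r L2_zero assms(3,4)] by simp
  then have "L2_norm \<Omega> (\<lambda>x. w x - w' x) = 0" using L2_norm_nonneg[of \<Omega>] by (simp add: order_antisym)
  then have "AE x in \<mu>. w x - w' x = 0"
    using L2_norm_eq_0D lap_L2(1)[OF r[unfolded is_resolvent_def]] by blast
  then show ?thesis by simp
qed

text \<open>Banach's theorem for the seminorm \<open>L2_norm\<close>; since elements are functions
  rather than classes, the fixed point equation comes out almost everywhere.\<close>

lemma contraction_fixpoint:
  assumes T: "\<And>v. v \<in> L2 \<Omega> \<Longrightarrow> T v \<in> L2 \<Omega>" and q: "0 \<le> q" "q < 1"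
    and contr: "\<And>v v'. v \<in> L2 \<Omega> \<Longrightarrow> v' \<in> L2 \<Omega> \<Longrightarrow>
      L2_norm \<Omega> (\<lambda>x. T v x - T v' x) \<le> q * L2_norm \<Omega> (\<lambda>x. v x - v' x)"
  obtains u where "u \<in> L2 \<Omega>" "AE x in \<mu>. T u x = u x"
proof -
  define s where "s k = (T ^^ k) (\<lambda>x. 0)" for k
  have sL: "s k \<in> L2 \<Omega>" for k by (induction k) (auto simp: s_def T)
  have sS: "s (Suc k) = T (s k)" for k by (simp add: s_def)
  define C where "C = L2_norm \<Omega> (\<lambda>x. s 1 x - s 0 x)"
  have step: "L2_norm \<Omega> (\<lambda>x. s (Suc k) x - s k x) \<le> C * q ^ k" for k
  proof (induction k)
    case (Suc k)
    have "L2_norm \<Omega> (\<lambda>x. s (Suc (Suc k)) x - s (Suc k) x) \<le> q * L2_norm \<Omega> (\<lambda>x. s (Suc k) x - s k x)"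
      unfolding sS[of "Suc k"] sS[of k] using contr[OF T[OF sL] sL] by simp
    also have "\<dots> \<le> q * (C * q ^ k)" by (rule mult_left_mono[OF Suc q(1)])
    finally show ?case by (simp add: mult.left_commute)
  qed (simp add: C_def)
  have tail: "L2_norm \<Omega> (\<lambda>x. s (k + n) x - s k x) \<le> C * q ^ k * (\<Sum>i<n. q ^ i)" for k n
  proof (induction n)
    case (Suc n)
    have "L2_norm \<Omega> (\<lambda>x. s (k + Suc n) x - s k x) \<le> L2_norm \<Omega> (\<lambda>x. s (Suc (k + n)) x - s (k + n) x)
        + L2_norm \<Omega> (\<lambda>x. s (k + n) x - s k x)"
      using L2_norm_triangle_via[OF sL sL sL] by simp
    also have "\<dots> \<le> C * q ^ (k + n) + C * q ^ k * (\<Sum>i<n. q ^ i)" by (intro add_mono step Suc)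
    finally show ?case by (simp add: power_add algebra_simps)
  qed simp
  have C0: "0 \<le> C" by (simp add: C_def)
  have tail': "L2_norm \<Omega> (\<lambda>x. s j x - s k x) \<le> C / (1 - q) * q ^ k" if kj: "k \<le> j" for j k
  proof -
    obtain n where n: "j = k + n" using le_Suc_ex[OF kj] by blast
    have "(\<Sum>i<n. q ^ i) \<le> 1 / (1 - q)"
      using q unfolding sum_gp_strict by (simp add: divide_right_mono)
    then have "C * q ^ k * (\<Sum>i<n. q ^ i) \<le> C * q ^ k * (1 / (1 - q))"
      using C0 q by (intro mult_left_mono) auto
    then show ?thesis using tail[of k n] n by simp
  qed
  obtain u where u: "u \<in> L2 \<Omega>" "(\<lambda>k. L2_norm \<Omega> (\<lambda>x. s k x - u x)) \<longlonglongrightarrow> 0"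
  proof (rule L2_complete[of s, OF sL])
    fix e :: real assume e: "0 < e"
    have "(\<lambda>k. C / (1 - q) * q ^ k) \<longlonglongrightarrow> 0"
      using tendsto_mult_left[OF LIMSEQ_realpow_zero[OF q], of "C / (1 - q)"] by simp
    then have "\<forall>\<^sub>F k in sequentially. C / (1 - q) * q ^ k < e"
      using e by (rule order_tendstoD)
    then obtain M where M: "\<And>k. k \<ge> M \<Longrightarrow> C / (1 - q) * q ^ k < e"
      unfolding eventually_sequentially by blast
    have "L2_norm \<Omega> (\<lambda>x. s j x - s k x) < e" if "j \<ge> M" "k \<ge> M" for j k
    proof (cases "k \<le> j")
      case True then show ?thesis using tail'[OF True] M[OF that(2)] by linarith
    next
      case False
      then show ?thesis
        using tail'[of j k] M[OF that(1)] L2_norm_diff_commute[of \<Omega> "s j" "s k"] by simp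
    qed
    then show "\<exists>M. \<forall>j\<ge>M. \<forall>k\<ge>M. L2_norm \<Omega> (\<lambda>x. s j x - s k x) < e" by blast
  qed
  have "L2_norm \<Omega> (\<lambda>x. T u x - u x) \<le> 0"
  proof (rule LIMSEQ_le_const)
    show "(\<lambda>k. q * L2_norm \<Omega> (\<lambda>x. s k x - u x) + L2_norm \<Omega> (\<lambda>x. s (Suc k) x - u x)) \<longlonglongrightarrow> 0"
      using tendsto_add[OF tendsto_mult_left[OF u(2), of q] LIMSEQ_Suc[OF u(2)]] by simp
    have "L2_norm \<Omega> (\<lambda>x. T u x - u x) \<le> q * L2_norm \<Omega> (\<lambda>x. s k x - u x) + L2_norm \<Omega> (\<lambda>x. s (Suc k) x - u x)" for k
      using L2_norm_triangle_via[OF T[OF u(1)] sL[of "Suc k"] u(1)] contr[OF u(1) sL[of k]]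
      unfolding sS by (simp add: L2_norm_diff_commute[of \<Omega> u])
    then show "\<exists>N. \<forall>k\<ge>N. L2_norm \<Omega> (\<lambda>x. T u x - u x)
        \<le> q * L2_norm \<Omega> (\<lambda>x. s k x - u x) + L2_norm \<Omega> (\<lambda>x. s (Suc k) x - u x)" by blast
  qed
  then have "L2_norm \<Omega> (\<lambda>x. T u x - u x) = 0" by (simp add: order_antisym)
  then have "AE x in \<mu>. T u x - u x = 0" by (intro L2_norm_eq_0D L2_diff T u)
  then show ?thesis using that u(1) by simp
qed

text \<open>The equation is rewritten as (l + A) w = h + (l - m) w with a real \<open>l\<close>, for
  which Dirichlet's principle provides the resolvent. Its norm is at most 1/l, so the map is a
  contraction once |l - m| stays below l by a fixed factor.\<close>

lemma resolvent_exists: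
  assumes m: "m \<in> borel_measurable \<mu>" "\<And>x. x \<in> \<Omega> \<Longrightarrow> norm (m x) \<le> M"
    and c: "0 < c" "\<And>x. x \<in> \<Omega> \<Longrightarrow> c \<le> Re (m x)" and h: "h \<in> L2 \<Omega>"
  shows "\<exists>w. is_resolvent \<Omega> m h w"
\<comment> \<open>The inequality \<open>c \<le> M\<close>, which makes \<open>M\<close> positive, is
  read off at a point of the domain.\<close>
proof (cases "\<Omega> = {}")
  case True
  then have "h = (\<lambda>x. h x - m x * 0) " by simp
  have "lap (\<lambda>x. 0) (\<lambda>x. h x - m x * 0)"
    by (rule lap_cong_AE[OF lap_zero]) (use h True in auto)
  then show ?thesis unfolding is_resolvent_def by blast
next
  case False
  then obtain x0 where "x0 \<in> \<Omega>" by blast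
  then have "c \<le> M" using m(2)[of x0] c(2)[of x0] complex_Re_le_cmod[of "m x0"] by linarith
  then have M: "0 < M" using c by simp
  \<comment> \<open>From |l - m|^2 \<le> l^2 - 2 l c + M^2: the choice l c = M^2 turns the
    right-hand side into l^2 - M^2, which is smaller than l^2.\<close>
  define l where "l = M\<^sup>2 / c"
  have l: "0 < l" "l * c = M\<^sup>2" using M c by (auto simp: l_def)
  have "c * c \<le> M * M" using \<open>c \<le> M\<close> c by (intro mult_mono) auto
  then have lM: "M \<le> l" using \<open>c \<le> M\<close> c M by (simp add: l_def power2_eq_square pos_le_divide_eq)
  define q where "q = sqrt (l\<^sup>2 - M\<^sup>2) / l"
  have q: "0 \<le> q" "q < 1"
  proof -
    have "sqrt (l\<^sup>2 - M\<^sup>2) < sqrt (l\<^sup>2)" using M by (subst real_sqrt_less_iff) simp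
    then show "q < 1" using l by (simp add: q_def)
    show "0 \<le> q" using l lM M by (simp add: q_def power_mono)
  qed
  have lm: "norm (of_real l - m x) \<le> l * q" if "x \<in> \<Omega>" for x
  proof -
    have "(norm (of_real l - m x))\<^sup>2 = l\<^sup>2 - 2 * l * Re (m x) + (norm (m x))\<^sup>2"
      unfolding cmod_power2 by (simp add: power2_eq_square algebra_simps)
    also have "\<dots> \<le> l\<^sup>2 - 2 * l * c + M\<^sup>2"
      using c(2)[OF that] m(2)[OF that] l by (intro add_mono diff_mono mult_left_mono power_mono) auto
    also have "\<dots> = l\<^sup>2 - M\<^sup>2" using l(2) by simp
    finally have "norm (of_real l - m x) \<le> sqrt (l\<^sup>2 - M\<^sup>2)" by (rule real_le_rsqrt)
    then show ?thesis using l by (simp add: q_def)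
  qed
  have mm: "(\<lambda>x. of_real l - m x) \<in> borel_measurable \<mu>" using m(1) by measurable
  note lmL = L2_mult[OF _ mm lm]
  define R where "R v = (SOME w. lap w (\<lambda>x. v x - of_real l * w x))" for v
  have R: "is_resolvent \<Omega> (\<lambda>x. of_real l) v (R v)" if "v \<in> L2 \<Omega>" for v
    unfolding is_resolvent_def R_def by (rule someI_ex[OF real_resolvent_exists[OF l(1) that]])
  define T where "T v = R (\<lambda>x. h x + (of_real l - m x) * v x)" for v
  have hm: "(\<lambda>x. h x + (of_real l - m x) * v x) \<in> L2 \<Omega>" if "v \<in> L2 \<Omega>" for v
    by (rule L2_add[OF h lmL[OF that]])
  note RT = R[OF hm, folded T_def]
  have TL: "T v \<in> L2 \<Omega>" if "v \<in> L2 \<Omega>" for v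
    using lap_L2(1)[OF RT[OF that, unfolded is_resolvent_def]] .
  obtain u where u: "u \<in> L2 \<Omega>" "AE x in \<mu>. T u x = u x"
  proof (rule contraction_fixpoint[of T q, OF TL q])
    fix v v' assume v: "v \<in> L2 \<Omega>" "v' \<in> L2 \<Omega>"
    have "is_resolvent \<Omega> (\<lambda>x. of_real l) (\<lambda>x. (of_real l - m x) * (v x - v' x)) (\<lambda>x. T v x - T v' x)"
      using is_resolvent_diff[OF RT[OF v(1)] RT[OF v(2)]] by (simp add: right_diff_distrib)
    then have "L2_norm \<Omega> (\<lambda>x. T v x - T v' x) \<le> L2_norm \<Omega> (\<lambda>x. (of_real l - m x) * (v x - v' x)) / l"
      by (rule resolvent_bound) (use l lmL[OF L2_diff[OF v]] in auto)
    also have "\<dots> \<le> (l * q * L2_norm \<Omega> (\<lambda>x. v x - v' x)) / l"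
      using l q by (intro divide_right_mono L2_norm_mult_le mm lm L2_diff v) auto
    finally show "L2_norm \<Omega> (\<lambda>x. T v x - T v' x) \<le> q * L2_norm \<Omega> (\<lambda>x. v x - v' x)" using l by simp
  qed auto
  \<comment> \<open>The solution is \<open>T u\<close> and not \<open>u\<close>: only the former is
    known to lie in the domain of A, the two being equal merely almost everywhere.\<close>
  have "lap (T u) (\<lambda>x. h x - m x * T u x)"
  proof (rule lap_cong_AE[OF RT[OF u(1), unfolded is_resolvent_def]])
    show "(\<lambda>x. h x - m x * T u x) \<in> L2 \<Omega>" by (intro L2_diff h L2_mult[OF TL m] u)
    show "AE x in \<mu>. h x + (of_real l - m x) * u x - of_real l * T u x = h x - m x * T u x"
      using u(2) by eventually_elim (simp add: algebra_simps)
  qed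
  then show ?thesis unfolding is_resolvent_def by blast
qed

text \<open>The equation fixes its solution only up to null sets, hence the choice. Equal data yield
  literally the same function, which later makes the discrete solution exactly periodic.\<close>

definition resolv :: "('a \<Rightarrow> complex) \<Rightarrow> ('a \<Rightarrow> complex) \<Rightarrow> 'a \<Rightarrow> complex" where
  "resolv m h = (SOME w. is_resolvent \<Omega> m h w)"

text \<open>The constant \<open>c\<close> is a parameter because it enters the resolvent bound; the
  upper bound enters only qualitatively, through existence.\<close>

definition coercive :: "real \<Rightarrow> ('a \<Rightarrow> complex) \<Rightarrow> bool" where
  "coercive c m \<longleftrightarrow> 0 < c \<and> m \<in> borel_measurable \<mu> \<and> (\<exists>M. \<forall>x\<in>\<Omega>. norm (m x) \<le> M) \<and> (\<forall>x\<in>\<Omega>. c \<le> Re (m x))"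

lemma resolv_is_resolvent:
  assumes "coercive c m" "h \<in> L2 \<Omega>"
  shows "is_resolvent \<Omega> m h (resolv m h)"
proof -
  have "\<exists>w. is_resolvent \<Omega> m h w"
    using assms unfolding coercive_def by (auto intro: resolvent_exists)
  then show ?thesis unfolding resolv_def by (rule someI_ex)
qed

lemma resolv_L2:
  assumes "coercive c m" "h \<in> L2 \<Omega>"
  shows "resolv m h \<in> L2 \<Omega>"
  using lap_L2(1)[OF resolv_is_resolvent[OF assms, unfolded is_resolvent_def]] .

lemma coercive_bound:
  assumes "coercive c m" "h \<in> L2 \<Omega>" "is_resolvent \<Omega> m h w"
  shows "L2_norm \<Omega> w \<le> L2_norm \<Omega> h / c"
  by (rule resolvent_bound[OF assms(3,2)]) (use assms(1) in \<open>auto simp: coercive_def\<close>)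

section \<open>Differentiation of resolvents\<close>

text \<open>A complex derivative in L2 with a quadratic remainder in place of o(|z - z0|). This form
  is stable under the product and resolvent rules below and is available because all symbols are
  holomorphic.\<close>

definition L2_deriv :: "(complex \<Rightarrow> 'a \<Rightarrow> complex) \<Rightarrow> complex \<Rightarrow> ('a \<Rightarrow> complex) \<Rightarrow> bool" where
  "L2_deriv h z0 h' \<longleftrightarrow> h' \<in> L2 \<Omega> \<and> (\<exists>r>0. \<exists>C. \<forall>z. norm (z - z0) < r \<longrightarrow> h z \<in> L2 \<Omega> \<and>
     L2_norm \<Omega> (\<lambda>x. h z x - h z0 x - (z - z0) * h' x) \<le> C * (norm (z - z0))\<^sup>2)"

text \<open>The counterpart for multiplication operators: the remainder is quadratic uniformly in
  \<open>x\<close>, that is, in operator norm.\<close>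

definition mult_deriv :: "(complex \<Rightarrow> 'a \<Rightarrow> complex) \<Rightarrow> complex \<Rightarrow> ('a \<Rightarrow> complex) \<Rightarrow> bool" where
  "mult_deriv m z0 m' \<longleftrightarrow> m' \<in> borel_measurable \<mu> \<and>
     (\<exists>B. \<forall>x\<in>\<Omega>. norm (m z0 x) \<le> B \<and> norm (m' x) \<le> B) \<and>
     (\<exists>r>0. \<exists>C. \<forall>z. norm (z - z0) < r \<longrightarrow> m z \<in> borel_measurable \<mu> \<and>
       (\<forall>x\<in>\<Omega>. norm (m z x - m z0 x - (z - z0) * m' x) \<le> C * (norm (z - z0))\<^sup>2))"

lemma L2_derivE:
  assumes "L2_deriv h z0 h'"
  obtains r C L where "0 < r" "0 \<le> C" "0 \<le> L" "h' \<in> L2 \<Omega>" "h z0 \<in> L2 \<Omega>"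
    "\<And>z. norm (z - z0) < r \<Longrightarrow> h z \<in> L2 \<Omega>"
    "\<And>z. norm (z - z0) < r \<Longrightarrow> L2_norm \<Omega> (\<lambda>x. h z x - h z0 x - (z - z0) * h' x) \<le> C * (norm (z - z0))\<^sup>2"
    "\<And>z. norm (z - z0) < r \<Longrightarrow> L2_norm \<Omega> (\<lambda>x. h z x - h z0 x) \<le> L * norm (z - z0)"
proof -
  obtain r C where rC: "0 < r" "h' \<in> L2 \<Omega>" "\<And>z. norm (z - z0) < r \<Longrightarrow> h z \<in> L2 \<Omega>"
    "\<And>z. norm (z - z0) < r \<Longrightarrow> L2_norm \<Omega> (\<lambda>x. h z x - h z0 x - (z - z0) * h' x) \<le> C * (norm (z - z0))\<^sup>2"
    using assms unfolding L2_deriv_def by blast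
  have h0: "h z0 \<in> L2 \<Omega>" using rC(1) rC(3)[of z0] by simp
  show ?thesis
  \<comment> \<open>A radius of at most one bounds |z - z0|^2 by |z - z0|, so that the quadratic
    remainder also gives a Lipschitz bound.\<close>
  proof (rule that[of "min r 1" "max C 0" "max C 0 + L2_norm \<Omega> h'"])
    fix z assume z: "norm (z - z0) < min r 1"
    then show hz: "h z \<in> L2 \<Omega>" using rC(3) by simp
    have "C * (norm (z - z0))\<^sup>2 \<le> max C 0 * (norm (z - z0))\<^sup>2" by (intro mult_right_mono) auto
    then show q: "L2_norm \<Omega> (\<lambda>x. h z x - h z0 x - (z - z0) * h' x) \<le> max C 0 * (norm (z - z0))\<^sup>2"
      using rC(4)[of z] z by simp
    have "(norm (z - z0))\<^sup>2 \<le> norm (z - z0)"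
      using z by (simp add: power2_eq_square mult_left_le_one_le)
    then have "max C 0 * (norm (z - z0))\<^sup>2 \<le> max C 0 * norm (z - z0)" by (intro mult_left_mono) auto
    moreover have "L2_norm \<Omega> (\<lambda>x. h z x - h z0 x) \<le>
      L2_norm \<Omega> (\<lambda>x. h z x - h z0 x - (z - z0) * h' x) + L2_norm \<Omega> (\<lambda>x. (z - z0) * h' x)"
      using L2_norm_triangle[OF L2_diff[OF L2_diff[OF hz h0] L2_cmult[OF rC(2), of "z - z0"]] L2_cmult[OF rC(2), of "z - z0"]]
      by simp
    ultimately show "L2_norm \<Omega> (\<lambda>x. h z x - h z0 x) \<le> (max C 0 + L2_norm \<Omega> h') * norm (z - z0)"
      using q by (simp add: distrib_right mult.commute[of "L2_norm \<Omega> h'"])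
  qed (use rC h0 in auto)
qed

lemma mult_derivE:
  assumes "mult_deriv m z0 m'"
  obtains r B C where "0 < r" "r \<le> 1" "0 \<le> B" "0 \<le> C" "m' \<in> borel_measurable \<mu>" "m z0 \<in> borel_measurable \<mu>"
    "\<And>x. x \<in> \<Omega> \<Longrightarrow> norm (m z0 x) \<le> B" "\<And>x. x \<in> \<Omega> \<Longrightarrow> norm (m' x) \<le> B"
    "\<And>z. norm (z - z0) < r \<Longrightarrow> m z \<in> borel_measurable \<mu>"
    "\<And>z x. norm (z - z0) < r \<Longrightarrow> x \<in> \<Omega> \<Longrightarrow> norm (m z x - m z0 x - (z - z0) * m' x) \<le> C * (norm (z - z0))\<^sup>2"
    "\<And>z x. norm (z - z0) < r \<Longrightarrow> x \<in> \<Omega> \<Longrightarrow> norm (m z x - m z0 x) \<le> (C + B) * norm (z - z0)"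
proof -
  obtain B r C where rC: "0 < r" "m' \<in> borel_measurable \<mu>" "\<And>x. x \<in> \<Omega> \<Longrightarrow> norm (m z0 x) \<le> B" "\<And>x. x \<in> \<Omega> \<Longrightarrow> norm (m' x) \<le> B"
    "\<And>z. norm (z - z0) < r \<Longrightarrow> m z \<in> borel_measurable \<mu>"
    "\<And>z x. norm (z - z0) < r \<Longrightarrow> x \<in> \<Omega> \<Longrightarrow> norm (m z x - m z0 x - (z - z0) * m' x) \<le> C * (norm (z - z0))\<^sup>2"
    using assms unfolding mult_deriv_def by blast
  show ?thesis
  proof (rule that[of "min r 1" "max B 0" "max C 0"])
    show "m z0 \<in> borel_measurable \<mu>" using rC(1) rC(5)[of z0] by simp
    show b: "norm (m z0 x) \<le> max B 0" "norm (m' x) \<le> max B 0" if "x \<in> \<Omega>" for x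
      using rC(3,4)[OF that] by auto
    fix z assume z: "norm (z - z0) < min r 1"
    then show "m z \<in> borel_measurable \<mu>" using rC(5) by simp
    fix x assume x: "x \<in> \<Omega>"
    have "C * (norm (z - z0))\<^sup>2 \<le> max C 0 * (norm (z - z0))\<^sup>2" by (intro mult_right_mono) auto
    then show q: "norm (m z x - m z0 x - (z - z0) * m' x) \<le> max C 0 * (norm (z - z0))\<^sup>2"
      using rC(6)[of z x] z x by simp
    have "(norm (z - z0))\<^sup>2 \<le> norm (z - z0)"
      using z by (simp add: power2_eq_square mult_left_le_one_le)
    then have "max C 0 * (norm (z - z0))\<^sup>2 \<le> max C 0 * norm (z - z0)" by (intro mult_left_mono) auto
    moreover have "norm ((z - z0) * m' x) \<le> max B 0 * norm (z - z0)"
      using b(2)[OF x] by (simp add: norm_mult mult.commute mult_right_mono)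
    moreover have "norm (m z x - m z0 x) \<le> norm (m z x - m z0 x - (z - z0) * m' x) + norm ((z - z0) * m' x)"
      using norm_triangle_ineq[of "m z x - m z0 x - (z - z0) * m' x" "(z - z0) * m' x"] by simp
    ultimately show "norm (m z x - m z0 x) \<le> (max C 0 + max B 0) * norm (z - z0)"
      using q by (simp add: distrib_right)
  qed (use rC in auto)
qed

lemma L2_deriv_const: "h \<in> L2 \<Omega> \<Longrightarrow> L2_deriv (\<lambda>z. h) z0 (\<lambda>x. 0)"
  unfolding L2_deriv_def by (auto intro!: exI[of _ 1])

lemma L2_deriv_diff:
  assumes "L2_deriv h z0 h'" "L2_deriv g z0 g'"
  shows "L2_deriv (\<lambda>z x. h z x - g z x) z0 (\<lambda>x. h' x - g' x)"
proof -
  obtain r C L where h: "0 < r" "0 \<le> C" "0 \<le> L" "h' \<in> L2 \<Omega>" "h z0 \<in> L2 \<Omega>"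
    "\<And>z. norm (z - z0) < r \<Longrightarrow> h z \<in> L2 \<Omega>"
    "\<And>z. norm (z - z0) < r \<Longrightarrow> L2_norm \<Omega> (\<lambda>x. h z x - h z0 x - (z - z0) * h' x) \<le> C * (norm (z - z0))\<^sup>2"
    "\<And>z. norm (z - z0) < r \<Longrightarrow> L2_norm \<Omega> (\<lambda>x. h z x - h z0 x) \<le> L * norm (z - z0)"
    by (fact L2_derivE[OF assms(1)])
  obtain s D M where g: "0 < s" "0 \<le> D" "0 \<le> M" "g' \<in> L2 \<Omega>" "g z0 \<in> L2 \<Omega>"
    "\<And>z. norm (z - z0) < s \<Longrightarrow> g z \<in> L2 \<Omega>"
    "\<And>z. norm (z - z0) < s \<Longrightarrow> L2_norm \<Omega> (\<lambda>x. g z x - g z0 x - (z - z0) * g' x) \<le> D * (norm (z - z0))\<^sup>2"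
    "\<And>z. norm (z - z0) < s \<Longrightarrow> L2_norm \<Omega> (\<lambda>x. g z x - g z0 x) \<le> M * norm (z - z0)"
    by (fact L2_derivE[OF assms(2)])
  have "L2_norm \<Omega> (\<lambda>x. h z x - g z x - (h z0 x - g z0 x) - (z - z0) * (h' x - g' x)) \<le> (C + D) * (norm (z - z0))\<^sup>2"
    if z: "norm (z - z0) < min r s" for z
  proof -
    let ?a = "\<lambda>x. h z x - h z0 x - (z - z0) * h' x" and ?b = "\<lambda>x. g z x - g z0 x - (z - z0) * g' x"
    have "(\<lambda>x. h z x - g z x - (h z0 x - g z0 x) - (z - z0) * (h' x - g' x)) = (\<lambda>x. ?a x - ?b x)"
      by (simp add: algebra_simps)
    moreover have "L2_norm \<Omega> (\<lambda>x. ?a x - ?b x) \<le> L2_norm \<Omega> ?a + L2_norm \<Omega> ?b"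
      using z by (intro L2_norm_triangle_diff L2_diff L2_cmult h g) auto
    ultimately show ?thesis using h(7)[of z] g(7)[of z] z by (simp add: distrib_right)
  qed
  then show ?thesis unfolding L2_deriv_def
    using L2_diff[OF h(4) g(4)] L2_diff[OF h(6) g(6)] h(1) g(1)
    by (intro conjI exI[of _ "min r s"] exI[of _ "C + D"] allI impI) auto
qed

lemma L2_deriv_cmult:
  assumes "L2_deriv h z0 h'"
  shows "L2_deriv (\<lambda>z x. c * h z x) z0 (\<lambda>x. c * h' x)"
proof -
  obtain r C where rC: "0 < r" "h' \<in> L2 \<Omega>" "\<And>z. norm (z - z0) < r \<Longrightarrow> h z \<in> L2 \<Omega>"
    "\<And>z. norm (z - z0) < r \<Longrightarrow> L2_norm \<Omega> (\<lambda>x. h z x - h z0 x - (z - z0) * h' x) \<le> C * (norm (z - z0))\<^sup>2"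
    using assms unfolding L2_deriv_def by blast
  have eq: "(\<lambda>x. c * h z x - c * h z0 x - (z - z0) * (c * h' x)) = (\<lambda>x. c * (h z x - h z0 x - (z - z0) * h' x))" for z
    by (simp add: algebra_simps)
  have "L2_norm \<Omega> (\<lambda>x. c * h z x - c * h z0 x - (z - z0) * (c * h' x)) \<le> norm c * C * (norm (z - z0))\<^sup>2"
    if "norm (z - z0) < r" for z
    unfolding eq using mult_left_mono[OF rC(4)[OF that] norm_ge_zero[of c]] by (simp add: mult.assoc)
  then show ?thesis unfolding L2_deriv_def using rC by blast
qed

lemma L2_deriv_mult:
  assumes "mult_deriv m z0 m'" "L2_deriv h z0 h'"
  shows "L2_deriv (\<lambda>z x. m z x * h z x) z0 (\<lambda>x. m' x * h z0 x + m z0 x * h' x)"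
proof -
  obtain s B D where m: "0 < s" "s \<le> 1" "0 \<le> B" "0 \<le> D" "m' \<in> borel_measurable \<mu>" "m z0 \<in> borel_measurable \<mu>"
    "\<And>x. x \<in> \<Omega> \<Longrightarrow> norm (m z0 x) \<le> B" "\<And>x. x \<in> \<Omega> \<Longrightarrow> norm (m' x) \<le> B"
    "\<And>z. norm (z - z0) < s \<Longrightarrow> m z \<in> borel_measurable \<mu>"
    "\<And>z x. norm (z - z0) < s \<Longrightarrow> x \<in> \<Omega> \<Longrightarrow> norm (m z x - m z0 x - (z - z0) * m' x) \<le> D * (norm (z - z0))\<^sup>2"
    "\<And>z x. norm (z - z0) < s \<Longrightarrow> x \<in> \<Omega> \<Longrightarrow> norm (m z x - m z0 x) \<le> (D + B) * norm (z - z0)"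
    by (fact mult_derivE[OF assms(1)])
  obtain r C L where h: "0 < r" "0 \<le> C" "0 \<le> L" "h' \<in> L2 \<Omega>" "h z0 \<in> L2 \<Omega>"
    "\<And>z. norm (z - z0) < r \<Longrightarrow> h z \<in> L2 \<Omega>"
    "\<And>z. norm (z - z0) < r \<Longrightarrow> L2_norm \<Omega> (\<lambda>x. h z x - h z0 x - (z - z0) * h' x) \<le> C * (norm (z - z0))\<^sup>2"
    "\<And>z. norm (z - z0) < r \<Longrightarrow> L2_norm \<Omega> (\<lambda>x. h z x - h z0 x) \<le> L * norm (z - z0)"
    by (fact L2_derivE[OF assms(2)])
  define K where "K = D * (L2_norm \<Omega> (h z0) + L) + B * L + B * C"
  have main: "(\<lambda>x. m z x * h z x) \<in> L2 \<Omega> \<and> L2_norm \<Omega> (\<lambda>x. m z x * h z x - m z0 x * h z0 x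
      - (z - z0) * (m' x * h z0 x + m z0 x * h' x)) \<le> K * (norm (z - z0))\<^sup>2"
    if z: "norm (z - z0) < min r s" for z
  proof -
    have zr: "norm (z - z0) < r" "norm (z - z0) < s" using z by auto
    let ?z = "norm (z - z0)"
    \<comment> \<open>The remainder of the product splits into (remainder of m) h, a product m' (h -
      h0) of order |z - z0| times the factor z - z0, and m0 (remainder of h); each summand is
      quadratically small.\<close>
    let ?q = "\<lambda>x. m z x - m z0 x - (z - z0) * m' x"
    let ?a = "\<lambda>x. ?q x * h z x"
    let ?b = "\<lambda>x. (z - z0) * (m' x * (h z x - h z0 x))"
    let ?c = "\<lambda>x. m z0 x * (h z x - h z0 x - (z - z0) * h' x)"
    have [measurable]: "m z \<in> borel_measurable \<mu>" "m z0 \<in> borel_measurable \<mu>" "m' \<in> borel_measurable \<mu>"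
      using m(5,6) m(9)[OF zr(2)] by auto
    have qm: "?q \<in> borel_measurable \<mu>" by measurable
    note d1 = L2_diff[OF h(6)[OF zr(1)] h(5)]
    note d2 = L2_diff[OF d1 L2_cmult[OF h(4), of "z - z0"]]
    have aL: "?a \<in> L2 \<Omega>" by (rule L2_mult[OF h(6)[OF zr(1)] qm m(10)[OF zr(2)]])
    have bL: "?b \<in> L2 \<Omega>" by (rule L2_cmult[OF L2_mult[OF d1 m(5,8)]])
    have cL: "?c \<in> L2 \<Omega>" by (rule L2_mult[OF d2 m(6,7)])
    have hz: "L2_norm \<Omega> (h z) \<le> L2_norm \<Omega> (h z0) + L"
    proof -
      have "L2_norm \<Omega> (h z) \<le> L2_norm \<Omega> (h z0) + L2_norm \<Omega> (\<lambda>x. h z x - h z0 x)"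
        using L2_norm_triangle[OF h(5) d1] by simp
      also have "\<dots> \<le> L2_norm \<Omega> (h z0) + L * ?z" using h(8)[OF zr(1)] by simp
      also have "L * ?z \<le> L * 1" using zr(2) m(2) h(3) by (intro mult_left_mono) auto
      finally show ?thesis by simp
    qed
    have "L2_norm \<Omega> ?a \<le> D * ?z\<^sup>2 * L2_norm \<Omega> (h z)"
      by (rule L2_norm_mult_le[OF h(6)[OF zr(1)] qm m(10)[OF zr(2)]]) (use m in auto)
    also have "\<dots> \<le> D * ?z\<^sup>2 * (L2_norm \<Omega> (h z0) + L)" using m by (intro mult_left_mono hz) auto
    finally have a: "L2_norm \<Omega> ?a \<le> D * ?z\<^sup>2 * (L2_norm \<Omega> (h z0) + L)" .
    have "L2_norm \<Omega> ?b = ?z * L2_norm \<Omega> (\<lambda>x. m' x * (h z x - h z0 x))" by (rule L2_norm_cmult)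
    also have "\<dots> \<le> ?z * (B * L2_norm \<Omega> (\<lambda>x. h z x - h z0 x))"
      by (intro mult_left_mono L2_norm_mult_le d1 m) auto
    also have "\<dots> \<le> ?z * (B * (L * ?z))" by (intro mult_left_mono h zr m) auto
    finally have b: "L2_norm \<Omega> ?b \<le> ?z * (B * (L * ?z))" .
    have "L2_norm \<Omega> ?c \<le> B * L2_norm \<Omega> (\<lambda>x. h z x - h z0 x - (z - z0) * h' x)"
      by (intro L2_norm_mult_le d2 m)
    also have "\<dots> \<le> B * (C * ?z\<^sup>2)" by (intro mult_left_mono h zr m)
    finally have c: "L2_norm \<Omega> ?c \<le> B * (C * ?z\<^sup>2)" .
    have eq: "(\<lambda>x. m z x * h z x - m z0 x * h z0 x - (z - z0) * (m' x * h z0 x + m z0 x * h' x))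
        = (\<lambda>x. ?a x + ?b x + ?c x)"
      by (simp add: algebra_simps)
    have "L2_norm \<Omega> (\<lambda>x. ?a x + ?b x + ?c x) \<le> K * ?z\<^sup>2"
      using L2_norm_triangle3[OF aL bL cL] a b c by (simp add: K_def algebra_simps power2_eq_square)
    moreover have "(\<lambda>x. m z x * h z x) \<in> L2 \<Omega>"
    proof (rule L2_mult[OF h(6)[OF zr(1)] m(9)[OF zr(2)]])
      fix x assume "x \<in> \<Omega>"
      then show "norm (m z x) \<le> (D + B) * ?z + B"
        using m(11)[OF zr(2), of x] m(7)[of x] norm_triangle_ineq[of "m z x - m z0 x" "m z0 x"] by simp
    qed
    ultimately show ?thesis unfolding eq by blast
  qed
  have "(\<lambda>x. m' x * h z0 x + m z0 x * h' x) \<in> L2 \<Omega>"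
    by (intro L2_add L2_mult[OF h(5) m(5,8)] L2_mult[OF h(4) m(6,7)])
  moreover have "0 < min r s" using h m by simp
  ultimately show ?thesis unfolding L2_deriv_def using main by blast
qed

text \<open>Tested against a fixed \<open>v\<close>, the vector-valued function becomes holomorphic
  in the ordinary sense; the contour arguments use only these scalar functions.\<close>

lemma L2_deriv_inner:
  assumes "L2_deriv h z0 h'" "v \<in> L2 \<Omega>"
  shows "((\<lambda>z. L2_inner \<Omega> (h z) v) has_field_derivative L2_inner \<Omega> h' v) (at z0)"
proof -
  obtain r C L where h: "0 < r" "0 \<le> C" "0 \<le> L" "h' \<in> L2 \<Omega>" "h z0 \<in> L2 \<Omega>"
    "\<And>z. norm (z - z0) < r \<Longrightarrow> h z \<in> L2 \<Omega>"
    "\<And>z. norm (z - z0) < r \<Longrightarrow> L2_norm \<Omega> (\<lambda>x. h z x - h z0 x - (z - z0) * h' x) \<le> C * (norm (z - z0))\<^sup>2"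
    "\<And>z. norm (z - z0) < r \<Longrightarrow> L2_norm \<Omega> (\<lambda>x. h z x - h z0 x) \<le> L * norm (z - z0)"
    by (fact L2_derivE[OF assms(1)])
  let ?f = "\<lambda>z. L2_inner \<Omega> (h z) v" and ?K = "C * L2_norm \<Omega> v"
  have est: "norm ((?f z - ?f z0) / (z - z0) - L2_inner \<Omega> h' v) \<le> ?K * norm (z - z0)"
    if "z \<noteq> z0" "norm (z - z0) < r" for z
  proof -
    have "?f z - ?f z0 - (z - z0) * L2_inner \<Omega> h' v = L2_inner \<Omega> (\<lambda>x. h z x - h z0 x - (z - z0) * h' x) v"
      using h that assms(2) by (simp add: inner_diff_left inner_cmult_left)
    then have "norm (?f z - ?f z0 - (z - z0) * L2_inner \<Omega> h' v) \<le>
        L2_norm \<Omega> (\<lambda>x. h z x - h z0 x - (z - z0) * h' x) * L2_norm \<Omega> v"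
      using Cauchy_Schwarz_L2[OF L2_diff[OF L2_diff[OF h(6)[OF that(2)] h(5)] L2_cmult[OF h(4), of "z - z0"]] assms(2)]
      by simp
    also have "\<dots> \<le> C * (norm (z - z0))\<^sup>2 * L2_norm \<Omega> v" by (intro mult_right_mono h that) auto
    finally have "norm (?f z - ?f z0 - (z - z0) * L2_inner \<Omega> h' v) / norm (z - z0) \<le> ?K * norm (z - z0)"
      using that by (simp add: divide_le_eq power2_eq_square algebra_simps)
    moreover have "(?f z - ?f z0) / (z - z0) - L2_inner \<Omega> h' v = (?f z - ?f z0 - (z - z0) * L2_inner \<Omega> h' v) / (z - z0)"
      using that by (simp add: field_simps)
    ultimately show ?thesis by (simp add: norm_divide)
  qed
  have "((\<lambda>z. (?f z - ?f z0) / (z - z0) - L2_inner \<Omega> h' v) \<longlongrightarrow> 0) (at z0)"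
  proof (rule Lim_null_comparison)
    show "\<forall>\<^sub>F z in at z0. norm ((?f z - ?f z0) / (z - z0) - L2_inner \<Omega> h' v) \<le> ?K * norm (z - z0)"
      unfolding eventually_at using h(1) est by (auto simp: dist_norm intro!: exI[of _ r])
    show "((\<lambda>z. ?K * norm (z - z0)) \<longlongrightarrow> 0) (at z0)"
      by (auto intro!: tendsto_eq_intros)
  qed
  then show ?thesis by (simp add: has_field_derivative_iff LIM_zero_iff)
qed

text \<open>Formal differentiation of (m + A) w = h gives (m + A) w' = h' - m' w. To justify it, the
  increment and then the Taylor remainder of \<open>w\<close> are seen to solve resolvent equations
  with small right-hand sides.\<close>

lemma L2_deriv_resolv:
  assumes md: "mult_deriv m z0 m'" and hd: "L2_deriv h z0 h'"
    and co: "0 < \<rho>" "\<And>z. norm (z - z0) < \<rho> \<Longrightarrow> coercive c (m z)"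
  shows "L2_deriv (\<lambda>z. resolv (m z) (h z)) z0 (resolv (m z0) (\<lambda>x. h' x - m' x * resolv (m z0) (h z0) x))"
proof -
  obtain s B D where m: "0 < s" "s \<le> 1" "0 \<le> B" "0 \<le> D" "m' \<in> borel_measurable \<mu>" "m z0 \<in> borel_measurable \<mu>"
    "\<And>x. x \<in> \<Omega> \<Longrightarrow> norm (m z0 x) \<le> B" "\<And>x. x \<in> \<Omega> \<Longrightarrow> norm (m' x) \<le> B"
    "\<And>z. norm (z - z0) < s \<Longrightarrow> m z \<in> borel_measurable \<mu>"
    "\<And>z x. norm (z - z0) < s \<Longrightarrow> x \<in> \<Omega> \<Longrightarrow> norm (m z x - m z0 x - (z - z0) * m' x) \<le> D * (norm (z - z0))\<^sup>2"
    "\<And>z x. norm (z - z0) < s \<Longrightarrow> x \<in> \<Omega> \<Longrightarrow> norm (m z x - m z0 x) \<le> (D + B) * norm (z - z0)"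
    by (fact mult_derivE[OF md])
  obtain r C L where h: "0 < r" "0 \<le> C" "0 \<le> L" "h' \<in> L2 \<Omega>" "h z0 \<in> L2 \<Omega>"
    "\<And>z. norm (z - z0) < r \<Longrightarrow> h z \<in> L2 \<Omega>"
    "\<And>z. norm (z - z0) < r \<Longrightarrow> L2_norm \<Omega> (\<lambda>x. h z x - h z0 x - (z - z0) * h' x) \<le> C * (norm (z - z0))\<^sup>2"
    "\<And>z. norm (z - z0) < r \<Longrightarrow> L2_norm \<Omega> (\<lambda>x. h z x - h z0 x) \<le> L * norm (z - z0)"
    by (fact L2_derivE[OF hd])
  have co0: "coercive c (m z0)" using co by simp
  have c: "0 < c" using co0 by (simp add: coercive_def)
  define w where "w z = resolv (m z) (h z)" for z
  define w' where "w' = resolv (m z0) (\<lambda>x. h' x - m' x * w z0 x)"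
  have w0: "w z0 \<in> L2 \<Omega>" unfolding w_def by (rule resolv_L2[OF co0 h(5)])
  have rhs': "(\<lambda>x. h' x - m' x * w z0 x) \<in> L2 \<Omega>" by (intro L2_diff h L2_mult[OF w0 m(5,8)])
  have w': "w' \<in> L2 \<Omega>" unfolding w'_def by (rule resolv_L2[OF co0 rhs'])
  define N where "N = L2_norm \<Omega> (w z0)"
  define L' where "L' = (L + (D + B) * N) / c"
  define K where "K = (C + D * N + (D + B) * L') / c"
  have main: "w z \<in> L2 \<Omega> \<and> L2_norm \<Omega> (\<lambda>x. w z x - w z0 x - (z - z0) * w' x) \<le> K * (norm (z - z0))\<^sup>2"
    if z: "norm (z - z0) < min \<rho> (min r s)" for z
  proof -
    have zr: "norm (z - z0) < r" "norm (z - z0) < s" "norm (z - z0) < \<rho>" using z by auto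
    let ?z = "norm (z - z0)"
    note hz = h(6)[OF zr(1)] and cz = co(2)[OF zr(3)]
    have wz: "w z \<in> L2 \<Omega>" unfolding w_def by (rule resolv_L2[OF cz hz])
    have [measurable]: "m z \<in> borel_measurable \<mu>" "m z0 \<in> borel_measurable \<mu>" "m' \<in> borel_measurable \<mu>"
      using m(5,6) m(9)[OF zr(2)] by auto
    have dm: "(\<lambda>x. m z x - m z0 x) \<in> borel_measurable \<mu>" by measurable
    have qm: "(\<lambda>x. m z x - m z0 x - (z - z0) * m' x) \<in> borel_measurable \<mu>" by measurable
    have lz: "lap (w z) (\<lambda>x. h z x - m z x * w z x)"
      using resolv_is_resolvent[OF cz hz] by (simp add: is_resolvent_def w_def)
    have l0: "lap (w z0) (\<lambda>x. h z0 x - m z0 x * w z0 x)"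
      using resolv_is_resolvent[OF co0 h(5)] by (simp add: is_resolvent_def w_def)
    have l': "lap w' (\<lambda>x. h' x - m' x * w z0 x - m z0 x * w' x)"
      using resolv_is_resolvent[OF co0 rhs'] by (simp add: is_resolvent_def w'_def)
    note dh = L2_diff[OF hz h(5)] and dw = L2_diff[OF wz w0]
    note a1 = L2_mult[OF w0 dm m(11)[OF zr(2)]]
    \<comment> \<open>The increment solves an equation with the varying multiplier
      \<open>m z\<close>; this is where coercivity uniform near \<open>z0\<close> enters. The
      outcome is a Lipschitz bound.\<close>
    have "is_resolvent \<Omega> (m z) (\<lambda>x. (h z x - h z0 x) - (m z x - m z0 x) * w z0 x) (\<lambda>x. w z x - w z0 x)"
      using lap_diff[OF lz l0] unfolding is_resolvent_def by (simp add: algebra_simps)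
    from coercive_bound[OF cz L2_diff[OF dh a1] this]
    have "L2_norm \<Omega> (\<lambda>x. w z x - w z0 x) \<le> L2_norm \<Omega> (\<lambda>x. (h z x - h z0 x) - (m z x - m z0 x) * w z0 x) / c" .
    also have "\<dots> \<le> (L2_norm \<Omega> (\<lambda>x. h z x - h z0 x) + L2_norm \<Omega> (\<lambda>x. (m z x - m z0 x) * w z0 x)) / c"
      using c by (intro divide_right_mono L2_norm_triangle_diff[OF dh a1]) auto
    also have "\<dots> \<le> (L * ?z + (D + B) * ?z * N) / c"
      unfolding N_def using c m(3,4) by (intro divide_right_mono add_mono h zr L2_norm_mult_le[OF w0 dm m(11)[OF zr(2)]]) auto
    also have "\<dots> = L' * ?z" unfolding L'_def by (simp add: algebra_simps add_divide_distrib)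
    finally have lip: "L2_norm \<Omega> (\<lambda>x. w z x - w z0 x) \<le> L' * ?z" .
    let ?a = "\<lambda>x. h z x - h z0 x - (z - z0) * h' x"
    let ?b = "\<lambda>x. (m z x - m z0 x - (z - z0) * m' x) * w z0 x"
    let ?c = "\<lambda>x. (m z x - m z0 x) * (w z x - w z0 x)"
    have aL: "?a \<in> L2 \<Omega>" by (intro L2_diff L2_cmult hz h)
    have bL: "?b \<in> L2 \<Omega>" by (rule L2_mult[OF w0 qm m(10)[OF zr(2)]])
    have cL: "?c \<in> L2 \<Omega>" by (rule L2_mult[OF dw dm m(11)[OF zr(2)]])
    have nb: "L2_norm \<Omega> ?b \<le> D * ?z\<^sup>2 * N"
      unfolding N_def by (rule L2_norm_mult_le[OF w0 qm m(10)[OF zr(2)]]) (use m in auto)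
    have "L2_norm \<Omega> ?c \<le> (D + B) * ?z * L2_norm \<Omega> (\<lambda>x. w z x - w z0 x)"
      by (rule L2_norm_mult_le[OF dw dm m(11)[OF zr(2)]]) (use m in auto)
    also have "\<dots> \<le> (D + B) * ?z * (L' * ?z)" using m by (intro mult_left_mono lip) auto
    finally have nc: "L2_norm \<Omega> ?c \<le> (D + B) * ?z * (L' * ?z)" .
    \<comment> \<open>With the multiplier frozen at \<open>z0\<close>, the right-hand side consists
      of the remainder of h, the remainder of m, and a product of two increments.\<close>
    have "is_resolvent \<Omega> (m z0) (\<lambda>x. ?a x - ?b x - ?c x) (\<lambda>x. w z x - w z0 x - (z - z0) * w' x)"
      using lap_diff[OF lap_diff[OF lz l0] lap_cmult[OF l', of "z - z0"]]
      unfolding is_resolvent_def by (simp add: algebra_simps)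
    from coercive_bound[OF co0 L2_diff[OF L2_diff[OF aL bL] cL] this]
    have "L2_norm \<Omega> (\<lambda>x. w z x - w z0 x - (z - z0) * w' x) \<le> L2_norm \<Omega> (\<lambda>x. ?a x - ?b x - ?c x) / c" .
    also have "\<dots> \<le> (C * ?z\<^sup>2 + D * ?z\<^sup>2 * N + (D + B) * ?z * (L' * ?z)) / c"
    proof (intro divide_right_mono)
      show "L2_norm \<Omega> (\<lambda>x. ?a x - ?b x - ?c x) \<le> C * ?z\<^sup>2 + D * ?z\<^sup>2 * N + (D + B) * ?z * (L' * ?z)"
        using L2_norm_triangle_diff[OF L2_diff[OF aL bL] cL] L2_norm_triangle_diff[OF aL bL] h(7)[OF zr(1)] nb nc
        by linarith
    qed (use c in simp)
    also have "\<dots> = K * ?z\<^sup>2" unfolding K_def by (simp add: algebra_simps add_divide_distrib power2_eq_square)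
    finally show ?thesis using wz by blast
  qed
  have "0 < min \<rho> (min r s)" using co m h by simp
  then have "L2_deriv w z0 w'" unfolding L2_deriv_def using w' main by blast
  then show ?thesis by (simp add: w_def[abs_def] w'_def)
qed

end

lemma Union_cball_cball:
  fixes z :: complex
  assumes "0 \<le> K" "0 < e"
  shows "cball z (K + e) = (\<Union>p\<in>cball z K. cball p e)"
proof (intro equalityI subsetI)
  fix w assume w: "w \<in> cball z (K + e)"
  \<comment> \<open>The point that divides the segment from \<open>z\<close> to \<open>w\<close> in
    the ratio \<open>K\<close> to \<open>e\<close>.\<close>
  define p where "p = z + of_real (K / (K + e)) * (w - z)"
  have "norm (p - z) = \<bar>K / (K + e)\<bar> * norm (w - z)"
    by (simp only: p_def add_diff_cancel_left' norm_mult norm_of_real)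
  also have "\<dots> = K / (K + e) * norm (w - z)" using assms by simp
  also have "\<dots> \<le> K / (K + e) * (K + e)"
    using w assms by (intro mult_left_mono) (auto simp: dist_norm norm_minus_commute)
  finally have "p \<in> cball z K" using assms by (simp add: dist_norm norm_minus_commute)
  moreover have "w - p = of_real (e / (K + e)) * (w - z)"
  proof -
    have "complex_of_real (e / (K + e)) = 1 - of_real (K / (K + e))"
    proof -
      have "K + e \<noteq> 0" using assms by simp
      then have "e / (K + e) = 1 - K / (K + e)" by (simp add: field_simps)
      then show ?thesis by (metis of_real_1 of_real_diff)
    qed
    then show ?thesis unfolding p_def
      by (simp only: left_diff_distrib mult_1_left diff_diff_eq)
  qed
  then have "norm (w - p) = \<bar>e / (K + e)\<bar> * norm (w - z)" by (simp only: norm_mult norm_of_real)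
  then have "norm (w - p) = e / (K + e) * norm (w - z)" using assms by simp
  then have "norm (w - p) \<le> e / (K + e) * (K + e)"
    using w assms by (simp only:) (intro mult_left_mono, auto simp: dist_norm norm_minus_commute)
  then have "w \<in> cball p e" using assms by (simp add: dist_norm norm_minus_commute)
  ultimately show "w \<in> (\<Union>p\<in>cball z K. cball p e)" by blast
next
  fix w assume "w \<in> (\<Union>p\<in>cball z K. cball p e)"
  then obtain p where "dist z p \<le> K" "dist p w \<le> e" by auto
  then show "w \<in> cball z (K + e)" using dist_triangle[of z w p] by simp
qed

lemma compact_image_bound:
  fixes f :: "'b::metric_space \<Rightarrow> 'c::real_normed_vector"
  assumes "compact Q" "continuous_on Q f"
  shows "\<exists>B. \<forall>b\<in>Q. norm (f b) \<le> B"
proof -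
  have "bounded (f ` Q)" by (intro compact_imp_bounded compact_continuous_image assms)
  then obtain B where "\<forall>y\<in>f ` Q. norm y \<le> B" unfolding bounded_iff by blast
  then show ?thesis by blast
qed

text \<open>The margin that compactness provides lets \<open>z\<close> vary near \<open>z0\<close>
  while all values \<open>z + u x\<close> stay in one compact subset of \<open>S\<close>.\<close>

lemma cball_enlarge:
  fixes z :: complex
  assumes "open S" "cball z K \<subseteq> S" "0 \<le> K"
  obtains e where "0 < e" "cball z (K + e) \<subseteq> S"
proof -
  obtain e where "0 < e" "(\<Union>p\<in>cball z K. cball p e) \<subseteq> S"
    using compact_subset_open_imp_cball_epsilon_subset[OF compact_cball assms(1,2)] by auto
  then show ?thesis using that Union_cball_cball[OF assms(3), of e z] by auto
qed

section \<open>Resolvents of symbols\<close>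

text \<open>In the application \<open>u\<close> is \<rho> U and \<open>K\<close> bounds it, so
  \<open>z + u x\<close> is the value of \<open>beta\<close>, a point of \<open>cball z K\<close>.
  Conditions on \<open>z\<close> are therefore stated through this ball.\<close>

locale multiplier = bounded_domain \<Omega> for \<Omega> :: "'a::euclidean_space set" +
  fixes u :: "'a \<Rightarrow> complex" and K :: real
  assumes u_meas: "u \<in> borel_measurable (lebesgue_on \<Omega>)"
    and u_bound: "\<And>x. x \<in> \<Omega> \<Longrightarrow> norm (u x) \<le> K" and K_nonneg: "0 \<le> K"
begin

lemma shift_mem: "x \<in> \<Omega> \<Longrightarrow> norm (z - z0) \<le> e \<Longrightarrow> z + u x \<in> cball z0 (K + e)"
  using norm_triangle_ineq[of "z - z0" "u x"] u_bound[of x]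
  by (simp add: dist_norm norm_minus_commute algebra_simps)

lemma shift_mem0: "x \<in> \<Omega> \<Longrightarrow> z + u x \<in> cball z K"
  using shift_mem[of x z z 0] by simp

text \<open>\<open>f\<close> may be wild outside \<open>A\<close>, for instance across a branch cut,
  so it is first replaced by its extension by zero.\<close>

lemma shift_measurable:
  assumes "continuous_on A f" "closed A" "\<And>x. x \<in> \<Omega> \<Longrightarrow> z + u x \<in> A"
  shows "(\<lambda>x. f (z + u x) :: complex) \<in> borel_measurable \<mu>"
proof -
  have g: "(\<lambda>b. indicator A b *\<^sub>R f b) \<in> borel_measurable borel"
    by (rule borel_measurable_continuous_on_indicator) (use assms in auto)
  have "(\<lambda>x. z + u x) \<in> borel_measurable \<mu>" using u_meas by measurable
  from measurable_compose[OF this g]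
  show ?thesis by (rule measurable_cong[THEN iffD1, rotated]) (use assms(3) in simp)
qed

lemma shift_bounded:
  assumes "continuous_on S f" "cball z K \<subseteq> S"
  shows "\<exists>B. \<forall>x\<in>\<Omega>. norm (f (z + u x) :: complex) \<le> B"
proof -
  obtain B where "\<And>b. b \<in> cball z K \<Longrightarrow> norm (f b) \<le> B"
    using compact_image_bound[OF compact_cball continuous_on_subset[OF assms]] by blast
  then show ?thesis using shift_mem0 by blast
qed

text \<open>Taylor's formula on a compact convex ball around \<open>z0\<close> that contains all
  values \<open>z + u x\<close>; the maximum of the second derivative there makes the remainder
  uniform in \<open>x\<close>.\<close>

lemma shift_mult_deriv:
  assumes S: "open S" "cball z0 K \<subseteq> S"
    and f: "\<And>b. b \<in> S \<Longrightarrow> (f has_field_derivative f' b) (at b)"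
  shows "mult_deriv (\<lambda>z x. f (z + u x)) z0 (\<lambda>x. f' (z0 + u x))"
proof -
  have hol: "f holomorphic_on S" using f S(1) holomorphic_on_open by blast
  have f'_eq: "deriv f b = f' b" if "b \<in> S" for b using f[OF that] by (rule DERIV_imp_deriv)
  have hol': "f' holomorphic_on S"
    by (rule holomorphic_transform[OF holomorphic_deriv[OF hol S(1)] f'_eq])
  have f'': "(f' has_field_derivative deriv f' b) (at b)" if "b \<in> S" for b
    by (rule holomorphic_derivI[OF hol' S(1) that])
  obtain e where e: "0 < e" "cball z0 (K + e) \<subseteq> S" using cball_enlarge[OF S K_nonneg] by blast
  obtain B where B: "\<And>b. b \<in> cball z0 (K + e) \<Longrightarrow> norm (deriv f' b) \<le> B"
    using compact_image_bound[OF compact_cball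
      continuous_on_subset[OF holomorphic_on_imp_continuous_on[OF holomorphic_deriv[OF hol' S(1)]] e(2)]] by blast
  note cf = holomorphic_on_imp_continuous_on[OF hol] and cf' = holomorphic_on_imp_continuous_on[OF hol']
  have meas: "(\<lambda>x. g (z + u x)) \<in> borel_measurable \<mu>" if "continuous_on S g" "norm (z - z0) \<le> e" for z and g :: "complex \<Rightarrow> complex"
    by (rule shift_measurable[OF continuous_on_subset[OF that(1) e(2)] closed_cball shift_mem[OF _ that(2)]])
  have "norm (f (z + u x) - f (z0 + u x) - (z - z0) * f' (z0 + u x)) \<le> B * (norm (z - z0))\<^sup>2"
    if z: "norm (z - z0) < e" and x: "x \<in> \<Omega>" for z x
  proof -
    \<comment> \<open>The sequence of successive derivatives that the Taylor theorem expects, of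
      which only the first three entries are reached.\<close>
    let ?F = "\<lambda>i::nat. if i = 0 then f else if i = 1 then f' else deriv f'"
    have "norm (?F 0 (z + u x) - (\<Sum>i\<le>1. ?F i (z0 + u x) * ((z + u x) - (z0 + u x)) ^ i / fact i))
        \<le> B * norm ((z + u x) - (z0 + u x)) ^ (Suc 1) / fact 1"
    proof (rule complex_Taylor[where S="cball z0 (K + e)"])
      show "z + u x \<in> cball z0 (K + e)" using shift_mem[OF x] z by simp
      show "z0 + u x \<in> cball z0 (K + e)" using shift_mem[OF x, of z0 z0] e by simp
      fix i :: nat and y assume y: "y \<in> cball z0 (K + e)" and i: "i \<le> 1"
      have yS: "y \<in> S" using y e(2) by blast
      have "i = 0 \<or> i = 1" using i by auto
      then show "(?F i has_field_derivative ?F (Suc i) y) (at y within cball z0 (K + e))"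
        using has_field_derivative_at_within[OF f[OF yS]] has_field_derivative_at_within[OF f''[OF yS]]
        by (elim disjE) simp_all
    qed (use B in auto)
    then show ?thesis by (simp add: power2_eq_square algebra_simps)
  qed
  moreover obtain B1 where "\<And>x. x \<in> \<Omega> \<Longrightarrow> norm (f (z0 + u x)) \<le> B1" using shift_bounded[OF cf S(2)] by blast
  moreover obtain B2 where "\<And>x. x \<in> \<Omega> \<Longrightarrow> norm (f' (z0 + u x)) \<le> B2" using shift_bounded[OF cf' S(2)] by blast
  ultimately have "\<forall>x\<in>\<Omega>. norm (f (z0 + u x)) \<le> max B1 B2 \<and> norm (f' (z0 + u x)) \<le> max B1 B2"
    "\<forall>z. norm (z - z0) < e \<longrightarrow> (\<lambda>x. f (z + u x)) \<in> borel_measurable \<mu> \<and>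
       (\<forall>x\<in>\<Omega>. norm (f (z + u x) - f (z0 + u x) - (z - z0) * f' (z0 + u x)) \<le> B * (norm (z - z0))\<^sup>2)"
    using meas[OF cf] by (auto simp: le_max_iff_disj)
  moreover have "(\<lambda>x. f' (z0 + u x)) \<in> borel_measurable \<mu>" using meas[OF cf', of z0] e by simp
  ultimately show ?thesis unfolding mult_deriv_def using e(1) by blast
qed

text \<open>The positive minimum of Re f over the enlarged compact ball serves as one constant for
  all nearby \<open>z\<close>.\<close>

lemma shift_coercive:
  assumes S: "open S" "cball z0 K \<subseteq> S" and f: "continuous_on S f" "\<And>b. b \<in> S \<Longrightarrow> 0 < Re (f b)"
  shows "\<exists>e>0. \<exists>c. \<forall>z. norm (z - z0) < e \<longrightarrow> coercive c (\<lambda>x. f (z + u x))"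
proof -
  obtain e where e: "0 < e" "cball z0 (K + e) \<subseteq> S" using cball_enlarge[OF S K_nonneg] by blast
  let ?Q = "cball z0 (K + e)"
  have cf: "continuous_on ?Q f" by (rule continuous_on_subset[OF f(1) e(2)])
  have "\<exists>b\<in>?Q. \<forall>b'\<in>?Q. Re (f b) \<le> Re (f b')"
    by (rule continuous_attains_inf) (use e K_nonneg cf in \<open>auto intro!: continuous_intros\<close>)
  then obtain b where b: "b \<in> ?Q" "\<And>b'. b' \<in> ?Q \<Longrightarrow> Re (f b) \<le> Re (f b')" by blast
  obtain B where B: "\<And>b. b \<in> ?Q \<Longrightarrow> norm (f b) \<le> B" using compact_image_bound[OF compact_cball cf] by blast
  have "coercive (Re (f b)) (\<lambda>x. f (z + u x))" if "norm (z - z0) < e" for z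
    unfolding coercive_def using shift_measurable[OF cf closed_cball] shift_mem[of _ z z0 e] that b f(2) e(2) B
    by (auto intro!: exI[of _ B])
  then show ?thesis using e(1) by blast
qed

lemma mult_shift_L2:
  assumes "cball z K \<subseteq> A" "continuous_on A f" "h \<in> L2 \<Omega>"
  shows "(\<lambda>x. f (z + u x) * h x) \<in> L2 \<Omega>"
proof -
  obtain B where B: "\<And>x. x \<in> \<Omega> \<Longrightarrow> norm (f (z + u x)) \<le> B" using shift_bounded[OF assms(2,1)] by blast
  show ?thesis
    by (rule L2_mult[OF assms(3) shift_measurable[OF continuous_on_subset[OF assms(2,1)] closed_cball shift_mem0] B])
qed

lemma mult_shift_norm_le:
  assumes "cball z K \<subseteq> A" "continuous_on A f" "h \<in> L2 \<Omega>"
    and "\<And>x. x \<in> \<Omega> \<Longrightarrow> norm (f (z + u x)) \<le> B" "0 \<le> B"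
  shows "L2_norm \<Omega> (\<lambda>x. f (z + u x) * h x) \<le> B * L2_norm \<Omega> h"
  by (rule L2_norm_mult_le[OF assms(3)
      shift_measurable[OF continuous_on_subset[OF assms(2,1)] closed_cball shift_mem0] assms(4,5)])

end

text \<open>\<open>F\<close> is the symbol added to A and \<open>P0\<close> the symbol of the
  right-hand side. Both the exact power and the one of the scheme satisfy F' = \<alpha> P0, which
  lets one theory treat them together; \<open>P1\<close> and \<open>P2\<close> are the derivatives
  of \<open>P0\<close>.\<close>

locale symbol_problem = multiplier \<Omega> u K for \<Omega> :: "'a::euclidean_space set" and u K +
  fixes \<alpha> :: real and S :: "complex set" and F P0 P1 P2 :: "complex \<Rightarrow> complex"
  assumes \<alpha>: "0 < \<alpha>" "\<alpha> < 1" and S_open: "open S"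
    and F_deriv: "\<And>b. b \<in> S \<Longrightarrow> (F has_field_derivative of_real \<alpha> * P0 b) (at b)"
    and P0_deriv: "\<And>b. b \<in> S \<Longrightarrow> (P0 has_field_derivative P1 b) (at b)"
    and P1_deriv: "\<And>b. b \<in> S \<Longrightarrow> (P1 has_field_derivative P2 b) (at b)"
    and Re_F: "\<And>b. b \<in> S \<Longrightarrow> 0 < Re (F b)"
begin

lemma symbol_continuous: "continuous_on S F" "continuous_on S P0" "continuous_on S P1" "continuous_on S P2"
proof -
  have "P1 holomorphic_on S" using P1_deriv S_open holomorphic_on_open by blast
  then have "deriv P1 holomorphic_on S" using S_open by (rule holomorphic_deriv)
  then have "P2 holomorphic_on S"
    by (rule holomorphic_transform) (use P1_deriv in \<open>auto intro: DERIV_imp_deriv\<close>)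
  then show "continuous_on S P2" by (rule holomorphic_on_imp_continuous_on)
  show "continuous_on S F" by (rule DERIV_continuous_on[OF has_field_derivative_at_within[OF F_deriv]])
  show "continuous_on S P0" by (rule DERIV_continuous_on[OF has_field_derivative_at_within[OF P0_deriv]])
  show "continuous_on S P1" by (rule DERIV_continuous_on[OF has_field_derivative_at_within[OF P1_deriv]])
qed

definition sol :: "('a \<Rightarrow> complex) \<Rightarrow> complex \<Rightarrow> 'a \<Rightarrow> complex" where
  "sol g z = resolv (\<lambda>x. F (z + u x)) (\<lambda>x. P0 (z + u x) * g x)"

text \<open>The right-hand side comes from differentiating (F + A) S = P0 g once in z, with F' =
  \<alpha> P0.\<close>

definition sol1 :: "('a \<Rightarrow> complex) \<Rightarrow> complex \<Rightarrow> 'a \<Rightarrow> complex" where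
  "sol1 g z = resolv (\<lambda>x. F (z + u x))
     (\<lambda>x. P1 (z + u x) * g x - of_real \<alpha> * (P0 (z + u x) * sol g z x))"

text \<open>Second derivative of the same equation; the factor 2 collects the two mixed terms P0 S'
  of the product rule.\<close>

definition sol2 :: "('a \<Rightarrow> complex) \<Rightarrow> complex \<Rightarrow> 'a \<Rightarrow> complex" where
  "sol2 g z = resolv (\<lambda>x. F (z + u x))
     (\<lambda>x. P2 (z + u x) * g x - 2 * of_real \<alpha> * (P0 (z + u x) * sol1 g z x) - of_real \<alpha> * (P1 (z + u x) * sol g z x))"

context
  fixes g z
  assumes g: "g \<in> L2 \<Omega>" and z: "cball z K \<subseteq> S"
begin

lemma F_coercive: obtains c where "coercive c (\<lambda>x. F (z + u x))"
proof -
  obtain e c where "0 < e" "\<And>y. norm (y - z) < e \<Longrightarrow> coercive c (\<lambda>x. F (y + u x))"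
    using shift_coercive[OF S_open z symbol_continuous(1) Re_F] by blast
  then show ?thesis using that[of c] by simp
qed

lemma sol_resolvent:
  "sol g z \<in> L2 \<Omega>" "is_resolvent \<Omega> (\<lambda>x. F (z + u x)) (\<lambda>x. P0 (z + u x) * g x) (sol g z)"
proof -
  obtain c where c: "coercive c (\<lambda>x. F (z + u x))" by (rule F_coercive)
  have h: "(\<lambda>x. P0 (z + u x) * g x) \<in> L2 \<Omega>" by (intro mult_shift_L2[OF z] symbol_continuous g)
  show "sol g z \<in> L2 \<Omega>" "is_resolvent \<Omega> (\<lambda>x. F (z + u x)) (\<lambda>x. P0 (z + u x) * g x) (sol g z)"
    unfolding sol_def using resolv_L2[OF c h] resolv_is_resolvent[OF c h] by auto
qed

lemma sol1_resolvent:
  "sol1 g z \<in> L2 \<Omega>" "is_resolvent \<Omega> (\<lambda>x. F (z + u x))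
     (\<lambda>x. P1 (z + u x) * g x - of_real \<alpha> * (P0 (z + u x) * sol g z x)) (sol1 g z)"
proof -
  obtain c where c: "coercive c (\<lambda>x. F (z + u x))" by (rule F_coercive)
  have h: "(\<lambda>x. P1 (z + u x) * g x - of_real \<alpha> * (P0 (z + u x) * sol g z x)) \<in> L2 \<Omega>"
    by (intro L2_diff L2_cmult mult_shift_L2[OF z] symbol_continuous g sol_resolvent)
  show "sol1 g z \<in> L2 \<Omega>" "is_resolvent \<Omega> (\<lambda>x. F (z + u x))
     (\<lambda>x. P1 (z + u x) * g x - of_real \<alpha> * (P0 (z + u x) * sol g z x)) (sol1 g z)"
    unfolding sol1_def using resolv_L2[OF c h] resolv_is_resolvent[OF c h] by auto
qed

lemma sol2_resolvent:
  "sol2 g z \<in> L2 \<Omega>" "is_resolvent \<Omega> (\<lambda>x. F (z + u x))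
     (\<lambda>x. P2 (z + u x) * g x - 2 * of_real \<alpha> * (P0 (z + u x) * sol1 g z x)
        - of_real \<alpha> * (P1 (z + u x) * sol g z x)) (sol2 g z)"
proof -
  obtain c where c: "coercive c (\<lambda>x. F (z + u x))" by (rule F_coercive)
  have h: "(\<lambda>x. P2 (z + u x) * g x - 2 * of_real \<alpha> * (P0 (z + u x) * sol1 g z x)
        - of_real \<alpha> * (P1 (z + u x) * sol g z x)) \<in> L2 \<Omega>"
    by (intro L2_diff L2_cmult mult_shift_L2[OF z] symbol_continuous g sol_resolvent sol1_resolvent)
  show "sol2 g z \<in> L2 \<Omega>" "is_resolvent \<Omega> (\<lambda>x. F (z + u x))
     (\<lambda>x. P2 (z + u x) * g x - 2 * of_real \<alpha> * (P0 (z + u x) * sol1 g z x)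
        - of_real \<alpha> * (P1 (z + u x) * sol g z x)) (sol2 g z)"
    unfolding sol2_def using resolv_L2[OF c h] resolv_is_resolvent[OF c h] by auto
qed

lemma sol_L2_deriv: "L2_deriv (sol g) z (sol1 g z)"
proof -
  obtain e c where ec: "0 < e" "\<And>y. norm (y - z) < e \<Longrightarrow> coercive c (\<lambda>x. F (y + u x))"
    using shift_coercive[OF S_open z symbol_continuous(1) Re_F] by blast
  note hd = L2_deriv_mult[OF shift_mult_deriv[OF S_open z P0_deriv] L2_deriv_const[OF g]]
  from L2_deriv_resolv[OF shift_mult_deriv[OF S_open z F_deriv] hd ec]
  show ?thesis by (simp add: sol_def[abs_def] sol1_def mult.assoc)
qed

lemma sol1_L2_deriv: "L2_deriv (sol1 g) z (sol2 g z)"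
proof -
  obtain e c where ec: "0 < e" "\<And>y. norm (y - z) < e \<Longrightarrow> coercive c (\<lambda>x. F (y + u x))"
    using shift_coercive[OF S_open z symbol_continuous(1) Re_F] by blast
  note hd = L2_deriv_diff[OF L2_deriv_mult[OF shift_mult_deriv[OF S_open z P1_deriv] L2_deriv_const[OF g]]
    L2_deriv_cmult[OF L2_deriv_mult[OF shift_mult_deriv[OF S_open z P0_deriv] sol_L2_deriv], of "of_real \<alpha>"]]
  \<comment> \<open>One term P0 S' comes from the right-hand side of the equation for S', the other
    from the derivative of the symbol.\<close>
  have eq: "(\<lambda>x. P2 (z + u x) * g x + P1 (z + u x) * 0 - of_real \<alpha> * (P1 (z + u x) * sol g z x + P0 (z + u x) * sol1 g z x)
        - of_real \<alpha> * P0 (z + u x) * sol1 g z x)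
      = (\<lambda>x. P2 (z + u x) * g x - 2 * of_real \<alpha> * (P0 (z + u x) * sol1 g z x) - of_real \<alpha> * (P1 (z + u x) * sol g z x))"
    by (rule ext) (simp add: algebra_simps)
  from L2_deriv_resolv[OF shift_mult_deriv[OF S_open z F_deriv] hd ec]
  show ?thesis unfolding sol1_def[symmetric] eq sol2_def[symmetric] .
qed

lemma inner_sol_deriv:
  assumes "v \<in> L2 \<Omega>"
  shows "((\<lambda>z. L2_inner \<Omega> (sol g z) v) has_field_derivative L2_inner \<Omega> (sol1 g z) v) (at z)"
    "((\<lambda>z. L2_inner \<Omega> (sol1 g z) v) has_field_derivative L2_inner \<Omega> (sol2 g z) v) (at z)"
  by (rule L2_deriv_inner[OF sol_L2_deriv assms] L2_deriv_inner[OF sol1_L2_deriv assms])+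

end

end

section \<open>Norm bounds for abstract solutions, their derivatives and their differences\<close>

lemma (in bounded_domain) L2_norm_diff_le:
  assumes "u \<in> L2 \<Omega>" "v \<in> L2 \<Omega>" "L2_norm \<Omega> u \<le> a" "L2_norm \<Omega> v \<le> b"
  shows "L2_norm \<Omega> (\<lambda>x. u x - v x) \<le> a + b"
  using L2_norm_triangle_diff[OF assms(1,2)] assms(3,4) by linarith

context symbol_problem begin

text \<open>\<open>Xa\<close> stands for |z|^\<alpha>: right-hand sides carry this factor and the
  resolvent divides by it, so only the constant \<open>M\<close> survives.\<close>

lemma resolvent_bound_scaled:
  assumes z: "cball z K \<subseteq> S" and X: "0 < Xa" "1 \<le> M"
    and F: "\<And>x. x \<in> \<Omega> \<Longrightarrow> Xa / M \<le> Re (F (z + u x))"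
    and w: "is_resolvent \<Omega> (\<lambda>x. F (z + u x)) h w" "h \<in> L2 \<Omega>" "L2_norm \<Omega> h \<le> Xa * R"
  shows "L2_norm \<Omega> w \<le> M * R"
proof -
  have "L2_norm \<Omega> w \<le> L2_norm \<Omega> h / (Xa / M)"
    by (rule resolvent_bound[OF w(1,2) _ F]) (use X in auto)
  also have "\<dots> \<le> Xa * R / (Xa / M)" using w(3) X by (intro divide_right_mono) auto
  also have "\<dots> = M * R" using X by simp
  finally show ?thesis .
qed

lemma alpha_scaled_le:
  assumes "L2_norm \<Omega> f \<le> a"
  shows "L2_norm \<Omega> (\<lambda>x. of_real \<alpha> * f x) \<le> a"
proof -
  have "\<alpha> * L2_norm \<Omega> f \<le> 1 * L2_norm \<Omega> f" using \<alpha> by (intro mult_right_mono) auto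
  then show ?thesis using assms \<alpha> by simp
qed

lemma two_alpha_scaled_le:
  assumes "L2_norm \<Omega> f \<le> a"
  shows "L2_norm \<Omega> (\<lambda>x. 2 * of_real \<alpha> * f x) \<le> 2 * a"
proof -
  have "L2_norm \<Omega> (\<lambda>x. 2 * of_real \<alpha> * f x) = 2 * L2_norm \<Omega> (\<lambda>x. of_real \<alpha> * f x)"
    by (simp add: norm_mult)
  then show ?thesis using alpha_scaled_le[OF assms] by linarith
qed

text \<open>With X = |z|, the symbol P_k contributes M Xa / X^(k+1) and each resolvent M / Xa. The
  powers |z|^\<alpha> cancel, every derivative gains 1/X, and smaller powers of \<open>M\<close> are
  absorbed using \<open>1 \<le> M\<close>.\<close>

lemma sol_bounds:
  assumes g: "g \<in> L2 \<Omega>" and z: "cball z K \<subseteq> S" and X: "0 < X" "0 < Xa" "1 \<le> M"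
    and F: "\<And>x. x \<in> \<Omega> \<Longrightarrow> Xa / M \<le> Re (F (z + u x))"
    and P0: "\<And>x. x \<in> \<Omega> \<Longrightarrow> norm (P0 (z + u x)) \<le> M * Xa / X"
    and P1: "\<And>x. x \<in> \<Omega> \<Longrightarrow> norm (P1 (z + u x)) \<le> M * Xa / X ^ 2"
    and P2: "\<And>x. x \<in> \<Omega> \<Longrightarrow> norm (P2 (z + u x)) \<le> M * Xa / X ^ 3"
  shows "L2_norm \<Omega> (sol g z) \<le> M ^ 2 / X * L2_norm \<Omega> g"
    "L2_norm \<Omega> (sol1 g z) \<le> 2 * M ^ 4 / X ^ 2 * L2_norm \<Omega> g"
    "L2_norm \<Omega> (sol2 g z) \<le> 6 * M ^ 6 / X ^ 3 * L2_norm \<Omega> g"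
proof -
  define N where "N = L2_norm \<Omega> g"
  have N: "0 \<le> N" by (simp add: N_def)
  note c = symbol_continuous
  note s0 = sol_resolvent[OF g z] and s1 = sol1_resolvent[OF g z] and s2 = sol2_resolvent[OF g z]
  have nn: "0 \<le> M * Xa / X" "0 \<le> M * Xa / X ^ 2" "0 \<le> M * Xa / X ^ 3" using X by auto
  have M: "M ^ i \<le> M ^ j" if "i \<le> j" for i j by (rule power_increasing[OF that X(3)])
  have M0: "0 < M" using X by simp
  have "L2_norm \<Omega> (\<lambda>x. P0 (z + u x) * g x) \<le> M * Xa / X * N"
    unfolding N_def by (rule mult_shift_norm_le[OF z c(2) g P0 nn(1)])
  also have "M * Xa / X * N = Xa * (M / X * N)" by simp
  finally have "L2_norm \<Omega> (sol g z) \<le> M * (M / X * N)"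
    by (intro resolvent_bound_scaled[OF z X(2,3) F s0(2)] mult_shift_L2[OF z c(2)] g)
  then have b0: "L2_norm \<Omega> (sol g z) \<le> M ^ 2 / X * N" by (simp add: power2_eq_square)
  then show "L2_norm \<Omega> (sol g z) \<le> M ^ 2 / X * L2_norm \<Omega> g" by (simp add: N_def)
  have p00: "L2_norm \<Omega> (\<lambda>x. P0 (z + u x) * sol g z x) \<le> M * Xa / X * (M ^ 2 / X * N)"
    by (rule order_trans[OF mult_shift_norm_le[OF z c(2) s0(1) P0 nn(1)] mult_left_mono[OF b0 nn(1)]])
  have "L2_norm \<Omega> (\<lambda>x. P1 (z + u x) * g x - of_real \<alpha> * (P0 (z + u x) * sol g z x))
      \<le> M * Xa / X ^ 2 * N + M * Xa / X * (M ^ 2 / X * N)"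
    unfolding N_def
    by (intro L2_norm_diff_le mult_shift_norm_le[OF z c(3) g P1 nn(2)] alpha_scaled_le p00[unfolded N_def]
        L2_cmult mult_shift_L2[OF z c(3)] mult_shift_L2[OF z c(2)] g s0)
  also have "\<dots> = (M + M ^ 3) * (Xa / X ^ 2 * N)" using X by (simp add: power_eq_if field_simps)
  also have "\<dots> \<le> (2 * M ^ 3) * (Xa / X ^ 2 * N)"
    using M[of 1 3] X N by (intro mult_right_mono) auto
  finally have "L2_norm \<Omega> (\<lambda>x. P1 (z + u x) * g x - of_real \<alpha> * (P0 (z + u x) * sol g z x)) \<le> Xa * (2 * M ^ 3 / X ^ 2 * N)"
    by (simp add: mult_ac)
  then have "L2_norm \<Omega> (sol1 g z) \<le> M * (2 * M ^ 3 / X ^ 2 * N)"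
    by (intro resolvent_bound_scaled[OF z X(2,3) F s1(2)] L2_diff L2_cmult mult_shift_L2[OF z c(2)]
      mult_shift_L2[OF z c(3)] g s0)
  also have "\<dots> = 2 * M ^ 4 / X ^ 2 * N" by (simp add: power_eq_if)
  finally have b1: "L2_norm \<Omega> (sol1 g z) \<le> 2 * M ^ 4 / X ^ 2 * N" .
  then show "L2_norm \<Omega> (sol1 g z) \<le> 2 * M ^ 4 / X ^ 2 * L2_norm \<Omega> g" by (simp add: N_def)
  have p01: "L2_norm \<Omega> (\<lambda>x. P0 (z + u x) * sol1 g z x) \<le> M * Xa / X * (2 * M ^ 4 / X ^ 2 * N)"
    by (rule order_trans[OF mult_shift_norm_le[OF z c(2) s1(1) P0 nn(1)] mult_left_mono[OF b1 nn(1)]])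
  have p10: "L2_norm \<Omega> (\<lambda>x. P1 (z + u x) * sol g z x) \<le> M * Xa / X ^ 2 * (M ^ 2 / X * N)"
    by (rule order_trans[OF mult_shift_norm_le[OF z c(3) s0(1) P1 nn(2)] mult_left_mono[OF b0 nn(2)]])
  have "L2_norm \<Omega> (\<lambda>x. P2 (z + u x) * g x - 2 * of_real \<alpha> * (P0 (z + u x) * sol1 g z x)
        - of_real \<alpha> * (P1 (z + u x) * sol g z x))
      \<le> M * Xa / X ^ 3 * N + 2 * (M * Xa / X * (2 * M ^ 4 / X ^ 2 * N)) + M * Xa / X ^ 2 * (M ^ 2 / X * N)"
    unfolding N_def
    by (intro L2_norm_diff_le mult_shift_norm_le[OF z c(4) g P2 nn(3)] alpha_scaled_le two_alpha_scaled_le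
        p01[unfolded N_def] p10[unfolded N_def]
        L2_diff L2_cmult mult_shift_L2[OF z c(3)] mult_shift_L2[OF z c(2)] mult_shift_L2[OF z c(4)] g s0 s1)
  also have "\<dots> = (M + 4 * M ^ 5 + M ^ 3) * (Xa / X ^ 3 * N)" using X by (simp add: power_eq_if field_simps)
  also have "\<dots> \<le> (6 * M ^ 5) * (Xa / X ^ 3 * N)"
    using M[of 1 5] M[of 3 5] X N by (intro mult_right_mono) auto
  finally have "L2_norm \<Omega> (\<lambda>x. P2 (z + u x) * g x - 2 * of_real \<alpha> * (P0 (z + u x) * sol1 g z x)
        - of_real \<alpha> * (P1 (z + u x) * sol g z x)) \<le> Xa * (6 * M ^ 5 / X ^ 3 * N)"
    by (simp add: mult_ac)
  then have "L2_norm \<Omega> (sol2 g z) \<le> M * (6 * M ^ 5 / X ^ 3 * N)"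
    by (intro resolvent_bound_scaled[OF z X(2,3) F s2(2)] L2_diff L2_cmult mult_shift_L2[OF z c(2)]
      mult_shift_L2[OF z c(3)] mult_shift_L2[OF z c(4)] g s0 s1)
  also have "\<dots> = 6 * M ^ 6 / X ^ 3 * N" by (simp add: power_eq_if)
  finally show "L2_norm \<Omega> (sol2 g z) \<le> 6 * M ^ 6 / X ^ 3 * L2_norm \<Omega> g" by (simp add: N_def)
qed

end

text \<open>The unprimed data will be the continuous symbol, the data with prefix \<open>d\<close>
  the discrete one; \<open>F'\<close> is the second symbol, not a derivative.\<close>

locale symbol_pair = symbol_problem \<Omega> u K \<alpha> S F P0 P1 P2 + d: symbol_problem \<Omega> u K \<alpha> S' F' Q0 Q1 Q2
  for \<Omega> :: "'a::euclidean_space set" and u K \<alpha> S F P0 P1 P2 S' F' Q0 Q1 Q2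
begin

lemma mult_diff_L2:
  assumes z: "cball z K \<subseteq> S" "cball z K \<subseteq> S'" and f: "continuous_on S f" "continuous_on S' f'" and h: "h \<in> L2 \<Omega>"
  shows "(\<lambda>x. (f (z + u x) - f' (z + u x)) * h x) \<in> L2 \<Omega>"
  using L2_diff[OF mult_shift_L2[OF z(1) f(1) h] mult_shift_L2[OF z(2) f(2) h]]
  by (simp add: left_diff_distrib)

lemma mult_diff_norm_le:
  assumes z: "cball z K \<subseteq> S" "cball z K \<subseteq> S'" and f: "continuous_on S f" "continuous_on S' f'"
    and B: "\<And>x. x \<in> \<Omega> \<Longrightarrow> norm (f (z + u x) - f' (z + u x)) \<le> B" "0 \<le> B"
    and h: "h \<in> L2 \<Omega>" "L2_norm \<Omega> h \<le> N"
  shows "L2_norm \<Omega> (\<lambda>x. (f (z + u x) - f' (z + u x)) * h x) \<le> B * N"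
proof -
  have "continuous_on (S \<inter> S') (\<lambda>b. f b - f' b)"
    by (intro continuous_intros continuous_on_subset[OF f(1)] continuous_on_subset[OF f(2)]) auto
  from mult_shift_norm_le[OF _ this h(1) B] z
  have "L2_norm \<Omega> (\<lambda>x. (f (z + u x) - f' (z + u x)) * h x) \<le> B * L2_norm \<Omega> h" by simp
  also have "\<dots> \<le> B * N" by (rule mult_left_mono[OF h(2) B(2)])
  finally show ?thesis .
qed

lemma mult_norm_le:
  assumes z: "cball z K \<subseteq> S" and f: "continuous_on S f"
    and B: "\<And>x. x \<in> \<Omega> \<Longrightarrow> norm (f (z + u x)) \<le> B" "0 \<le> B"
    and h: "h \<in> L2 \<Omega>" "L2_norm \<Omega> h \<le> N"
  shows "L2_norm \<Omega> (\<lambda>x. f (z + u x) * h x) \<le> B * N"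
  by (rule order_trans[OF mult_shift_norm_le[OF z f h(1) B] mult_left_mono[OF h(2) B(2)]])

text \<open>A difference of symbols is smaller than the symbols themselves by a factor \<tau> X.
  Each term of the subtracted equations contains exactly one such factor, directly or through a
  difference bounded before, so the bounds of \<open>sol_bounds\<close> are multiplied by \<tau>
  X.\<close>

lemma sol_diff_bounds:
  assumes g: "g \<in> L2 \<Omega>" and z: "cball z K \<subseteq> S" "cball z K \<subseteq> S'" and X: "0 < X" "0 < Xa" "1 \<le> M" and \<tau>: "0 < \<tau>"
    and F: "\<And>x. x \<in> \<Omega> \<Longrightarrow> Xa / M \<le> Re (F (z + u x))" "\<And>x. x \<in> \<Omega> \<Longrightarrow> Xa / M \<le> Re (F' (z + u x))"
    and P0: "\<And>x. x \<in> \<Omega> \<Longrightarrow> norm (P0 (z + u x)) \<le> M * Xa / X" "\<And>x. x \<in> \<Omega> \<Longrightarrow> norm (Q0 (z + u x)) \<le> M * Xa / X"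
    and P1: "\<And>x. x \<in> \<Omega> \<Longrightarrow> norm (P1 (z + u x)) \<le> M * Xa / X ^ 2" "\<And>x. x \<in> \<Omega> \<Longrightarrow> norm (Q1 (z + u x)) \<le> M * Xa / X ^ 2"
    and Q2: "\<And>x. x \<in> \<Omega> \<Longrightarrow> norm (Q2 (z + u x)) \<le> M * Xa / X ^ 3"
    and dF: "\<And>x. x \<in> \<Omega> \<Longrightarrow> norm (F (z + u x) - F' (z + u x)) \<le> M * \<tau> * Xa * X"
    and d0: "\<And>x. x \<in> \<Omega> \<Longrightarrow> norm (P0 (z + u x) - Q0 (z + u x)) \<le> M * \<tau> * Xa"
    and d1: "\<And>x. x \<in> \<Omega> \<Longrightarrow> norm (P1 (z + u x) - Q1 (z + u x)) \<le> M * \<tau> * Xa / X"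
    and d2: "\<And>x. x \<in> \<Omega> \<Longrightarrow> norm (P2 (z + u x) - Q2 (z + u x)) \<le> M * \<tau> * Xa / X ^ 2"
  shows "L2_norm \<Omega> (\<lambda>x. sol2 g z x - d.sol2 g z x) \<le> 26 * M ^ 8 * \<tau> / X ^ 2 * L2_norm \<Omega> g"
proof -
  define N where "N = L2_norm \<Omega> g"
  have N: "0 \<le> N" by (simp add: N_def)
  note c = symbol_continuous and c' = d.symbol_continuous
  note s0 = sol_resolvent[OF g z(1)] and s1 = sol1_resolvent[OF g z(1)] and s2 = sol2_resolvent[OF g z(1)]
  note t0 = d.sol_resolvent[OF g z(2)] and t1 = d.sol1_resolvent[OF g z(2)] and t2 = d.sol2_resolvent[OF g z(2)]
  note L = is_resolvent_def
  note y = d.sol_bounds[OF g z(2) X F(2) P0(2) P1(2) Q2, folded N_def]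
  have nn: "0 \<le> M * Xa / X" "0 \<le> M * Xa / X ^ 2" "0 \<le> M * \<tau> * Xa * X" "0 \<le> M * \<tau> * Xa"
    "0 \<le> M * \<tau> * Xa / X" "0 \<le> M * \<tau> * Xa / X ^ 2" using X \<tau> by auto
  have M: "M ^ i \<le> M ^ j" if "i \<le> j" for i j by (rule power_increasing[OF that X(3)])
  have gN: "L2_norm \<Omega> g \<le> N" by (simp add: N_def)
  let ?e = "\<lambda>x. sol g z x - d.sol g z x" and ?e1 = "\<lambda>x. sol1 g z x - d.sol1 g z x"
    and ?e2 = "\<lambda>x. sol2 g z x - d.sol2 g z x"
  have eL: "?e \<in> L2 \<Omega>" "?e1 \<in> L2 \<Omega>" by (intro L2_diff s0 s1 t0 t1)+
  note mL = mult_diff_L2[OF z] and mN = mult_diff_norm_le[OF z]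
  note aF = mN[OF c(1) c'(1) dF nn(3)] and a0 = mN[OF c(2) c'(2) d0 nn(4)] and a1 = mN[OF c(3) c'(3) d1 nn(5)]
    and a2 = mN[OF c(4) c'(4) d2 nn(6)] and b0 = mult_norm_le[OF z(1) c(2) P0(1) nn(1)]
    and b1 = mult_norm_le[OF z(1) c(3) P1(1) nn(2)]
  note LF = mL[OF c(1) c'(1)] and L0 = mL[OF c(2) c'(2)] and L1 = mL[OF c(3) c'(3)] and L2 = mL[OF c(4) c'(4)]
    and K0 = mult_shift_L2[OF z(1) c(2)] and K1 = mult_shift_L2[OF z(1) c(3)]

  let ?h = "\<lambda>x. (P0 (z + u x) - Q0 (z + u x)) * g x - (F (z + u x) - F' (z + u x)) * d.sol g z x"
  \<comment> \<open>In the subtraction the resolvent of the first symbol is kept, so F - F' acts on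
    the solution of the second problem. The equations for both derivatives follow the same
    pattern.\<close>
  have r: "is_resolvent \<Omega> (\<lambda>x. F (z + u x)) ?h ?e"
    using lap_diff[OF s0(2)[unfolded L] t0(2)[unfolded L]] unfolding L by (simp add: algebra_simps)
  have hL: "?h \<in> L2 \<Omega>" by (intro L2_diff L0 LF g t0)
  have "L2_norm \<Omega> ?h \<le> M * \<tau> * Xa * N + M * \<tau> * Xa * X * (M ^ 2 / X * N)"
    by (intro L2_norm_diff_le a0 aF L0 LF g gN t0 y)
  also have "\<dots> = (M + M ^ 3) * (Xa * \<tau> * N)" using X by (simp add: power_eq_if field_simps)
  also have "\<dots> \<le> (2 * M ^ 3) * (Xa * \<tau> * N)" using M[of 1 3] X N \<tau> by (intro mult_right_mono) auto
  finally have "L2_norm \<Omega> ?h \<le> Xa * (2 * M ^ 3 * \<tau> * N)" by (simp add: mult_ac)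
  from resolvent_bound_scaled[OF z(1) X(2,3) F(1) r hL this]
  have e: "L2_norm \<Omega> ?e \<le> 2 * M ^ 4 * \<tau> * N" by (simp add: power_eq_if mult_ac)

  let ?h1 = "\<lambda>x. (P1 (z + u x) - Q1 (z + u x)) * g x - of_real \<alpha> * (P0 (z + u x) * ?e x)
    - of_real \<alpha> * ((P0 (z + u x) - Q0 (z + u x)) * d.sol g z x) - (F (z + u x) - F' (z + u x)) * d.sol1 g z x"
  have r1: "is_resolvent \<Omega> (\<lambda>x. F (z + u x)) ?h1 ?e1"
    using lap_diff[OF s1(2)[unfolded L] t1(2)[unfolded L]] unfolding L by (simp add: algebra_simps)
  have hL1: "?h1 \<in> L2 \<Omega>" by (intro L2_diff L2_cmult L0 L1 LF K0 eL g t0 t1 s0)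
  have "L2_norm \<Omega> ?h1 \<le> M * \<tau> * Xa / X * N + M * Xa / X * (2 * M ^ 4 * \<tau> * N)
      + M * \<tau> * Xa * (M ^ 2 / X * N) + M * \<tau> * Xa * X * (2 * M ^ 4 / X ^ 2 * N)"
    by (intro L2_norm_diff_le alpha_scaled_le a1 a0 aF b0 L0 L1 LF K0 L2_diff L2_cmult g gN t0 t1 s0 y e)
  also have "\<dots> = (M + 4 * M ^ 5 + M ^ 3) * (Xa * \<tau> / X * N)" using X by (simp add: power_eq_if field_simps)
  also have "\<dots> \<le> (6 * M ^ 5) * (Xa * \<tau> / X * N)" using M[of 1 5] M[of 3 5] X N \<tau> by (intro mult_right_mono) auto
  finally have "L2_norm \<Omega> ?h1 \<le> Xa * (6 * M ^ 5 * \<tau> / X * N)" by (simp add: mult_ac)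
  from resolvent_bound_scaled[OF z(1) X(2,3) F(1) r1 hL1 this]
  have e1: "L2_norm \<Omega> ?e1 \<le> 6 * M ^ 6 * \<tau> / X * N" by (simp add: power_eq_if mult_ac)

  let ?h2 = "\<lambda>x. (P2 (z + u x) - Q2 (z + u x)) * g x - 2 * of_real \<alpha> * (P0 (z + u x) * ?e1 x)
    - 2 * of_real \<alpha> * ((P0 (z + u x) - Q0 (z + u x)) * d.sol1 g z x)
    - of_real \<alpha> * (P1 (z + u x) * ?e x) - of_real \<alpha> * ((P1 (z + u x) - Q1 (z + u x)) * d.sol g z x)
    - (F (z + u x) - F' (z + u x)) * d.sol2 g z x"
  have r2: "is_resolvent \<Omega> (\<lambda>x. F (z + u x)) ?h2 ?e2"
    using lap_diff[OF s2(2)[unfolded L] t2(2)[unfolded L]] unfolding L by (simp add: algebra_simps)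
  have hL2: "?h2 \<in> L2 \<Omega>" by (intro L2_diff L2_cmult L0 L1 L2 LF K0 K1 eL g t0 t1 t2 s0 s1)
  have "L2_norm \<Omega> ?h2 \<le> M * \<tau> * Xa / X ^ 2 * N + 2 * (M * Xa / X * (6 * M ^ 6 * \<tau> / X * N))
      + 2 * (M * \<tau> * Xa * (2 * M ^ 4 / X ^ 2 * N)) + M * Xa / X ^ 2 * (2 * M ^ 4 * \<tau> * N)
      + M * \<tau> * Xa / X * (M ^ 2 / X * N) + M * \<tau> * Xa * X * (6 * M ^ 6 / X ^ 3 * N)"
    by (intro L2_norm_diff_le alpha_scaled_le two_alpha_scaled_le a2 a1 a0 aF b0 b1 L0 L1 L2 LF K0 K1 L2_diff L2_cmult
      g gN t0 t1 t2 s0 s1 y e e1)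
  also have "\<dots> = (M + 18 * M ^ 7 + 6 * M ^ 5 + M ^ 3) * (Xa * \<tau> / X ^ 2 * N)"
    using X by (simp add: power_eq_if field_simps)
  \<comment> \<open>26 = 1 + 18 + 6 + 1 after raising all powers of \<open>M\<close> to the seventh;
    one more resolvent makes it the eighth.\<close>
  also have "\<dots> \<le> (26 * M ^ 7) * (Xa * \<tau> / X ^ 2 * N)"
    using M[of 1 7] M[of 3 7] M[of 5 7] X N \<tau> by (intro mult_right_mono) auto
  finally have "L2_norm \<Omega> ?h2 \<le> Xa * (26 * M ^ 7 * \<tau> / X ^ 2 * N)" by (simp add: mult_ac)
  from resolvent_bound_scaled[OF z(1) X(2,3) F(1) r2 hL2 this]
  show ?thesis by (simp add: power_eq_if mult_ac N_def)
qed

end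

section \<open>The continuous and the discrete symbol\<close>

text \<open>Taylor's formula at 0 on the closed right half plane, where all derivatives of exp(-s)
  have modulus at most one.\<close>

lemma exp_neg_bounds:
  assumes "0 \<le> Re s"
  shows "norm (1 - exp (- s)) \<le> norm s" "norm (1 - exp (- s) - s) \<le> (norm s)\<^sup>2"
proof -
  let ?S = "{s. 0 \<le> Re s}"
  let ?f = "\<lambda>(i::nat) s. (-1) ^ i * exp (- s) :: complex"
  have conv: "convex ?S" by (rule convex_halfspace_Re_ge)
  have d: "(?f i has_field_derivative ?f (Suc i) x) (at x within ?S)" for i x
    by (auto intro!: derivative_eq_intros)
  have B: "norm (?f i x) \<le> 1" if "x \<in> ?S" for i x
    using that by (simp add: norm_mult norm_power)
  have "norm (?f 0 s - (\<Sum>i\<le>0. ?f i 0 * (s - 0) ^ i / fact i)) \<le> 1 * norm (s - 0) ^ Suc 0 / fact 0"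
    by (rule complex_Taylor[where f="?f" and S="?S", OF conv d B]) (use assms in auto)
  then show "norm (1 - exp (- s)) \<le> norm s" by (simp add: norm_minus_commute)
  have "norm (?f 0 s - (\<Sum>i\<le>1. ?f i 0 * (s - 0) ^ i / fact i)) \<le> 1 * norm (s - 0) ^ Suc 1 / fact 1"
    by (rule complex_Taylor[where f="?f" and S="?S", OF conv d B]) (use assms in auto)
  then have "norm (exp (- s) - 1 + s) \<le> (norm s)\<^sup>2" by (simp add: power2_eq_square algebra_simps)
  then show "norm (1 - exp (- s) - s) \<le> (norm s)\<^sup>2"
    using norm_minus_cancel[of "exp (- s) - 1 + s"] by (simp add: algebra_simps)
qed

text \<open>The zeros of 1 - exp(-s) are the multiples of 2 \<pi> \<i>, and the disjunction excludes
  all but 0. Near 0 the bound follows from Taylor's formula, elsewhere from compactness. The limit 3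
  \<pi> / 2 leaves room for points pushed beyond Im s = \<pi> by the shift with \<rho> U.\<close>

lemma exp_neg_lower_bound:
  assumes "1 \<le> L"
  shows "\<exists>c>0. c \<le> 1 \<and> (\<forall>s. 0 \<le> Re s \<and> Re s \<le> L \<and> \<bar>Im s\<bar> \<le> L \<and> (1 \<le> Re s \<or> \<bar>Im s\<bar> \<le> 3 * pi / 2)
    \<longrightarrow> c * norm s \<le> norm (1 - exp (- s)))"
proof -
  define Q where "Q = {s. 0 \<le> Re s \<and> Re s \<le> L \<and> \<bar>Im s\<bar> \<le> L \<and> (1 \<le> Re s \<or> \<bar>Im s\<bar> \<le> 3 * pi / 2) \<and> 1/2 \<le> norm s}"
  have bd: "norm s \<le> 2 * L" if "s \<in> Q" for s
    using that cmod_le[of s] by (auto simp: Q_def)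
  have "closed Q"
    unfolding Q_def by (intro closed_Collect_conj closed_Collect_disj closed_Collect_le continuous_intros)
  moreover have "bounded Q" using bd by (auto simp: bounded_iff)
  ultimately have cQ: "compact Q" by (simp add: compact_eq_bounded_closed)
  have nz: "norm (1 - exp (- s)) > 0" if "s \<in> Q" for s
  proof -
    have "exp (- s) \<noteq> 1"
    proof
      assume "exp (- s) = 1"
      then obtain n :: int where n: "Re s = 0" "- Im s = of_int (2 * n) * pi" by (auto simp: exp_eq_1)
      then have "\<bar>Im s\<bar> \<le> 3 * pi / 2" using that by (auto simp: Q_def)
      then have "\<bar>of_int (2 * n) * pi\<bar> \<le> 3 * pi / 2" using n(2) by (metis abs_minus_cancel)
      then have "\<bar>of_int (2 * n) :: real\<bar> * pi \<le> 3 / 2 * pi" by (simp add: abs_mult)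
      then have "\<bar>of_int (2 * n) :: real\<bar> \<le> 3 / 2" by simp
      then have "n = 0" by linarith
      then have "s = 0" using n by (simp add: complex_eq_iff)
      then show False using that by (simp add: Q_def)
    qed
    then show ?thesis by simp
  qed
  have "\<exists>m>0. \<forall>s\<in>Q. m \<le> norm (1 - exp (- s))"
  proof (cases "Q = {}")
    case False
    have "\<exists>b\<in>Q. \<forall>s\<in>Q. norm (1 - exp (- b)) \<le> norm (1 - exp (- s))"
      by (rule continuous_attains_inf[OF cQ False]) (intro continuous_intros)
    then show ?thesis using nz by blast
  qed (auto intro: exI[of _ 1])
  then obtain m where m: "0 < m" "\<And>s. s \<in> Q \<Longrightarrow> m \<le> norm (1 - exp (- s))" by blast
  \<comment> \<open>Near 0 the Taylor error leaves half of |s|; on \<open>Q\<close> the modulus of s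
    is at most 2 L while the function is at least \<open>m\<close>.\<close>
  define c where "c = min (1/2) (m / (2 * L))"
  have c: "0 < c" "c \<le> 1/2" "c \<le> m / (2 * L)" using m assms by (auto simp: c_def)
  have "c * norm s \<le> norm (1 - exp (- s))"
    if s: "0 \<le> Re s" "Re s \<le> L" "\<bar>Im s\<bar> \<le> L" "1 \<le> Re s \<or> \<bar>Im s\<bar> \<le> 3 * pi / 2" for s
  proof (cases "norm s < 1/2")
    case True
    have "(norm s)\<^sup>2 \<le> 1/2 * norm s" unfolding power2_eq_square by (intro mult_right_mono) (use True in auto)
    moreover have "norm s \<le> norm (1 - exp (- s)) + norm (1 - exp (- s) - s)"
      using norm_triangle_ineq4[of "1 - exp (- s)" "1 - exp (- s) - s"] by simp
    ultimately have "1/2 * norm s \<le> norm (1 - exp (- s))" using exp_neg_bounds(2)[OF s(1)] by linarith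
    moreover have "c * norm s \<le> 1/2 * norm s" using c by (intro mult_right_mono) auto
    ultimately show ?thesis by linarith
  next
    case False
    then have sQ: "s \<in> Q" using s by (simp add: Q_def)
    have "c * norm s \<le> m / (2 * L) * (2 * L)" using c bd[OF sQ] m assms by (intro mult_mono) auto
    also have "\<dots> = m" using assms by simp
    finally show ?thesis using m(2)[OF sQ] by linarith
  qed
  then show ?thesis using c by (intro exI[of _ c]) auto
qed

section \<open>Fractional powers on a sector\<close>

lemma not_nonpos_Reals_if_Re_gt:
  assumes "- \<eta> * norm b < Re b" "\<eta> \<le> 1"
  shows "b \<notin> \<real>\<^sub>\<le>\<^sub>0" "b \<noteq> 0"
proof -
  show "b \<notin> \<real>\<^sub>\<le>\<^sub>0"
  proof
    assume "b \<in> \<real>\<^sub>\<le>\<^sub>0"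
    then have "Im b = 0" "Re b \<le> 0" by (auto simp: complex_nonpos_Reals_iff)
    then have "norm b = - Re b" by (simp add: cmod_eq_Re)
    moreover have "\<eta> * norm b \<le> 1 * norm b" using assms(2) by (intro mult_right_mono) auto
    ultimately show False using assms(1) by simp
  qed
  show "b \<noteq> 0" using assms by auto
qed

text \<open>The first hypothesis says |Arg b| < \<pi>/2 + \<phi>. The power multiplies the argument
  by \<alpha>, which brings it back into a range where the cosine is monotone and
  nonnegative.\<close>

lemma Re_powr_lower_bound:
  assumes b: "- sin \<phi> * norm b < Re b" and \<phi>: "0 \<le> \<phi>" "\<phi> < pi / 2"
    and \<alpha>: "0 < \<alpha>" "\<alpha> * (pi / 2 + \<phi>) \<le> pi / 2"
  shows "cos (\<alpha> * (pi / 2 + \<phi>)) * norm b powr \<alpha> \<le> Re (b powr of_real \<alpha>)"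
proof -
  have b0: "b \<noteq> 0" using not_nonpos_Reals_if_Re_gt(2)[OF b] by simp
  have "Re b = norm b * cos (Arg b)" using b0 by (simp add: cos_Arg)
  then have "norm b * (- sin \<phi>) < norm b * cos (Arg b)" using b by (simp add: mult.commute)
  moreover have "0 < norm b" using b0 by simp
  ultimately have "- sin \<phi> < cos (Arg b)" by (simp only: mult_less_cancel_left_pos)
  then have "cos (pi / 2 + \<phi>) < cos \<bar>Arg b\<bar>" by (simp add: cos_add)
  moreover have "\<bar>Arg b\<bar> \<le> pi" using mpi_less_Arg[of b] Arg_le_pi[of b] by linarith
  ultimately have le: "\<bar>Arg b\<bar> \<le> pi / 2 + \<phi>"
    using cos_mono_less_eq[of "pi / 2 + \<phi>" "\<bar>Arg b\<bar>"] \<phi> by simp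
  have "\<alpha> * (pi / 2 + \<phi>) \<le> pi" using \<alpha>(2) pi_gt_zero by linarith
  then have "cos (\<alpha> * (pi / 2 + \<phi>)) \<le> cos \<bar>\<alpha> * Arg b\<bar>"
    using le \<alpha> by (intro cos_monotone_0_pi_le) (auto simp: abs_mult)
  then have "cos (\<alpha> * (pi / 2 + \<phi>)) \<le> cos (\<alpha> * Arg b)" by simp
  then have "cos (\<alpha> * (pi / 2 + \<phi>)) * norm b powr \<alpha> \<le> cos (\<alpha> * Arg b) * norm b powr \<alpha>"
    by (rule mult_right_mono) simp
  also have "\<dots> = Re (b powr of_real \<alpha>)"
    using b0 by (simp add: powr_def Re_exp Arg_eq_Im_Ln mult.commute)
  finally show ?thesis .
qed

lemma norm_powr_of_real: "norm (b powr of_real r) = norm b powr r" for b :: complex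
  using norm_powr_real_powr'[of "of_real r" b] by simp

text \<open>Differences of powers of comparable points of the right half plane; the segment between the
  points may pass close to 0, so the mean value theorem is only used when they are close together.\<close>

lemma powr_diff_bound:
  assumes "0 < c" "c \<le> 1" "r \<le> 1"
  shows "\<exists>C\<ge>1. \<forall>b d :: complex. 0 < Re b \<longrightarrow> 0 < Re d \<longrightarrow> c * norm b \<le> norm d \<longrightarrow> norm d \<le> norm b
    \<longrightarrow> norm (d powr of_real r) \<le> C * norm b powr r
      \<and> norm (b powr of_real r - d powr of_real r) \<le> C * norm b powr (r - 1) * norm (b - d)"
proof -
  define C1 where "C1 = max 1 (c powr r)"
  \<comment> \<open>The first summand serves points that are far apart, the second the mean value
    theorem on points of modulus at least |b|/2.\<close>
  define C where "C = 2 * (1 + C1) + \<bar>r\<bar> * (1/2) powr (r - 1)"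
  have C: "1 \<le> C1" "C1 \<le> C" "2 * (1 + C1) \<le> C" "\<bar>r\<bar> * (1/2) powr (r - 1) \<le> C" "1 \<le> C"
  proof -
    have "0 \<le> \<bar>r\<bar> * (1/2) powr (r - 1)" "1 \<le> C1" by (auto simp: C1_def)
    then show "1 \<le> C1" "C1 \<le> C" "2 * (1 + C1) \<le> C" "\<bar>r\<bar> * (1/2) powr (r - 1) \<le> C" "1 \<le> C"
      unfolding C_def by auto
  qed
  have main: "norm (d powr of_real r) \<le> C * norm b powr r
      \<and> norm (b powr of_real r - d powr of_real r) \<le> C * norm b powr (r - 1) * norm (b - d)"
    if b: "0 < Re b" and d: "0 < Re d" and cd: "c * norm b \<le> norm d" "norm d \<le> norm b" for b d :: complex
  proof -
    have b0: "0 < norm b" using b by auto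
    have "norm d powr r \<le> C1 * norm b powr r"
    proof (cases "0 \<le> r")
      case True
      then have "norm d powr r \<le> norm b powr r" using cd(2) by (intro powr_mono2) auto
      also have "\<dots> \<le> C1 * norm b powr r" using mult_right_mono[OF C(1), of "norm b powr r"] by simp
      finally show ?thesis .
    next
      case False
      then have "norm d powr r \<le> (c * norm b) powr r" using cd(1) b0 assms by (intro powr_mono2') auto
      also have "\<dots> = c powr r * norm b powr r" using assms b0 by (simp add: powr_mult)
      also have "\<dots> \<le> C1 * norm b powr r" by (intro mult_right_mono) (auto simp: C1_def)
      finally show ?thesis .
    qed
    note dr = this
    have "norm (b powr of_real r - d powr of_real r) \<le> C * norm b powr (r - 1) * norm (b - d)"
    proof (cases "norm (b - d) \<le> norm b / 2")
      case True
      \<comment> \<open>The ball keeps points at modulus at least |b|/2, the half plane keeps them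
        off the branch cut, and the intersection remains convex.\<close>
      define S where "S = {z. 0 < Re z} \<inter> cball b (norm b / 2)"
      have "norm (b powr of_real r - d powr of_real r) \<le> (\<bar>r\<bar> * (norm b / 2) powr (r - 1)) * norm (b - d)"
      proof (rule field_differentiable_bound[where S=S])
        show "convex S" unfolding S_def by (intro convex_Int convex_halfspace_Re_gt convex_cball)
        show "b \<in> S" "d \<in> S" using b d True b0 by (auto simp: S_def dist_norm)
        fix z assume z: "z \<in> S"
        then have zz: "z \<notin> \<real>\<^sub>\<le>\<^sub>0" using not_nonpos_Reals_if_Re_gt[of 0 z] by (simp add: S_def)
        have "((\<lambda>w. w powr of_real r) has_field_derivative of_real r * z powr (of_real r - 1)) (at z)"
          by (rule has_field_derivative_powr[OF zz])
        then show "((\<lambda>w. w powr of_real r) has_field_derivative of_real r * z powr of_real (r - 1)) (at z within S)"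
          by (simp add: has_field_derivative_at_within)
        have "norm b \<le> norm z + norm (b - z)" using norm_triangle_ineq[of z "b - z"] by simp
        then have "norm b / 2 \<le> norm z" using z by (simp add: S_def dist_norm)
        then have "norm z powr (r - 1) \<le> (norm b / 2) powr (r - 1)"
          using b0 assms by (intro powr_mono2') auto
        then show "norm (of_real r * z powr of_real (r - 1)) \<le> \<bar>r\<bar> * (norm b / 2) powr (r - 1)"
          by (simp add: norm_mult norm_powr_of_real mult_left_mono del: of_real_diff)
      qed
      also have "(norm b / 2) powr (r - 1) = (1/2) powr (r - 1) * norm b powr (r - 1)"
        using b0 powr_mult[of "1/2" "norm b" "r - 1"] by (simp add: mult.commute)
      also have "\<bar>r\<bar> * ((1/2) powr (r - 1) * norm b powr (r - 1)) * norm (b - d)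
          = \<bar>r\<bar> * (1/2) powr (r - 1) * (norm b powr (r - 1) * norm (b - d))" by simp
      also have "\<dots> \<le> C * (norm b powr (r - 1) * norm (b - d))"
        by (intro mult_right_mono C) auto
      finally show ?thesis by (simp add: mult.assoc)
    next
      case False
      \<comment> \<open>The points are further apart than |b|/2: the two powers are estimated
        separately and one factor |b| is traded for 2 |b - d|.\<close>
      have "norm (b powr of_real r - d powr of_real r) \<le> norm b powr r + norm d powr r"
        using norm_triangle_ineq4[of "b powr of_real r" "d powr of_real r"] by (simp add: norm_powr_of_real)
      also have "\<dots> \<le> (1 + C1) * norm b powr r" using dr by (simp add: distrib_right)
      also have "norm b powr r = norm b powr (r - 1) * norm b"
        using b0 powr_add[of "norm b" "r - 1" 1] by simp
      also have "(1 + C1) * (norm b powr (r - 1) * norm b) \<le> (1 + C1) * (norm b powr (r - 1) * (2 * norm (b - d)))"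
        using False C by (intro mult_left_mono) auto
      also have "\<dots> = 2 * (1 + C1) * (norm b powr (r - 1) * norm (b - d))" by simp
      also have "\<dots> \<le> C * (norm b powr (r - 1) * norm (b - d))" by (intro mult_right_mono C) auto
      finally show ?thesis by (simp add: mult.assoc)
    qed
    moreover have "C1 * norm b powr r \<le> C * norm b powr r" using C by (intro mult_right_mono) auto
    ultimately show ?thesis using dr by (simp add: norm_powr_of_real)
  qed
  then show ?thesis using C(5) by (intro exI[of _ C]) blast
qed

lemma powr_of_real_deriv:
  fixes b :: complex
  assumes "b \<notin> \<real>\<^sub>\<le>\<^sub>0"
  shows "((\<lambda>b. b powr of_real r) has_field_derivative of_real r * b powr of_real (r - 1)) (at b)"
  using has_field_derivative_powr[OF assms, of "of_real r"] by simp

text \<open>(1 - \<zeta>) / \<tau> at \<zeta> = exp(-b \<tau>), the symbol of the backward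
  difference, which approximates \<open>b\<close> to first order in \<tau>.\<close>

definition diff_quot :: "real \<Rightarrow> complex \<Rightarrow> complex" where
  "diff_quot \<tau> b = (1 - exp (- (b * of_real \<tau>))) / of_real \<tau>"

context
  fixes \<alpha> :: real
begin

definition cF :: "complex \<Rightarrow> complex" where "cF b = b powr of_real \<alpha>"
definition cP0 :: "complex \<Rightarrow> complex" where "cP0 b = b powr of_real (\<alpha> - 1)"
definition cP1 :: "complex \<Rightarrow> complex" where "cP1 b = of_real (\<alpha> - 1) * b powr of_real (\<alpha> - 2)"
definition cP2 :: "complex \<Rightarrow> complex" where
  "cP2 b = of_real ((\<alpha> - 1) * (\<alpha> - 2)) * b powr of_real (\<alpha> - 3)"

definition dF :: "real \<Rightarrow> complex \<Rightarrow> complex" where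
  "dF \<tau> b = diff_quot \<tau> b powr of_real \<alpha>"
text \<open>The derivative of \<open>diff_quot\<close> is exp(-b \<tau>), so this is once more
  F'/\<alpha>. The extra exponential is also what the generating function of the initial term of the
  scheme produces; see \<open>dP0_via_dF\<close>.\<close>

definition dP0 :: "real \<Rightarrow> complex \<Rightarrow> complex" where
  "dP0 \<tau> b = diff_quot \<tau> b powr of_real (\<alpha> - 1) * exp (- (b * of_real \<tau>))"
definition dP1 :: "real \<Rightarrow> complex \<Rightarrow> complex" where
  "dP1 \<tau> b = of_real (\<alpha> - 1) * (diff_quot \<tau> b powr of_real (\<alpha> - 2) * exp (- (b * of_real \<tau>)) ^ 2)
     - of_real \<tau> * (diff_quot \<tau> b powr of_real (\<alpha> - 1) * exp (- (b * of_real \<tau>)))"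
definition dP2 :: "real \<Rightarrow> complex \<Rightarrow> complex" where
  "dP2 \<tau> b = of_real ((\<alpha> - 1) * (\<alpha> - 2)) * (diff_quot \<tau> b powr of_real (\<alpha> - 3) * exp (- (b * of_real \<tau>)) ^ 3)
     - of_real (3 * (\<alpha> - 1) * \<tau>) * (diff_quot \<tau> b powr of_real (\<alpha> - 2) * exp (- (b * of_real \<tau>)) ^ 2)
     + of_real (\<tau>\<^sup>2) * (diff_quot \<tau> b powr of_real (\<alpha> - 1) * exp (- (b * of_real \<tau>)))"

end

section \<open>Derivatives and size of the continuous and the discrete symbol\<close>

lemma continuous_symbol_derivs:
  assumes "b \<notin> \<real>\<^sub>\<le>\<^sub>0"
  shows "(cF \<alpha> has_field_derivative of_real \<alpha> * cP0 \<alpha> b) (at b)"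
    "(cP0 \<alpha> has_field_derivative cP1 \<alpha> b) (at b)"
    "(cP1 \<alpha> has_field_derivative cP2 \<alpha> b) (at b)"
proof -
  show "(cF \<alpha> has_field_derivative of_real \<alpha> * cP0 \<alpha> b) (at b)"
    unfolding cF_def[abs_def] cP0_def by (rule powr_of_real_deriv[OF assms])
  show "(cP0 \<alpha> has_field_derivative cP1 \<alpha> b) (at b)"
    using powr_of_real_deriv[OF assms, of "\<alpha> - 1"] unfolding cP0_def[abs_def] cP1_def by simp
  have "((\<lambda>b. of_real (\<alpha> - 1) * b powr of_real (\<alpha> - 2)) has_field_derivative
      of_real (\<alpha> - 1) * (of_real (\<alpha> - 2) * b powr of_real (\<alpha> - 2 - 1))) (at b)"
    by (rule DERIV_cmult[OF powr_of_real_deriv[OF assms]])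
  then show "(cP1 \<alpha> has_field_derivative cP2 \<alpha> b) (at b)"
    unfolding cP1_def[abs_def] cP2_def by (simp add: mult.assoc)
qed

lemma diff_quot_Re_pos:
  assumes "0 < \<tau>" "0 < Re b"
  shows "0 < Re (diff_quot \<tau> b)"
proof -
  have "norm (exp (- (b * of_real \<tau>))) < 1" using assms by simp
  then have "Re (exp (- (b * of_real \<tau>))) < 1" using complex_Re_le_cmod[of "exp (- (b * of_real \<tau>))"] by linarith
  then show ?thesis using assms by (simp add: diff_quot_def)
qed

lemma diff_quot_deriv:
  assumes "0 < \<tau>"
  shows "(diff_quot \<tau> has_field_derivative exp (- (b * of_real \<tau>))) (at b)"
  unfolding diff_quot_def[abs_def] using assms by (auto intro!: derivative_eq_intros)

lemma discrete_symbol_derivs: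
  assumes \<tau>: "0 < \<tau>" and b: "0 < Re b"
  shows "(dF \<alpha> \<tau> has_field_derivative of_real \<alpha> * dP0 \<alpha> \<tau> b) (at b)"
    "(dP0 \<alpha> \<tau> has_field_derivative dP1 \<alpha> \<tau> b) (at b)"
    "(dP1 \<alpha> \<tau> has_field_derivative dP2 \<alpha> \<tau> b) (at b)"
proof -
  have nz: "diff_quot \<tau> b \<notin> \<real>\<^sub>\<le>\<^sub>0" using diff_quot_Re_pos[OF assms] by (auto simp: complex_nonpos_Reals_iff)
  have d [derivative_intros]: "((\<lambda>b. diff_quot \<tau> b powr of_real r) has_field_derivative
      of_real r * diff_quot \<tau> b powr of_real (r - 1) * exp (- (b * of_real \<tau>))) (at b)" for r
    by (rule DERIV_chain2[OF powr_of_real_deriv[OF nz] diff_quot_deriv[OF \<tau>]])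
  have e [derivative_intros]: "((\<lambda>b. exp (- (b * of_real \<tau>))) has_field_derivative - of_real \<tau> * exp (- (b * of_real \<tau>))) (at b)"
    by (auto intro!: derivative_eq_intros)
  show "(dF \<alpha> \<tau> has_field_derivative of_real \<alpha> * dP0 \<alpha> \<tau> b) (at b)"
    unfolding dF_def[abs_def] dP0_def using d[of \<alpha>] by (simp add: mult.assoc)
  show "(dP0 \<alpha> \<tau> has_field_derivative dP1 \<alpha> \<tau> b) (at b)"
    unfolding dP0_def[abs_def]
    by (rule derivative_eq_intros refl)+ (simp add: dP1_def algebra_simps power2_eq_square)
  show "(dP1 \<alpha> \<tau> has_field_derivative dP2 \<alpha> \<tau> b) (at b)"
    unfolding dP1_def[abs_def]
    by (rule derivative_eq_intros refl)+ (simp add: dP2_def algebra_simps power2_eq_square power3_eq_cube)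
qed

lemma norm_mult_le': "norm x \<le> a \<Longrightarrow> norm y \<le> b \<Longrightarrow> norm (x * y) \<le> a * b" for x y :: complex
  by (simp add: norm_mult mult_mono')

text \<open>With d = diff_quot \<tau> b, the conditions give c |b| \<le> |d| \<le> |b| and |b - d|
  \<le> \<tau> |b|^2. Powers of d are thus comparable to those of b and differ from them by a
  relative error \<tau> |b|; the exponential factors cost another \<tau> |b| each.\<close>

lemma discrete_symbol_bounds:
  assumes \<alpha>: "0 < \<alpha>" "\<alpha> < 1" and L: "1 \<le> L"
  shows "\<exists>M\<ge>1. \<forall>\<tau> b. 0 < \<tau> \<longrightarrow> 0 < Re b \<longrightarrow> Re b * \<tau> \<le> L \<longrightarrow> \<bar>Im b\<bar> * \<tau> \<le> L \<longrightarrow>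
      (1 \<le> Re b * \<tau> \<or> \<bar>Im b\<bar> * \<tau> \<le> 3 * pi / 2) \<longrightarrow>
      norm b powr \<alpha> / M \<le> Re (dF \<alpha> \<tau> b) \<and>
      norm (dP0 \<alpha> \<tau> b) \<le> M * norm b powr \<alpha> / norm b \<and>
      norm (dP1 \<alpha> \<tau> b) \<le> M * norm b powr \<alpha> / norm b ^ 2 \<and>
      norm (dP2 \<alpha> \<tau> b) \<le> M * norm b powr \<alpha> / norm b ^ 3 \<and>
      norm (cF \<alpha> b - dF \<alpha> \<tau> b) \<le> M * \<tau> * norm b powr \<alpha> * norm b \<and>
      norm (cP0 \<alpha> b - dP0 \<alpha> \<tau> b) \<le> M * \<tau> * norm b powr \<alpha> \<and>
      norm (cP1 \<alpha> b - dP1 \<alpha> \<tau> b) \<le> M * \<tau> * norm b powr \<alpha> / norm b \<and>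
      norm (cP2 \<alpha> b - dP2 \<alpha> \<tau> b) \<le> M * \<tau> * norm b powr \<alpha> / norm b ^ 2"
proof -
  obtain c where c: "0 < c" "c \<le> 1" and lower: "\<And>s. 0 \<le> Re s \<Longrightarrow> Re s \<le> L \<Longrightarrow> \<bar>Im s\<bar> \<le> L \<Longrightarrow>
      1 \<le> Re s \<or> \<bar>Im s\<bar> \<le> 3 * pi / 2 \<Longrightarrow> c * norm s \<le> norm (1 - exp (- s))"
    using exp_neg_lower_bound[OF L] by blast
  define P where "P r C \<longleftrightarrow> 1 \<le> C \<and> (\<forall>b d :: complex. 0 < Re b \<longrightarrow> 0 < Re d \<longrightarrow> c * norm b \<le> norm d \<longrightarrow>
      norm d \<le> norm b \<longrightarrow> norm (d powr of_real r) \<le> C * norm b powr r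
      \<and> norm (b powr of_real r - d powr of_real r) \<le> C * norm b powr (r - 1) * norm (b - d))" for r C
  have "\<exists>C. P r C" if "r \<le> 1" for r unfolding P_def using powr_diff_bound[OF c that] by blast
  then obtain Cf where P: "\<And>r. r \<le> 1 \<Longrightarrow> P r (Cf r)" by metis
  have Cf: "\<And>r. r \<le> 1 \<Longrightarrow> 1 \<le> Cf r"
    "\<And>r b d :: complex. r \<le> 1 \<Longrightarrow> 0 < Re b \<Longrightarrow> 0 < Re d \<Longrightarrow> c * norm b \<le> norm d \<Longrightarrow> norm d \<le> norm b
      \<Longrightarrow> norm (d powr of_real r) \<le> Cf r * norm b powr r"
    "\<And>r b d :: complex. r \<le> 1 \<Longrightarrow> 0 < Re b \<Longrightarrow> 0 < Re d \<Longrightarrow> c * norm b \<le> norm d \<Longrightarrow> norm d \<le> norm b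
      \<Longrightarrow> norm (b powr of_real r - d powr of_real r) \<le> Cf r * norm b powr (r - 1) * norm (b - d)"
    using P unfolding P_def by blast+
  \<comment> \<open>One constant for the exponents \<alpha> - k with k = 0, 1, 2, 3.\<close>
  define C where "C = Cf \<alpha> + Cf (\<alpha> - 1) + Cf (\<alpha> - 2) + Cf (\<alpha> - 3)"
  have C: "Cf \<alpha> \<le> C" "Cf (\<alpha> - 1) \<le> C" "Cf (\<alpha> - 2) \<le> C" "Cf (\<alpha> - 3) \<le> C" "1 \<le> C"
    using Cf(1)[of \<alpha>] Cf(1)[of "\<alpha> - 1"] Cf(1)[of "\<alpha> - 2"] Cf(1)[of "\<alpha> - 3"] \<alpha> by (auto simp: C_def)
  define w where "w = cos (\<alpha> * (pi / 2))"
  have w: "0 < w" unfolding w_def by (rule cos_gt_zero) (use \<alpha> in auto)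
  \<comment> \<open>The polynomial in \<open>L\<close> dominates all polynomials in \<tau> |b| \<le>
    2 L met below, the largest being 2 + 3 y + y^2 and 11 + y; the last summand serves the lower
    bound of the real part.\<close>
  define M where "M = C * (13 + 8 * L + 4 * L\<^sup>2) + 1 / (w * c)"
  have CM: "C * (13 + 8 * L + 4 * L\<^sup>2) \<le> M" using w c by (simp add: M_def)
  have "1 * (13 + 8 * L + 4 * L\<^sup>2) \<le> C * (13 + 8 * L + 4 * L\<^sup>2)" using C L by (intro mult_right_mono) auto
  moreover have "1 \<le> 1 * (13 + 8 * L + 4 * L\<^sup>2)" using L by (simp add: add_nonneg_nonneg add_increasing2)
  ultimately have M1: "1 \<le> M" using CM by (rule_tac order_trans[OF order_trans])
  have wM: "1 / M \<le> w * c"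
  proof -
    have "0 \<le> C * (13 + 8 * L + 4 * L\<^sup>2)" using C L by (intro mult_nonneg_nonneg) auto
    then have "1 / (w * c) \<le> M" by (simp add: M_def)
    then show ?thesis using w c M1 by (simp add: field_simps)
  qed
  have main: "norm b powr \<alpha> / M \<le> Re (dF \<alpha> \<tau> b) \<and>
      norm (dP0 \<alpha> \<tau> b) \<le> M * norm b powr \<alpha> / norm b \<and>
      norm (dP1 \<alpha> \<tau> b) \<le> M * norm b powr \<alpha> / norm b ^ 2 \<and>
      norm (dP2 \<alpha> \<tau> b) \<le> M * norm b powr \<alpha> / norm b ^ 3 \<and>
      norm (cF \<alpha> b - dF \<alpha> \<tau> b) \<le> M * \<tau> * norm b powr \<alpha> * norm b \<and>
      norm (cP0 \<alpha> b - dP0 \<alpha> \<tau> b) \<le> M * \<tau> * norm b powr \<alpha> \<and>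
      norm (cP1 \<alpha> b - dP1 \<alpha> \<tau> b) \<le> M * \<tau> * norm b powr \<alpha> / norm b \<and>
      norm (cP2 \<alpha> b - dP2 \<alpha> \<tau> b) \<le> M * \<tau> * norm b powr \<alpha> / norm b ^ 2"
    if \<tau>: "0 < \<tau>" and b: "0 < Re b" and bL: "Re b * \<tau> \<le> L" "\<bar>Im b\<bar> * \<tau> \<le> L"
      "1 \<le> Re b * \<tau> \<or> \<bar>Im b\<bar> * \<tau> \<le> 3 * pi / 2" for \<tau> b
  proof -
    define s where "s = b * of_real \<tau>"
    define d where "d = diff_quot \<tau> b"
    define E where "E = exp (- s)"
    define A B where "A = norm b powr \<alpha>" and "B = norm b"
    \<comment> \<open>Boundedness of this quantity allows surplus factors \<tau> |b| to be absorbed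
      into the constant.\<close>
    define y where "y = \<tau> * B"
    have B: "0 < B" using b by (auto simp: B_def)
    have A: "0 < A" using B by (simp add: A_def B_def)
    have Re_s: "Re s = Re b * \<tau>" "\<bar>Im s\<bar> = \<bar>Im b\<bar> * \<tau>" "0 \<le> Re s" using \<tau> b by (auto simp: s_def abs_mult)
    have ns: "norm s = y" using \<tau> by (simp add: s_def y_def B_def norm_mult)
    have yL: "y \<le> 2 * L" using cmod_le[of s] Re_s bL ns by simp
    have y0: "0 \<le> y" using \<tau> B by (simp add: y_def)
    have dE: "d = (1 - E) / of_real \<tau>" by (simp add: d_def diff_quot_def E_def s_def)
    have nd: "norm d = norm (1 - E) / \<tau>" using \<tau> by (simp add: dE norm_divide)
    have Rd: "0 < Re d" unfolding d_def by (rule diff_quot_Re_pos[OF \<tau> b])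
    have "c * y \<le> norm (1 - E)" using lower[of s] Re_s bL ns by (simp add: E_def)
    then have cd: "c * norm b \<le> norm d" using \<tau> by (simp add: nd y_def B_def pos_le_divide_eq mult_ac)
    have "norm (1 - E) \<le> y" using exp_neg_bounds(1)[OF Re_s(3)] ns by (simp add: E_def)
    note E1 = this
    then have db: "norm d \<le> norm b" using \<tau> by (simp add: nd y_def B_def pos_divide_le_eq mult_ac)
    have "b - d = - ((1 - E - s) / of_real \<tau>)" using \<tau> by (simp add: dE s_def field_simps)
    then have "norm (b - d) = norm (1 - E - s) / \<tau>" using \<tau> by (simp add: norm_divide)
    also have "\<dots> \<le> y\<^sup>2 / \<tau>" using exp_neg_bounds(2)[OF Re_s(3)] \<tau> ns by (intro divide_right_mono) (auto simp: E_def)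
    also have "\<dots> = \<tau> * B\<^sup>2" using \<tau> by (simp add: y_def power2_eq_square)
    finally have bd: "norm (b - d) \<le> \<tau> * B\<^sup>2" .
    have nE: "norm E \<le> 1" using Re_s(3) by (simp add: E_def)
    have nE': "norm (E ^ j) \<le> 1" for j using power_mono[OF nE norm_ge_zero, of j] by (simp add: norm_power)
    have E2: "norm (1 - E ^ 2) \<le> 2 * y"
    proof -
      have "norm (1 + E) \<le> 2" using norm_triangle_ineq[of 1 E] nE by simp
      then have "norm ((1 + E) * (1 - E)) \<le> 2 * y" by (rule norm_mult_le'[OF _ E1])
      then show ?thesis by (simp add: power2_eq_square algebra_simps)
    qed
    have E3: "norm (1 - E ^ 3) \<le> 3 * y"
    proof -
      have "norm (1 + E + E ^ 2) \<le> 3"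
        using norm_triangle_ineq[of "1 + E" "E ^ 2"] norm_triangle_ineq[of 1 E] nE nE'[of 2] by simp
      then have "norm ((1 + E + E ^ 2) * (1 - E)) \<le> 3 * y" by (rule norm_mult_le'[OF _ E1])
      then show ?thesis by (simp add: power2_eq_square power3_eq_cube algebra_simps)
    qed
    have pw: "norm b powr (\<alpha> - real k) = A / B ^ k" for k
      using B by (simp add: A_def B_def powr_diff powr_realpow)
    have D: "norm (d powr of_real (\<alpha> - real k)) \<le> C * (A / B ^ k)"
      and bD: "norm (b powr of_real (\<alpha> - real k) - d powr of_real (\<alpha> - real k)) \<le> C * \<tau> * (A * B / B ^ k)"
      if k: "k \<le> 3" for k
    proof -
      have r1: "\<alpha> - real k \<le> 1" using \<alpha> by simp
      have "k = 0 \<or> k = 1 \<or> k = 2 \<or> k = 3" using k by auto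
      then have CC: "Cf (\<alpha> - real k) \<le> C" using C by auto
      have "norm (d powr of_real (\<alpha> - real k)) \<le> Cf (\<alpha> - real k) * (A / B ^ k)"
        using Cf(2)[OF r1 b Rd cd db] unfolding pw .
      also have "\<dots> \<le> C * (A / B ^ k)" using CC A B by (intro mult_right_mono) auto
      finally show "norm (d powr of_real (\<alpha> - real k)) \<le> C * (A / B ^ k)" .
      have "norm b powr (\<alpha> - real k - 1) = A / B ^ k / B" using pw[of "Suc k"] by (simp add: algebra_simps)
      then have "norm (b powr of_real (\<alpha> - real k) - d powr of_real (\<alpha> - real k)) \<le> Cf (\<alpha> - real k) * (A / B ^ k / B) * norm (b - d)"
        using Cf(3)[OF r1 b Rd cd db] by simp
      also have "\<dots> \<le> C * (A / B ^ k / B) * (\<tau> * B\<^sup>2)"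
        using CC C A B bd by (intro mult_mono mult_right_mono) auto
      also have "\<dots> = C * \<tau> * (A * B / B ^ k)" using B by (simp add: power2_eq_square)
      finally show "norm (b powr of_real (\<alpha> - real k) - d powr of_real (\<alpha> - real k)) \<le> C * \<tau> * (A * B / B ^ k)" .
    qed
    define D1 D2 D3 where "D1 = d powr of_real (\<alpha> - 1)" and "D2 = d powr of_real (\<alpha> - 2)" and "D3 = d powr of_real (\<alpha> - 3)"
    define b1 b2 b3 where "b1 = b powr of_real (\<alpha> - 1)" and "b2 = b powr of_real (\<alpha> - 2)" and "b3 = b powr of_real (\<alpha> - 3)"
    have nD: "norm D1 \<le> C * (A / B)" "norm D2 \<le> C * (A / B ^ 2)" "norm D3 \<le> C * (A / B ^ 3)"
      using D[of 1] D[of 2] D[of 3] by (simp_all add: D1_def D2_def D3_def)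
    have nb: "norm (b1 - D1) \<le> C * \<tau> * A" "norm (b2 - D2) \<le> C * \<tau> * (A / B)" "norm (b3 - D3) \<le> C * \<tau> * (A / B ^ 2)"
      using bD[of 1] bD[of 2] bD[of 3] B
      by (simp_all add: D1_def D2_def D3_def b1_def b2_def b3_def power2_eq_square power3_eq_cube)
    have a1: "norm (complex_of_real (\<alpha> - 1)) \<le> 1" "norm (complex_of_real ((\<alpha> - 1) * (\<alpha> - 2))) \<le> 2"
    proof -
      show "norm (complex_of_real (\<alpha> - 1)) \<le> 1" unfolding norm_of_real using \<alpha> by simp
      have "\<bar>\<alpha> - 1\<bar> * \<bar>\<alpha> - 2\<bar> \<le> 1 * 2" using \<alpha> by (intro mult_mono) auto
      then show "norm (complex_of_real ((\<alpha> - 1) * (\<alpha> - 2))) \<le> 2" unfolding norm_of_real abs_mult by simp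
    qed
    have a3: "norm (complex_of_real (3 * (\<alpha> - 1) * \<tau>)) \<le> 3 * \<tau>"
      unfolding norm_of_real abs_mult using \<alpha> \<tau> by (simp add: mult_left_le_one_le)
    have t1: "norm (complex_of_real \<tau>) \<le> \<tau>" "norm (complex_of_real (\<tau>\<^sup>2)) \<le> \<tau>\<^sup>2"
      unfolding norm_of_real using \<tau> by auto
    have DE: "norm (D1 * E) \<le> C * (A / B)" "norm (D2 * E ^ 2) \<le> C * (A / B ^ 2)" "norm (D3 * E ^ 3) \<le> C * (A / B ^ 3)"
      using norm_mult_le'[OF nD(1) nE] norm_mult_le'[OF nD(2) nE'[of 2]] norm_mult_le'[OF nD(3) nE'[of 3]] by simp_all
    have Q0: "dP0 \<alpha> \<tau> b = D1 * E" by (simp add: dP0_def D1_def d_def E_def s_def)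
    have Q1: "dP1 \<alpha> \<tau> b = of_real (\<alpha> - 1) * (D2 * E ^ 2) - of_real \<tau> * (D1 * E)"
      by (simp add: dP1_def D1_def D2_def d_def E_def s_def)
    have Q2: "dP2 \<alpha> \<tau> b = of_real ((\<alpha> - 1) * (\<alpha> - 2)) * (D3 * E ^ 3)
        - of_real (3 * (\<alpha> - 1) * \<tau>) * (D2 * E ^ 2) + of_real (\<tau>\<^sup>2) * (D1 * E)"
      by (simp add: dP2_def D1_def D2_def D3_def d_def E_def s_def)
    have le_M: "C * x \<le> M" if "x \<le> 13 + 8 * L + 4 * L\<^sup>2" for x
      using mult_left_mono[OF that, of C] C CM by linarith
    have y2: "y\<^sup>2 \<le> 4 * L\<^sup>2" using power_mono[OF yL y0, of 2] by (simp add: power_mult_distrib)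
    have L2: "0 \<le> L\<^sup>2" by simp
    have r1: "A / M \<le> Re (dF \<alpha> \<tau> b)"
    proof -
      have "A / M = A * (1 / M)" by simp
      also have "\<dots> \<le> A * (w * c)" using wM A by (intro mult_left_mono) auto
      also have "\<dots> = w * (c * A)" by simp
      also have "\<dots> \<le> w * norm d powr \<alpha>"
      proof (intro mult_left_mono)
        \<comment> \<open>Since c \<le> 1 and \<alpha> < 1, the power c^\<alpha> is at least
          c.\<close>
        have "c powr 1 \<le> c powr \<alpha>" using c \<alpha> by (intro powr_mono') auto
        then have "c * A \<le> c powr \<alpha> * A" using A c by (intro mult_right_mono) auto
        also have "\<dots> = (c * norm b) powr \<alpha>" using c by (simp add: A_def powr_mult)
        also have "\<dots> \<le> norm d powr \<alpha>" using cd c \<alpha> by (intro powr_mono2) auto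
        finally show "c * A \<le> norm d powr \<alpha>" .
      qed (use w in simp)
      also have "\<dots> \<le> Re (d powr of_real \<alpha>)"
        using Re_powr_lower_bound[of 0 d \<alpha>] Rd \<alpha> by (simp add: w_def mult_left_le)
      finally show ?thesis by (simp add: dF_def d_def)
    qed
    have r2: "norm (dP0 \<alpha> \<tau> b) \<le> M * A / B"
    proof -
      have "norm (dP0 \<alpha> \<tau> b) \<le> C * 1 * (A / B)" using DE(1) by (simp add: Q0)
      also have "\<dots> \<le> M * (A / B)" using le_M[of 1] A B L by (intro mult_right_mono) auto
      finally show ?thesis by simp
    qed
    have r3: "norm (dP1 \<alpha> \<tau> b) \<le> M * A / B ^ 2"
    proof -
      have "norm (dP1 \<alpha> \<tau> b) \<le> 1 * (C * (A / B ^ 2)) + \<tau> * (C * (A / B))"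
        unfolding Q1 by (intro order_trans[OF norm_triangle_ineq4] add_mono norm_mult_le' a1 t1 DE)
      also have "\<dots> = C * (1 + y) * (A / B ^ 2)" using B by (simp add: y_def power2_eq_square field_simps)
      also have "1 + y \<le> 13 + 8 * L + 4 * L\<^sup>2" using yL L L2 by linarith
      then have "C * (1 + y) * (A / B ^ 2) \<le> M * (A / B ^ 2)" using A B by (intro mult_right_mono le_M) auto
      finally show ?thesis by simp
    qed
    have r4: "norm (dP2 \<alpha> \<tau> b) \<le> M * A / B ^ 3"
    proof -
      have "norm (dP2 \<alpha> \<tau> b) \<le> 2 * (C * (A / B ^ 3)) + 3 * \<tau> * (C * (A / B ^ 2)) + \<tau>\<^sup>2 * (C * (A / B))"
        unfolding Q2 by (intro order_trans[OF norm_triangle_ineq] order_trans[OF norm_triangle_ineq4] add_mono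
          norm_mult_le' a1 a3 t1 DE)
      also have "\<dots> = C * (2 + 3 * y + y\<^sup>2) * (A / B ^ 3)"
        using B by (simp add: y_def power2_eq_square power3_eq_cube field_simps)
      also have "\<dots> \<le> M * (A / B ^ 3)" using yL y2 L A B by (intro mult_right_mono le_M) auto
      finally show ?thesis by simp
    qed
    have r5: "norm (cF \<alpha> b - dF \<alpha> \<tau> b) \<le> M * \<tau> * A * B"
    proof -
      have "norm (cF \<alpha> b - dF \<alpha> \<tau> b) \<le> C * 1 * (\<tau> * A * B)" using bD[of 0] by (simp add: cF_def dF_def d_def mult_ac)
      also have "\<dots> \<le> M * (\<tau> * A * B)" using L A B \<tau> by (intro mult_right_mono le_M) auto
      finally show ?thesis by (simp add: mult_ac)
    qed
    have r6: "norm (cP0 \<alpha> b - dP0 \<alpha> \<tau> b) \<le> M * \<tau> * A"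
    proof -
      \<comment> \<open>The error of the power is separated from the error of replacing the factor
        \<open>E\<close> by one; the two derivatives are split in the same way.\<close>
      have "cP0 \<alpha> b - dP0 \<alpha> \<tau> b = (b1 - D1) + D1 * (1 - E)" by (simp add: cP0_def Q0 b1_def algebra_simps)
      then have "norm (cP0 \<alpha> b - dP0 \<alpha> \<tau> b) \<le> C * \<tau> * A + C * (A / B) * y"
        by (simp only:) (intro order_trans[OF norm_triangle_ineq] add_mono norm_mult_le' nD nb E1)
      also have "\<dots> = C * 2 * (\<tau> * A)" using B by (simp add: y_def)
      also have "\<dots> \<le> M * (\<tau> * A)" using L A B \<tau> by (intro mult_right_mono le_M) auto
      finally show ?thesis by (simp add: mult_ac)
    qed
    have r7: "norm (cP1 \<alpha> b - dP1 \<alpha> \<tau> b) \<le> M * \<tau> * A / B"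
    proof -
      have "cP1 \<alpha> b - dP1 \<alpha> \<tau> b = of_real (\<alpha> - 1) * ((b2 - D2) + D2 * (1 - E ^ 2)) + of_real \<tau> * (D1 * E)"
        unfolding Q1 by (simp add: cP1_def b2_def algebra_simps)
      then have "norm (cP1 \<alpha> b - dP1 \<alpha> \<tau> b) \<le> 1 * (C * \<tau> * (A / B) + C * (A / B ^ 2) * (2 * y)) + \<tau> * (C * (A / B))"
        by (simp only:) (intro order_trans[OF norm_triangle_ineq] add_mono norm_mult_le' nD nb E2 a1 t1 DE)
      also have "\<dots> = C * 4 * (\<tau> * A / B)" using B by (simp add: y_def power2_eq_square)
      also have "\<dots> \<le> M * (\<tau> * A / B)" using L A B \<tau> by (intro mult_right_mono le_M) auto
      finally show ?thesis by (simp add: mult_ac)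
    qed
    have r8: "norm (cP2 \<alpha> b - dP2 \<alpha> \<tau> b) \<le> M * \<tau> * A / B ^ 2"
    proof -
      have "cP2 \<alpha> b - dP2 \<alpha> \<tau> b = of_real ((\<alpha> - 1) * (\<alpha> - 2)) * ((b3 - D3) + D3 * (1 - E ^ 3))
          + of_real (3 * (\<alpha> - 1) * \<tau>) * (D2 * E ^ 2) - of_real (\<tau>\<^sup>2) * (D1 * E)"
        unfolding Q2 by (simp add: cP2_def b3_def algebra_simps)
      then have "norm (cP2 \<alpha> b - dP2 \<alpha> \<tau> b) \<le> 2 * (C * \<tau> * (A / B ^ 2) + C * (A / B ^ 3) * (3 * y))
          + 3 * \<tau> * (C * (A / B ^ 2)) + \<tau>\<^sup>2 * (C * (A / B))"
        by (simp only:) (intro order_trans[OF norm_triangle_ineq] order_trans[OF norm_triangle_ineq4] add_mono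
          norm_mult_le' nD nb E3 a1 a3 t1 DE)
      also have "\<dots> = C * (11 + y) * (\<tau> * A / B ^ 2)"
        using B by (simp add: y_def power2_eq_square power3_eq_cube field_simps)
      also have "11 + y \<le> 13 + 8 * L + 4 * L\<^sup>2" using yL L L2 by linarith
      then have "C * (11 + y) * (\<tau> * A / B ^ 2) \<le> M * (\<tau> * A / B ^ 2)"
        using A B \<tau> by (intro mult_right_mono le_M) auto
      finally show ?thesis by (simp add: mult_ac)
    qed
    show ?thesis using r1 r2 r3 r4 r5 r6 r7 r8 by (simp add: A_def B_def)
  qed
  then show ?thesis using M1 by blast
qed

text \<open>Translates bounds in terms of B = |z + u x| into bounds in terms of X = |z|; a factor 2
  arises for each integer power and one more for the power \<alpha>.\<close>

lemma scale_convert: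
  assumes "0 < X" "X / 2 \<le> B" "B \<le> 2 * X" "0 < \<alpha>" "\<alpha> < (1::real)"
  shows "B powr \<alpha> \<le> 2 * X powr \<alpha>" "X powr \<alpha> / 2 \<le> B powr \<alpha>" "B powr \<alpha> / B ^ k \<le> 2 ^ (k + 1) * (X powr \<alpha> / X ^ k)"
    "B powr \<alpha> * B \<le> 4 * (X powr \<alpha> * X)"
proof -
  have B: "0 < B" using assms by linarith
  have "B powr \<alpha> \<le> (2 * X) powr \<alpha>" using assms B by (intro powr_mono2) auto
  also have "\<dots> = 2 powr \<alpha> * X powr \<alpha>" using assms by (simp add: powr_mult)
  also have "\<dots> \<le> 2 powr 1 * X powr \<alpha>" using assms by (intro mult_right_mono powr_mono) auto
  finally show 1: "B powr \<alpha> \<le> 2 * X powr \<alpha>" by simp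
  have "X powr \<alpha> / 2 = (1/2) powr 1 * X powr \<alpha>" by simp
  also have "\<dots> \<le> (1/2) powr \<alpha> * X powr \<alpha>" using assms by (intro mult_right_mono powr_mono') auto
  also have "\<dots> = (X / 2) powr \<alpha>" using powr_mult[of "1/2" X \<alpha>] assms by simp
  also have "\<dots> \<le> B powr \<alpha>" using assms by (intro powr_mono2) auto
  finally show "X powr \<alpha> / 2 \<le> B powr \<alpha>" .
  have "(X / 2) ^ k \<le> B ^ k" using assms by (intro power_mono) auto
  then have "B powr \<alpha> / B ^ k \<le> (2 * X powr \<alpha>) / (X / 2) ^ k" using 1 assms by (intro frac_le) auto
  also have "\<dots> = 2 ^ (k + 1) * (X powr \<alpha> / X ^ k)" by (simp add: power_divide)
  finally show "B powr \<alpha> / B ^ k \<le> 2 ^ (k + 1) * (X powr \<alpha> / X ^ k)" .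
  have "B powr \<alpha> * B \<le> (2 * X powr \<alpha>) * (2 * X)" using 1 assms B by (intro mult_mono) auto
  then show "B powr \<alpha> * B \<le> 4 * (X powr \<alpha> * X)" by simp
qed

section \<open>The two concrete problems and their uniform bounds\<close>

locale fractional_problem = multiplier \<Omega> u K for \<Omega> :: "'a::euclidean_space set" and u K +
  fixes \<alpha> :: real
  assumes \<alpha>01: "0 < \<alpha>" "\<alpha> < 1"
begin

text \<open>The excess angle of the sector over the half plane. It leaves the gap \<pi>/4 (1 -
  \<alpha>)(2 - \<alpha>) between \<alpha> (\<pi>/2 + \<phi>) and \<pi>/2.\<close>

definition \<phi> :: real where "\<phi> = pi / 4 * (1 - \<alpha>)"

lemma \<phi>: "0 < \<phi>" "\<phi> < pi / 2" "\<alpha> * (pi / 2 + \<phi>) < pi / 2" "0 < sin \<phi>" "sin \<phi> < 1"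
proof -
  show 1: "0 < \<phi>" using \<alpha>01 by (simp add: \<phi>_def)
  have "pi / 4 * (1 - \<alpha>) < pi / 4 * 1" using \<alpha>01 by (intro mult_strict_left_mono) auto
  then show 2: "\<phi> < pi / 2" using pi_gt_zero unfolding \<phi>_def by linarith
  have "0 < pi / 4 * ((1 - \<alpha>) * (2 - \<alpha>))" using \<alpha>01 by (intro mult_pos_pos) auto
  also have "pi / 4 * ((1 - \<alpha>) * (2 - \<alpha>)) = pi / 2 - \<alpha> * (pi / 2 + \<phi>)" by (simp add: \<phi>_def field_simps)
  finally show "\<alpha> * (pi / 2 + \<phi>) < pi / 2" by simp
  show "0 < sin \<phi>" using 1 2 by (intro sin_gt_zero) auto
  have "sin \<phi> < sin (pi / 2)" using 1 2 by (subst sin_mono_less_eq) auto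
  then show "sin \<phi> < 1" by simp
qed

definition \<omega> :: real where "\<omega> = cos (\<alpha> * (pi / 2 + \<phi>))"

lemma \<omega>_pos: "0 < \<omega>"
  unfolding \<omega>_def by (rule cos_gt_zero) (use \<phi> \<alpha>01 in \<open>auto intro!: mult_pos_pos add_pos_pos\<close>)

text \<open>The points with |Arg b| < \<pi>/2 + \<phi>, written without the argument function so
  that openness and perturbation estimates are immediate.\<close>

definition sector :: "complex set" where "sector = {b. - sin \<phi> * norm b < Re b}"

lemma sector_D: "b \<in> sector \<Longrightarrow> b \<notin> \<real>\<^sub>\<le>\<^sub>0" "b \<in> sector \<Longrightarrow> b \<noteq> 0"
  using not_nonpos_Reals_if_Re_gt[of "sin \<phi>" b] \<phi>(5) by (auto simp: sector_def)

lemma sector_Re: "b \<in> sector \<Longrightarrow> \<omega> * norm b powr \<alpha> \<le> Re (cF \<alpha> b)"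
  unfolding cF_def \<omega>_def by (rule Re_powr_lower_bound) (use \<phi> \<alpha>01 in \<open>auto simp: sector_def\<close>)

sublocale symbol_problem \<Omega> u K \<alpha> sector "cF \<alpha>" "cP0 \<alpha>" "cP1 \<alpha>" "cP2 \<alpha>"
proof
  show "open sector" unfolding sector_def by (intro open_Collect_less continuous_intros)
  fix b assume b: "b \<in> sector"
  show "0 < Re (cF \<alpha> b)"
  proof -
    have "0 < \<omega> * norm b powr \<alpha>" using sector_D(2)[OF b] \<omega>_pos by simp
    then show ?thesis using sector_Re[OF b] by linarith
  qed
qed (use \<alpha>01 continuous_symbol_derivs sector_D in auto)

text \<open>Here |exp(-b \<tau>)| < 1, so \<open>diff_quot\<close> keeps a positive real part. The
  symbol of the scheme is used on this set, whereas the contour of the exact solution leaves it and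
  needs \<open>sector\<close>.\<close>

definition halfplane :: "complex set" where "halfplane = {b. 0 < Re b}"

lemma halfplane_sector: "halfplane \<subseteq> sector"
proof
  fix b assume "b \<in> halfplane"
  then have "0 < Re b" by (simp add: halfplane_def)
  moreover have "0 \<le> sin \<phi> * norm b" using \<phi>(4) by simp
  ultimately show "b \<in> sector" by (simp add: sector_def)
qed

text \<open>\<open>diff_quot\<close> maps the half plane into itself, so positivity of Re F is
  inherited from the continuous power.\<close>

lemma discrete_symbol_pair:
  assumes "0 < \<tau>"
  shows "symbol_pair \<Omega> u K \<alpha> sector (cF \<alpha>) (cP0 \<alpha>) (cP1 \<alpha>) (cP2 \<alpha>)
    halfplane (dF \<alpha> \<tau>) (dP0 \<alpha> \<tau>) (dP1 \<alpha> \<tau>) (dP2 \<alpha> \<tau>)"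
proof -
  interpret d: symbol_problem \<Omega> u K \<alpha> halfplane "dF \<alpha> \<tau>" "dP0 \<alpha> \<tau>" "dP1 \<alpha> \<tau>" "dP2 \<alpha> \<tau>"
  proof
    show "open halfplane" unfolding halfplane_def by (intro open_Collect_less continuous_intros)
    fix b assume "b \<in> halfplane"
    then have "0 < Re (diff_quot \<tau> b)" using diff_quot_Re_pos[OF assms] by (simp add: halfplane_def)
    then have s: "diff_quot \<tau> b \<in> halfplane" by (simp add: halfplane_def)
    show "0 < Re (dF \<alpha> \<tau> b)"
      using Re_F[of "diff_quot \<tau> b"] s halfplane_sector by (auto simp: dF_def cF_def)
  qed (use \<alpha>01 discrete_symbol_derivs[OF assms] in \<open>auto simp: halfplane_def\<close>)
  show ?thesis ..
qed

lemma shift_norm: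
  assumes "x \<in> \<Omega>" "2 * K \<le> norm z"
  shows "norm z / 2 \<le> norm (z + u x)" "norm (z + u x) \<le> 2 * norm z"
  using norm_triangle_ineq[of z "u x"] norm_triangle_ineq4[of "z + u x" "u x"] u_bound[OF assms(1)] assms(2) by auto

lemma continuous_symbol_bounds:
  "\<exists>M\<ge>1. \<forall>z. 0 < norm z \<longrightarrow> 2 * K \<le> norm z \<longrightarrow> cball z K \<subseteq> sector \<longrightarrow> (\<forall>x\<in>\<Omega>.
     norm z powr \<alpha> / M \<le> Re (cF \<alpha> (z + u x)) \<and>
     norm (cP0 \<alpha> (z + u x)) \<le> M * norm z powr \<alpha> / norm z \<and>
     norm (cP1 \<alpha> (z + u x)) \<le> M * norm z powr \<alpha> / norm z ^ 2 \<and>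
     norm (cP2 \<alpha> (z + u x)) \<le> M * norm z powr \<alpha> / norm z ^ 3)"
proof -
  \<comment> \<open>32 = 2 * 16, where 2 bounds |(\<alpha> - 1)(\<alpha> - 2)| and 16 comes from
    \<open>scale_convert\<close> with k = 3; 2/\<omega> serves the lower bound.\<close>
  define M where "M = 32 + 2 / \<omega>"
  have M: "32 \<le> M" "2 / \<omega> \<le> M" using \<omega>_pos by (auto simp: M_def)
  have main: "norm z powr \<alpha> / M \<le> Re (cF \<alpha> (z + u x)) \<and>
     norm (cP0 \<alpha> (z + u x)) \<le> M * norm z powr \<alpha> / norm z \<and>
     norm (cP1 \<alpha> (z + u x)) \<le> M * norm z powr \<alpha> / norm z ^ 2 \<and>
     norm (cP2 \<alpha> (z + u x)) \<le> M * norm z powr \<alpha> / norm z ^ 3"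
    if z: "0 < norm z" "2 * K \<le> norm z" "cball z K \<subseteq> sector" and x: "x \<in> \<Omega>" for z x
  proof -
    let ?b = "z + u x"
    define X Xa where "X = norm z" and "Xa = norm z powr \<alpha>"
    have X: "0 < X" "0 < Xa" using z by (auto simp: X_def Xa_def)
    note sc = scale_convert[OF z(1) shift_norm[OF x z(2)] \<alpha>01, folded X_def Xa_def]
    have bs: "?b \<in> sector" using shift_mem0[OF x] z(3) by blast
    have nb: "0 < norm ?b" using sector_D(2)[OF bs] by simp
    have pw: "norm ?b powr (\<alpha> - real k) = norm ?b powr \<alpha> / norm ?b ^ k" for k
      using nb by (simp add: powr_diff powr_realpow)
    have e: "norm ?b powr (\<alpha> - real k) \<le> 2 ^ (k + 1) * (Xa / X ^ k)" for k unfolding pw by (rule sc(3))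
    have "Xa / M \<le> \<omega> * norm ?b powr \<alpha>"
    proof -
      have "Xa / M \<le> Xa / (2 / \<omega>)" using M X \<omega>_pos by (intro divide_left_mono) auto
      also have "\<dots> = \<omega> * (Xa / 2)" by simp
      also have "\<dots> \<le> \<omega> * norm ?b powr \<alpha>" using sc(2) \<omega>_pos by (intro mult_left_mono) auto
      finally show ?thesis .
    qed
    then have 1: "Xa / M \<le> Re (cF \<alpha> ?b)" using sector_Re[OF bs] by linarith
    have "norm (cP0 \<alpha> ?b) \<le> 4 * (Xa / X)" using e[of 1] by (simp add: cP0_def norm_powr_of_real del: of_real_diff)
    also have "\<dots> \<le> M * (Xa / X)" using M X by (intro mult_right_mono) auto
    finally have 2: "norm (cP0 \<alpha> ?b) \<le> M * Xa / X" by simp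
    have "norm (cP1 \<alpha> ?b) = \<bar>\<alpha> - 1\<bar> * norm ?b powr (\<alpha> - 2)"
      by (simp only: cP1_def norm_mult norm_of_real norm_powr_of_real)
    also have "\<dots> \<le> 1 * (8 * (Xa / X ^ 2))" using e[of 2] \<alpha>01 by (intro mult_mono) auto
    also have "\<dots> \<le> M * (Xa / X ^ 2)" using M X mult_right_mono[of 8 M "Xa / X ^ 2"] by simp
    finally have 3: "norm (cP1 \<alpha> ?b) \<le> M * Xa / X ^ 2" by simp
    have "norm (cP2 \<alpha> ?b) = \<bar>\<alpha> - 1\<bar> * \<bar>\<alpha> - 2\<bar> * norm ?b powr (\<alpha> - 3)"
      by (simp only: cP2_def norm_mult norm_of_real norm_powr_of_real abs_mult)
    also have "\<dots> \<le> 1 * 2 * (16 * (Xa / X ^ 3))" using e[of 3] \<alpha>01 by (intro mult_mono) auto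
    also have "\<dots> \<le> M * (Xa / X ^ 3)" using M X mult_right_mono[of 32 M "Xa / X ^ 3"] by simp
    finally have 4: "norm (cP2 \<alpha> ?b) \<le> M * Xa / X ^ 3" by simp
    from 1 2 3 4 show ?thesis by (simp add: X_def Xa_def)
  qed
  then show ?thesis using M(1) by (intro exI[of _ M]) auto
qed

text \<open>The step size varies with the number of steps, so the discrete solutions carry it as an
  argument; interpreting \<open>symbol_pair\<close> inside a proof makes its theory apply to these
  terms.\<close>

abbreviation "dsol \<tau> \<equiv> symbol_problem.sol \<Omega> u (dF \<alpha> \<tau>) (dP0 \<alpha> \<tau>)"
abbreviation "dsol1 \<tau> \<equiv> symbol_problem.sol1 \<Omega> u \<alpha> (dF \<alpha> \<tau>) (dP0 \<alpha> \<tau>) (dP1 \<alpha> \<tau>)"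
abbreviation "dsol2 \<tau> \<equiv> symbol_problem.sol2 \<Omega> u \<alpha> (dF \<alpha> \<tau>) (dP0 \<alpha> \<tau>) (dP1 \<alpha> \<tau>) (dP2 \<alpha> \<tau>)"

lemma continuous_sol_bounds:
  "\<exists>C>0. \<forall>g\<in>L2 \<Omega>. \<forall>z. 0 < norm z \<longrightarrow> 2 * K \<le> norm z \<longrightarrow> cball z K \<subseteq> sector \<longrightarrow>
     L2_norm \<Omega> (sol g z) \<le> C / norm z * L2_norm \<Omega> g \<and>
     L2_norm \<Omega> (sol1 g z) \<le> C / norm z ^ 2 * L2_norm \<Omega> g \<and>
     L2_norm \<Omega> (sol2 g z) \<le> C / norm z ^ 3 * L2_norm \<Omega> g"
proof -
  obtain M where M: "1 \<le> M" "\<And>z x. 0 < norm z \<Longrightarrow> 2 * K \<le> norm z \<Longrightarrow> cball z K \<subseteq> sector \<Longrightarrow> x \<in> \<Omega> \<Longrightarrow>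
     norm z powr \<alpha> / M \<le> Re (cF \<alpha> (z + u x)) \<and>
     norm (cP0 \<alpha> (z + u x)) \<le> M * norm z powr \<alpha> / norm z \<and>
     norm (cP1 \<alpha> (z + u x)) \<le> M * norm z powr \<alpha> / norm z ^ 2 \<and>
     norm (cP2 \<alpha> (z + u x)) \<le> M * norm z powr \<alpha> / norm z ^ 3"
    using continuous_symbol_bounds by blast
  define C where "C = 6 * M ^ 6"
  have p: "M ^ 2 \<le> M ^ 6" "M ^ 4 \<le> M ^ 6" "0 < M ^ 6" "0 < M ^ 2" "0 < M ^ 4" using M(1) by (auto intro: power_increasing)
  have C: "M ^ 2 \<le> C" "2 * M ^ 4 \<le> C" "6 * M ^ 6 \<le> C" "0 < C" using p unfolding C_def by linarith+
  have "L2_norm \<Omega> (sol g z) \<le> C / norm z * L2_norm \<Omega> g \<and>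
     L2_norm \<Omega> (sol1 g z) \<le> C / norm z ^ 2 * L2_norm \<Omega> g \<and>
     L2_norm \<Omega> (sol2 g z) \<le> C / norm z ^ 3 * L2_norm \<Omega> g"
    if g: "g \<in> L2 \<Omega>" and z: "0 < norm z" "2 * K \<le> norm z" "cball z K \<subseteq> sector" for g z
  proof -
    have Xa: "0 < norm z powr \<alpha>" using z by simp
    note b = sol_bounds[OF g z(3,1) Xa M(1)]
    have "L2_norm \<Omega> (sol g z) \<le> M ^ 2 / norm z * L2_norm \<Omega> g"
      by (rule b(1)) (use M(2)[OF z] in auto)
    moreover have "L2_norm \<Omega> (sol1 g z) \<le> 2 * M ^ 4 / norm z ^ 2 * L2_norm \<Omega> g"
      by (rule b(2)) (use M(2)[OF z] in auto)
    moreover have "L2_norm \<Omega> (sol2 g z) \<le> 6 * M ^ 6 / norm z ^ 3 * L2_norm \<Omega> g"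
      by (rule b(3)) (use M(2)[OF z] in auto)
    moreover have "x / norm z ^ k * L2_norm \<Omega> g \<le> C / norm z ^ k * L2_norm \<Omega> g" if "x \<le> C" for x k
      using that by (intro mult_right_mono divide_right_mono) auto
    from this[OF C(1), of 1] this[OF C(2), of 2] this[OF C(3), of 3]
    have "M ^ 2 / norm z * L2_norm \<Omega> g \<le> C / norm z * L2_norm \<Omega> g"
      "2 * M ^ 4 / norm z ^ 2 * L2_norm \<Omega> g \<le> C / norm z ^ 2 * L2_norm \<Omega> g"
      "6 * M ^ 6 / norm z ^ 3 * L2_norm \<Omega> g \<le> C / norm z ^ 3 * L2_norm \<Omega> g" by simp_all
    ultimately show ?thesis by linarith
  qed
  then show ?thesis using C(4) by blast
qed

lemma cball_halfplane: "K < Re z \<Longrightarrow> cball z K \<subseteq> halfplane"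
proof
  fix b assume z: "K < Re z" and "b \<in> cball z K"
  then have "\<bar>Re (z - b)\<bar> \<le> K" using abs_Re_le_cmod[of "z - b"] by (simp add: dist_norm)
  then show "b \<in> halfplane" using z by (simp add: halfplane_def)
qed

text \<open>The main point is uniformity in \<tau> and t: on this line and strip, b = z + u x
  satisfies the conditions of \<open>discrete_symbol_bounds\<close> with a fixed
  \<open>L\<close>.\<close>

lemma discrete_error_bound:
  assumes T: "0 < T"
  shows "\<exists>C>0. \<forall>g\<in>L2 \<Omega>. \<forall>\<tau> t z. 0 < \<tau> \<longrightarrow> \<tau> \<le> t \<longrightarrow> t \<le> T \<longrightarrow> Re z = 2 * K + 1 + 1 / t \<longrightarrow> \<bar>Im z\<bar> \<le> pi / \<tau> \<longrightarrow>
     L2_norm \<Omega> (\<lambda>x. sol2 g z x - dsol2 \<tau> g z x) \<le> C * \<tau> / norm z ^ 2 * L2_norm \<Omega> g"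
proof -
  obtain M1 where M1: "1 \<le> M1" "\<And>z x. 0 < norm z \<Longrightarrow> 2 * K \<le> norm z \<Longrightarrow> cball z K \<subseteq> sector \<Longrightarrow> x \<in> \<Omega> \<Longrightarrow>
     norm z powr \<alpha> / M1 \<le> Re (cF \<alpha> (z + u x)) \<and>
     norm (cP0 \<alpha> (z + u x)) \<le> M1 * norm z powr \<alpha> / norm z \<and>
     norm (cP1 \<alpha> (z + u x)) \<le> M1 * norm z powr \<alpha> / norm z ^ 2 \<and>
     norm (cP2 \<alpha> (z + u x)) \<le> M1 * norm z powr \<alpha> / norm z ^ 3"
    using continuous_symbol_bounds by blast
  \<comment> \<open>Re b \<tau> is at most (3K + 1 + 1/t) \<tau> \<le> (3K + 1) T + 1, because
    \<tau> \<le> t \<le> T, and |Im b| \<tau> is at most \<pi> + K \<tau>.\<close>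
  define L where "L = (3 * K + 1) * T + 1 + pi"
  have L: "1 \<le> L" using K_nonneg T by (simp add: L_def add_increasing add_increasing2)
  obtain M2 where M2: "1 \<le> M2" "\<And>\<tau> b. 0 < \<tau> \<Longrightarrow> 0 < Re b \<Longrightarrow> Re b * \<tau> \<le> L \<Longrightarrow> \<bar>Im b\<bar> * \<tau> \<le> L \<Longrightarrow>
      (1 \<le> Re b * \<tau> \<or> \<bar>Im b\<bar> * \<tau> \<le> 3 * pi / 2) \<Longrightarrow>
      norm b powr \<alpha> / M2 \<le> Re (dF \<alpha> \<tau> b) \<and>
      norm (dP0 \<alpha> \<tau> b) \<le> M2 * norm b powr \<alpha> / norm b \<and>
      norm (dP1 \<alpha> \<tau> b) \<le> M2 * norm b powr \<alpha> / norm b ^ 2 \<and>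
      norm (dP2 \<alpha> \<tau> b) \<le> M2 * norm b powr \<alpha> / norm b ^ 3 \<and>
      norm (cF \<alpha> b - dF \<alpha> \<tau> b) \<le> M2 * \<tau> * norm b powr \<alpha> * norm b \<and>
      norm (cP0 \<alpha> b - dP0 \<alpha> \<tau> b) \<le> M2 * \<tau> * norm b powr \<alpha> \<and>
      norm (cP1 \<alpha> b - dP1 \<alpha> \<tau> b) \<le> M2 * \<tau> * norm b powr \<alpha> / norm b \<and>
      norm (cP2 \<alpha> b - dP2 \<alpha> \<tau> b) \<le> M2 * \<tau> * norm b powr \<alpha> / norm b ^ 2"
    using discrete_symbol_bounds[OF \<alpha>01 L] by blast
  \<comment> \<open>16 is the largest factor of \<open>scale_convert\<close> for k \<le> 3.\<close>
  define M where "M = M1 + 16 * M2"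
  have M: "1 \<le> M" "M1 \<le> M" "16 * M2 \<le> M" "2 * M2 \<le> M" using M1(1) M2(1) by (auto simp: M_def)
  have main: "L2_norm \<Omega> (\<lambda>x. sol2 g z x - dsol2 \<tau> g z x) \<le> 26 * M ^ 8 * \<tau> / norm z ^ 2 * L2_norm \<Omega> g"
    if g: "g \<in> L2 \<Omega>" and \<tau>: "0 < \<tau>" "\<tau> \<le> t" "t \<le> T" and z: "Re z = 2 * K + 1 + 1 / t" "\<bar>Im z\<bar> \<le> pi / \<tau>" for g \<tau> t z
  proof -
    interpret symbol_pair \<Omega> u K \<alpha> sector "cF \<alpha>" "cP0 \<alpha>" "cP1 \<alpha>" "cP2 \<alpha>"
      halfplane "dF \<alpha> \<tau>" "dP0 \<alpha> \<tau>" "dP1 \<alpha> \<tau>" "dP2 \<alpha> \<tau>"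
      by (rule discrete_symbol_pair[OF \<tau>(1)])
    have t: "0 < t" "0 < 1 / t" using \<tau> by auto
    have Kz: "K < Re z" "2 * K \<le> Re z" using z(1) K_nonneg t by linarith+
    have zh: "cball z K \<subseteq> halfplane" by (rule cball_halfplane[OF Kz(1)])
    then have zs: "cball z K \<subseteq> sector" using halfplane_sector by blast
    have nz: "0 < norm z" "2 * K \<le> norm z" using complex_Re_le_cmod[of z] Kz K_nonneg by linarith+
    define X Xa where "X = norm z" and "Xa = norm z powr \<alpha>"
    have X: "0 < X" "0 < Xa" using nz by (auto simp: X_def Xa_def)
    have c: "Xa / M \<le> Re (cF \<alpha> (z + u x)) \<and> norm (cP0 \<alpha> (z + u x)) \<le> M * Xa / X \<and>
        norm (cP1 \<alpha> (z + u x)) \<le> M * Xa / X ^ 2 \<and> norm (cP2 \<alpha> (z + u x)) \<le> M * Xa / X ^ 3" if x: "x \<in> \<Omega>" for x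
    proof -
      have "Xa / M \<le> Xa / M1" using M M1(1) X by (intro divide_left_mono) auto
      moreover have "M1 * Xa / X ^ k \<le> M * Xa / X ^ k" for k
        using M X by (intro divide_right_mono mult_right_mono) auto
      from this[of 1] this[of 2] this[of 3]
      have "M1 * Xa / X \<le> M * Xa / X" "M1 * Xa / X ^ 2 \<le> M * Xa / X ^ 2" "M1 * Xa / X ^ 3 \<le> M * Xa / X ^ 3" by simp_all
      ultimately show ?thesis using M1(2)[OF nz zs x, folded X_def Xa_def] by linarith
    qed
    have d: "Xa / M \<le> Re (dF \<alpha> \<tau> (z + u x)) \<and> norm (dP0 \<alpha> \<tau> (z + u x)) \<le> M * Xa / X \<and>
        norm (dP1 \<alpha> \<tau> (z + u x)) \<le> M * Xa / X ^ 2 \<and> norm (dP2 \<alpha> \<tau> (z + u x)) \<le> M * Xa / X ^ 3 \<and>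
        norm (cF \<alpha> (z + u x) - dF \<alpha> \<tau> (z + u x)) \<le> M * \<tau> * Xa * X \<and>
        norm (cP0 \<alpha> (z + u x) - dP0 \<alpha> \<tau> (z + u x)) \<le> M * \<tau> * Xa \<and>
        norm (cP1 \<alpha> (z + u x) - dP1 \<alpha> \<tau> (z + u x)) \<le> M * \<tau> * Xa / X \<and>
        norm (cP2 \<alpha> (z + u x) - dP2 \<alpha> \<tau> (z + u x)) \<le> M * \<tau> * Xa / X ^ 2" if x: "x \<in> \<Omega>" for x
    proof -
      let ?b = "z + u x"
      define B A where "B = norm ?b" and "A = norm ?b powr \<alpha>"
      note sc = scale_convert[OF nz(1) shift_norm[OF x nz(2)] \<alpha>01, folded X_def Xa_def B_def, folded A_def[folded B_def]]
      have ub: "\<bar>Re (u x)\<bar> \<le> K" "\<bar>Im (u x)\<bar> \<le> K"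
        using abs_Re_le_cmod[of "u x"] abs_Im_le_cmod[of "u x"] u_bound[OF x] by linarith+
      have Re_b: "Re ?b = Re z + Re (u x)" "Im ?b = Im z + Im (u x)" by simp_all
      have Re_ge: "K + 1 \<le> Re ?b" using ub(1) z(1) t Re_b by linarith
      have Re_le: "Re ?b \<le> 3 * K + 1 + 1 / t" using ub(1) z(1) Re_b by linarith
      have Im_le: "\<bar>Im ?b\<bar> \<le> pi / \<tau> + K" using ub(2) z(2) Re_b by linarith
      have tt: "\<tau> / t \<le> 1" using \<tau> t by simp
      have "Re ?b * \<tau> \<le> (3 * K + 1 + 1 / t) * \<tau>" using Re_le \<tau> by (intro mult_right_mono) auto
      also have "\<dots> = (3 * K + 1) * \<tau> + \<tau> / t" by (simp add: distrib_right)
      also have "\<dots> \<le> (3 * K + 1) * T + 1" using \<tau> tt K_nonneg by (intro add_mono mult_left_mono) auto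
      finally have 1: "Re ?b * \<tau> \<le> L" using pi_gt_zero unfolding L_def by linarith
      have "\<bar>Im ?b\<bar> * \<tau> \<le> (pi / \<tau> + K) * \<tau>" using Im_le \<tau> by (intro mult_right_mono) auto
      also have "\<dots> = pi + K * \<tau>" using \<tau> by (simp add: distrib_right)
      finally have 2: "\<bar>Im ?b\<bar> * \<tau> \<le> pi + K * \<tau>" .
      have "K * \<tau> \<le> (3 * K + 1) * T" using \<tau> K_nonneg by (intro mult_mono) auto
      then have 3: "\<bar>Im ?b\<bar> * \<tau> \<le> L" using 2 unfolding L_def by linarith
      \<comment> \<open>The shift by \<open>u x\<close> may move Im b \<tau> towards the zero 2
        \<pi> \<i> of 1 - exp(-s) only when K \<tau> is large, and then Re b \<tau> exceeds
        one.\<close>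
      have 4: "1 \<le> Re ?b * \<tau> \<or> \<bar>Im ?b\<bar> * \<tau> \<le> 3 * pi / 2"
      proof (cases "K * \<tau> \<le> pi / 2")
        case False
        have "K * \<tau> \<le> Re ?b * \<tau>" using Re_ge \<tau> by (intro mult_right_mono) auto
        then show ?thesis using False pi_gt3 by linarith
      qed (use 2 in linarith)
      have Rp: "0 < Re ?b" using Re_ge K_nonneg by linarith
      note m = M2(2)[OF \<tau>(1) Rp 1 3 4, folded A_def, folded B_def]
      have r1: "Xa / M \<le> A / M2"
      proof -
        have "Xa / M \<le> Xa / (2 * M2)" using M M2(1) X by (intro divide_left_mono) auto
        also have "\<dots> = (Xa / 2) / M2" by simp
        also have "\<dots> \<le> A / M2" using sc(2) M2(1) by (intro divide_right_mono) auto
        finally show ?thesis .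
      qed
      have r2: "M2 * A / B ^ k \<le> M * Xa / X ^ k" if "k \<le> 3" for k
      proof -
        have "(2::real) ^ (k + 1) \<le> 2 ^ 4" using that by (intro power_increasing) auto
        then have "2 ^ (k + 1) * (Xa / X ^ k) \<le> 16 * (Xa / X ^ k)" using X by (intro mult_right_mono) auto
        then have "A / B ^ k \<le> 16 * (Xa / X ^ k)" using sc(3)[of k] by linarith
        then have "M2 * (A / B ^ k) \<le> M2 * (16 * (Xa / X ^ k))" using M2(1) by (intro mult_left_mono) auto
        also have "\<dots> = (16 * M2) * (Xa / X ^ k)" by simp
        also have "\<dots> \<le> M * (Xa / X ^ k)" using M X by (intro mult_right_mono) auto
        finally show ?thesis by simp
      qed
      have r3: "M2 * \<tau> * A / B ^ k \<le> M * \<tau> * Xa / X ^ k" if "k \<le> 3" for k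
        using mult_left_mono[OF r2[OF that], of \<tau>] \<tau> by (simp add: mult_ac)
      have "M2 * \<tau> * (A * B) \<le> M2 * \<tau> * (4 * (Xa * X))" using M2(1) \<tau> sc(4) by (intro mult_left_mono) auto
      also have "\<dots> = 4 * M2 * (\<tau> * Xa * X)" by simp
      also have "\<dots> \<le> M * (\<tau> * Xa * X)" using M M2(1) \<tau> X by (intro mult_right_mono) auto
      finally have r4: "M2 * \<tau> * A * B \<le> M * \<tau> * Xa * X" by (simp add: mult_ac)
      from m r1 r2[of 1] r2[of 2] r2[of 3] r3[of 0] r3[of 1] r3[of 2] r4 show ?thesis by auto
    qed
    have "L2_norm \<Omega> (\<lambda>x. sol2 g z x - d.sol2 g z x) \<le> 26 * M ^ 8 * \<tau> / X ^ 2 * L2_norm \<Omega> g"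
      by (rule sol_diff_bounds[OF g zs zh X M(1) \<tau>(1)]) (use c d in blast)+
    then show ?thesis by (simp add: X_def)
  qed
  have "0 < 26 * M ^ 8" using M(1) by simp
  then show ?thesis using main by blast
qed

end

section \<open>Deforming the contour\<close>

text \<open>Far out this is the sector |Arg z| < \<pi>/2 + arcsin \<eta>; the offset
  \<open>c\<close> makes room for the shift by \<rho> U. Its complement is a sublevel set of a
  convex function, hence convex.\<close>

definition cut_region :: "real \<Rightarrow> real \<Rightarrow> complex set" where
  "cut_region \<eta> c = {z. c < Re z + \<eta> * norm z}"

text \<open>A move to the right by p raises Re z by p and lowers \<eta> |z| by at most \<eta>
  p.\<close>

lemma cut_region_right:
  assumes "z \<in> cut_region \<eta> c" "0 \<le> \<eta>" "\<eta> < 1" "0 \<le> p"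
  shows "z + of_real p \<in> cut_region \<eta> c"
proof -
  have "norm z \<le> norm (z + of_real p) + p"
    using norm_triangle_ineq4[of "z + of_real p" "of_real p"] assms(4) by simp
  then have "\<eta> * norm z \<le> \<eta> * norm (z + of_real p) + \<eta> * p"
    using mult_left_mono[OF _ assms(2)] by (simp add: distrib_left[symmetric])
  moreover have "\<eta> * p \<le> 1 * p" using assms by (intro mult_right_mono) auto
  ultimately show ?thesis using assms(1) by (simp add: cut_region_def)
qed

lemma open_cut_region: "open (cut_region \<eta> c)"
  unfolding cut_region_def by (intro open_Collect_less continuous_intros)

lemma halfplane_cut_region:
  assumes "0 \<le> \<eta>" "0 \<le> c" "c < Re z * (1 + \<eta>)"
  shows "z \<in> cut_region \<eta> c"
  using mult_left_mono[OF complex_Re_le_cmod[of z] assms(1)] assms(3)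
  by (simp add: cut_region_def algebra_simps)

text \<open>Each point is joined to the half plane Re z > c by a horizontal segment, which gives
  connectedness. The complement is convex and contains the negative real axis, so its only component
  is unbounded.\<close>

lemma simply_connected_cut_region:
  assumes \<eta>: "0 \<le> \<eta>" "\<eta> < 1" and c: "0 \<le> c"
  shows "simply_connected (cut_region \<eta> c)"
  unfolding simply_connected_eq_unbounded_complement_components[OF open_cut_region]
proof
  let ?H = "{z. c < Re z}"
  have H: "?H \<subseteq> cut_region \<eta> c"
  proof
    fix z assume "z \<in> ?H"
    then have z: "c < Re z" by simp
    have "0 \<le> \<eta> * Re z" using z c \<eta> by (intro mult_nonneg_nonneg) auto
    then have "c < Re z * (1 + \<eta>)" using z by (simp add: algebra_simps)
    then show "z \<in> cut_region \<eta> c" by (rule halfplane_cut_region[OF \<eta>(1) c])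
  qed
  have "cut_region \<eta> c = (\<Union>z\<in>cut_region \<eta> c. ?H \<union> closed_segment z (z + of_real (\<bar>Re z\<bar> + c + 1)))"
  proof (intro equalityI subsetI)
    fix w assume "w \<in> (\<Union>z\<in>cut_region \<eta> c. ?H \<union> closed_segment z (z + of_real (\<bar>Re z\<bar> + c + 1)))"
    then obtain z where z: "z \<in> cut_region \<eta> c" "w \<in> ?H \<union> closed_segment z (z + of_real (\<bar>Re z\<bar> + c + 1))" by blast
    then consider "w \<in> ?H" | "w \<in> closed_segment z (z + of_real (\<bar>Re z\<bar> + c + 1))" by blast
    then show "w \<in> cut_region \<eta> c"
    proof cases
      case 2
      then obtain s where s: "0 \<le> s" "w = (1 - s) *\<^sub>R z + s *\<^sub>R (z + of_real (\<bar>Re z\<bar> + c + 1))"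
        by (auto simp: closed_segment_def)
      then have "w = z + of_real (s * (\<bar>Re z\<bar> + c + 1))" by (simp add: algebra_simps scaleR_conv_of_real)
      then show ?thesis using cut_region_right[OF z(1) \<eta>, of "s * (\<bar>Re z\<bar> + c + 1)"] s c by simp
    qed (use H in blast)
  qed auto
  moreover have "connected (\<Union>z\<in>cut_region \<eta> c. ?H \<union> closed_segment z (z + of_real (\<bar>Re z\<bar> + c + 1)))"
  proof (rule connected_Union)
    show "connected s" if "s \<in> (\<lambda>z. ?H \<union> closed_segment z (z + of_real (\<bar>Re z\<bar> + c + 1))) ` cut_region \<eta> c" for s
      using that
    proof (elim imageE)
      fix z assume s: "s = ?H \<union> closed_segment z (z + of_real (\<bar>Re z\<bar> + c + 1))"
      have "z + of_real (\<bar>Re z\<bar> + c + 1) \<in> ?H \<inter> closed_segment z (z + of_real (\<bar>Re z\<bar> + c + 1))" by simp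
      then show ?thesis unfolding s
        by (intro connected_Un convex_connected convex_halfspace_Re_gt connected_segment) blast
    qed
    have "of_real (c + 1) \<in> \<Inter> ((\<lambda>z. ?H \<union> closed_segment z (z + of_real (\<bar>Re z\<bar> + c + 1))) ` cut_region \<eta> c)" by simp
    then show "\<Inter> ((\<lambda>z. ?H \<union> closed_segment z (z + of_real (\<bar>Re z\<bar> + c + 1))) ` cut_region \<eta> c) \<noteq> {}" by blast
  qed
  ultimately show "connected (cut_region \<eta> c)" by simp
  have ray: "- of_real r \<in> - cut_region \<eta> c" if "0 \<le> r" for r
  proof -
    have "\<eta> * r \<le> 1 * r" using \<eta> that by (intro mult_right_mono) auto
    then have "\<not> c < - r + \<eta> * r" using c by linarith
    then show ?thesis using that by (simp add: cut_region_def)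
  qed
  have conv: "convex (- cut_region \<eta> c)"
  proof -
    have "(1 - t) *\<^sub>R x + t *\<^sub>R y \<in> - cut_region \<eta> c"
      if xy: "x \<in> - cut_region \<eta> c" "y \<in> - cut_region \<eta> c" and t: "0 \<le> t" "t \<le> 1" for x y t
    proof -
      have "norm ((1 - t) *\<^sub>R x + t *\<^sub>R y) \<le> (1 - t) * norm x + t * norm y"
        using norm_triangle_ineq[of "(1 - t) *\<^sub>R x" "t *\<^sub>R y"] t by simp
      from mult_left_mono[OF this \<eta>(1)]
      have "Re ((1 - t) *\<^sub>R x + t *\<^sub>R y) + \<eta> * norm ((1 - t) *\<^sub>R x + t *\<^sub>R y)
          \<le> (1 - t) * (Re x + \<eta> * norm x) + t * (Re y + \<eta> * norm y)"
        by (simp add: algebra_simps)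
      also have "\<dots> \<le> (1 - t) * c + t * c"
        using xy t by (intro add_mono mult_left_mono) (auto simp: cut_region_def)
      finally show ?thesis by (simp add: cut_region_def algebra_simps)
    qed
    then show ?thesis by (auto simp: convex_alt)
  qed
  have comp: "components (- cut_region \<eta> c) = {- cut_region \<eta> c}"
    using ray[of 0] convex_connected[OF conv] by (auto simp: components_eq_sing_iff)
  have "\<not> bounded (- cut_region \<eta> c)"
  proof
    assume "bounded (- cut_region \<eta> c)"
    then obtain B where "\<And>z. z \<in> - cut_region \<eta> c \<Longrightarrow> norm z \<le> B" by (auto simp: bounded_iff)
    from this[OF ray[of "\<bar>B\<bar> + 1"]] have "norm (complex_of_real (\<bar>B\<bar> + 1)) \<le> B" by (simp only: norm_minus_cancel)
    then show False unfolding norm_of_real by simp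
  qed
  then show "\<forall>C\<in>components (- cut_region \<eta> c). \<not> bounded C" by (simp add: comp)
qed

section \<open>Primitives along the contour and its replacement by a vertical line\<close>

lemma has_integral_halfline_tendsto:
  fixes f :: "real \<Rightarrow> complex"
  assumes "(f has_integral I) {a..}"
  shows "((\<lambda>b. integral {a..b} f) \<longlongrightarrow> I) at_top"
proof (rule tendstoI)
  fix e :: real assume "0 < e"
  let ?g = "\<lambda>x. if x \<in> {a..} then f x else 0"
  obtain B where B: "0 < B" "\<And>p q. ball 0 B \<subseteq> cbox p q \<Longrightarrow> norm (integral (cbox p q) ?g - I) < e"
    using assms \<open>0 < e\<close> unfolding has_integral_alt' by blast
  show "\<forall>\<^sub>F b in at_top. dist (integral {a..b} f) I < e"
    using eventually_ge_at_top[of "max B \<bar>a\<bar>"]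
  proof eventually_elim
    case (elim b)
    have "ball 0 B \<subseteq> cbox (- b) b" using elim by (auto simp: dist_norm)
    then have "norm (integral {- b..b} ?g - I) < e" using B(2) by simp
    moreover have "integral {- b..b} ?g = integral {a..b} f"
    proof -
      have "integral {- b..b} ?g = integral ({- b..b} \<inter> {a..}) f"
        using Henstock_Kurzweil_Integration.integral_restrict_Int[of "{- b..b}" "{a..}" f] by (simp add: Int_commute)
      also have "{- b..b} \<inter> {a..} = {a..b}" using elim by auto
      finally show ?thesis .
    qed
    ultimately show ?case by (simp add: dist_norm)
  qed
qed

lemma cut_region_primitive:
  assumes "0 \<le> \<eta>" "\<eta> < 1" "0 \<le> c" "f holomorphic_on cut_region \<eta> c"
  shows "\<exists>h. \<forall>z\<in>cut_region \<eta> c. (h has_field_derivative f z) (at z)"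
  using simply_connected_cut_region[OF assms(1-3)] assms(4)
  unfolding simply_connected_eq_global_primitive[OF open_cut_region] by blast

text \<open>The primitive arises by integrating \<^term>\<open>exp (z * of_real t) * W z\<close> by parts twice.\<close>

lemma primitive_by_parts:
  fixes z :: complex
  assumes W: "(W has_field_derivative W1) (at z)" and W1: "(W' has_field_derivative W2) (at z)" "W' z = W1"
    and \<Phi>: "(\<Phi> has_field_derivative exp (z * of_real t) * W2) (at z)" and t: "t \<noteq> 0"
  shows "((\<lambda>z. (\<Phi> z - exp (z * of_real t) * W' z + of_real t * (exp (z * of_real t) * W z)) / of_real t ^ 2)
    has_field_derivative exp (z * of_real t) * W z) (at z)"
proof -
  have e: "((\<lambda>z. exp (z * of_real t)) has_field_derivative of_real t * exp (z * of_real t)) (at z)"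
    by (auto intro!: derivative_eq_intros)
  have "((\<lambda>z. (\<Phi> z - exp (z * of_real t) * W' z + of_real t * (exp (z * of_real t) * W z)) / of_real t ^ 2)
    has_field_derivative (exp (z * of_real t) * W2 - (of_real t * exp (z * of_real t) * W' z + W2 * exp (z * of_real t))
      + of_real t * (of_real t * exp (z * of_real t) * W z + W1 * exp (z * of_real t))) / of_real t ^ 2) (at z)"
    by (intro DERIV_cdivide DERIV_add DERIV_diff DERIV_cmult DERIV_mult' \<Phi> DERIV_mult[OF e W] DERIV_mult[OF e W1(1)])
  moreover have "(exp (z * of_real t) * W2 - (of_real t * exp (z * of_real t) * W' z + W2 * exp (z * of_real t))
      + of_real t * (of_real t * exp (z * of_real t) * W z + W1 * exp (z * of_real t))) / of_real t ^ 2 = exp (z * of_real t) * W z"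
    using t W1(2) by (simp add: field_simps power2_eq_square)
  ultimately show ?thesis by simp
qed

lemma ray_integral_limit:
  assumes \<Phi>: "\<And>r. \<kappa> \<le> r \<Longrightarrow> (\<Phi> has_field_derivative f (rcis r \<theta>)) (at (rcis r \<theta>))"
    and I: "((\<lambda>r. f (rcis r \<theta>) * cis \<theta>) has_integral I) {\<kappa>..}"
  shows "((\<lambda>b. \<Phi> (rcis b \<theta>) - \<Phi> (rcis \<kappa> \<theta>)) \<longlongrightarrow> I) at_top"
proof (rule Lim_transform_eventually[OF has_integral_halfline_tendsto[OF I]])
  show "\<forall>\<^sub>F b in at_top. integral {\<kappa>..b} (\<lambda>r. f (rcis r \<theta>) * cis \<theta>) = \<Phi> (rcis b \<theta>) - \<Phi> (rcis \<kappa> \<theta>)"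
    using eventually_ge_at_top[of \<kappa>]
  proof eventually_elim
    case (elim b)
    have "((\<lambda>r. f (rcis r \<theta>) * cis \<theta>) has_integral (\<Phi> (rcis b \<theta>) - \<Phi> (rcis \<kappa> \<theta>))) {\<kappa>..b}"
    proof (rule fundamental_theorem_of_calculus[OF elim])
      fix r assume r: "r \<in> {\<kappa>..b}"
      have "((\<lambda>r. rcis r \<theta>) has_vector_derivative cis \<theta>) (at r within {\<kappa>..b})"
        unfolding rcis_def by (auto intro!: derivative_eq_intros)
      moreover have "(\<Phi> has_field_derivative f (rcis r \<theta>)) (at (rcis r \<theta>) within (\<lambda>r. rcis r \<theta>) ` {\<kappa>..b})"
        by (rule has_field_derivative_at_within[OF \<Phi>]) (use r in auto)
      ultimately have "((\<Phi> \<circ> (\<lambda>r. rcis r \<theta>)) has_vector_derivative cis \<theta> * f (rcis r \<theta>)) (at r within {\<kappa>..b})"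
        by (rule field_vector_diff_chain_within)
      then show "((\<lambda>r. \<Phi> (rcis r \<theta>)) has_vector_derivative f (rcis r \<theta>) * cis \<theta>) (at r within {\<kappa>..b})"
        by (simp add: o_def mult.commute)
    qed
    then show ?case by (rule integral_unique)
  qed
qed

lemma arc_in_contour:
  assumes \<kappa>: "0 < \<kappa>" and \<theta>: "0 < \<theta>" "\<theta> < pi"
    and zp: "z \<in> path_image (part_circlepath 0 \<kappa> (- \<theta>) \<theta>)"
  shows "z \<in> contour \<theta> \<kappa>"
proof -
  obtain s where s: "- \<theta> \<le> s" "s \<le> \<theta>" "z = rcis \<kappa> s"
    using zp \<theta> by (auto simp: path_image_part_circlepath rcis_def cis_conv_exp)
  have "Arg z = s" by (rule Arg_unique'[OF \<kappa> _ s(3)]) (use s \<theta> in auto)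
  then show ?thesis using s \<kappa> by (auto simp: contour_def)
qed

text \<open>On each of the three pieces the integral is an increment of the primitive; the values at
  the two corners cancel, and only the ends at infinity remain.\<close>

lemma contour_primitive_limit:
  assumes \<kappa>: "0 < \<kappa>" and \<theta>: "0 < \<theta>" "\<theta> < pi"
    and \<Phi>: "\<And>z. z \<in> contour \<theta> \<kappa> \<Longrightarrow> (\<Phi> has_field_derivative f z) (at z)"
    and I: "has_integral_along_contour f \<theta> \<kappa> I"
  shows "((\<lambda>b. \<Phi> (rcis b \<theta>) - \<Phi> (rcis b (- \<theta>))) \<longlongrightarrow> I) at_top"
proof -
  obtain Il Ia Iu where *: "((\<lambda>r. f (rcis r (- \<theta>)) * cis (- \<theta>)) has_integral Il) {\<kappa>..}"
      "(f has_contour_integral Ia) (part_circlepath 0 \<kappa> (- \<theta>) \<theta>)"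
      "((\<lambda>r. f (rcis r \<theta>) * cis \<theta>) has_integral Iu) {\<kappa>..}" "I = - Il + Ia + Iu"
    using I unfolding has_integral_along_contour_def by blast
  have c: "rcis r \<theta> \<in> contour \<theta> \<kappa>" "rcis r (- \<theta>) \<in> contour \<theta> \<kappa>" if "\<kappa> \<le> r" for r
    using that by (auto simp: contour_def)
  have u: "((\<lambda>b. \<Phi> (rcis b \<theta>) - \<Phi> (rcis \<kappa> \<theta>)) \<longlongrightarrow> Iu) at_top"
    by (rule ray_integral_limit[OF \<Phi>[OF c(1)] *(3)])
  have l: "((\<lambda>b. \<Phi> (rcis b (- \<theta>)) - \<Phi> (rcis \<kappa> (- \<theta>))) \<longlongrightarrow> Il) at_top"
    by (rule ray_integral_limit[OF \<Phi>[OF c(2)] *(1)])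
  have "(f has_contour_integral (\<Phi> (pathfinish (part_circlepath 0 \<kappa> (- \<theta>) \<theta>)) - \<Phi> (pathstart (part_circlepath 0 \<kappa> (- \<theta>) \<theta>))))
      (part_circlepath 0 \<kappa> (- \<theta>) \<theta>)"
  proof (rule contour_integral_primitive[where S="contour \<theta> \<kappa>"])
    show "(\<Phi> has_field_derivative f x) (at x within contour \<theta> \<kappa>)" if "x \<in> contour \<theta> \<kappa>" for x
      using \<Phi>[OF that] by (rule has_field_derivative_at_within)
  qed (use arc_in_contour[OF \<kappa> \<theta>] in auto)
  then have Ia: "Ia = \<Phi> (rcis \<kappa> \<theta>) - \<Phi> (rcis \<kappa> (- \<theta>))"
    using has_contour_integral_unique[OF *(2)] by (simp add: rcis_def cis_conv_exp)
  have "((\<lambda>b. \<Phi> (rcis b \<theta>) - \<Phi> (rcis \<kappa> \<theta>) - (\<Phi> (rcis b (- \<theta>)) - \<Phi> (rcis \<kappa> (- \<theta>))) + Ia) \<longlongrightarrow> Iu - Il + Ia) at_top"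
    by (intro tendsto_intros u l)
  moreover have "\<Phi> (rcis b \<theta>) - \<Phi> (rcis \<kappa> \<theta>) - (\<Phi> (rcis b (- \<theta>)) - \<Phi> (rcis \<kappa> (- \<theta>))) + Ia
      = \<Phi> (rcis b \<theta>) - \<Phi> (rcis b (- \<theta>))" for b unfolding Ia by simp
  moreover have "Iu - Il + Ia = I" using *(4) by simp
  ultimately show ?thesis by simp
qed

text \<open>The horizontal segment from the ray to the vertical line has length of order b, while
  the integrand is of order b^-3 there; its contribution vanishes.\<close>

lemma horizontal_link_tendsto:
  assumes \<eta>: "0 \<le> \<eta>" "\<eta> < 1" and \<Phi>: "\<And>z. z \<in> cut_region \<eta> c \<Longrightarrow> (\<Phi> has_field_derivative exp (z * of_real t) * W z) (at z)"
    and W: "\<And>z. z \<in> cut_region \<eta> c \<Longrightarrow> R \<le> norm z \<Longrightarrow> norm (W z) \<le> C / norm z ^ 3" and "0 \<le> C"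
    and t: "0 < t" and \<sigma>: "0 < \<sigma>" and \<theta>: "cos \<theta> \<le> 0" "sin \<theta> \<noteq> 0"
    and ray: "\<And>b. \<kappa> \<le> b \<Longrightarrow> rcis b \<theta> \<in> cut_region \<eta> c"
  shows "((\<lambda>b. \<Phi> (Complex \<sigma> (b * sin \<theta>)) - \<Phi> (rcis b \<theta>)) \<longlongrightarrow> 0) at_top"
proof (rule Lim_null_comparison)
  \<comment> \<open>The segment has length at most 2 b, its points have modulus at least b |sin
    \<theta>|, and the exponential is at most exp(\<sigma> t). This bounds the increment by E /
    b^2.\<close>
  define E where "E = exp (\<sigma> * t) * C * 2 / \<bar>sin \<theta>\<bar> ^ 3"
  show "((\<lambda>b. E / b) \<longlongrightarrow> 0) at_top"
    by (rule tendsto_divide_0[OF tendsto_const filterlim_at_top_imp_at_infinity[OF filterlim_ident]])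
  have E0: "0 \<le> E" using \<open>0 \<le> C\<close> by (simp add: E_def)
  show "\<forall>\<^sub>F b in at_top. norm (\<Phi> (Complex \<sigma> (b * sin \<theta>)) - \<Phi> (rcis b \<theta>)) \<le> E / b"
    \<comment> \<open>The thresholds ensure in turn that the ray lies in the region, that 1/b \<le>
      1, that the length bound holds, and that the decay of \<open>W\<close> applies.\<close>
    using eventually_ge_at_top[of "max (max \<kappa> 1) (max \<sigma> (R / \<bar>sin \<theta>\<bar>))"]
  proof eventually_elim
    case (elim b)
    then have b: "\<kappa> \<le> b" "1 \<le> b" "\<sigma> \<le> b" "R / \<bar>sin \<theta>\<bar> \<le> b" by auto
    define p q where "p = rcis b \<theta>" and "q = Complex \<sigma> (b * sin \<theta>)"
    have pD: "p \<in> cut_region \<eta> c" unfolding p_def by (rule ray[OF b(1)])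
    have bc: "b * cos \<theta> \<le> 0" "- b \<le> b * cos \<theta>"
      using \<theta> b mult_nonneg_nonpos[of b "cos \<theta>"] mult_left_mono[of "-1" "cos \<theta>" b] by auto
    have qp: "q = p + of_real (\<sigma> - b * cos \<theta>)"
      by (simp add: p_def q_def complex_eq_iff)
    have len: "norm (q - p) \<le> 2 * b"
    proof -
      have "norm (q - p) = \<bar>\<sigma> - b * cos \<theta>\<bar>" unfolding qp by (simp only: add_diff_cancel_left' norm_of_real)
      then show ?thesis using bc b \<sigma> by linarith
    qed
    let ?S = "closed_segment p q"
    have seg: "z \<in> cut_region \<eta> c \<and> Im z = b * sin \<theta> \<and> Re z \<le> \<sigma>" if z: "z \<in> ?S" for z
    proof -
      obtain s where s: "0 \<le> s" "s \<le> 1" "z = (1 - s) *\<^sub>R p + s *\<^sub>R q" using z by (auto simp: closed_segment_def)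
      then have zz: "z = p + of_real (s * (\<sigma> - b * cos \<theta>))" by (simp add: qp algebra_simps scaleR_conv_of_real)
      have "0 \<le> s * (\<sigma> - b * cos \<theta>)" using s bc \<sigma> by (intro mult_nonneg_nonneg) auto
      then have "z \<in> cut_region \<eta> c" unfolding zz by (rule cut_region_right[OF pD \<eta>])
      moreover have "Im z = b * sin \<theta>" by (simp add: zz p_def)
      moreover have "s * (\<sigma> - b * cos \<theta>) \<le> 1 * (\<sigma> - b * cos \<theta>)" using s bc \<sigma> by (intro mult_right_mono) auto
      then have "Re z \<le> \<sigma>" by (simp add: zz p_def)
      ultimately show ?thesis by blast
    qed
    have "norm (\<Phi> q - \<Phi> p) \<le> (exp (\<sigma> * t) * (C / (b * \<bar>sin \<theta>\<bar>) ^ 3)) * norm (q - p)"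
    proof (rule field_differentiable_bound[where S="?S"])
      fix z assume z: "z \<in> ?S"
      show "(\<Phi> has_field_derivative exp (z * of_real t) * W z) (at z within ?S)"
        by (rule has_field_derivative_at_within[OF \<Phi>]) (use seg[OF z] in blast)
      have "\<bar>Im z\<bar> = b * \<bar>sin \<theta>\<bar>" using seg[OF z] b by (simp add: abs_mult)
      then have nz: "b * \<bar>sin \<theta>\<bar> \<le> norm z" using abs_Im_le_cmod[of z] by simp
      have bs: "0 < b * \<bar>sin \<theta>\<bar>" "R \<le> b * \<bar>sin \<theta>\<bar>" using b \<theta> by (auto simp: field_simps)
      have "norm (W z) \<le> C / norm z ^ 3" by (rule W) (use seg[OF z] nz bs in auto)
      also have "\<dots> \<le> C / (b * \<bar>sin \<theta>\<bar>) ^ 3"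
      proof (intro divide_left_mono power_mono nz mult_pos_pos zero_less_power bs(1) \<open>0 \<le> C\<close>)
        show "0 < norm z" using nz bs(1) by linarith
      qed (use bs(1) b \<theta> in auto)
      finally have "norm (W z) \<le> C / (b * \<bar>sin \<theta>\<bar>) ^ 3" .
      moreover have "norm (exp (z * of_real t)) \<le> exp (\<sigma> * t)" using seg[OF z] t by simp
      ultimately show "norm (exp (z * of_real t) * W z) \<le> exp (\<sigma> * t) * (C / (b * \<bar>sin \<theta>\<bar>) ^ 3)"
        unfolding norm_mult by (intro mult_mono) auto
    qed auto
    also have "\<dots> \<le> (exp (\<sigma> * t) * (C / (b * \<bar>sin \<theta>\<bar>) ^ 3)) * (2 * b)"
      using len b \<open>0 \<le> C\<close> by (intro mult_left_mono) auto
    also have "\<dots> = E / b * (1 / b)"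
    proof -
      have "e * (C / (b * s) ^ 3) * (2 * b) = e * C * 2 / s ^ 3 / b * (1 / b)" for e s :: real
        using b by (simp add: power_mult_distrib power3_eq_cube mult_ac)
      then show ?thesis unfolding E_def .
    qed
    also have "\<dots> \<le> E / b * 1" using b E0 by (intro mult_left_mono) auto
    finally show ?case by (simp add: p_def q_def)
  qed
qed

text \<open>t^2 times the primitive of exp(z t) W differs from \<Phi> by boundary terms, which
  vanish along the rays because the exponential is at most one there while W and W1 decay. The end
  points are then slid horizontally to Re z = \<sigma>.\<close>

lemma vertical_representation:
  assumes \<eta>: "0 \<le> \<eta>" "\<eta> < 1"
    and W: "\<And>z. z \<in> cut_region \<eta> c \<Longrightarrow> (W has_field_derivative W1 z) (at z)"
      "\<And>z. z \<in> cut_region \<eta> c \<Longrightarrow> (W1 has_field_derivative W2 z) (at z)"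
    and C: "0 \<le> C" "\<And>z. z \<in> cut_region \<eta> c \<Longrightarrow> R \<le> norm z \<Longrightarrow> norm (W z) \<le> C / norm z"
      "\<And>z. z \<in> cut_region \<eta> c \<Longrightarrow> R \<le> norm z \<Longrightarrow> norm (W1 z) \<le> C / norm z ^ 2"
      "\<And>z. z \<in> cut_region \<eta> c \<Longrightarrow> R \<le> norm z \<Longrightarrow> norm (W2 z) \<le> C / norm z ^ 3"
    and \<Phi>: "\<And>z. z \<in> cut_region \<eta> c \<Longrightarrow> (\<Phi> has_field_derivative exp (z * of_real t) * W2 z) (at z)"
    and \<theta>: "pi / 2 < \<theta>" "\<theta> < pi" and \<kappa>: "0 < \<kappa>" "contour \<theta> \<kappa> \<subseteq> cut_region \<eta> c"
    and t: "0 < t" and \<sigma>: "0 < \<sigma>"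
    and I: "has_integral_along_contour (\<lambda>z. exp (z * of_real t) * W z) \<theta> \<kappa> I"
  shows "((\<lambda>b. \<Phi> (Complex \<sigma> (b * sin \<theta>)) - \<Phi> (Complex \<sigma> (- (b * sin \<theta>)))) \<longlongrightarrow> of_real t ^ 2 * I) at_top"
proof -
  have \<theta>': "0 < \<theta>" "cos \<theta> \<le> 0" "sin \<theta> \<noteq> 0"
  proof -
    show "0 < \<theta>" using \<theta> pi_gt_zero by linarith
    then show "sin \<theta> \<noteq> 0" using sin_gt_zero[of \<theta>] \<theta> by simp
    have "cos \<theta> < cos (pi / 2)" using \<theta> by (subst cos_mono_less_eq) auto
    then show "cos \<theta> \<le> 0" by simp
  qed
  have ray: "rcis b \<theta> \<in> cut_region \<eta> c" "rcis b (- \<theta>) \<in> cut_region \<eta> c" if "\<kappa> \<le> b" for b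
    using that \<kappa>(2) by (auto simp: contour_def)
  define \<Psi> where "\<Psi> z = (\<Phi> z - exp (z * of_real t) * W1 z + of_real t * (exp (z * of_real t) * W z)) / of_real t ^ 2" for z
  have "(\<Psi> has_field_derivative exp (z * of_real t) * W z) (at z)" if "z \<in> contour \<theta> \<kappa>" for z
  proof -
    have zD: "z \<in> cut_region \<eta> c" using that \<kappa> by blast
    show ?thesis unfolding \<Psi>_def[abs_def]
      by (rule primitive_by_parts[OF W(1)[OF zD] W(2)[OF zD] refl \<Phi>[OF zD]]) (use t in simp)
  qed
  from contour_primitive_limit[OF \<kappa>(1) \<theta>'(1) \<theta>(2) this I]
  have lim: "((\<lambda>b. \<Psi> (rcis b \<theta>) - \<Psi> (rcis b (- \<theta>))) \<longlongrightarrow> I) at_top" .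
  have small: "((\<lambda>b. \<Phi> (rcis b \<psi>) - of_real t ^ 2 * \<Psi> (rcis b \<psi>)) \<longlongrightarrow> 0) at_top"
    if r: "\<And>b. \<kappa> \<le> b \<Longrightarrow> rcis b \<psi> \<in> cut_region \<eta> c" and cos: "cos \<psi> \<le> 0" for \<psi>
  proof (rule Lim_null_comparison)
    show "((\<lambda>b. (C + t * C) / b) \<longlongrightarrow> 0) at_top"
      by (rule tendsto_divide_0[OF tendsto_const filterlim_at_top_imp_at_infinity[OF filterlim_ident]])
    show "\<forall>\<^sub>F b in at_top. norm (\<Phi> (rcis b \<psi>) - of_real t ^ 2 * \<Psi> (rcis b \<psi>)) \<le> (C + t * C) / b"
      using eventually_ge_at_top[of "max (max \<kappa> 1) R"]
    proof eventually_elim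
      case (elim b)
      define z where "z = rcis b \<psi>"
      have b: "\<kappa> \<le> b" "1 \<le> b" "R \<le> b" using elim by auto
      have nz: "norm z = b" using b by (simp add: z_def)
      have zD: "z \<in> cut_region \<eta> c" unfolding z_def by (rule r[OF b(1)])
      have "b * cos \<psi> * t \<le> 0" using b cos t by (intro mult_nonpos_nonneg mult_nonneg_nonpos) auto
      then have e: "norm (exp (z * of_real t)) \<le> 1" by (simp add: z_def)
      have "b \<le> b ^ 2" using b by (simp add: power2_eq_square)
      then have "C / b ^ 2 \<le> C / b" using b C(1) by (intro divide_left_mono) auto
      then have w1: "norm (W1 z) \<le> C / b" using C(3)[OF zD] nz b by simp
      have w0: "norm (W z) \<le> C / b" using C(2)[OF zD] nz b by simp
      have "\<Phi> z - of_real t ^ 2 * \<Psi> z = exp (z * of_real t) * W1 z - of_real t * (exp (z * of_real t) * W z)"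
        using t by (simp add: \<Psi>_def)
      also have "norm \<dots> \<le> norm (exp (z * of_real t)) * norm (W1 z) + t * (norm (exp (z * of_real t)) * norm (W z))"
        using norm_triangle_ineq4[of "exp (z * of_real t) * W1 z" "of_real t * (exp (z * of_real t) * W z)"] t
        by (simp add: norm_mult)
      also have "\<dots> \<le> 1 * (C / b) + t * (1 * (C / b))"
        using e w0 w1 t by (intro add_mono mult_mono mult_left_mono) auto
      finally show ?case by (simp add: z_def add_divide_distrib)
    qed
  qed
  have 1: "((\<lambda>b. \<Phi> (Complex \<sigma> (b * sin \<theta>)) - \<Phi> (rcis b \<theta>)) \<longlongrightarrow> 0) at_top"
    by (rule horizontal_link_tendsto[OF \<eta> \<Phi> C(4,1) t \<sigma> \<theta>'(2,3) ray(1)])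
  have 2: "((\<lambda>b. \<Phi> (Complex \<sigma> (b * sin (- \<theta>))) - \<Phi> (rcis b (- \<theta>))) \<longlongrightarrow> 0) at_top"
    by (rule horizontal_link_tendsto[OF \<eta> \<Phi> C(4,1) t \<sigma> _ _ ray(2)]) (use \<theta>' in auto)
  have cm: "cos (- \<theta>) \<le> 0" using \<theta>' by simp
  note 3 = small[OF ray(1) \<theta>'(2)] and 4 = small[OF ray(2) cm]
  \<comment> \<open>A telescoping sum: two horizontal slides, two boundary terms, and the limit
    along the contour, which alone survives.\<close>
  have "((\<lambda>b. (\<Phi> (Complex \<sigma> (b * sin \<theta>)) - \<Phi> (rcis b \<theta>)) - (\<Phi> (Complex \<sigma> (b * sin (- \<theta>))) - \<Phi> (rcis b (- \<theta>)))
      + (\<Phi> (rcis b \<theta>) - of_real t ^ 2 * \<Psi> (rcis b \<theta>)) - (\<Phi> (rcis b (- \<theta>)) - of_real t ^ 2 * \<Psi> (rcis b (- \<theta>)))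
      + of_real t ^ 2 * (\<Psi> (rcis b \<theta>) - \<Psi> (rcis b (- \<theta>)))) \<longlongrightarrow> 0 - 0 + 0 - 0 + of_real t ^ 2 * I) at_top"
    by (intro tendsto_add tendsto_diff tendsto_mult tendsto_const 1 2 3 4 lim)
  moreover have "(\<Phi> (Complex \<sigma> (b * sin \<theta>)) - \<Phi> (rcis b \<theta>)) - (\<Phi> (Complex \<sigma> (b * sin (- \<theta>))) - \<Phi> (rcis b (- \<theta>)))
      + (\<Phi> (rcis b \<theta>) - of_real t ^ 2 * \<Psi> (rcis b \<theta>)) - (\<Phi> (rcis b (- \<theta>)) - of_real t ^ 2 * \<Psi> (rcis b (- \<theta>)))
      + of_real t ^ 2 * (\<Psi> (rcis b \<theta>) - \<Psi> (rcis b (- \<theta>))) = \<Phi> (Complex \<sigma> (b * sin \<theta>)) - \<Phi> (Complex \<sigma> (- (b * sin \<theta>)))" for b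
    by (simp add: right_diff_distrib)
  ultimately show ?thesis by (simp only: diff_0_right add_0_left add_0)
qed

section \<open>Representation of the scheme\<close>

text \<open>Convergence at \<zeta> = 1/2 bounds |d i| by M 2^i; for |\<zeta>| \<le> 1/4 the tail is
  then dominated by a geometric series of ratio at most 1/2.\<close>

lemma power_series_tail_bound:
  fixes d :: "nat \<Rightarrow> real" and S :: "complex \<Rightarrow> complex"
  assumes S: "\<And>\<zeta>. norm \<zeta> < 1 \<Longrightarrow> (\<lambda>i. of_real (d i) * \<zeta> ^ i) sums S \<zeta>"
  shows "\<exists>M\<ge>0. \<forall>n \<zeta>. norm \<zeta> \<le> 1/4 \<longrightarrow> norm (S \<zeta> - (\<Sum>i<n. of_real (d i) * \<zeta> ^ i)) \<le> M * (2 * norm \<zeta>) ^ n"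
proof -
  have "summable (\<lambda>i. of_real (d i) * (1/2 :: complex) ^ i)" using S[of "1/2"] by (simp add: sums_iff)
  then have "(\<lambda>i. of_real (d i) * (1/2 :: complex) ^ i) \<longlonglongrightarrow> 0" by (rule summable_LIMSEQ_zero)
  then have "Bseq (\<lambda>i. of_real (d i) * (1/2 :: complex) ^ i)" by (intro convergent_imp_Bseq) (auto simp: convergent_def)
  then obtain M where M: "0 < M" "\<And>i. norm (of_real (d i) * (1/2 :: complex) ^ i) \<le> M" by (auto simp: Bseq_def)
  have dM: "\<bar>d i\<bar> \<le> M * 2 ^ i" for i
  proof -
    have "\<bar>d i\<bar> * (1/2) ^ i \<le> M" using M(2)[of i] by (simp add: norm_mult norm_power norm_divide)
    then show ?thesis by (simp add: power_divide divide_le_eq)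
  qed
  have "norm (S \<zeta> - (\<Sum>i<n. of_real (d i) * \<zeta> ^ i)) \<le> 2 * M * (2 * norm \<zeta>) ^ n" if z: "norm \<zeta> \<le> 1/4" for n \<zeta>
  proof -
    let ?f = "\<lambda>i. of_real (d i) * \<zeta> ^ i" and ?r = "2 * norm \<zeta>"
    have r: "0 \<le> ?r" "?r \<le> 1/2" using z by auto
    have sm: "summable ?f" and Sz: "S \<zeta> = suminf ?f" using S[of \<zeta>] z by (auto simp: sums_iff)
    have "S \<zeta> - sum ?f {..<n} = (\<Sum>i. ?f (i + n))"
      unfolding Sz by (simp add: suminf_minus_initial_segment[OF sm])
    also have "norm \<dots> \<le> (\<Sum>i. M * ?r ^ n * ?r ^ i)"
    proof (rule norm_suminf_le)
      fix i
      have "norm (?f (i + n)) = \<bar>d (i + n)\<bar> * norm \<zeta> ^ (i + n)" by (simp add: norm_mult norm_power)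
      also have "\<dots> \<le> (M * 2 ^ (i + n)) * norm \<zeta> ^ (i + n)" by (intro mult_right_mono dM) auto
      also have "\<dots> = M * ?r ^ n * ?r ^ i" by (simp add: power_add power_mult_distrib)
      finally show "norm (?f (i + n)) \<le> M * ?r ^ n * ?r ^ i" .
      show "summable (\<lambda>i. M * ?r ^ n * ?r ^ i)" by (intro summable_mult summable_geometric) (use r in auto)
    qed
    also have "\<dots> = M * ?r ^ n * (1 / (1 - ?r))"
      using r by (subst suminf_mult) (auto intro!: summable_geometric simp: suminf_geometric)
    also have "\<dots> \<le> M * ?r ^ n * 2"
      using r M(1) by (intro mult_left_mono) (auto simp: divide_le_eq)
    finally show ?thesis by (simp add: mult_ac)
  qed
  then show ?thesis using M(1) by (intro exI[of _ "2 * M"]) auto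
qed

text \<open>For the initial term of the scheme. The infinite counterpart is the generating function
  \<xi>/(1 - \<xi>) times the series of a; the last summand is the truncation error.\<close>

lemma sum_powers_partial_sums:
  fixes \<xi> :: complex
  shows "(1 - \<xi>) * (\<Sum>m=1..N. \<xi> ^ m * (\<Sum>i<m. a i)) = \<xi> * (\<Sum>i<N. a i * \<xi> ^ i) - \<xi> ^ Suc N * (\<Sum>i<N. a i)"
proof (induction N)
  case (Suc N)
  have step: "(1 - \<xi>) * (\<Sum>m=1..Suc N. \<xi> ^ m * (\<Sum>i<m. a i))
      = (1 - \<xi>) * (\<Sum>m=1..N. \<xi> ^ m * (\<Sum>i<m. a i)) + (1 - \<xi>) * (\<xi> ^ Suc N * (\<Sum>i<Suc N. a i))"
    by (simp add: distrib_left)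
  show ?case unfolding step Suc by (simp add: algebra_simps)
qed simp

text \<open>The substitution j = m - i; for fixed j the index i runs up to N - j, which is where the
  truncation at N shows.\<close>

lemma sum_convolution_swap:
  fixes f :: "nat \<Rightarrow> nat \<Rightarrow> complex"
  shows "(\<Sum>m=1..N. \<Sum>i<m. f i (m - i)) = (\<Sum>j=1..N. \<Sum>i<Suc (N - j). f i j)"
  unfolding sum.Sigma[OF finite_atLeastAtMost ballI[OF finite_lessThan]]
  by (rule sum.reindex_bij_witness[of _ "\<lambda>(j, i). (i + j, i)" "\<lambda>(m, i). (m - i, i)"]) auto

section \<open>The generating polynomial of the scheme\<close>

context fractional_problem begin

text \<open>Because \<open>diff_quot\<close> is (1 - \<xi>)/\<tau>, lowering the exponent by one
  divides by it. The right-hand side is the generating function of the partial sums of d, so the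
  initial term of the scheme becomes \<open>dP0\<close> / \<tau>.\<close>

lemma dP0_via_dF:
  assumes "0 < \<tau>" "0 < Re b"
  shows "dP0 \<alpha> \<tau> b / of_real \<tau> = dF \<alpha> \<tau> b * exp (- (b * of_real \<tau>)) / (1 - exp (- (b * of_real \<tau>)))"
proof -
  have q: "diff_quot \<tau> b \<noteq> 0" using diff_quot_Re_pos[OF assms] by auto
  have "diff_quot \<tau> b powr of_real (\<alpha> - 1) = diff_quot \<tau> b powr of_real \<alpha> / diff_quot \<tau> b"
    using q by (simp add: powr_diff)
  then show ?thesis using assms q by (simp add: dP0_def dF_def diff_quot_def)
qed

text \<open>Multiplying the m-th equation by exp(-m \<tau> z) and adding gives the resolvent
  equation of the scheme up to the parts of the power series that the truncation at N removes. They
  start at the power N + 1 of q = exp(-(Re z - K) \<tau>), one more than exp(z t_n) can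
  compensate.\<close>

lemma discrete_generating_bound:
  assumes \<tau>: "0 < \<tau>" and d: "BE_coeffs \<alpha> \<tau> d" and g: "g \<in> L2 \<Omega>"
    and lapv: "\<And>m. m \<in> {1..N} \<Longrightarrow> lap (Gd m) (v m)"
    and eq: "\<And>m. m \<in> {1..N} \<Longrightarrow> AE x in \<mu>.
      (\<Sum>i<m. of_real (d i) * exp (- (of_real (real i * \<tau>) * u x)) * Gd (m - i) x) + v m x
        = exp (- (of_real (real m * \<tau>) * u x)) * (\<Sum>i<m. of_real (d i)) * g x"
  shows "\<exists>C. \<exists>s0>K. \<forall>z. s0 \<le> Re z \<longrightarrow>
      L2_norm \<Omega> (\<lambda>x. (\<Sum>m=1..N. exp (- (z * of_real (real m * \<tau>))) * Gd m x) - dsol \<tau> g z x / of_real \<tau>)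
        \<le> C * exp (- (Re z - K) * \<tau>) ^ Suc N"
proof -
  interpret d: symbol_pair \<Omega> u K \<alpha> sector "cF \<alpha>" "cP0 \<alpha>" "cP1 \<alpha>" "cP2 \<alpha>"
    halfplane "dF \<alpha> \<tau>" "dP0 \<alpha> \<tau>" "dP1 \<alpha> \<tau>" "dP2 \<alpha> \<tau>"
    by (rule discrete_symbol_pair[OF \<tau>])
  define S where "S \<zeta> = ((1 - \<zeta>) / of_real \<tau>) powr of_real \<alpha>" for \<zeta> :: complex
  have Ssum: "(\<lambda>i. of_real (d i) * \<zeta> ^ i) sums S \<zeta>" if "norm \<zeta> < 1" for \<zeta>
    using d that unfolding BE_coeffs_def S_def by blast
  obtain M where M: "0 \<le> M" "\<And>n \<zeta>. norm \<zeta> \<le> 1/4 \<Longrightarrow> norm (S \<zeta> - (\<Sum>i<n. of_real (d i) * \<zeta> ^ i)) \<le> M * (2 * norm \<zeta>) ^ n"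
    using power_series_tail_bound[OF Ssum] by blast
  \<comment> \<open>The constants here may depend on N and \<tau>, since only the limit Re z to
    infinity is taken with them; this allows the base 2 to be absorbed.\<close>
  define M' where "M' = M * 2 ^ Suc N"
  have M'0: "0 \<le> M'" using M(1) by (simp add: M'_def)
  have tail: "norm (S \<zeta> - (\<Sum>i<n. of_real (d i) * \<zeta> ^ i)) \<le> M' * norm \<zeta> ^ n" if "norm \<zeta> \<le> 1/4" "n \<le> Suc N" for n \<zeta>
  proof -
    have "(2::real) ^ n \<le> 2 ^ Suc N" using that by (intro power_increasing) auto
    then have "M * 2 ^ n * norm \<zeta> ^ n \<le> M' * norm \<zeta> ^ n"
      unfolding M'_def using M(1) by (intro mult_right_mono mult_left_mono) auto
    then show ?thesis using M(2)[OF that(1), of n] by (simp add: power_mult_distrib mult.assoc)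
  qed
  define Dn where "Dn = norm (\<Sum>i<N. complex_of_real (d i))"
  define CB where "CB = 2 * (M' + Dn)"
  have CB: "0 \<le> CB" using M'0 by (simp add: CB_def Dn_def)
  define NG where "NG = (\<Sum>j=1..N. L2_norm \<Omega> (Gd j))"
  \<comment> \<open>|1 - \<xi>| \<ge> 1/2 makes the difference quotient at least 1/(2 \<tau>) in
    modulus; this is the resulting coercivity constant.\<close>
  define c where "c = \<omega> * (1 / (2 * \<tau>)) powr \<alpha>"
  have c: "0 < c" using \<omega>_pos \<tau> by (simp add: c_def)
  \<comment> \<open>To the right of this abscissa q \<le> 1/4, which puts all values \<xi> into the
    disc of \<open>power_series_tail_bound\<close>.\<close>
  define s0 where "s0 = K + ln 4 / \<tau>"
  have s0: "K < s0" using \<tau> by (simp add: s0_def)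
  have main: "L2_norm \<Omega> (\<lambda>x. (\<Sum>m=1..N. exp (- (z * of_real (real m * \<tau>))) * Gd m x) - dsol \<tau> g z x / of_real \<tau>)
        \<le> (M' * NG + CB * L2_norm \<Omega> g) / c * exp (- (Re z - K) * \<tau>) ^ Suc N" if z: "s0 \<le> Re z" for z
  proof -
    define q where "q = exp (- (Re z - K) * \<tau>)"
    have q0: "0 < q" by (simp add: q_def)
    have "ln 4 \<le> (Re z - K) * \<tau>" using z \<tau> by (simp add: s0_def field_simps)
    then have "- (Re z - K) * \<tau> \<le> - ln 4" unfolding mult_minus_left by linarith
    then have "q \<le> exp (- ln 4)" unfolding q_def by (simp only: exp_le_cancel_iff)
    then have q4: "q \<le> 1/4" by (simp add: exp_minus)
    have Kz: "K < Re z" using z s0 by simp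
    have zh: "cball z K \<subseteq> halfplane" by (rule cball_halfplane[OF Kz])
    define \<xi> where "\<xi> b = exp (- (b * of_real \<tau>))" for b :: complex
    have xiq: "norm (\<xi> (z + u x)) \<le> q" if x: "x \<in> \<Omega>" for x
    proof -
      have "- K \<le> Re (u x)" using abs_Re_le_cmod[of "u x"] u_bound[OF x] by linarith
      then have "(Re z - K) * \<tau> \<le> (Re z + Re (u x)) * \<tau>" using \<tau> by (intro mult_right_mono) auto
      then show ?thesis by (simp add: \<xi>_def q_def algebra_simps)
    qed
    have xi4: "norm (\<xi> (z + u x)) \<le> 1/4" if "x \<in> \<Omega>" for x using xiq[OF that] q4 by linarith
    have dFS: "dF \<alpha> \<tau> b = S (\<xi> b)" for b by (simp add: dF_def diff_quot_def S_def \<xi>_def)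
    define e where "e m = exp (- (z * of_real (real m * \<tau>)))" for m
    have em: "norm (e m) \<le> q ^ m" for m
    proof -
      have "norm (e m) = exp (- (Re z * \<tau>)) ^ m"
        by (simp add: e_def exp_of_nat_mult[symmetric] algebra_simps)
      also have "\<dots> \<le> q ^ m" using K_nonneg \<tau> by (intro power_mono) (auto simp: q_def algebra_simps)
      finally show ?thesis .
    qed
    have xm: "\<xi> (z + u x) ^ m = e m * exp (- (of_real (real m * \<tau>) * u x))" for x m
      by (simp add: \<xi>_def e_def exp_of_nat_mult[symmetric] exp_add[symmetric] algebra_simps)
    have emi: "e m * exp (- (of_real (real i * \<tau>) * u x)) = \<xi> (z + u x) ^ i * e (m - i)" if "i < m" for m i x
      unfolding xm using that by (simp add: e_def exp_add[symmetric] of_nat_diff algebra_simps)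
    \<comment> \<open>G^j meets the coefficients d_i only for i \<le> N - j, so \<open>?A j\<close>
      is the missing tail of the symbol; \<open>?B\<close> is the corresponding defect of the
      initial term.\<close>
    let ?A = "\<lambda>j b. dF \<alpha> \<tau> b - (\<Sum>i<Suc (N - j). of_real (d i) * \<xi> b ^ i)"
    let ?B = "\<lambda>b. (\<Sum>m=1..N. \<xi> b ^ m * (\<Sum>i<m. of_real (d i))) - dP0 \<alpha> \<tau> b / of_real \<tau>"
    define P where "P = (\<lambda>x. \<Sum>m=1..N. e m * Gd m x)"
    define r where "r = (\<lambda>x. (\<Sum>j=1..N. e j * (?A j (z + u x) * Gd j x)) + ?B (z + u x) * g x)"
    have xic: "continuous_on halfplane (\<lambda>b. \<xi> b ^ i)" for i unfolding \<xi>_def by (intro continuous_intros)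
    have Ac: "continuous_on halfplane (?A j)" for j
      by (intro continuous_on_diff continuous_on_sum continuous_on_mult continuous_on_const xic d.d.symbol_continuous)
    have Bc: "continuous_on halfplane ?B"
      by (intro continuous_on_diff continuous_on_sum continuous_on_mult continuous_on_divide continuous_on_const xic d.d.symbol_continuous)
        (use \<tau> in auto)
    have GL: "Gd j \<in> L2 \<Omega>" if "j \<in> {1..N}" for j using lap_L2(1)[OF lapv[OF that]] .
    have Aj: "norm (?A j (z + u x)) \<le> M' * q ^ Suc (N - j)" if x: "x \<in> \<Omega>" for j x
    proof -
      have "norm (?A j (z + u x)) \<le> M' * norm (\<xi> (z + u x)) ^ Suc (N - j)"
        unfolding dFS by (rule tail[OF xi4[OF x]]) simp
      also have "\<dots> \<le> M' * q ^ Suc (N - j)" using M'0 xiq[OF x] by (intro mult_left_mono power_mono) auto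
      finally show ?thesis .
    qed
    have Bb: "norm (?B (z + u x)) \<le> CB * q ^ Suc N" if x: "x \<in> \<Omega>" for x
    proof -
      let ?x = "\<xi> (z + u x)"
      have n1: "1/2 \<le> norm (1 - ?x)" using norm_triangle_ineq2[of 1 ?x] xi4[OF x] by simp
      then have ne: "1 - ?x \<noteq> 0" by auto
      have Rp: "0 < Re (z + u x)" using shift_mem0[OF x, of z] zh by (auto simp: halfplane_def)
      have "(1 - ?x) * (dP0 \<alpha> \<tau> (z + u x) / of_real \<tau>) = ?x * S ?x"
        unfolding dP0_via_dF[OF \<tau> Rp] dFS using ne by (simp add: \<xi>_def mult.commute)
      \<comment> \<open>The factor 1 - ?x, bounded below in modulus by 1/2, collapses the double sum
        to a truncated series.\<close>
      then have "(1 - ?x) * ?B (z + u x) = ?x * (\<Sum>i<N. of_real (d i) * ?x ^ i) - ?x ^ Suc N * (\<Sum>i<N. of_real (d i)) - ?x * S ?x"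
        unfolding right_diff_distrib sum_powers_partial_sums by simp
      also have "\<dots> = - (?x * (S ?x - (\<Sum>i<N. of_real (d i) * ?x ^ i))) - ?x ^ Suc N * (\<Sum>i<N. of_real (d i))"
        by (simp add: algebra_simps)
      finally have "norm ((1 - ?x) * ?B (z + u x)) \<le> norm (?x * (S ?x - (\<Sum>i<N. of_real (d i) * ?x ^ i)))
          + norm (?x ^ Suc N * (\<Sum>i<N. of_real (d i)))"
        using norm_triangle_ineq4[of "- (?x * (S ?x - (\<Sum>i<N. of_real (d i) * ?x ^ i)))" "?x ^ Suc N * (\<Sum>i<N. of_real (d i))"]
        by (simp only: norm_minus_cancel)
      also have "\<dots> \<le> norm ?x * (M' * norm ?x ^ N) + norm ?x ^ Suc N * Dn"
        unfolding norm_mult norm_power Dn_def by (intro add_mono mult_left_mono tail xi4[OF x]) auto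
      also have "\<dots> = norm ?x ^ Suc N * (M' + Dn)" by (simp add: algebra_simps)
      also have "\<dots> \<le> q ^ Suc N * (M' + Dn)"
        using xiq[OF x] M'0 by (intro mult_right_mono power_mono) (auto simp: Dn_def)
      finally have *: "norm (1 - ?x) * norm (?B (z + u x)) \<le> q ^ Suc N * (M' + Dn)" by (simp only: norm_mult)
      have "1/2 * norm (?B (z + u x)) \<le> norm (1 - ?x) * norm (?B (z + u x))" using n1 by (intro mult_right_mono) auto
      then have "norm (?B (z + u x)) \<le> 2 * (q ^ Suc N * (M' + Dn))" using * by linarith
      then show ?thesis unfolding CB_def by (simp only: mult_ac)
    qed
    have rL: "r \<in> L2 \<Omega>" unfolding r_def
      by (intro L2_add L2_sum L2_cmult mult_shift_L2[OF zh Ac] mult_shift_L2[OF zh Bc] GL g)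
    have nr: "L2_norm \<Omega> r \<le> (M' * NG + CB * L2_norm \<Omega> g) * q ^ Suc N"
    proof -
      have one: "L2_norm \<Omega> (\<lambda>x. e j * (?A j (z + u x) * Gd j x)) \<le> M' * q ^ Suc N * L2_norm \<Omega> (Gd j)"
        if j: "j \<in> {1..N}" for j
      proof -
        have "L2_norm \<Omega> (\<lambda>x. ?A j (z + u x) * Gd j x) \<le> M' * q ^ Suc (N - j) * L2_norm \<Omega> (Gd j)"
          by (rule mult_shift_norm_le[OF zh Ac GL[OF j] Aj]) (use M'0 q0 in auto)
        then have "L2_norm \<Omega> (\<lambda>x. e j * (?A j (z + u x) * Gd j x)) \<le> q ^ j * (M' * q ^ Suc (N - j) * L2_norm \<Omega> (Gd j))"
          unfolding L2_norm_cmult using em[of j] q0 by (intro mult_mono) auto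
        also have "\<dots> = M' * (q ^ j * q ^ Suc (N - j)) * L2_norm \<Omega> (Gd j)" by simp
        \<comment> \<open>The weight of G^j and the order of its missing tail add up to N + 1,
          whatever j is.\<close>
        also have "q ^ j * q ^ Suc (N - j) = q ^ Suc N" using j by (simp add: power_add[symmetric])
        finally show ?thesis .
      qed
      have sum_le: "L2_norm \<Omega> (\<lambda>x. \<Sum>j\<in>J. e j * (?A j (z + u x) * Gd j x)) \<le> (\<Sum>j\<in>J. M' * q ^ Suc N * L2_norm \<Omega> (Gd j))"
        if "J \<subseteq> {1..N}" for J
      proof -
        have "finite J" using that finite_subset by blast
        then show ?thesis using that
        proof (induction J rule: finite_induct)
          case (insert j J)
          have "L2_norm \<Omega> (\<lambda>x. e j * (?A j (z + u x) * Gd j x) + (\<Sum>j\<in>J. e j * (?A j (z + u x) * Gd j x)))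
            \<le> L2_norm \<Omega> (\<lambda>x. e j * (?A j (z + u x) * Gd j x)) + L2_norm \<Omega> (\<lambda>x. \<Sum>j\<in>J. e j * (?A j (z + u x) * Gd j x))"
            using insert by (intro L2_norm_triangle L2_sum L2_cmult mult_shift_L2[OF zh Ac] GL) auto
          also have "\<dots> \<le> M' * q ^ Suc N * L2_norm \<Omega> (Gd j) + (\<Sum>j\<in>J. M' * q ^ Suc N * L2_norm \<Omega> (Gd j))"
            using insert by (intro add_mono one) auto
          finally show ?case using insert by simp
        qed simp
      qed
      have "L2_norm \<Omega> r \<le> L2_norm \<Omega> (\<lambda>x. \<Sum>j=1..N. e j * (?A j (z + u x) * Gd j x)) + L2_norm \<Omega> (\<lambda>x. ?B (z + u x) * g x)"
        unfolding r_def
        by (intro L2_norm_triangle L2_sum L2_cmult mult_shift_L2[OF zh Ac] mult_shift_L2[OF zh Bc] GL g)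
      also have "\<dots> \<le> (\<Sum>j=1..N. M' * q ^ Suc N * L2_norm \<Omega> (Gd j)) + CB * q ^ Suc N * L2_norm \<Omega> g"
        using CB q0 by (intro add_mono sum_le mult_shift_norm_le[OF zh Bc g Bb]) auto
      also have "\<dots> = (M' * NG + CB * L2_norm \<Omega> g) * q ^ Suc N"
        unfolding NG_def by (simp add: sum_distrib_left algebra_simps)
      finally show ?thesis .
    qed
    have "AE x in \<mu>. \<forall>m\<in>{1..N}. (\<Sum>i<m. of_real (d i) * exp (- (of_real (real i * \<tau>) * u x)) * Gd (m - i) x) + v m x
        = exp (- (of_real (real m * \<tau>) * u x)) * (\<Sum>i<m. of_real (d i)) * g x"
      by (rule AE_finite_allI) (use eq in auto)
    then have AE: "AE x in \<mu>. (\<Sum>m=1..N. e m * v m x) = r x + dP0 \<alpha> \<tau> (z + u x) * (g x / of_real \<tau>) - dF \<alpha> \<tau> (z + u x) * P x"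
    proof eventually_elim
      case (elim x)
      let ?x = "\<xi> (z + u x)"
      have "(\<Sum>m=1..N. e m * v m x) = (\<Sum>m=1..N. e m * (exp (- (of_real (real m * \<tau>) * u x)) * (\<Sum>i<m. of_real (d i)) * g x
          - (\<Sum>i<m. of_real (d i) * exp (- (of_real (real i * \<tau>) * u x)) * Gd (m - i) x)))"
        using elim by (intro sum.cong refl arg_cong2[where f="(*)"]) (auto simp: eq_diff_eq add.commute)
      also have "\<dots> = (\<Sum>m=1..N. ?x ^ m * (\<Sum>i<m. of_real (d i)) * g x
          - (\<Sum>i<m. of_real (d i) * ?x ^ i * (e (m - i) * Gd (m - i) x)))"
      proof (intro sum.cong refl)
        fix m
        have "e m * (\<Sum>i<m. of_real (d i) * exp (- (of_real (real i * \<tau>) * u x)) * Gd (m - i) x)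
            = (\<Sum>i<m. of_real (d i) * ?x ^ i * (e (m - i) * Gd (m - i) x))"
          unfolding sum_distrib_left
        proof (intro sum.cong refl)
          fix i assume "i \<in> {..<m}"
          then have "i < m" by simp
          have "e m * (of_real (d i) * exp (- (of_real (real i * \<tau>) * u x)) * Gd (m - i) x)
              = of_real (d i) * (e m * exp (- (of_real (real i * \<tau>) * u x))) * Gd (m - i) x" by (simp only: mult_ac)
          then show "e m * (of_real (d i) * exp (- (of_real (real i * \<tau>) * u x)) * Gd (m - i) x)
              = of_real (d i) * ?x ^ i * (e (m - i) * Gd (m - i) x)"
            unfolding emi[OF \<open>i < m\<close>] by (simp only: mult_ac)
        qed
        then show "e m * (exp (- (of_real (real m * \<tau>) * u x)) * (\<Sum>i<m. of_real (d i)) * g x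
            - (\<Sum>i<m. of_real (d i) * exp (- (of_real (real i * \<tau>) * u x)) * Gd (m - i) x))
          = ?x ^ m * (\<Sum>i<m. of_real (d i)) * g x - (\<Sum>i<m. of_real (d i) * ?x ^ i * (e (m - i) * Gd (m - i) x))"
          unfolding right_diff_distrib xm by (simp only: mult_ac)
      qed
      also have "\<dots> = (\<Sum>m=1..N. ?x ^ m * (\<Sum>i<m. of_real (d i))) * g x
          - (\<Sum>j=1..N. \<Sum>i<Suc (N - j). of_real (d i) * ?x ^ i * (e j * Gd j x))"
        unfolding sum_subtractf sum_convolution_swap[symmetric] by (simp only: sum_distrib_right)
      also have "\<dots> = r x + dP0 \<alpha> \<tau> (z + u x) * (g x / of_real \<tau>) - dF \<alpha> \<tau> (z + u x) * P x"
        unfolding r_def P_def sum_distrib_right[symmetric] left_diff_distrib right_diff_distrib sum_subtractf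
        by (simp add: sum_distrib_left mult_ac)
      finally show ?case .
    qed
    have lP: "lap P (\<lambda>x. \<Sum>m=1..N. e m * v m x)"
      unfolding P_def by (intro lap_sum lap_cmult lapv)
    have PL: "P \<in> L2 \<Omega>" by (rule lap_L2(1)[OF lP])
    have gt: "(\<lambda>x. g x / of_real \<tau>) \<in> L2 \<Omega>" using L2_cmult[OF g, of "1 / of_real \<tau>"] by simp
    have rP: "is_resolvent \<Omega> (\<lambda>x. dF \<alpha> \<tau> (z + u x)) (\<lambda>x. r x + dP0 \<alpha> \<tau> (z + u x) * (g x / of_real \<tau>)) P"
      unfolding is_resolvent_def
      by (rule lap_cong_AE[OF lP _ AE])
         (intro L2_diff L2_add rL mult_shift_L2[OF zh] d.d.symbol_continuous gt PL)
    have "lap (dsol \<tau> g z) (\<lambda>x. dP0 \<alpha> \<tau> (z + u x) * g x - dF \<alpha> \<tau> (z + u x) * dsol \<tau> g z x)"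
      using d.d.sol_resolvent(2)[OF g zh] by (simp add: is_resolvent_def)
    from lap_cmult[OF this, of "1 / of_real \<tau>"]
    have rY: "is_resolvent \<Omega> (\<lambda>x. dF \<alpha> \<tau> (z + u x)) (\<lambda>x. dP0 \<alpha> \<tau> (z + u x) * (g x / of_real \<tau>)) (\<lambda>x. dsol \<tau> g z x / of_real \<tau>)"
      by (simp add: is_resolvent_def diff_divide_distrib)
    have rd: "is_resolvent \<Omega> (\<lambda>x. dF \<alpha> \<tau> (z + u x)) r (\<lambda>x. P x - dsol \<tau> g z x / of_real \<tau>)"
      using is_resolvent_diff[OF rP rY] by simp
    have "L2_norm \<Omega> (\<lambda>x. P x - dsol \<tau> g z x / of_real \<tau>) \<le> L2_norm \<Omega> r / c"
    proof (rule resolvent_bound[OF rd rL c])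
      fix x assume x: "x \<in> \<Omega>"
      let ?x = "\<xi> (z + u x)" and ?d = "diff_quot \<tau> (z + u x)"
      have Rp: "0 < Re (z + u x)" using shift_mem0[OF x, of z] zh by (auto simp: halfplane_def)
      have "?d \<in> sector" using diff_quot_Re_pos[OF \<tau> Rp] halfplane_sector by (auto simp: halfplane_def)
      then have 1: "\<omega> * norm ?d powr \<alpha> \<le> Re (dF \<alpha> \<tau> (z + u x))" using sector_Re by (simp add: dF_def cF_def)
      have "1/2 \<le> norm (1 - ?x)" using norm_triangle_ineq2[of 1 ?x] xi4[OF x] by simp
      then have "1/2 / \<tau> \<le> norm (1 - ?x) / \<tau>" using \<tau> by (intro divide_right_mono) auto
      then have "1 / (2 * \<tau>) \<le> norm ?d" using \<tau> by (simp add: diff_quot_def norm_divide \<xi>_def)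
      then have "(1 / (2 * \<tau>)) powr \<alpha> \<le> norm ?d powr \<alpha>" using \<tau> \<alpha>01 by (intro powr_mono2) auto
      then have "c \<le> \<omega> * norm ?d powr \<alpha>" unfolding c_def using \<omega>_pos by (intro mult_left_mono) auto
      then show "c \<le> Re (dF \<alpha> \<tau> (z + u x))" using 1 by linarith
    qed
    also have "\<dots> \<le> (M' * NG + CB * L2_norm \<Omega> g) * q ^ Suc N / c" using c by (intro divide_right_mono nr) auto
    finally show ?thesis by (simp add: P_def e_def q_def)
  qed
  then show ?thesis using s0 by blast
qed

text \<open>The discrete symbols depend on z only through exp(-z \<tau>). Since the data of
  \<open>resolv\<close> agree literally, so do the chosen functions, not merely almost
  everywhere.\<close>

lemma dsol_periodic:
  assumes "0 < \<tau>"
  shows "dsol \<tau> g (z + of_real (2 * pi / \<tau>) * \<i>) = dsol \<tau> g z"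
    "dsol1 \<tau> g (z + of_real (2 * pi / \<tau>) * \<i>) = dsol1 \<tau> g z"
proof -
  interpret d: symbol_pair \<Omega> u K \<alpha> sector "cF \<alpha>" "cP0 \<alpha>" "cP1 \<alpha>" "cP2 \<alpha>"
    halfplane "dF \<alpha> \<tau>" "dP0 \<alpha> \<tau>" "dP1 \<alpha> \<tau>" "dP2 \<alpha> \<tau>"
    by (rule discrete_symbol_pair[OF assms])
  let ?p = "of_real (2 * pi / \<tau>) * \<i>"
  have e: "exp (- ((z + ?p + w) * of_real \<tau>)) = exp (- ((z + w) * of_real \<tau>))" for w
  proof -
    have "- ((z + ?p + w) * of_real \<tau>) = - ((z + w) * of_real \<tau>) - 2 * of_real pi * \<i>"
      using assms by (simp add: algebra_simps)
    then show ?thesis by (simp add: exp_diff)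
  qed
  have q: "diff_quot \<tau> (z + ?p + w) = diff_quot \<tau> (z + w)" for w
    unfolding diff_quot_def e ..
  have s: "dF \<alpha> \<tau> (z + ?p + w) = dF \<alpha> \<tau> (z + w)" "dP0 \<alpha> \<tau> (z + ?p + w) = dP0 \<alpha> \<tau> (z + w)"
      "dP1 \<alpha> \<tau> (z + ?p + w) = dP1 \<alpha> \<tau> (z + w)" for w
    unfolding dF_def dP0_def dP1_def q e by (rule refl)+
  show 1: "dsol \<tau> g (z + ?p) = dsol \<tau> g z" unfolding d.d.sol_def s ..
  show "dsol1 \<tau> g (z + ?p) = dsol1 \<tau> g z" unfolding d.d.sol1_def s 1 ..
qed

text \<open>Integration over one period extracts the coefficient G^n of the generating polynomial.
  The increments of the primitives for the exact transform and for the polynomial do not depend on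
  z, and the difference of their integrands decays as Re z grows, so the increments agree.\<close>

lemma discrete_representation:
  assumes \<tau>: "0 < \<tau>" and d: "BE_coeffs \<alpha> \<tau> d" and g: "g \<in> L2 \<Omega>" and f: "f \<in> L2 \<Omega>"
    and lapv: "\<And>m. m \<in> {1..N} \<Longrightarrow> lap (Gd m) (v m)"
    and eq: "\<And>m. m \<in> {1..N} \<Longrightarrow> AE x in \<mu>.
      (\<Sum>i<m. of_real (d i) * exp (- (of_real (real i * \<tau>) * u x)) * Gd (m - i) x) + v m x
        = exp (- (of_real (real m * \<tau>) * u x)) * (\<Sum>i<m. of_real (d i)) * g x"
    and n: "n \<in> {1..N}" and t: "t = real n * \<tau>"
    and \<Phi>: "\<And>z. K < Re z \<Longrightarrow> (\<Phi> has_field_derivative exp (z * of_real t) * L2_inner \<Omega> (dsol2 \<tau> g z) f) (at z)"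
    and z0: "K < Re z0"
  shows "\<Phi> (z0 + of_real (2 * pi / \<tau>) * \<i>) - \<Phi> z0 = 2 * of_real pi * \<i> * (of_real t ^ 2 * L2_inner \<Omega> (Gd n) f)"
proof -
  interpret d: symbol_pair \<Omega> u K \<alpha> sector "cF \<alpha>" "cP0 \<alpha>" "cP1 \<alpha>" "cP2 \<alpha>"
    halfplane "dF \<alpha> \<tau>" "dP0 \<alpha> \<tau>" "dP1 \<alpha> \<tau>" "dP2 \<alpha> \<tau>"
    by (rule discrete_symbol_pair[OF \<tau>])
  define p where "p = of_real (2 * pi / \<tau>) * \<i>"
  have p: "Re p = 0" by (simp add: p_def)
  have t0: "0 < t" using \<tau> n t by simp
  let ?H = "{z. K < Re z}"
  define Y where "Y z = L2_inner \<Omega> (dsol \<tau> g z) f" for z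
  define Y1 where "Y1 z = L2_inner \<Omega> (dsol1 \<tau> g z) f" for z
  have Yp: "Y (z + p) = Y z" "Y1 (z + p) = Y1 z" for z
    unfolding Y_def Y1_def p_def dsol_periodic[OF \<tau>] by (rule refl)+
  have ep: "exp ((z + p) * of_real t) = exp (z * of_real t)" for z
  proof -
    have "(z + p) * of_real t = z * of_real t + \<i> * (of_int (int n) * (of_real pi * 2))"
      using \<tau> by (simp add: p_def t algebra_simps)
    then show ?thesis by (simp only: exp_plus_2pin)
  qed
  define \<Psi> where "\<Psi> z = (\<Phi> z - exp (z * of_real t) * Y1 z + of_real t * (exp (z * of_real t) * Y z)) / of_real t ^ 2" for z
  have \<Psi>: "(\<Psi> has_field_derivative exp (z * of_real t) * Y z) (at z)" if z: "K < Re z" for z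
    unfolding \<Psi>_def[abs_def] Y_def[abs_def] Y1_def[abs_def]
    by (rule primitive_by_parts[OF d.d.inner_sol_deriv(1)[OF g cball_halfplane[OF z] f]
        d.d.inner_sol_deriv(2)[OF g cball_halfplane[OF z] f] refl \<Phi>[OF z]]) (use t0 in simp)
  have \<Phi>\<Psi>: "\<Phi> (z + p) - \<Phi> z = of_real t ^ 2 * (\<Psi> (z + p) - \<Psi> z)" for z
  proof -
    have "of_real t ^ 2 * \<Psi> z = \<Phi> z - exp (z * of_real t) * Y1 z + of_real t * (exp (z * of_real t) * Y z)" for z
      using t0 by (simp add: \<Psi>_def)
    then show ?thesis by (simp add: right_diff_distrib ep Yp)
  qed
  define a where "a m = of_real \<tau> * L2_inner \<Omega> (Gd m) f" for m
  define s where "s m = real n * \<tau> - real m * \<tau>" for m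
  \<comment> \<open>A primitive of \<tau> exp(z t) <P(z), f>. The summand m = n of the integrand is
    constant, so its primitive is linear; the others are periodic and drop out of the
    increment.\<close>
  define Q where "Q z = (\<Sum>m=1..N. a m * (if m = n then z else exp (z * of_real (s m)) / of_real (s m)))" for z
  have s_ne: "s m \<noteq> 0" if "m \<noteq> n" for m using that \<tau> by (simp add: s_def)
  have sm_p: "exp ((z + p) * of_real (s m)) = exp (z * of_real (s m))" for z m
  proof -
    have "(z + p) * of_real (s m) = z * of_real (s m) + \<i> * (of_int (int n - int m) * (of_real pi * 2))"
      using \<tau> by (simp add: p_def s_def field_simps)
    then show ?thesis by (simp only: exp_plus_2pin)
  qed
  have Q_per: "Q (z + p) - Q z = 2 * of_real pi * \<i> * L2_inner \<Omega> (Gd n) f" for z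
  proof -
    have "Q (z + p) - Q z = (\<Sum>m=1..N. if m = n then a m * p else 0)"
      unfolding Q_def sum_subtractf[symmetric] by (intro sum.cong refl) (auto simp: sm_p distrib_left)
    also have "\<dots> = a n * p" using n by simp
    finally show ?thesis using \<tau> by (simp add: a_def p_def)
  qed
  have Q_deriv: "(Q has_field_derivative (\<Sum>m=1..N. a m * exp (z * of_real (s m)))) (at z)" for z
    unfolding Q_def[abs_def]
  proof (intro DERIV_sum DERIV_cmult)
    fix m
    show "((\<lambda>z. if m = n then z else exp (z * of_real (s m)) / of_real (s m)) has_field_derivative exp (z * of_real (s m))) (at z)"
    proof (cases "m = n")
      case True then show ?thesis by (simp add: s_def)
    next
      case False
      have "((\<lambda>z. exp (z * of_real (s m)) / of_real (s m)) has_field_derivative exp (z * of_real (s m))) (at z)"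
        using s_ne[OF False] by (auto intro!: derivative_eq_intros)
      then show ?thesis using False by simp
    qed
  qed
  define \<Delta> where "\<Delta> z = \<Psi> z - Q z" for z
  define P where "P z = (\<lambda>x. \<Sum>m=1..N. exp (- (z * of_real (real m * \<tau>))) * Gd m x)" for z
  have GL: "Gd j \<in> L2 \<Omega>" if "j \<in> {1..N}" for j using lap_L2(1)[OF lapv[OF that]] .
  have inner_P: "L2_inner \<Omega> (P z) f = (\<Sum>m=1..N. exp (- (z * of_real (real m * \<tau>))) * L2_inner \<Omega> (Gd m) f)" for z
  proof -
    have "L2_inner \<Omega> (\<lambda>x. \<Sum>m\<in>J. exp (- (z * of_real (real m * \<tau>))) * Gd m x) f
        = (\<Sum>m\<in>J. exp (- (z * of_real (real m * \<tau>))) * L2_inner \<Omega> (Gd m) f)" if "J \<subseteq> {1..N}" for J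
    proof -
      have "finite J" using that finite_subset by blast
      then show ?thesis using that
      proof (induction J rule: finite_induct)
        case (insert j J)
        have "L2_inner \<Omega> (\<lambda>x. exp (- (z * of_real (real j * \<tau>))) * Gd j x + (\<Sum>m\<in>J. exp (- (z * of_real (real m * \<tau>))) * Gd m x)) f
          = L2_inner \<Omega> (\<lambda>x. exp (- (z * of_real (real j * \<tau>))) * Gd j x) f + L2_inner \<Omega> (\<lambda>x. \<Sum>m\<in>J. exp (- (z * of_real (real m * \<tau>))) * Gd m x) f"
          using insert by (intro inner_add_left L2_sum L2_cmult GL f) auto
        then show ?case using insert by (simp only: sum.insert inner_cmult_left insert_subset simp_thms)
      qed simp
    qed
    then show ?thesis unfolding P_def by simp
  qed
  have \<Delta>_deriv: "(\<Delta> has_field_derivative - of_real \<tau> * (exp (z * of_real t) * L2_inner \<Omega> (\<lambda>x. P z x - dsol \<tau> g z x / of_real \<tau>) f)) (at z)"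
    if z: "K < Re z" for z
  proof -
    have PL: "P z \<in> L2 \<Omega>" unfolding P_def by (intro L2_sum L2_cmult GL)
    note dL = d.d.sol_resolvent(1)[OF g cball_halfplane[OF z]]
    have "(\<lambda>x. P z x - dsol \<tau> g z x / of_real \<tau>) = (\<lambda>x. P z x - (1 / of_real \<tau>) * dsol \<tau> g z x)" by simp
    then have "L2_inner \<Omega> (\<lambda>x. P z x - dsol \<tau> g z x / of_real \<tau>) f = L2_inner \<Omega> (P z) f - (1 / of_real \<tau>) * Y z"
      by (simp only: inner_diff_left[OF PL L2_cmult[OF dL] f] inner_cmult_left Y_def)
    then have "of_real \<tau> * (exp (z * of_real t) * L2_inner \<Omega> (\<lambda>x. P z x - dsol \<tau> g z x / of_real \<tau>) f)
        = of_real \<tau> * (exp (z * of_real t) * L2_inner \<Omega> (P z) f) - exp (z * of_real t) * Y z"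
      using \<tau> by (simp add: right_diff_distrib)
    also have "of_real \<tau> * (exp (z * of_real t) * L2_inner \<Omega> (P z) f) = (\<Sum>m=1..N. a m * exp (z * of_real (s m)))"
      unfolding inner_P sum_distrib_left
    proof (intro sum.cong refl)
      fix m
      have "exp (z * of_real t) * exp (- (z * of_real (real m * \<tau>))) = exp (z * of_real (s m))"
        by (simp add: exp_add[symmetric] s_def t right_diff_distrib)
      then show "of_real \<tau> * (exp (z * of_real t) * (exp (- (z * of_real (real m * \<tau>))) * L2_inner \<Omega> (Gd m) f)) = a m * exp (z * of_real (s m))"
        unfolding a_def by (metis mult.assoc mult.commute)
    qed
    finally have "exp (z * of_real t) * Y z - (\<Sum>m=1..N. a m * exp (z * of_real (s m)))
      = - of_real \<tau> * (exp (z * of_real t) * L2_inner \<Omega> (\<lambda>x. P z x - dsol \<tau> g z x / of_real \<tau>) f)" by simp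
    then show ?thesis unfolding \<Delta>_def[abs_def] using DERIV_diff[OF \<Psi>[OF z] Q_deriv] by simp
  qed
  \<comment> \<open>Both integrands have period \<open>p\<close>, so this increment is the same
    everywhere and may be estimated far to the right.\<close>
  have const: "\<Delta> (z + p) - \<Delta> z = \<Delta> (z0 + p) - \<Delta> z0" if z: "K < Re z" for z
  proof -
    have "\<Psi> (z + p) - \<Psi> z = \<Psi> (z0 + p) - \<Psi> z0"
    proof -
      have "\<exists>c. \<forall>z\<in>?H. \<Psi> (z + p) - \<Psi> z = c"
      proof (rule has_field_derivative_zero_constant)
        show "convex ?H" by (rule convex_halfspace_Re_gt)
        fix w assume w: "w \<in> ?H"
        have "((\<lambda>z. \<Psi> (z + p)) has_field_derivative exp ((w + p) * of_real t) * Y (w + p) * 1) (at w)"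
        proof (rule DERIV_chain2[where f=\<Psi> and g="\<lambda>z. z + p"])
          show "(\<Psi> has_field_derivative exp ((w + p) * of_real t) * Y (w + p)) (at (w + p))"
            by (rule \<Psi>) (use w p in simp)
          show "((\<lambda>z. z + p) has_field_derivative 1) (at w)" by (auto intro!: derivative_eq_intros)
        qed
        have "K < Re w" using w by simp
        from DERIV_diff[OF \<open>((\<lambda>z. \<Psi> (z + p)) has_field_derivative _) (at w)\<close> \<Psi>[OF this]]
        show "((\<lambda>z. \<Psi> (z + p) - \<Psi> z) has_field_derivative 0) (at w within ?H)"
          by (simp add: ep Yp has_field_derivative_at_within)
      qed
      then obtain c where "\<And>z. K < Re z \<Longrightarrow> \<Psi> (z + p) - \<Psi> z = c" by auto
      then show ?thesis using z z0 by simp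
    qed
    moreover have "Q (z + p) - Q z = Q (z0 + p) - Q z0" unfolding Q_per ..
    moreover have "\<Delta> (w + p) - \<Delta> w = (\<Psi> (w + p) - \<Psi> w) - (Q (w + p) - Q w)" for w by (simp add: \<Delta>_def)
    ultimately show ?thesis by simp
  qed
  obtain C s0 where C: "K < s0" "\<And>z. s0 \<le> Re z \<Longrightarrow>
      L2_norm \<Omega> (\<lambda>x. P z x - dsol \<tau> g z x / of_real \<tau>) \<le> C * exp (- (Re z - K) * \<tau>) ^ Suc N"
    using discrete_generating_bound[OF \<tau> d g lapv eq] unfolding P_def by blast
  define E where "E = \<tau> * (\<bar>C\<bar> * exp (K * \<tau>) ^ Suc N * L2_norm \<Omega> f) * norm p"
  have bound: "norm (\<Delta> (z0 + p) - \<Delta> z0) \<le> E * exp (- (r * \<tau>))" if r: "max s0 0 \<le> r" for r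
  proof -
    \<comment> \<open>A real base point: on the vertical segment from \<open>z\<close> to
      \<open>z + p\<close> the real part is constantly \<open>r\<close>.\<close>
    define z where "z = complex_of_real r"
    have Kz: "K < Re z" "s0 \<le> Re z" using r C(1) by (auto simp: z_def)
    have "norm (\<Delta> (z + p) - \<Delta> z) \<le> (\<tau> * (\<bar>C\<bar> * exp (K * \<tau>) ^ Suc N * L2_norm \<Omega> f) * exp (- (r * \<tau>))) * norm (z + p - z)"
    proof (rule field_differentiable_bound[where S="closed_segment z (z + p)"])
      fix w assume "w \<in> closed_segment z (z + p)"
      then have "Re w = r" using p by (auto simp: closed_segment_def z_def algebra_simps)
      then have w: "K < Re w" "s0 \<le> Re w" "Re w = r" using Kz by (auto simp: z_def)
      show "(\<Delta> has_field_derivative - of_real \<tau> * (exp (w * of_real t) * L2_inner \<Omega> (\<lambda>x. P w x - dsol \<tau> g w x / of_real \<tau>) f)) (at w within closed_segment z (z + p))"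
        by (rule has_field_derivative_at_within[OF \<Delta>_deriv[OF w(1)]])
      have PL: "P w \<in> L2 \<Omega>" unfolding P_def by (intro L2_sum L2_cmult GL)
      have "(\<lambda>x. dsol \<tau> g w x / of_real \<tau>) \<in> L2 \<Omega>"
        using L2_cmult[OF d.d.sol_resolvent(1)[OF g cball_halfplane[OF w(1)]], of "1 / of_real \<tau>"] by simp
      from Cauchy_Schwarz_L2[OF L2_diff[OF PL this] f]
      have "norm (L2_inner \<Omega> (\<lambda>x. P w x - dsol \<tau> g w x / of_real \<tau>) f)
          \<le> L2_norm \<Omega> (\<lambda>x. P w x - dsol \<tau> g w x / of_real \<tau>) * L2_norm \<Omega> f" .
      also have "\<dots> \<le> (C * exp (- (Re w - K) * \<tau>) ^ Suc N) * L2_norm \<Omega> f" by (intro mult_right_mono C(2) w) simp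
      also have "\<dots> \<le> (\<bar>C\<bar> * exp (- (r - K) * \<tau>) ^ Suc N) * L2_norm \<Omega> f"
        unfolding w(3) by (intro mult_right_mono) auto
      finally have i: "norm (L2_inner \<Omega> (\<lambda>x. P w x - dsol \<tau> g w x / of_real \<tau>) f)
          \<le> (\<bar>C\<bar> * exp (- (r - K) * \<tau>) ^ Suc N) * L2_norm \<Omega> f" .
      have e: "exp (- (r - K) * \<tau>) ^ Suc N = exp (K * \<tau>) ^ Suc N * exp (- (r * (real (Suc N) * \<tau>)))"
        by (simp only: exp_of_nat_mult[symmetric] exp_add[symmetric]) (simp add: algebra_simps)
      \<comment> \<open>Since n \<le> N, the residual of order N + 1 beats the growth exp(r t) by a
        factor exp(-r \<tau>).\<close>
      have "real n * \<tau> + \<tau> \<le> real (Suc N) * \<tau>" using n \<tau> by (simp add: distrib_right mult_right_mono)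
      then have "r * (t - real (Suc N) * \<tau>) \<le> r * (- \<tau>)" using r t by (intro mult_left_mono) auto
      then have "exp (r * t) * exp (- (r * (real (Suc N) * \<tau>))) \<le> exp (- (r * \<tau>))"
        by (simp add: exp_add[symmetric] right_diff_distrib)
      then have e2: "exp (r * t) * exp (- (r - K) * \<tau>) ^ Suc N \<le> exp (K * \<tau>) ^ Suc N * exp (- (r * \<tau>))"
        unfolding e using mult_left_mono[of "exp (r * t) * exp (- (r * (real (Suc N) * \<tau>)))" "exp (- (r * \<tau>))" "exp (K * \<tau>) ^ Suc N"]
        by (simp add: mult_ac)
      have "norm (- of_real \<tau> * (exp (w * of_real t) * L2_inner \<Omega> (\<lambda>x. P w x - dsol \<tau> g w x / of_real \<tau>) f))
          = \<tau> * (exp (r * t) * norm (L2_inner \<Omega> (\<lambda>x. P w x - dsol \<tau> g w x / of_real \<tau>) f))"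
        using \<tau> w(3) by (simp add: norm_mult)
      also have "\<dots> \<le> \<tau> * (exp (r * t) * ((\<bar>C\<bar> * exp (- (r - K) * \<tau>) ^ Suc N) * L2_norm \<Omega> f))"
        using \<tau> by (intro mult_left_mono i) auto
      also have "\<dots> = \<tau> * \<bar>C\<bar> * L2_norm \<Omega> f * (exp (r * t) * exp (- (r - K) * \<tau>) ^ Suc N)" by (simp only: mult_ac)
      also have "\<dots> \<le> \<tau> * \<bar>C\<bar> * L2_norm \<Omega> f * (exp (K * \<tau>) ^ Suc N * exp (- (r * \<tau>)))"
        using \<tau> by (intro mult_left_mono e2) auto
      finally show "norm (- of_real \<tau> * (exp (w * of_real t) * L2_inner \<Omega> (\<lambda>x. P w x - dsol \<tau> g w x / of_real \<tau>) f))
          \<le> \<tau> * (\<bar>C\<bar> * exp (K * \<tau>) ^ Suc N * L2_norm \<Omega> f) * exp (- (r * \<tau>))" by (simp only: mult_ac)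
    qed auto
    then show ?thesis unfolding const[OF Kz(1)] by (simp add: E_def mult_ac)
  qed
  have "norm (\<Delta> (z0 + p) - \<Delta> z0) \<le> 0"
  proof (rule tendsto_lowerbound)
    have "((\<lambda>r. exp (- (r * \<tau>))) \<longlongrightarrow> 0) at_top"
      by (rule filterlim_compose[OF exp_at_bot], rule filterlim_uminus_at_bot[THEN iffD2])
         (simp add: filterlim_at_top_mult_tendsto_pos[OF tendsto_const \<tau> filterlim_ident] mult.commute)
    from tendsto_mult_left[OF this, of E]
    show "((\<lambda>r. E * exp (- (r * \<tau>))) \<longlongrightarrow> 0) at_top" by simp
    show "\<forall>\<^sub>F r in at_top. norm (\<Delta> (z0 + p) - \<Delta> z0) \<le> E * exp (- (r * \<tau>))"
      using eventually_ge_at_top[of "max s0 0"] by eventually_elim (rule bound)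
  qed simp
  then have "\<Psi> (z0 + p) - \<Psi> z0 = Q (z0 + p) - Q z0" by (simp add: \<Delta>_def algebra_simps)
  then have "\<Phi> (z0 + p) - \<Phi> z0 = of_real t ^ 2 * (2 * of_real pi * \<i> * L2_inner \<Omega> (Gd n) f)"
    unfolding \<Phi>\<Psi> Q_per by simp
  then show ?thesis by (simp add: p_def mult_ac)
qed

end

section \<open>The error estimate\<close>

text \<open>A mean value inequality with the explicit majorant \<open>h\<close>; it takes the place
  of integrating the modulus of the integrand.\<close>

lemma vertical_difference_bound:
  assumes "a \<le> b" and \<Phi>: "\<And>y. a \<le> y \<Longrightarrow> y \<le> b \<Longrightarrow> (\<Phi> has_field_derivative F (Complex \<sigma> y)) (at (Complex \<sigma> y))"
    and h: "\<And>y. a \<le> y \<Longrightarrow> y \<le> b \<Longrightarrow> (h has_real_derivative h' y) (at y)"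
    and le: "\<And>y. a \<le> y \<Longrightarrow> y \<le> b \<Longrightarrow> norm (F (Complex \<sigma> y)) \<le> h' y"
  shows "norm (\<Phi> (Complex \<sigma> b) - \<Phi> (Complex \<sigma> a)) \<le> h b - h a"
proof (cases "a = b")
  case False
  have d: "((\<lambda>y. \<Phi> (Complex \<sigma> y)) has_vector_derivative \<i> * F (Complex \<sigma> y)) (at y)" if y: "a \<le> y" "y \<le> b" for y
  proof -
    have "Complex \<sigma> = (\<lambda>y. of_real \<sigma> + of_real y * \<i>)" by (simp add: complex_eq_iff fun_eq_iff)
    then have "(Complex \<sigma> has_vector_derivative \<i>) (at y)" by (auto intro!: derivative_eq_intros)
    from field_vector_diff_chain_at[OF this \<Phi>[OF y]] show ?thesis by (simp add: o_def)
  qed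
  show ?thesis
  proof (rule differentiable_bound_general[where f="\<lambda>y. \<Phi> (Complex \<sigma> y)" and \<phi>=h])
    show "a < b" using False assms(1) by simp
    show "continuous_on {a..b} h" by (intro continuous_at_imp_continuous_on ballI DERIV_isCont) (use h in auto)
    show "continuous_on {a..b} (\<lambda>y. \<Phi> (Complex \<sigma> y))"
      by (intro continuous_at_imp_continuous_on ballI) (use d has_vector_derivative_continuous in fastforce)
    fix y assume y: "a < y" "y < b"
    show "((\<lambda>y. \<Phi> (Complex \<sigma> y)) has_vector_derivative \<i> * F (Complex \<sigma> y)) (at y)" by (rule d) (use y in auto)
    show "(h has_vector_derivative h' y) (at y)"
      using h[of y] y by (simp add: has_real_derivative_iff_has_vector_derivative)
    show "norm (\<i> * F (Complex \<sigma> y)) \<le> h' y" using le[of y] y by (simp add: norm_mult)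
  qed
qed simp

lemma has_integral_along_contour_cong:
  assumes "has_integral_along_contour f \<theta> \<kappa> I" and fg: "\<And>z. z \<in> contour \<theta> \<kappa> \<Longrightarrow> f z = g z"
    and "0 < \<kappa>" "0 < \<theta>" "\<theta> < pi"
  shows "has_integral_along_contour g \<theta> \<kappa> I"
proof -
  obtain Il Ia Iu where *: "((\<lambda>r. f (rcis r (- \<theta>)) * cis (- \<theta>)) has_integral Il) {\<kappa>..}"
      "(f has_contour_integral Ia) (part_circlepath 0 \<kappa> (- \<theta>) \<theta>)"
      "((\<lambda>r. f (rcis r \<theta>) * cis \<theta>) has_integral Iu) {\<kappa>..}" "I = - Il + Ia + Iu"
    using assms(1) unfolding has_integral_along_contour_def by blast
  have c: "rcis r \<theta> \<in> contour \<theta> \<kappa>" "rcis r (- \<theta>) \<in> contour \<theta> \<kappa>" if "\<kappa> \<le> r" for r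
    using that by (auto simp: contour_def)
  have "((\<lambda>r. g (rcis r (- \<theta>)) * cis (- \<theta>)) has_integral Il) {\<kappa>..}"
    by (rule has_integral_eq[OF _ *(1)]) (use fg c in auto)
  moreover have "((\<lambda>r. g (rcis r \<theta>) * cis \<theta>) has_integral Iu) {\<kappa>..}"
    by (rule has_integral_eq[OF _ *(3)]) (use fg c in auto)
  moreover have "(g has_contour_integral Ia) (part_circlepath 0 \<kappa> (- \<theta>) \<theta>)"
    by (rule has_contour_integral_eq[OF *(2)]) (use fg arc_in_contour[OF assms(3-5)] in auto)
  ultimately show ?thesis unfolding has_integral_along_contour_def using *(4) by blast
qed

text \<open>On the arc the argument is at most \<theta> in modulus and the cosine decreases; on the
  rays the second relation is an equality.\<close>

lemma contour_lower_bounds: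
  assumes "z \<in> contour \<theta> \<kappa>" "0 < \<kappa>" "0 < \<theta>" "\<theta> < pi"
  shows "\<kappa> \<le> norm z" "norm z * cos \<theta> \<le> Re z"
proof -
  have "\<kappa> \<le> norm z \<and> norm z * cos \<theta> \<le> Re z"
    using assms(1) unfolding contour_def
  proof (elim UnE CollectE exE conjE)
    assume z: "norm z = \<kappa>" "\<bar>Arg z\<bar> \<le> \<theta>"
    then have "cos \<theta> \<le> cos \<bar>Arg z\<bar>" using assms by (intro cos_monotone_0_pi_le) auto
    then have "norm z * cos \<theta> \<le> norm z * cos (Arg z)" by (simp add: mult_left_mono)
    moreover have "z \<noteq> 0" using z assms by auto
    ultimately show ?thesis using z assms(2) by (simp add: cos_Arg)
  qed (use assms in auto)
  then show "\<kappa> \<le> norm z" "norm z * cos \<theta> \<le> Re z" by auto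
qed

section \<open>Representation of the solution and assembly of the estimate\<close>

context fractional_problem begin

text \<open>Moving a point by at most K changes Re z + sin \<phi> |z| by at most K (1 + sin \<phi>);
  with this offset the ball of radius K around each point stays in \<open>sector\<close>.\<close>

definition region :: "complex set" where "region = cut_region (sin \<phi>) (K * (1 + sin \<phi>))"

lemma region_cball: "z \<in> region \<Longrightarrow> cball z K \<subseteq> sector"
proof
  fix b assume z: "z \<in> region" and b: "b \<in> cball z K"
  have "norm (z - b) \<le> K" using b by (simp add: dist_norm)
  then have "Re z - K \<le> Re b" "norm z - K \<le> norm b"
    using complex_Re_le_cmod[of "z - b"] norm_triangle_ineq2[of z b] by auto
  then have "sin \<phi> * (norm z - K) + (Re z - K) \<le> sin \<phi> * norm b + Re b"
    using \<phi>(4) by (intro add_mono mult_left_mono) auto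
  then show "b \<in> sector" using z by (simp add: region_def cut_region_def sector_def algebra_simps)
qed

lemma region_halfplane: "K < Re z \<Longrightarrow> z \<in> region"
  unfolding region_def
  by (rule halfplane_cut_region) (use \<phi>(4) K_nonneg in \<open>auto intro: mult_strict_right_mono add_pos_pos\<close>)

text \<open>One admissible pair \<theta>, \<kappa> is picked from the nested filters so that the
  contour lies in \<open>region\<close>, and the contour is then replaced by the vertical line. The
  number \<open>s\<close> is sin \<theta>; it only rescales the truncation height.\<close>

lemma solution_representation:
  assumes g: "g \<in> L2 \<Omega>" and f: "f \<in> L2 \<Omega>" and sol: "is_solution \<Omega> \<alpha> \<rho> T U g G"
    and u: "\<And>x. u x = \<rho> * U x" and t: "0 < t" "t \<le> T" and \<sigma>: "0 < \<sigma>"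
    and \<Phi>: "\<And>z. z \<in> region \<Longrightarrow> (\<Phi> has_field_derivative exp (z * of_real t) * L2_inner \<Omega> (sol2 g z) f) (at z)"
  obtains s where "0 < s" "((\<lambda>b. \<Phi> (Complex \<sigma> (b * s)) - \<Phi> (Complex \<sigma> (- (b * s)))) \<longlongrightarrow>
    2 * of_real pi * \<i> * (of_real t ^ 2 * L2_inner \<Omega> (G t) f)) at_top"
proof -
  define c where "c = K * (1 + sin \<phi>)"
  have c0: "0 \<le> c" using K_nonneg \<phi>(4) by (simp add: c_def)
  define k where "k = 1 / (2 * of_real pi * \<i>)"
  have "((\<lambda>\<theta>. cos \<theta>) \<longlongrightarrow> cos (pi / 2)) (at_right (pi / 2))" by (intro tendsto_intros)
  \<comment> \<open>Half of sin \<phi> is reserved for this condition on \<theta>, the other half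
    for absorbing the offset \<open>c\<close> through the size of \<kappa>.\<close>
  then have ev1: "\<forall>\<^sub>F \<theta> in at_right (pi / 2). - (sin \<phi> / 2) < cos \<theta>"
    by (rule order_tendstoD) (use \<phi>(4) in simp)
  have ev2: "\<forall>\<^sub>F \<theta> in at_right (pi / 2). \<theta> \<in> {pi / 2<..<pi}"
    by (rule eventually_at_right_real) (use pi_gt_zero in simp)
  note ev3 = conjunct2[OF sol[unfolded is_solution_def]]
  from eventually_happens'[OF trivial_limit_at_right_real eventually_conj[OF ev1 eventually_conj[OF ev2 ev3]]]
  obtain \<theta> where \<theta>: "- (sin \<phi> / 2) < cos \<theta>" "pi / 2 < \<theta>" "\<theta> < pi" and ev: "\<forall>\<^sub>F \<kappa> in at_top. \<exists>w.
        (\<forall>z\<in>contour \<theta> \<kappa>. is_resolvent \<Omega> (\<lambda>x. beta \<rho> U z x powr of_real \<alpha>)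
            (\<lambda>x. beta \<rho> U z x powr of_real (\<alpha> - 1) * g x) (w z)) \<and>
        (\<forall>t\<in>{0<..T}. has_L2_integral_along_contour \<Omega>
            (\<lambda>z x. 1 / (2 * of_real pi * \<i>) * exp (z * of_real t) * w z x) \<theta> \<kappa> (G t))"
    unfolding greaterThanLessThan_iff by blast
  from eventually_happens'[OF trivial_limit_at_top_linorder eventually_conj[OF eventually_gt_at_top[of "2 * c / sin \<phi>"] ev]]
  obtain \<kappa> w where \<kappa>: "2 * c / sin \<phi> < \<kappa>" and w: "\<And>z. z \<in> contour \<theta> \<kappa> \<Longrightarrow> is_resolvent \<Omega> (\<lambda>x. beta \<rho> U z x powr of_real \<alpha>)
            (\<lambda>x. beta \<rho> U z x powr of_real (\<alpha> - 1) * g x) (w z)"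
    and int: "has_L2_integral_along_contour \<Omega>
            (\<lambda>z x. 1 / (2 * of_real pi * \<i>) * exp (z * of_real t) * w z x) \<theta> \<kappa> (G t)"
  proof (elim exE conjE)
    fix \<kappa> w
    assume "2 * c / sin \<phi> < \<kappa>"
      and w: "\<forall>z\<in>contour \<theta> \<kappa>. is_resolvent \<Omega> (\<lambda>x. beta \<rho> U z x powr of_real \<alpha>)
            (\<lambda>x. beta \<rho> U z x powr of_real (\<alpha> - 1) * g x) (w z)"
      and i: "\<forall>t\<in>{0<..T}. has_L2_integral_along_contour \<Omega>
            (\<lambda>z x. 1 / (2 * of_real pi * \<i>) * exp (z * of_real t) * w z x) \<theta> \<kappa> (G t)"
    have "t \<in> {0<..T}" using t by simp
    then show thesis using that[OF \<open>2 * c / sin \<phi> < \<kappa>\<close>, of w] bspec[OF w] bspec[OF i] by blast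
  qed
  have \<theta>0: "0 < \<theta>" using \<theta>(2) pi_gt_zero by linarith
  have \<kappa>0: "0 < \<kappa>" using \<kappa> c0 \<phi>(4) by (meson divide_nonneg_pos le_less_trans mult_nonneg_nonneg zero_le_numeral)
  have reg: "contour \<theta> \<kappa> \<subseteq> region"
  proof
    fix z assume z: "z \<in> contour \<theta> \<kappa>"
    note b = contour_lower_bounds[OF z \<kappa>0 \<theta>0 \<theta>(3)]
    \<comment> \<open>This is the choice \<kappa> > 2 c / sin \<phi>: half of sin \<phi> |z| exceeds
      the offset, the other half outweighs the negative real part on the rays.\<close>
    have "c < sin \<phi> / 2 * \<kappa>" using \<kappa> \<phi>(4) by (simp add: field_simps)
    also have "\<dots> \<le> sin \<phi> / 2 * norm z" using b \<phi>(4) by (intro mult_left_mono) auto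
    also have "\<dots> = norm z * (- (sin \<phi> / 2)) + sin \<phi> * norm z" by simp
    also have "\<dots> \<le> norm z * cos \<theta> + sin \<phi> * norm z" using \<theta>(1) \<phi>(4) by (intro add_mono mult_left_mono) auto
    also have "\<dots> \<le> Re z + sin \<phi> * norm z" using b by simp
    finally show "z \<in> region" by (simp add: region_def cut_region_def c_def)
  qed
  define W where "W z = k * L2_inner \<Omega> (sol g z) f" for z
  define W1 where "W1 z = k * L2_inner \<Omega> (sol1 g z) f" for z
  define W2 where "W2 z = k * L2_inner \<Omega> (sol2 g z) f" for z
  \<comment> \<open>The definition of the solution allows any family \<open>w\<close> of resolvents;
    uniqueness identifies it almost everywhere with \<open>sol g\<close>, hence in every inner
    product.\<close>
  have w_eq: "L2_inner \<Omega> (\<lambda>x. 1 / (2 * of_real pi * \<i>) * exp (z * of_real t) * w z x) f = exp (z * of_real t) * W z"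
    if z: "z \<in> contour \<theta> \<kappa>" for z
  proof -
    have zs: "cball z K \<subseteq> sector" using region_cball reg z by blast
    obtain e where e: "coercive e (\<lambda>x. cF \<alpha> (z + u x))" by (rule F_coercive[OF g zs])
    have r: "is_resolvent \<Omega> (\<lambda>x. cF \<alpha> (z + u x)) (\<lambda>x. cP0 \<alpha> (z + u x) * g x) (w z)"
      using w[OF z] by (simp add: beta_def cF_def cP0_def u)
    have "AE x in \<mu>. w z x = sol g z x"
      by (rule resolvent_unique[OF r sol_resolvent(2)[OF g zs]]) (use e in \<open>auto simp: coercive_def\<close>)
    then have "L2_inner \<Omega> (w z) f = L2_inner \<Omega> (sol g z) f"
      by (intro inner_cong_AE sol_resolvent(1)[OF g zs] f lap_L2(1)[OF r[unfolded is_resolvent_def]])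
    then show ?thesis by (simp only: inner_cmult_left) (simp add: W_def k_def)
  qed
  have "has_integral_along_contour (\<lambda>z. L2_inner \<Omega> (\<lambda>x. 1 / (2 * of_real pi * \<i>) * exp (z * of_real t) * w z x) f) \<theta> \<kappa> (L2_inner \<Omega> (G t) f)"
    using int f unfolding has_L2_integral_along_contour_def by blast
  from has_integral_along_contour_cong[OF this w_eq \<kappa>0 \<theta>0 \<theta>(3)]
  have I: "has_integral_along_contour (\<lambda>z. exp (z * of_real t) * W z) \<theta> \<kappa> (L2_inner \<Omega> (G t) f)" .
  obtain C where C: "0 < C" "\<And>z. 0 < norm z \<Longrightarrow> 2 * K \<le> norm z \<Longrightarrow> cball z K \<subseteq> sector \<Longrightarrow>
     L2_norm \<Omega> (sol g z) \<le> C / norm z * L2_norm \<Omega> g \<and>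
     L2_norm \<Omega> (sol1 g z) \<le> C / norm z ^ 2 * L2_norm \<Omega> g \<and>
     L2_norm \<Omega> (sol2 g z) \<le> C / norm z ^ 3 * L2_norm \<Omega> g"
    using continuous_sol_bounds g by blast
  define D where "D = norm k * C * L2_norm \<Omega> g * L2_norm \<Omega> f"
  have D0: "0 \<le> D" using C(1) by (simp add: D_def)
  have inner_le: "norm (k * L2_inner \<Omega> h f) \<le> D / X" if "h \<in> L2 \<Omega>" "L2_norm \<Omega> h \<le> C / X * L2_norm \<Omega> g" for h X
  proof -
    have "norm (k * L2_inner \<Omega> h f) \<le> norm k * (L2_norm \<Omega> h * L2_norm \<Omega> f)"
      unfolding norm_mult by (intro mult_left_mono Cauchy_Schwarz_L2 that f) simp
    also have "\<dots> \<le> norm k * (C / X * L2_norm \<Omega> g * L2_norm \<Omega> f)"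
      using that(2) by (intro mult_left_mono mult_right_mono) auto
    finally show ?thesis by (simp add: D_def)
  qed
  have bounds: "norm (W z) \<le> D / norm z" "norm (W1 z) \<le> D / norm z ^ 2" "norm (W2 z) \<le> D / norm z ^ 3"
    if z: "z \<in> region" and R: "2 * K + 1 \<le> norm z" for z
  proof -
    have zs: "cball z K \<subseteq> sector" by (rule region_cball[OF z])
    have nz: "0 < norm z" "2 * K \<le> norm z" using R K_nonneg by linarith+
    note b = C(2)[OF nz zs]
    show "norm (W z) \<le> D / norm z" "norm (W1 z) \<le> D / norm z ^ 2" "norm (W2 z) \<le> D / norm z ^ 3"
      unfolding W_def W1_def W2_def
      using inner_le[OF sol_resolvent(1)[OF g zs]] inner_le[OF sol1_resolvent(1)[OF g zs]]
        inner_le[OF sol2_resolvent(1)[OF g zs]] b by blast+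
  qed
  have "((\<lambda>b. k * \<Phi> (Complex \<sigma> (b * sin \<theta>)) - k * \<Phi> (Complex \<sigma> (- (b * sin \<theta>)))) \<longlongrightarrow>
      of_real t ^ 2 * L2_inner \<Omega> (G t) f) at_top"
  \<comment> \<open>The radius 2 K + 1 guarantees both that z is nonzero and that |z| \<ge> 2 K, as
    the bounds on the solution require.\<close>
  proof (rule vertical_representation[where \<eta>="sin \<phi>" and c=c and C=D and R="2 * K + 1" and W=W and ?W1.0=W1 and ?W2.0=W2 and \<Phi>="\<lambda>z. k * \<Phi> z", folded region_def[folded c_def]])
    fix z assume z: "z \<in> region"
    note zs = region_cball[OF z]
    show "(W has_field_derivative W1 z) (at z)" unfolding W_def[abs_def] W1_def
      by (rule DERIV_cmult[OF inner_sol_deriv(1)[OF g zs f]])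
    show "(W1 has_field_derivative W2 z) (at z)" unfolding W1_def[abs_def] W2_def
      by (rule DERIV_cmult[OF inner_sol_deriv(2)[OF g zs f]])
    show "((\<lambda>z. k * \<Phi> z) has_field_derivative exp (z * of_real t) * W2 z) (at z)"
      using DERIV_cmult[OF \<Phi>[OF z], of k] by (simp add: W2_def mult.left_commute)
  qed (use \<phi> D0 bounds \<theta> \<kappa>0 reg t \<sigma> I in auto)
  from tendsto_mult_left[OF this, of "1 / k"]
  have "((\<lambda>b. \<Phi> (Complex \<sigma> (b * sin \<theta>)) - \<Phi> (Complex \<sigma> (- (b * sin \<theta>)))) \<longlongrightarrow>
      2 * of_real pi * \<i> * (of_real t ^ 2 * L2_inner \<Omega> (G t) f)) at_top"
    by (simp add: k_def right_diff_distrib)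
  moreover have "0 < sin \<theta>" using \<theta>0 \<theta>(3) by (rule sin_gt_zero)
  ultimately show ?thesis using that by blast
qed

text \<open>Membership is part of the meaning of the contour integral, and at least one admissible
  pair \<theta>, \<kappa> exists because the filters are nontrivial.\<close>

lemma solution_in_L2:
  assumes sol: "is_solution \<Omega> \<alpha> \<rho> T U g G" and t: "0 < t" "t \<le> T"
  shows "G t \<in> L2 \<Omega>"
proof -
  obtain \<theta> where "\<forall>\<^sub>F \<kappa> in at_top. \<exists>w. (\<forall>z\<in>contour \<theta> \<kappa>. is_resolvent \<Omega> (\<lambda>x. beta \<rho> U z x powr of_real \<alpha>)
            (\<lambda>x. beta \<rho> U z x powr of_real (\<alpha> - 1) * g x) (w z)) \<and>
        (\<forall>t\<in>{0<..T}. has_L2_integral_along_contour \<Omega>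
            (\<lambda>z x. 1 / (2 * of_real pi * \<i>) * exp (z * of_real t) * w z x) \<theta> \<kappa> (G t))"
    using eventually_happens'[OF trivial_limit_at_right_real conjunct2[OF sol[unfolded is_solution_def]]] by blast
  from eventually_happens'[OF trivial_limit_at_top_linorder this] show ?thesis
    using t unfolding has_L2_integral_along_contour_def by (meson greaterThanAtMost_iff)
qed

text \<open>E / |y|^3 has the majorants -E/(2 y^2) on the right and E/(2 y^2) on the left; the
  contribution of the outer end has a favourable sign and is dropped.\<close>

lemma tail_difference_bound:
  assumes ab: "0 < a" "a \<le> b" and E: "0 \<le> E"
    and \<Phi>: "\<And>y. (\<Phi> has_field_derivative F (Complex \<sigma> y)) (at (Complex \<sigma> y))"
    and F: "\<And>y. norm (F (Complex \<sigma> y)) \<le> E / norm (Complex \<sigma> y) ^ 3"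
  shows "norm (\<Phi> (Complex \<sigma> b) - \<Phi> (Complex \<sigma> a)) \<le> E / (2 * a ^ 2)"
    "norm (\<Phi> (Complex \<sigma> (- a)) - \<Phi> (Complex \<sigma> (- b))) \<le> E / (2 * a ^ 2)"
proof -
  have le: "norm (F (Complex \<sigma> y)) \<le> E / \<bar>y\<bar> ^ 3" if "y \<noteq> 0" for y
  proof -
    have "\<bar>y\<bar> ^ 3 \<le> norm (Complex \<sigma> y) ^ 3" using abs_Im_le_cmod[of "Complex \<sigma> y"] by (intro power_mono) auto
    moreover have "0 < \<bar>y\<bar> ^ 3" using that by simp
    ultimately have "E / norm (Complex \<sigma> y) ^ 3 \<le> E / \<bar>y\<bar> ^ 3" using E by (intro divide_left_mono mult_pos_pos) auto
    then show ?thesis using F[of y] by linarith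
  qed
  have d: "((\<lambda>y. - (E / 2) * inverse (y ^ 2)) has_real_derivative E / y ^ 3) (at y)" if "y \<noteq> 0" for y :: real
    using that by (auto intro!: derivative_eq_intros simp: power2_eq_square power3_eq_cube field_simps)
  have "norm (\<Phi> (Complex \<sigma> b) - \<Phi> (Complex \<sigma> a)) \<le> - (E / 2) * inverse (b ^ 2) - (- (E / 2) * inverse (a ^ 2))"
  proof (rule vertical_difference_bound[OF ab(2) \<Phi> d])
    fix y assume "a \<le> y" "y \<le> b"
    then have "0 < y" using ab by simp
    then show "y \<noteq> 0" "norm (F (Complex \<sigma> y)) \<le> E / y ^ 3" using le[of y] by auto
  qed
  moreover have "0 \<le> E / 2 * inverse (b ^ 2)" using E by simp
  ultimately have "norm (\<Phi> (Complex \<sigma> b) - \<Phi> (Complex \<sigma> a)) \<le> E / 2 * inverse (a ^ 2)" by linarith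
  then show "norm (\<Phi> (Complex \<sigma> b) - \<Phi> (Complex \<sigma> a)) \<le> E / (2 * a ^ 2)" by (simp add: field_simps)
  have d': "((\<lambda>y. E / 2 * inverse (y ^ 2)) has_real_derivative E / (- y) ^ 3) (at y)" if "y \<noteq> 0" for y :: real
    using that by (auto intro!: derivative_eq_intros simp: power2_eq_square power3_eq_cube field_simps)
  have "norm (\<Phi> (Complex \<sigma> (- a)) - \<Phi> (Complex \<sigma> (- b))) \<le> E / 2 * inverse ((- a) ^ 2) - E / 2 * inverse ((- b) ^ 2)"
  proof (rule vertical_difference_bound[OF _ \<Phi> d'])
    show "- b \<le> - a" using ab by simp
    fix y assume "- b \<le> y" "y \<le> - a"
    then have "y < 0" using ab by simp
    then show "y \<noteq> 0" "norm (F (Complex \<sigma> y)) \<le> E / (- y) ^ 3" using le[of y] by auto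
  qed
  moreover have "0 \<le> E / 2 * inverse ((- b) ^ 2)" using E by simp
  ultimately have "norm (\<Phi> (Complex \<sigma> (- a)) - \<Phi> (Complex \<sigma> (- b))) \<le> E / 2 * inverse ((- a) ^ 2)" by linarith
  then show "norm (\<Phi> (Complex \<sigma> (- a)) - \<Phi> (Complex \<sigma> (- b))) \<le> E / (2 * a ^ 2)" by (simp add: field_simps)
qed

text \<open>1 / |\<sigma> + \<i> y|^2 has the primitive arctan(y/\<sigma>)/\<sigma>, whose
  increments are at most \<pi>/\<sigma> independently of \<open>a\<close>. Thus the height
  \<pi>/\<tau> of the strip does not enter.\<close>

lemma central_difference_bound:
  assumes a: "0 < a" and \<sigma>: "0 < \<sigma>" and E: "0 \<le> E"
    and \<Phi>: "\<And>y. (\<Phi> has_field_derivative F (Complex \<sigma> y)) (at (Complex \<sigma> y))"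
    and F: "\<And>y. \<bar>y\<bar> \<le> a \<Longrightarrow> norm (F (Complex \<sigma> y)) \<le> E / norm (Complex \<sigma> y) ^ 2"
  shows "norm (\<Phi> (Complex \<sigma> a) - \<Phi> (Complex \<sigma> (- a))) \<le> E * pi / \<sigma>"
proof -
  have d: "((\<lambda>y. E / \<sigma> * arctan (y / \<sigma>)) has_real_derivative E / norm (Complex \<sigma> y) ^ 2) (at y)" for y
  proof -
    have "((\<lambda>y. E / \<sigma> * arctan (y / \<sigma>)) has_real_derivative E / \<sigma> * (inverse (1 + (y / \<sigma>)\<^sup>2) * (1 / \<sigma>))) (at y)"
      using \<sigma> by (auto intro!: derivative_eq_intros)
    moreover have "E / \<sigma> * (inverse (1 + (y / \<sigma>)\<^sup>2) * (1 / \<sigma>)) = E / norm (Complex \<sigma> y) ^ 2"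
    proof -
      have "\<sigma>\<^sup>2 * (1 + (y / \<sigma>)\<^sup>2) = \<sigma>\<^sup>2 + y\<^sup>2" using \<sigma> by (simp add: power_divide distrib_left)
      moreover have "E / \<sigma> * (inverse (1 + (y / \<sigma>)\<^sup>2) * (1 / \<sigma>)) = E / (\<sigma>\<^sup>2 * (1 + (y / \<sigma>)\<^sup>2))"
        by (simp add: power2_eq_square inverse_eq_divide)
      ultimately show ?thesis by (simp add: cmod_power2)
    qed
    ultimately show ?thesis by simp
  qed
  have "norm (\<Phi> (Complex \<sigma> a) - \<Phi> (Complex \<sigma> (- a))) \<le> E / \<sigma> * arctan (a / \<sigma>) - E / \<sigma> * arctan (- a / \<sigma>)"
    by (rule vertical_difference_bound[OF _ \<Phi> d F]) (use a in auto)
  also have "\<dots> = E / \<sigma> * (arctan (a / \<sigma>) - arctan (- a / \<sigma>))" by (simp only: right_diff_distrib)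
  also have "\<dots> \<le> E / \<sigma> * pi"
    using arctan_bounded[of "a / \<sigma>"] arctan_bounded[of "- a / \<sigma>"] E \<sigma> by (intro mult_left_mono) auto
  finally show ?thesis by simp
qed

text \<open>Both scalar representations are applied with the error at time t as test element f, so
  that their difference is 2 \<pi> \<i> t^2 |f|^2. One factor |f| then cancels.\<close>

lemma backward_Euler_error:
  assumes T: "0 < T"
  obtains C where "0 < C" "\<And>\<rho> U g G \<tau> d N Gd v n. \<forall>x. u x = \<rho> * U x \<Longrightarrow> g \<in> L2 \<Omega> \<Longrightarrow> is_solution \<Omega> \<alpha> \<rho> T U g G \<Longrightarrow>
     0 < \<tau> \<Longrightarrow> BE_coeffs \<alpha> \<tau> d \<Longrightarrow> \<forall>m\<in>{1..N}. lap (Gd m) (v m) \<Longrightarrow>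
     \<forall>m\<in>{1..N}. AE x in \<mu>.
      (\<Sum>i<m. of_real (d i) * exp (- (of_real (real i * \<tau>) * u x)) * Gd (m - i) x) + v m x
        = exp (- (of_real (real m * \<tau>) * u x)) * (\<Sum>i<m. of_real (d i)) * g x \<Longrightarrow>
     n \<in> {1..N} \<Longrightarrow> real n * \<tau> \<le> T \<Longrightarrow>
     L2_norm \<Omega> (\<lambda>x. G (real n * \<tau>) x - Gd n x) \<le> C * \<tau> / (real n * \<tau>) * L2_norm \<Omega> g"
proof -
  obtain C1 where C1: "0 < C1" "\<And>g z. g \<in> L2 \<Omega> \<Longrightarrow> 0 < norm z \<Longrightarrow> 2 * K \<le> norm z \<Longrightarrow> cball z K \<subseteq> sector \<Longrightarrow>
     L2_norm \<Omega> (sol2 g z) \<le> C1 / norm z ^ 3 * L2_norm \<Omega> g"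
    using continuous_sol_bounds by blast
  obtain C2 where C2: "0 < C2" "\<And>g \<tau> t z. g \<in> L2 \<Omega> \<Longrightarrow> 0 < \<tau> \<Longrightarrow> \<tau> \<le> t \<Longrightarrow> t \<le> T \<Longrightarrow> Re z = 2 * K + 1 + 1 / t \<Longrightarrow>
     \<bar>Im z\<bar> \<le> pi / \<tau> \<Longrightarrow> L2_norm \<Omega> (\<lambda>x. sol2 g z x - dsol2 \<tau> g z x) \<le> C2 * \<tau> / norm z ^ 2 * L2_norm \<Omega> g"
    using discrete_error_bound[OF T] by blast
  \<comment> \<open>Bounds |exp(z t)| on the vertical line, since \<sigma> t = (2 K + 1) t +
    1.\<close>
  define E0 where "E0 = exp ((2 * K + 1) * T + 1)"
  define C where "C = E0 * (C1 + C2)"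
  have C0: "0 < C" using C1(1) C2(1) by (simp add: C_def E0_def)
  have main: "L2_norm \<Omega> (\<lambda>x. G (real n * \<tau>) x - Gd n x) \<le> C * \<tau> / (real n * \<tau>) * L2_norm \<Omega> g"
    if u': "\<forall>x. u x = \<rho> * U x" and g: "g \<in> L2 \<Omega>" and sol: "is_solution \<Omega> \<alpha> \<rho> T U g G"
      and \<tau>: "0 < \<tau>" and d: "BE_coeffs \<alpha> \<tau> d" and lapv': "\<forall>m\<in>{1..N}. lap (Gd m) (v m)"
      and eq': "\<forall>m\<in>{1..N}. AE x in \<mu>.
      (\<Sum>i<m. of_real (d i) * exp (- (of_real (real i * \<tau>) * u x)) * Gd (m - i) x) + v m x
        = exp (- (of_real (real m * \<tau>) * u x)) * (\<Sum>i<m. of_real (d i)) * g x"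
      and n: "n \<in> {1..N}" and nT: "real n * \<tau> \<le> T" for \<rho> U g G \<tau> d N Gd v n
  proof -
    note u = spec[OF u'] and lapv = bspec[OF lapv'] and eq = bspec[OF eq']
    interpret d: symbol_pair \<Omega> u K \<alpha> sector "cF \<alpha>" "cP0 \<alpha>" "cP1 \<alpha>" "cP2 \<alpha>"
      halfplane "dF \<alpha> \<tau>" "dP0 \<alpha> \<tau>" "dP1 \<alpha> \<tau>" "dP2 \<alpha> \<tau>"
      by (rule discrete_symbol_pair[OF \<tau>])
    define t where "t = real n * \<tau>"
    have "1 * \<tau> \<le> real n * \<tau>" using n \<tau> by (intro mult_right_mono) auto
    then have t: "0 < t" "\<tau> \<le> t" "t \<le> T" using \<tau> nT by (auto simp: t_def)
    define \<sigma> where "\<sigma> = 2 * K + 1 + 1 / t"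
    have \<sigma>: "0 < \<sigma>" "1 / t \<le> \<sigma>" "2 * K < \<sigma>" "K < \<sigma>" using K_nonneg t unfolding \<sigma>_def by (simp_all add: add_nonneg_pos)
    have GtL: "G t \<in> L2 \<Omega>"
      using solution_in_L2[OF sol t(1,3)] .
    define f where "f = (\<lambda>x. G t x - Gd n x)"
    have GnL: "Gd n \<in> L2 \<Omega>" using lap_L2(1)[OF lapv[OF n]] .
    have f: "f \<in> L2 \<Omega>" unfolding f_def by (intro L2_diff GtL GnL)
    define NF where "NF = L2_norm \<Omega> g * L2_norm \<Omega> f"
    have NF: "0 \<le> NF" by (simp add: NF_def)
    have hol: "(\<lambda>z. exp (z * of_real t) * L2_inner \<Omega> (sol2 g z) f) holomorphic_on region"
    proof -
      have "(\<lambda>z. L2_inner \<Omega> (sol1 g z) f) holomorphic_on region"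
        using inner_sol_deriv(2)[OF g region_cball f] open_cut_region holomorphic_on_open unfolding region_def by blast
      then have "deriv (\<lambda>z. L2_inner \<Omega> (sol1 g z) f) holomorphic_on region"
        unfolding region_def by (rule holomorphic_deriv[OF _ open_cut_region])
      then have "(\<lambda>z. L2_inner \<Omega> (sol2 g z) f) holomorphic_on region"
        by (rule holomorphic_transform) (use inner_sol_deriv(2)[OF g region_cball f] in \<open>auto intro: DERIV_imp_deriv\<close>)
      then show ?thesis by (intro holomorphic_intros)
    qed
    obtain \<Phi> where \<Phi>: "\<And>z. z \<in> region \<Longrightarrow> (\<Phi> has_field_derivative exp (z * of_real t) * L2_inner \<Omega> (sol2 g z) f) (at z)"
      using cut_region_primitive[OF _ _ _ hol[unfolded region_def]] \<phi>(4,5) K_nonneg unfolding region_def by auto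
    have opH: "open {z. K < Re z}" by (rule open_halfspace_Re_gt)
    have hol': "(\<lambda>z. exp (z * of_real t) * L2_inner \<Omega> (dsol2 \<tau> g z) f) holomorphic_on {z. K < Re z}"
    proof -
      note dd = d.d.inner_sol_deriv(2)[OF g cball_halfplane f]
      have "(\<lambda>z. L2_inner \<Omega> (dsol1 \<tau> g z) f) holomorphic_on {z. K < Re z}"
        using dd opH by (auto simp: holomorphic_on_open)
      then have "deriv (\<lambda>z. L2_inner \<Omega> (dsol1 \<tau> g z) f) holomorphic_on {z. K < Re z}"
        by (rule holomorphic_deriv[OF _ opH])
      then have "(\<lambda>z. L2_inner \<Omega> (dsol2 \<tau> g z) f) holomorphic_on {z. K < Re z}"
        by (rule holomorphic_transform) (use dd in \<open>auto intro: DERIV_imp_deriv\<close>)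
      then show ?thesis by (intro holomorphic_intros)
    qed
    obtain \<Psi> where \<Psi>: "\<And>z. K < Re z \<Longrightarrow> (\<Psi> has_field_derivative exp (z * of_real t) * L2_inner \<Omega> (dsol2 \<tau> g z) f) (at z)"
      using convex_imp_simply_connected[OF convex_halfspace_Re_gt[of K]] hol'
      unfolding simply_connected_eq_global_primitive[OF opH] by blast
    have lineR: "Complex \<sigma> y \<in> region" "K < Re (Complex \<sigma> y)" for y using region_halfplane \<sigma> by auto
    have norm_line: "0 < norm (Complex \<sigma> y)" "2 * K \<le> norm (Complex \<sigma> y)" for y
      using complex_Re_le_cmod[of "Complex \<sigma> y"] \<sigma> by auto
    have e: "norm (exp (Complex \<sigma> y * of_real t)) \<le> E0" for y
    proof -
      have "\<sigma> * t = (2 * K + 1) * t + 1" using t by (simp add: \<sigma>_def distrib_right)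
      also have "\<dots> \<le> (2 * K + 1) * T + 1" using t K_nonneg by (intro add_mono mult_left_mono) auto
      finally show ?thesis by (simp add: E0_def)
    qed
    have E0: "0 \<le> E0" by (simp add: E0_def)
    have F1: "norm (exp (Complex \<sigma> y * of_real t) * L2_inner \<Omega> (sol2 g (Complex \<sigma> y)) f) \<le> E0 * C1 * NF / norm (Complex \<sigma> y) ^ 3" for y
    proof -
      note zs = region_cball[OF lineR(1)]
      have "norm (L2_inner \<Omega> (sol2 g (Complex \<sigma> y)) f) \<le> L2_norm \<Omega> (sol2 g (Complex \<sigma> y)) * L2_norm \<Omega> f"
        by (rule Cauchy_Schwarz_L2[OF sol2_resolvent(1)[OF g zs] f])
      also have "\<dots> \<le> (C1 / norm (Complex \<sigma> y) ^ 3 * L2_norm \<Omega> g) * L2_norm \<Omega> f"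
        by (intro mult_right_mono C1(2) g zs norm_line) simp
      finally have "norm (exp (Complex \<sigma> y * of_real t) * L2_inner \<Omega> (sol2 g (Complex \<sigma> y)) f)
          \<le> E0 * ((C1 / norm (Complex \<sigma> y) ^ 3 * L2_norm \<Omega> g) * L2_norm \<Omega> f)"
        unfolding norm_mult using E0 by (intro mult_mono e) auto
      then show ?thesis by (simp add: NF_def mult_ac)
    qed
    have F2: "norm (exp (Complex \<sigma> y * of_real t) * L2_inner \<Omega> (sol2 g (Complex \<sigma> y)) f
        - exp (Complex \<sigma> y * of_real t) * L2_inner \<Omega> (dsol2 \<tau> g (Complex \<sigma> y)) f)
        \<le> E0 * C2 * \<tau> * NF / norm (Complex \<sigma> y) ^ 2" if y: "\<bar>y\<bar> \<le> pi / \<tau>" for y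
    proof -
      note zs = region_cball[OF lineR(1)] and zh = cball_halfplane[OF lineR(2)]
      note L = sol2_resolvent(1)[OF g zs] d.d.sol2_resolvent(1)[OF g zh]
      have "norm (L2_inner \<Omega> (\<lambda>x. sol2 g (Complex \<sigma> y) x - dsol2 \<tau> g (Complex \<sigma> y) x) f)
          \<le> L2_norm \<Omega> (\<lambda>x. sol2 g (Complex \<sigma> y) x - dsol2 \<tau> g (Complex \<sigma> y) x) * L2_norm \<Omega> f"
        by (rule Cauchy_Schwarz_L2[OF L2_diff[OF L] f])
      also have "\<dots> \<le> (C2 * \<tau> / norm (Complex \<sigma> y) ^ 2 * L2_norm \<Omega> g) * L2_norm \<Omega> f"
        by (intro mult_right_mono C2(2)[OF g \<tau> t(2,3)]) (use y in \<open>auto simp: \<sigma>_def\<close>)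
      finally have "norm (exp (Complex \<sigma> y * of_real t) * L2_inner \<Omega> (\<lambda>x. sol2 g (Complex \<sigma> y) x - dsol2 \<tau> g (Complex \<sigma> y) x) f)
          \<le> E0 * ((C2 * \<tau> / norm (Complex \<sigma> y) ^ 2 * L2_norm \<Omega> g) * L2_norm \<Omega> f)"
        unfolding norm_mult using E0 by (intro mult_mono e) auto
      then show ?thesis unfolding inner_diff_left[OF L f] by (simp add: NF_def right_diff_distrib mult_ac)
    qed
    define a where "a = pi / \<tau>"
    have a: "0 < a" using \<tau> by (simp add: a_def)
    have mid: "norm ((\<Phi> (Complex \<sigma> a) - \<Psi> (Complex \<sigma> a)) - (\<Phi> (Complex \<sigma> (- a)) - \<Psi> (Complex \<sigma> (- a))))
        \<le> (E0 * C2 * \<tau> * NF) * pi / \<sigma>"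
      by (rule central_difference_bound[OF a \<sigma>(1) _ DERIV_diff[OF \<Phi>[OF lineR(1)] \<Psi>[OF lineR(2)]]])
         (use F2 C2(1) \<tau> NF E0 in \<open>auto simp: a_def\<close>)
    have disc: "\<Psi> (Complex \<sigma> a) - \<Psi> (Complex \<sigma> (- a)) = 2 * of_real pi * \<i> * (of_real t ^ 2 * L2_inner \<Omega> (Gd n) f)"
    proof -
      have "Complex \<sigma> (- a) + of_real (2 * pi / \<tau>) * \<i> = Complex \<sigma> a" by (simp add: complex_eq_iff a_def field_simps)
      then show ?thesis
        using discrete_representation[OF \<tau> d g f lapv eq n t_def \<Psi> lineR(2)[of "- a"]] by simp
    qed
    obtain s where s: "0 < s" "((\<lambda>b. \<Phi> (Complex \<sigma> (b * s)) - \<Phi> (Complex \<sigma> (- (b * s)))) \<longlongrightarrow>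
        2 * of_real pi * \<i> * (of_real t ^ 2 * L2_inner \<Omega> (G t) f)) at_top"
      by (rule solution_representation[OF g f sol u t(1,3) \<sigma>(1) \<Phi>])
    define Z where "Z = 2 * of_real pi * \<i> * (of_real t ^ 2 * L2_inner \<Omega> f f)"
    have Z: "Z = 2 * of_real pi * \<i> * (of_real t ^ 2 * L2_inner \<Omega> (G t) f) - 2 * of_real pi * \<i> * (of_real t ^ 2 * L2_inner \<Omega> (Gd n) f)"
      unfolding Z_def right_diff_distrib[symmetric] inner_diff_left[OF GtL GnL f, symmetric] by (simp add: f_def)
    \<comment> \<open>The first summand is the comparison on the strip |Im z| \<le> \<pi>/\<tau>,
      the second the two tails of the exact solution, each E/(2 a^2).\<close>
    define B where "B = E0 * C2 * \<tau> * NF * pi / \<sigma> + E0 * C1 * NF / a ^ 2"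
    have "norm Z \<le> B"
    proof (rule tendsto_upperbound)
      show "((\<lambda>b. norm (\<Phi> (Complex \<sigma> (b * s)) - \<Phi> (Complex \<sigma> (- (b * s))) - (\<Psi> (Complex \<sigma> a) - \<Psi> (Complex \<sigma> (- a))))) \<longlongrightarrow> norm Z) at_top"
        unfolding Z disc by (intro tendsto_norm tendsto_diff s(2) tendsto_const)
      show "\<forall>\<^sub>F b in at_top. norm (\<Phi> (Complex \<sigma> (b * s)) - \<Phi> (Complex \<sigma> (- (b * s))) - (\<Psi> (Complex \<sigma> a) - \<Psi> (Complex \<sigma> (- a)))) \<le> B"
        using eventually_ge_at_top[of "a / s"]
      proof eventually_elim
        case (elim b)
        then have b: "a \<le> b * s" using s(1) by (simp add: pos_divide_le_eq)
        have E1: "0 \<le> E0 * C1 * NF" using E0 C1(1) NF by simp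
        note tl = tail_difference_bound[OF a b E1 \<Phi>[OF lineR(1)] F1]
        have "\<Phi> (Complex \<sigma> (b * s)) - \<Phi> (Complex \<sigma> (- (b * s))) - (\<Psi> (Complex \<sigma> a) - \<Psi> (Complex \<sigma> (- a)))
          = (\<Phi> (Complex \<sigma> (b * s)) - \<Phi> (Complex \<sigma> a)) + (\<Phi> (Complex \<sigma> (- a)) - \<Phi> (Complex \<sigma> (- (b * s))))
            + ((\<Phi> (Complex \<sigma> a) - \<Psi> (Complex \<sigma> a)) - (\<Phi> (Complex \<sigma> (- a)) - \<Psi> (Complex \<sigma> (- a))))" by simp
        also have "norm \<dots> \<le> E0 * C1 * NF / (2 * a ^ 2) + E0 * C1 * NF / (2 * a ^ 2) + (E0 * C2 * \<tau> * NF) * pi / \<sigma>"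
          by (intro order_trans[OF norm_triangle_ineq] add_mono tl mid)
        also have "\<dots> = B" by (simp add: B_def field_simps)
        finally show ?case .
      qed
    qed simp
    also have "B \<le> 2 * pi * (C * \<tau> * t * NF)"
    proof -
      \<comment> \<open>The term 1/t in \<sigma> turns the factor \<pi>/\<sigma> of the strip
        integral into the required power of t.\<close>
      have "1 / \<sigma> \<le> t" using \<sigma> t by (simp add: field_simps)
      then have "(E0 * C2 * \<tau> * NF * pi) * (1 / \<sigma>) \<le> (E0 * C2 * \<tau> * NF * pi) * t"
        using E0 C2(1) \<tau> NF by (intro mult_left_mono) auto
      then have 1: "E0 * C2 * \<tau> * NF * pi / \<sigma> \<le> pi * (E0 * C2 * (\<tau> * t * NF))" by (simp add: mult_ac)
      have pp: "1 \<le> pi ^ 2" using pi_ge_two power_mono[of 1 pi 2] by simp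
      \<comment> \<open>The tails are of size \<tau>^2, and one factor \<tau> is replaced by t \<ge>
        \<tau>.\<close>
      have "E0 * C1 * NF / a ^ 2 = E0 * C1 * NF * \<tau> ^ 2 / pi ^ 2" by (simp add: a_def power_divide)
      also have "\<dots> \<le> E0 * C1 * NF * \<tau> ^ 2 / 1" using pp E0 C1(1) NF by (intro divide_left_mono) auto
      also have "\<dots> \<le> E0 * C1 * NF * (\<tau> * t)"
        unfolding power2_eq_square div_by_1 using t \<tau> E0 C1(1) NF by (intro mult_left_mono) auto
      also have "\<dots> = 1 * (E0 * C1 * (\<tau> * t * NF))" by (simp only: mult_ac mult_1_left)
      also have "\<dots> \<le> pi * (E0 * C1 * (\<tau> * t * NF))"
        using pi_ge_two E0 C1(1) NF \<tau> t by (intro mult_right_mono) auto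
      finally have "B \<le> pi * (E0 * C2 * (\<tau> * t * NF)) + pi * (E0 * C1 * (\<tau> * t * NF))" using 1 by (simp add: B_def)
      also have "\<dots> = pi * (C * \<tau> * t * NF)" by (simp add: C_def algebra_simps)
      also have "\<dots> \<le> 2 * pi * (C * \<tau> * t * NF)"
        using C0 \<tau> t NF by (intro mult_right_mono) auto
      finally show ?thesis .
    qed
    finally have Zle: "norm Z \<le> 2 * pi * (C * \<tau> * t * NF)" .
    have "norm Z = 2 * pi * (t ^ 2 * (L2_norm \<Omega> f) ^ 2)"
      unfolding Z_def inner_self norm_mult norm_power norm_of_real using t by simp
    then have "t ^ 2 * (L2_norm \<Omega> f) ^ 2 \<le> C * \<tau> * t * NF" using Zle by simp
    then have le: "t * (t * L2_norm \<Omega> f * L2_norm \<Omega> f) \<le> t * (C * \<tau> * L2_norm \<Omega> g * L2_norm \<Omega> f)"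
      by (simp add: NF_def power2_eq_square mult_ac)
    have "t * L2_norm \<Omega> f \<le> C * \<tau> * L2_norm \<Omega> g"
    proof (cases "L2_norm \<Omega> f = 0")
      case False
      then have "0 < L2_norm \<Omega> f" using L2_norm_nonneg[of \<Omega> f] by linarith
      then show ?thesis using le t(1) by simp
    qed (use C0 \<tau> in simp)
    then have "L2_norm \<Omega> f \<le> C * \<tau> / t * L2_norm \<Omega> g" using t(1) by (simp add: field_simps)
    then show ?thesis by (simp add: f_def t_def)
  qed
  show ?thesis
    by (rule that[OF C0], rule main)
qed

end

theorem theorem3p1:
  fixes \<Omega> :: "'a::euclidean_space set"
    and \<alpha> T :: real
    and \<rho> :: complex
    and U :: "'a \<Rightarrow> complex"
  assumes "open \<Omega>" and "connected \<Omega>" and "\<Omega> \<noteq> {}" and "bounded \<Omega>"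
    and "0 < \<alpha>" and "\<alpha> < 1" and "0 < T"
    and "U \<in> borel_measurable (lebesgue_on (closure \<Omega>))"
    and "bounded (U ` closure \<Omega>)"
  shows "\<exists>C>0. \<forall>G0\<in>L2 \<Omega>. \<forall>G. is_solution \<Omega> \<alpha> \<rho> T U G0 G \<longrightarrow>
           (\<forall>N\<ge>1. \<forall>\<tau> d Gd. \<tau> = T / real N \<longrightarrow> BE_coeffs \<alpha> \<tau> d \<longrightarrow>
              is_BE_solution \<Omega> \<rho> U G0 \<tau> N d Gd \<longrightarrow>
              (\<forall>n\<in>{1..N}. L2_norm \<Omega> (\<lambda>x. G (real n * \<tau>) x - Gd n x)
                 \<le> C * inverse (real n * \<tau>) * \<tau> * L2_norm \<Omega> G0))"
proof -
  obtain B where B: "\<And>x. x \<in> closure \<Omega> \<Longrightarrow> norm (U x) \<le> B"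
    using assms(9) unfolding bounded_iff by blast
  \<comment> \<open>The absolute value gives \<open>0 \<le> K\<close> without inspecting a value of
    \<open>U\<close>.\<close>
  define K where "K = norm \<rho> * \<bar>B\<bar>"
  define u where "u = (\<lambda>x. \<rho> * U x)"
  interpret bounded_domain \<Omega> by standard (rule assms)+
  have "U \<in> borel_measurable \<mu>"
    by (rule measurable_restrict_mono[OF assms(8) closure_subset])
  interpret fractional_problem \<Omega> u K \<alpha>
  proof
    show "u \<in> borel_measurable \<mu>" unfolding u_def using \<open>U \<in> borel_measurable \<mu>\<close> by measurable
    show "norm (u x) \<le> K" if "x \<in> \<Omega>" for x
    proof -
      have "norm (U x) \<le> \<bar>B\<bar>" using B[of x] that closure_subset[of \<Omega>] by force
      then show ?thesis unfolding u_def K_def norm_mult by (rule mult_left_mono) simp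
    qed
    show "0 \<le> K" by (simp add: K_def)
    show "0 < \<alpha>" "\<alpha> < 1" by (rule assms)+
  qed
  show ?thesis
  proof (rule backward_Euler_error[OF assms(7)])
    fix C :: real
    assume C0: "0 < C" and C: "\<And>\<rho> U g G \<tau> d N Gd v n. \<forall>x. u x = \<rho> * U x \<Longrightarrow> g \<in> L2 \<Omega> \<Longrightarrow> is_solution \<Omega> \<alpha> \<rho> T U g G \<Longrightarrow>
       0 < \<tau> \<Longrightarrow> BE_coeffs \<alpha> \<tau> d \<Longrightarrow> \<forall>m\<in>{1..N}. lap (Gd m) (v m) \<Longrightarrow>
       \<forall>m\<in>{1..N}. AE x in \<mu>.
        (\<Sum>i<m. of_real (d i) * exp (- (of_real (real i * \<tau>) * u x)) * Gd (m - i) x) + v m x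
          = exp (- (of_real (real m * \<tau>) * u x)) * (\<Sum>i<m. of_real (d i)) * g x \<Longrightarrow>
       n \<in> {1..N} \<Longrightarrow> real n * \<tau> \<le> T \<Longrightarrow>
       L2_norm \<Omega> (\<lambda>x. G (real n * \<tau>) x - Gd n x) \<le> C * \<tau> / (real n * \<tau>) * L2_norm \<Omega> g"
    have main: "L2_norm \<Omega> (\<lambda>x. G (real n * \<tau>) x - Gd n x) \<le> C * inverse (real n * \<tau>) * \<tau> * L2_norm \<Omega> G0"
      if G0: "G0 \<in> L2 \<Omega>" and sol: "is_solution \<Omega> \<alpha> \<rho> T U G0 G" and N: "N \<ge> 1" and \<tau>: "\<tau> = T / real N"
        and d: "BE_coeffs \<alpha> \<tau> d" and be: "is_BE_solution \<Omega> \<rho> U G0 \<tau> N d Gd" and n: "n \<in> {1..N}" for G0 G N \<tau> d Gd n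
    proof -
      have \<tau>0: "0 < \<tau>" using \<tau> assms(7) N by simp
      have "real n * \<tau> \<le> real N * \<tau>" using n \<tau>0 by (intro mult_right_mono) auto
      then have nT: "real n * \<tau> \<le> T" using \<tau> N by simp
      have g0: "AE x in \<mu>. Gd 0 x = G0 x" using be by (simp add: is_BE_solution_def)
      have "\<forall>m\<in>{1..N}. \<exists>v. lap (Gd m) v \<and> (AE x in \<mu>.
             (\<Sum>i<m. of_real (d i) * exp (- of_real (real i * \<tau>) * \<rho> * U x) * Gd (m - i) x) + v x
               = exp (- of_real (real m * \<tau>) * \<rho> * U x) * (\<Sum>i<m. of_real (d i)) * Gd 0 x)"
        using be unfolding is_BE_solution_def by blast
      \<comment> \<open>A simultaneous choice of the values A G^m for all steps, as the generating
        polynomial needs them together.\<close>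
      from bchoice[OF this] obtain v where v: "\<forall>m\<in>{1..N}. lap (Gd m) (v m) \<and> (AE x in \<mu>.
             (\<Sum>i<m. of_real (d i) * exp (- of_real (real i * \<tau>) * \<rho> * U x) * Gd (m - i) x) + v m x
               = exp (- of_real (real m * \<tau>) * \<rho> * U x) * (\<Sum>i<m. of_real (d i)) * Gd 0 x)" by blast
      have "\<forall>m\<in>{1..N}. AE x in \<mu>.
        (\<Sum>i<m. of_real (d i) * exp (- (of_real (real i * \<tau>) * u x)) * Gd (m - i) x) + v m x
          = exp (- (of_real (real m * \<tau>) * u x)) * (\<Sum>i<m. of_real (d i)) * G0 x"
      proof
        fix m assume m: "m \<in> {1..N}"
        have "AE x in \<mu>. (\<Sum>i<m. of_real (d i) * exp (- of_real (real i * \<tau>) * \<rho> * U x) * Gd (m - i) x) + v m x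
               = exp (- of_real (real m * \<tau>) * \<rho> * U x) * (\<Sum>i<m. of_real (d i)) * Gd 0 x" using v m by blast
        with g0 show "AE x in \<mu>. (\<Sum>i<m. of_real (d i) * exp (- (of_real (real i * \<tau>) * u x)) * Gd (m - i) x) + v m x
          = exp (- (of_real (real m * \<tau>) * u x)) * (\<Sum>i<m. of_real (d i)) * G0 x"
          by eventually_elim (simp add: u_def mult.assoc)
      qed
      moreover have "\<forall>m\<in>{1..N}. lap (Gd m) (v m)" using v by blast
      ultimately have "L2_norm \<Omega> (\<lambda>x. G (real n * \<tau>) x - Gd n x) \<le> C * \<tau> / (real n * \<tau>) * L2_norm \<Omega> G0"
        by (intro C[OF _ G0 sol \<tau>0 d _ _ n nT]) (auto simp: u_def)
      also have "C * \<tau> / (real n * \<tau>) = C * inverse (real n * \<tau>) * \<tau>" by (simp add: divide_inverse mult_ac)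
      finally show ?thesis .
    qed
    show ?thesis
      by (intro exI[of _ C] conjI C0 ballI allI impI, rule main)
  qed
qed

end
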